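(* Let $\phi$ be a primitive odd Dirichlet character of conductor $N$ prime to $p$ with $\phi(p)=1$. Then $$L_p'(\phi\omega_p,0)=\mathscr L(\phi)\,L(\phi,0).$$
   Context: Fix a prime $p$ and an embedding $\iota_p:\bar{\mathbb Q}\hookrightarrow\bar{\mathbb Q}_p$. $\omega_p$ is the $p$-adic Teichmüller character (of conductor $p$ for $p$ odd, $4$ for $p=2$). $L_p(\phi\omega_p,s)$ is the Kubota–Leopoldt $p$-adic $L$-function, analytic in $s\in\mathbb Z_p$ and characterised by $L_p(\phi\omega_p,1-k)=(1-\phi(p)p^{k-1})L(\phi,1-k)$ for all integers $k\ge1$ with $\omega_p^{k-1}=\mathbf 1$; since $\phi(p)=1$ it vanishes at $s=0$. View $\phi$ as a character of $G_{\mathbb Q}$ with $\phi(\mathrm{Frob}_\ell)=\phi(\ell)$ (arithmetic Frobenius). Let $H$ be the fixed field of $\ker\phi$ and $G=\mathrm{Gal}(H/\mathbb Q)$. Let $\log_p$ be the $p$-adic logarithm with $\log_p(p)=0$, and let $\log_{v_0},\mathrm{ord}_{v_0}:\mathcal O_H[1/p]^\times\otimes\bar{\mathbb Q}_p\to\bar{\mathbb Q}_p$ be the linear maps $u\otimes x\mapsto\log_p(\iota_p(u))x$, $u\otimes x\mapsto\mathrm{ord}_p(\iota_p(u))x$. For an odd character $\psi$ of $G$, the $\psi^{-1}$-eigenspace of $\mathcal O_H[1/p]^\times\otimes\bar{\mathbb Q}_p$ is a line, with basis $u_\psi$, and $\mathrm{ord}_{v_0}(u_\psi)\neq0$. Define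 $\mathscr L(\psi)=-\log_{v_0}(u_\psi)/\mathrm{ord}_{v_0}(u_\psi)$. *)

theory Defs
  imports
    "HOL-Complex_Analysis.Complex_Analysis"
    "HOL-Library.Poly_Mapping"
    "HOL-Library.FuncSet"
    "HOL-Number_Theory.Totient"
    "HOL-Number_Theory.Cong"
begin

section \<open>The field of algebraic \<open>p\<close>-adic numbers\<close>

text \<open>
  The field \<open>'k\<close>, with absolute value \<open>dist x 0\<close>, is an algebraic closure of \<open>\<rat>\<^sub>p\<close> carrying the
  absolute value extending the normalised one: \<open>\<rat>\<^sub>p\<close>, being the completion of \<open>\<rat>\<close>, is the
  closure of \<open>\<rat>\<close> in \<open>'k\<close>, and is complete. These conditions determine \<open>'k\<close> up to isometric
  isomorphism. (The field \<open>'k\<close> itself is not complete.)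
\<close>

definition padic_numbers :: "'k::{field_char_0, metric_space} set"
  where "padic_numbers = closure \<rat>"

definition padic_integers :: "'k::{field_char_0, metric_space} set"
  where "padic_integers = closure \<int>"

locale padic_closure =
  fixes p :: nat
  assumes prime_p: "prime p"
    and dist_translate:
      "\<And>x y z :: 'k::{alg_closed_field, field_char_0, metric_space}. dist (x + z) (y + z) = dist x y"
    and abs_mult: "\<And>x y :: 'k. dist (x * y) 0 = dist x 0 * dist y 0"
    and ultrametric: "\<And>x y z :: 'k. dist x z \<le> max (dist x y) (dist y z)"
    and abs_of_int: "\<And>n. n \<noteq> 0 \<Longrightarrow> dist (of_int n :: 'k) 0 = 1 / real p ^ multiplicity (int p) n"
    and complete_padic_numbers: "complete (padic_numbers :: 'k set)"
    and algebraic_over_padic_numbers: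
      "\<And>x :: 'k. \<exists>f. f \<noteq> 0 \<and> (\<forall>i. coeff f i \<in> padic_numbers) \<and> poly f x = 0"

definition padic_ord :: "nat \<Rightarrow> 'k::{field_char_0, metric_space} \<Rightarrow> rat"
  where "padic_ord p x = (THE r. dist x 0 = real p powr (- of_rat r))"

text \<open>The Iwasawa branch of the logarithm; the value at \<open>0\<close> is a dummy, fixed for uniqueness.\<close>

definition padic_log :: "nat \<Rightarrow> 'k::{field_char_0, metric_space} \<Rightarrow> 'k"
  where "padic_log p = (THE L.
    (\<forall>x y. x \<noteq> 0 \<longrightarrow> y \<noteq> 0 \<longrightarrow> L (x * y) = L x + L y) \<and>
    (\<forall>x. dist x 0 < 1 \<longrightarrow> (\<lambda>n. (-1) ^ n * x ^ Suc n / of_nat (Suc n)) sums L (1 + x)) \<and>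
    L (of_nat p) = 0 \<and> L 0 = 0)"

text \<open>\<open>\<omega>(a)\<close> is the root of unity in \<open>\<int>\<^sub>p\<close> congruent to \<open>a\<close> modulo \<open>q\<close>, the conductor of \<open>\<omega>\<close>.\<close>

definition teichmuller :: "nat \<Rightarrow> int \<Rightarrow> 'k::{field_char_0, metric_space}"
  where "teichmuller p a =
    (let q = (if p = 2 then 4 else p) in
     if coprime a (int p)
     then THE z. z ^ totient q = 1 \<and> dist z (of_int a) \<le> dist (of_nat q :: 'k) 0
     else 0)"

definition has_padic_derivative ::
    "('k::{field_char_0, metric_space} \<Rightarrow> 'k) \<Rightarrow> 'k \<Rightarrow> 'k \<Rightarrow> bool"
    (infix \<open>has'_padic'_derivative\<close> 50)
  where "(f has_padic_derivative D) x \<longleftrightarrow>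
    ((\<lambda>s. (f s - f x) / (s - x)) \<longlongrightarrow> D) (at x within padic_integers)"

text \<open>
  A single power series on all of \<open>\<int>\<^sub>p\<close> is required. Local analyticity would not make the
  interpolation property below characteristic for \<open>p = 2\<close>, where the interpolation points
  \<open>1 - k\<close> with \<open>k\<close> odd are dense only in \<open>2\<int>\<^sub>2\<close>.
\<close>

definition padic_analytic :: "('k::{field_char_0, metric_space} \<Rightarrow> 'k) \<Rightarrow> bool"
  where "padic_analytic f \<longleftrightarrow> (\<exists>a. \<forall>s\<in>padic_integers. (\<lambda>n. a n * s ^ n) sums f s)"


section \<open>Algebraic numbers\<close>

text \<open>\<open>\<rat>\<close>-bar is the field of algebraic numbers in \<open>\<complex>\<close>; only the values of \<open>\<iota>\<close> there matter.\<close>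

definition Qbar :: "complex set"
  where "Qbar = {x. algebraic x}"

definition Zbar :: "complex set"
  where "Zbar = {x. algebraic_int x}"

definition qbar_embedding :: "(complex \<Rightarrow> 'k::field_char_0) \<Rightarrow> bool"
  where "qbar_embedding \<iota> \<longleftrightarrow> \<iota> 1 = 1 \<and>
    (\<forall>x\<in>Qbar. \<forall>y\<in>Qbar. \<iota> (x + y) = \<iota> x + \<iota> y \<and> \<iota> (x * y) = \<iota> x * \<iota> y)"

text \<open>Automorphisms of a subfield \<open>F\<close> of \<open>\<complex>\<close>; they automatically fix \<open>\<rat>\<close>.\<close>

definition Gal :: "complex set \<Rightarrow> (complex \<Rightarrow> complex) set"
  where "Gal F = {\<sigma> \<in> F \<rightarrow>\<^sub>E F. bij_betw \<sigma> F F \<and>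
    (\<forall>x\<in>F. \<forall>y\<in>F. \<sigma> (x + y) = \<sigma> x + \<sigma> y \<and> \<sigma> (x * y) = \<sigma> x * \<sigma> y)}"

text \<open>\<open>\<O>\<^sub>F[1/p]\<close>\<close>

definition p_integers :: "nat \<Rightarrow> complex set \<Rightarrow> complex set"
  where "p_integers p F = {x \<in> F. \<exists>n. of_nat p ^ n * x \<in> Zbar}"

definition p_units :: "nat \<Rightarrow> complex set \<Rightarrow> complex set"
  where "p_units p F = {u \<in> p_integers p F. \<exists>v \<in> p_integers p F. u * v = 1}"


section \<open>Dirichlet characters\<close>

definition dirichlet_character :: "nat \<Rightarrow> (int \<Rightarrow> complex) \<Rightarrow> bool"
  where "dirichlet_character N \<phi> \<longleftrightarrow> N > 0 \<and> (\<forall>a. \<phi> (a + int N) = \<phi> a) \<and>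
    (\<forall>a b. \<phi> (a * b) = \<phi> a * \<phi> b) \<and> (\<forall>a. \<phi> a = 0 \<longleftrightarrow> \<not> coprime a (int N))"

definition primitive_dirichlet_character :: "nat \<Rightarrow> (int \<Rightarrow> complex) \<Rightarrow> bool"
  where "primitive_dirichlet_character N \<phi> \<longleftrightarrow> dirichlet_character N \<phi> \<and>
    (\<forall>d. d dvd N \<longrightarrow> d < N \<longrightarrow> (\<exists>a. coprime a (int N) \<and> [a = 1] (mod int d) \<and> \<phi> a \<noteq> 1))"

text \<open>The analytic continuation of the Dirichlet series; for non-principal \<open>\<phi>\<close> it is entire.\<close>

definition dirichlet_L :: "(int \<Rightarrow> complex) \<Rightarrow> complex \<Rightarrow> complex"
  where "dirichlet_L \<phi> = (THE f. f holomorphic_on UNIV \<and>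
    (\<forall>s. Re s > 1 \<longrightarrow> (\<lambda>n. \<phi> (int (Suc n)) / of_nat (Suc n) powr s) sums f s))"

text \<open>
  A Dirichlet character of modulus \<open>N\<close> as a character of \<open>G\<^sub>\<rat>\<close>, by way of
  \<open>Gal(\<rat>(\<zeta>\<^sub>N)/\<rat>) \<cong> (\<int>/N)\<^sup>\<times>\<close>, where \<open>a\<close> corresponds to \<open>\<zeta>\<^sub>N \<mapsto> \<zeta>\<^sub>N\<^sup>a\<close>. Lemma
  \<open>galois_character_Frobenius\<close> below shows that this is the normalisation in which an
  arithmetic Frobenius at \<open>\<ell>\<close> is sent to \<open>\<phi>(\<ell>)\<close>.
\<close>

definition galois_character :: "nat \<Rightarrow> (int \<Rightarrow> complex) \<Rightarrow> (complex \<Rightarrow> complex) \<Rightarrow> complex"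
  where "galois_character N \<phi> \<sigma> =
    (THE z. \<exists>a::int. \<sigma> (cis (2 * pi / N)) = cis (2 * pi * a / N) \<and> z = \<phi> a)"

definition cut_out_field :: "nat \<Rightarrow> (int \<Rightarrow> complex) \<Rightarrow> complex set"
  where "cut_out_field N \<phi> =
    {x \<in> Qbar. \<forall>\<sigma> \<in> Gal Qbar. galois_character N \<phi> \<sigma> = 1 \<longrightarrow> \<sigma> x = x}"

text \<open>The induced character of the quotient \<open>Gal(H/\<rat>)\<close> of \<open>G\<^sub>\<rat>\<close>, with \<open>H\<close> the field cut out by \<open>\<phi>\<close>.\<close>

definition quotient_character :: "nat \<Rightarrow> (int \<Rightarrow> complex) \<Rightarrow> (complex \<Rightarrow> complex) \<Rightarrow> complex"
  where "quotient_character N \<phi> \<tau> =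
    (THE z. \<exists>\<sigma> \<in> Gal Qbar. (\<forall>x \<in> cut_out_field N \<phi>. \<sigma> x = \<tau> x) \<and> z = galois_character N \<phi> \<sigma>)"

definition Zbar_prime_ideal :: "complex set \<Rightarrow> bool"
  where "Zbar_prime_ideal M \<longleftrightarrow> M \<subseteq> Zbar \<and> 0 \<in> M \<and> 1 \<notin> M \<and>
    (\<forall>x\<in>M. \<forall>y\<in>M. x + y \<in> M) \<and> (\<forall>x\<in>Zbar. \<forall>y\<in>M. x * y \<in> M) \<and>
    (\<forall>x\<in>Zbar. \<forall>y\<in>Zbar. x * y \<in> M \<longrightarrow> x \<in> M \<or> y \<in> M)"

definition arithmetic_Frobenius :: "nat \<Rightarrow> (complex \<Rightarrow> complex) \<Rightarrow> bool"
  where "arithmetic_Frobenius l \<sigma> \<longleftrightarrow> \<sigma> \<in> Gal Qbar \<and>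
    (\<exists>M. Zbar_prime_ideal M \<and> of_nat l \<in> M \<and> (\<forall>x\<in>Zbar. \<sigma> x - x ^ l \<in> M))"

lemma dirichlet_character_cong:
  assumes "dirichlet_character N \<phi>" "[a = b] (mod int N)"
  shows "\<phi> a = \<phi> b"
proof -
  have per: "\<phi> (c + int N) = \<phi> c" for c
    using assms(1) by (simp add: dirichlet_character_def)
  have n: "\<phi> (c + int N * int k) = \<phi> c" for c k
  proof (induction k)
    case (Suc k)
    have "\<phi> (c + int N * int (Suc k)) = \<phi> ((c + int N * int k) + int N)"
      by (simp add: algebra_simps)
    then show ?case using per Suc by metis
  qed simp
  obtain k where k: "b = a + int N * k"
    using assms(2) by (auto simp: cong_iff_lin)
  show ?thesis
  proof (cases "k \<ge> 0")
    case True
    then show ?thesis using n[of a "nat k"] k by simp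
  next
    case False
    then show ?thesis using n[of b "nat (- k)"] k by simp
  qed
qed

lemma cis_eq_cong:
  fixes a b :: int
  assumes "N > 0" "cis (2 * pi * a / N) = cis (2 * pi * b / N)"
  shows "[a = b] (mod int N)"
proof -
  have "sin (2 * pi * a / N) = sin (2 * pi * b / N) \<and> cos (2 * pi * a / N) = cos (2 * pi * b / N)"
    using assms(2) by (simp add: cis.ctr complex_eq_iff)
  then obtain k :: int where "2 * pi * a / N = 2 * pi * b / N + 2 * pi * k"
    by (auto simp: sin_cos_eq_iff)
  then have "2 * pi * (a - (b + real N * k)) = 0"
    using assms(1) by (simp add: field_simps)
  then have "real_of_int a = real_of_int (b + int N * k)" by simp
  then have "a = b + int N * k" by linarith
  then show ?thesis by (simp add: cong_def)
qed

lemma galois_character_Frobenius: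
  assumes \<phi>: "dirichlet_character N \<phi>" and frob: "arithmetic_Frobenius l \<sigma>" and cop: "coprime l N"
  shows "galois_character N \<phi> \<sigma> = \<phi> (int l)"
proof -
  have N: "N > 0" using \<phi> by (simp add: dirichlet_character_def)
  define \<zeta> where "\<zeta> = cis (2 * pi / N)"
  have root_int: "z \<in> Zbar" if "z ^ N = 1" for z
    using algebraic_int_root[of 1 "monom 1 N" z] N that
    by (simp add: Zbar_def poly_monom degree_monom_eq)
  have \<zeta>N: "\<zeta> ^ N = 1" using N by (simp add: \<zeta>_def Complex.DeMoivre)
  have power_root: "(z ^ n) ^ N = 1" if "z ^ N = 1" for z :: complex and n
    by (simp add: that power_mult[symmetric] mult.commute[of n N]) (simp add: power_mult that)
  have \<zeta>_pow: "\<zeta> ^ n = cis (2 * pi * n / N)" for n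
    by (simp add: \<zeta>_def Complex.DeMoivre field_simps)
  obtain M where M: "Zbar_prime_ideal M" "of_nat l \<in> M" "\<forall>x\<in>Zbar. \<sigma> x - x ^ l \<in> M"
    and \<sigma>: "\<sigma> \<in> Gal Qbar"
    using frob unfolding arithmetic_Frobenius_def by blast
  have M0: "0 \<in> M" and M1: "1 \<notin> M"
    and M_add: "\<And>x y. x \<in> M \<Longrightarrow> y \<in> M \<Longrightarrow> x + y \<in> M"
    and M_mult: "\<And>x y. x \<in> Zbar \<Longrightarrow> y \<in> M \<Longrightarrow> x * y \<in> M"
    using M(1) by (auto simp: Zbar_prime_ideal_def)
  have int_Z: "of_int n \<in> Zbar" for n by (simp add: Zbar_def)
  have N_notin: "of_nat N \<notin> M"
  proof
    assume "of_nat N \<in> M"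
    have "gcd (int l) (int N) = 1" using cop by (simp add: coprime_iff_gcd_eq_1[symmetric])
    then obtain a b where "a * int l + b * int N = 1"
      using bezout_int[of "int l" "int N"] by metis
    then have "of_int (a * int l + b * int N) = (1 :: complex)" by (simp only: of_int_1)
    then have "of_int a * of_nat l + of_int b * of_nat N = (1 :: complex)" by simp
    then show False
      using M_add[OF M_mult[OF int_Z M(2)] M_mult[OF int_Z \<open>of_nat N \<in> M\<close>]] M1 by metis
  qed
  have eq_1: "z = 1" if z: "z ^ N = 1" "z - 1 \<in> M" for z
  proof (rule ccontr)
    assume "z \<noteq> 1"
    have zZ: "z ^ i \<in> Zbar" for i
      using z(1) by (intro root_int power_root)
    have pow: "z ^ i - 1 \<in> M" for i
    proof (induction i)
      case 0
      then show ?case using M0 by simp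
    next
      case (Suc i)
      have "z ^ Suc i - 1 = (z ^ i - 1) + z ^ i * (z - 1)" by (simp add: algebra_simps)
      then show ?case using M_add[OF Suc M_mult[OF zZ z(2)]] by metis
    qed
    have "(\<Sum>i<n. z ^ i - 1) \<in> M" for n
    proof (induction n)
      case 0
      then show ?case using M0 by simp
    next
      case (Suc n)
      then show ?case using M_add[OF Suc pow] by simp
    qed
    moreover have "(\<Sum>i<N. z ^ i - 1) = - of_nat N"
      using z(1) \<open>z \<noteq> 1\<close> by (simp add: sum_subtractf sum_gp_strict)
    ultimately have "- of_nat N \<in> M" by metis
    then have "of_int (-1) * (- of_nat N) \<in> M" using M_mult[OF int_Z] by blast
    then show False using N_notin by simp
  qed
  have \<zeta>Z: "\<zeta> \<in> Zbar" using \<zeta>N by (rule root_int)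
  then have \<zeta>Q: "\<zeta> \<in> Qbar" by (auto simp: Zbar_def Qbar_def)
  have Q1: "1 \<in> Qbar" by (simp add: Qbar_def algebraic_int_imp_algebraic)
  have \<zeta>powQ: "\<zeta> ^ n \<in> Qbar" for n
  proof -
    have "(\<zeta> ^ n) ^ N = 1" using \<zeta>N by (rule power_root)
    then show ?thesis using root_int by (auto simp: Zbar_def Qbar_def)
  qed
  have \<sigma>_mult: "\<sigma> (x * y) = \<sigma> x * \<sigma> y" if "x \<in> Qbar" "y \<in> Qbar" for x y
    using \<sigma> that by (auto simp: Gal_def)
  have \<sigma>1: "\<sigma> 1 = 1"
  proof -
    have Q0: "0 \<in> Qbar" by (simp add: Qbar_def algebraic_int_imp_algebraic)
    have "\<sigma> 0 = \<sigma> 0 + \<sigma> 0" using \<sigma> Q0 by (auto simp: Gal_def)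
    then have "\<sigma> 0 = 0" by simp
    moreover have "inj_on \<sigma> Qbar" using \<sigma> by (auto simp: Gal_def bij_betw_def)
    ultimately have "\<sigma> 1 \<noteq> 0" using Q0 Q1 by (metis inj_onD zero_neq_one)
    then show ?thesis using \<sigma>_mult[OF Q1 Q1] by simp
  qed
  have \<sigma>_pow: "\<sigma> (\<zeta> ^ n) = \<sigma> \<zeta> ^ n" for n
    by (induction n) (simp_all add: \<sigma>1 \<sigma>_mult \<zeta>Q \<zeta>powQ)
  have \<sigma>\<zeta>: "\<sigma> \<zeta> ^ N = 1" using \<sigma>_pow[of N] \<zeta>N \<sigma>1 by simp
  have \<zeta>0: "\<zeta> \<noteq> 0" by (simp add: \<zeta>_def)
  have "\<sigma> \<zeta> / \<zeta> ^ l = 1"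
  proof (rule eq_1)
    show root: "(\<sigma> \<zeta> / \<zeta> ^ l) ^ N = 1"
      by (simp add: power_divide \<sigma>\<zeta> power_root[OF \<zeta>N])
    have "(1 / \<zeta> ^ l) ^ N = 1"
      by (simp add: power_divide power_root[OF \<zeta>N])
    then have "1 / \<zeta> ^ l * (\<sigma> \<zeta> - \<zeta> ^ l) \<in> M"
      using M_mult M(3) \<zeta>Z root_int by blast
    then show "\<sigma> \<zeta> / \<zeta> ^ l - 1 \<in> M" using \<zeta>0 by (simp add: field_simps)
  qed
  then have "\<sigma> \<zeta> = cis (2 * pi * int l / N)"
    using \<zeta>0 \<zeta>_pow[of l] by simp
  then show ?thesis
    unfolding galois_character_def \<zeta>_def[symmetric]
    using cis_eq_cong[OF N, of _ "int l"] dirichlet_character_cong[OF \<phi>, of _ "int l"]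
    by (intro the_equality) (metis, metis)
qed


section \<open>Tensor products\<close>

text \<open>
  For a multiplicative group \<open>U \<subseteq> \<complex>\<^sup>\<times>\<close>, an element of \<open>U \<otimes>\<^sub>\<int> 'k\<close> is represented by a formal
  sum \<open>\<Sum> c\<^sub>i [u\<^sub>i]\<close> standing for \<open>\<Sum> u\<^sub>i \<otimes> c\<^sub>i\<close>. Two formal sums represent the same element iff
  their difference is in the subspace \<open>tensor_relations U\<close>.
\<close>

definition formal_sums :: "complex set \<Rightarrow> (complex \<Rightarrow>\<^sub>0 'k::field) set"
  where "formal_sums U = {x. Poly_Mapping.keys x \<subseteq> U}"

inductive_set tensor_relations :: "complex set \<Rightarrow> (complex \<Rightarrow>\<^sub>0 'k::field) set"
  for U :: "complex set" where
  zero: "0 \<in> tensor_relations U"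
| step: "x \<in> tensor_relations U \<Longrightarrow> u \<in> U \<Longrightarrow> v \<in> U \<Longrightarrow>
    x + (Poly_Mapping.single (u * v) c - Poly_Mapping.single u c - Poly_Mapping.single v c)
      \<in> tensor_relations U"

definition tensor_eq :: "complex set \<Rightarrow> (complex \<Rightarrow>\<^sub>0 'k::field) \<Rightarrow> (complex \<Rightarrow>\<^sub>0 'k) \<Rightarrow> bool"
  where "tensor_eq U x y \<longleftrightarrow> x - y \<in> tensor_relations U"

definition tensor_scale :: "'k::field \<Rightarrow> (complex \<Rightarrow>\<^sub>0 'k) \<Rightarrow> (complex \<Rightarrow>\<^sub>0 'k)"
  where "tensor_scale c = Poly_Mapping.map ((*) c)"

definition tensor_act :: "(complex \<Rightarrow> complex) \<Rightarrow> (complex \<Rightarrow>\<^sub>0 'k::field) \<Rightarrow> (complex \<Rightarrow>\<^sub>0 'k)"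
  where "tensor_act \<tau> x =
    (\<Sum>u\<in>Poly_Mapping.keys x. Poly_Mapping.single (\<tau> u) (Poly_Mapping.lookup x u))"

text \<open>The linear map \<open>u \<otimes> c \<mapsto> f(u)c\<close>.\<close>

definition tensor_lift :: "(complex \<Rightarrow> 'k) \<Rightarrow> (complex \<Rightarrow>\<^sub>0 'k::field) \<Rightarrow> 'k"
  where "tensor_lift f x = (\<Sum>u\<in>Poly_Mapping.keys x. f u * Poly_Mapping.lookup x u)"

lemma tensor_lift_add: "tensor_lift f (x + y) = tensor_lift f x + tensor_lift f y"
proof -
  let ?A = "Poly_Mapping.keys x \<union> Poly_Mapping.keys y"
  have *: "tensor_lift f z = (\<Sum>u\<in>?A. f u * Poly_Mapping.lookup z u)"
    if "Poly_Mapping.keys z \<subseteq> ?A" for z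
    unfolding tensor_lift_def using that
    by (intro sum.mono_neutral_left) (auto simp: in_keys_iff)
  show ?thesis
    using Poly_Mapping.keys_add[of x y]
    by (simp add: * lookup_add distrib_left sum.distrib)
qed

lemma tensor_lift_single: "tensor_lift f (Poly_Mapping.single u c) = f u * c"
  by (simp add: tensor_lift_def)

lemma tensor_lift_diff: "tensor_lift f (x - y) = tensor_lift f x - tensor_lift f y"
  using tensor_lift_add[of f "x - y" y] by simp

text \<open>\<open>tensor_lift f\<close> descends to \<open>U \<otimes>\<^sub>\<int> 'k\<close> when \<open>f\<close> is a homomorphism on \<open>U\<close>.\<close>

lemma tensor_lift_cong:
  assumes "\<And>u v. u \<in> U \<Longrightarrow> v \<in> U \<Longrightarrow> f (u * v) = f u + f v" and "tensor_eq U x y"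
  shows "tensor_lift f x = tensor_lift f y"
proof -
  have "tensor_lift f z = 0" if "z \<in> tensor_relations U" for z
    using that
  proof induction
    case zero
    show ?case by (simp add: tensor_lift_def)
  next
    case (step x u v c)
    then show ?case
      by (simp add: tensor_lift_add tensor_lift_diff tensor_lift_single assms(1) algebra_simps)
  qed
  then have "tensor_lift f (x - y) = 0" using assms(2) by (simp add: tensor_eq_def)
  then show ?thesis by (simp add: tensor_lift_diff)
qed


section \<open>The two sides of the formula\<close>

text \<open>The \<open>\<psi>\<^sup>-\<^sup>1\<close>-eigenspace of \<open>\<O>\<^sub>H[1/p]\<^sup>\<times> \<otimes> 'k\<close>.\<close>

definition inverse_eigenspace ::
    "nat \<Rightarrow> (complex \<Rightarrow> 'k::field) \<Rightarrow> complex set \<Rightarrow> ((complex \<Rightarrow> complex) \<Rightarrow> complex) \<Rightarrow>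
     (complex \<Rightarrow>\<^sub>0 'k) set"
  where "inverse_eigenspace p \<iota> H \<psi> = {x \<in> formal_sums (p_units p H).
    \<forall>\<tau> \<in> Gal H. tensor_eq (p_units p H) (tensor_act \<tau> x) (tensor_scale (\<iota> (inverse (\<psi> \<tau>))) x)}"

definition inverse_eigenspace_basis ::
    "nat \<Rightarrow> (complex \<Rightarrow> 'k::field) \<Rightarrow> complex set \<Rightarrow> ((complex \<Rightarrow> complex) \<Rightarrow> complex) \<Rightarrow>
     (complex \<Rightarrow>\<^sub>0 'k) \<Rightarrow> bool"
  where "inverse_eigenspace_basis p \<iota> H \<psi> u \<longleftrightarrow>
    u \<in> inverse_eigenspace p \<iota> H \<psi> \<and> \<not> tensor_eq (p_units p H) u 0 \<and>
    (\<forall>x \<in> inverse_eigenspace p \<iota> H \<psi>. \<exists>c. tensor_eq (p_units p H) x (tensor_scale c u))"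

definition L_invariant ::
    "nat \<Rightarrow> (complex \<Rightarrow> 'k::{field_char_0, metric_space}) \<Rightarrow> complex set \<Rightarrow>
     ((complex \<Rightarrow> complex) \<Rightarrow> complex) \<Rightarrow> 'k"
  where "L_invariant p \<iota> H \<psi> =
    (let u = (SOME u. inverse_eigenspace_basis p \<iota> H \<psi> u)
     in - tensor_lift (\<lambda>x. padic_log p (\<iota> x)) u
          / tensor_lift (\<lambda>x. of_rat (padic_ord p (\<iota> x))) u)"

text \<open>
  \<open>L\<^sub>p(\<phi>\<omega>\<^sub>p, \<cdot>)\<close> on \<open>\<int>\<^sub>p\<close>, for \<open>\<phi>\<close> odd of conductor greater than 1 and prime to \<open>p\<close>
  (so that there is no pole); the parameter is \<open>\<phi>\<close>, not \<open>\<phi>\<omega>\<^sub>p\<close>.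
\<close>

definition kubota_leopoldt ::
    "nat \<Rightarrow> (complex \<Rightarrow> 'k::{field_char_0, metric_space}) \<Rightarrow> (int \<Rightarrow> complex) \<Rightarrow> 'k \<Rightarrow> 'k"
  where "kubota_leopoldt p \<iota> \<phi> = (THE f. f \<in> extensional padic_integers \<and> padic_analytic f \<and>
    (\<forall>k::nat. k \<ge> 1 \<longrightarrow> (\<forall>a. coprime a (int p) \<longrightarrow> (teichmuller p a :: 'k) ^ (k - 1) = 1) \<longrightarrow>
       f (1 - of_nat k) =
         \<iota> ((1 - \<phi> (int p) * of_nat p ^ (k - 1)) * dirichlet_L \<phi> (1 - of_nat k))))"

end

theory Submission
 imports Defs "HOL-Number_Theory.Residues" "Jordan_Normal_Form.Char_Poly"
begin

text \<open>
 The derivative at 0 of the measure-theoretic interpolation of \<open>L(\<phi>, 1 - k)\<close> is a logarithmic moment of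
 \<open>c = \<iota> \<circ> \<phi>\<close>. Let \<open>N\<close> divide \<open>q - 1\<close> with \<open>q = p\<^sup>f\<close>. A change of variables turns the moment into a
 combination of logarithms of factorials, and by the formula of Gross and Koblitz into
 \<open>\<Sum>\<^sub>r c(r) log g(r)\<close> for the Gauss sums \<open>g(r)\<close> over the field with \<open>q\<close> elements; the valuations of the \<open>g(r)\<close>
 give \<open>L(\<phi>, 0)\<close> in the same way. Since the norms of the \<open>g(r)\<^sup>N\<close> to \<open>H\<close> are \<open>p\<close>-units of \<open>H\<close>,
 these sums are the values of \<open>log\<close> and \<open>ord\<close> at an element of the eigenspace. The eigenspace is a
 line: an element of valuation 0 vanishes, because a \<open>p\<close>-unit all of whose conjugates have absolute
 value 1 in \<open>\<complex>\<close> and valuation 0 is a root of unity.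
\<close>

text \<open>The two sides meet in \<open>log_sum_units\<close>, the logarithm of Morita's Gamma
  function. \<open>log_moment_formula\<close> writes the derivative through its values at the
  integers \<open>r * p^(f * s) div N\<close>, and \<open>gs_lim\<close> writes the logarithms of
  the Gauss sums through its values at integers with repeated digits. After a permutation of the
  residues by \<open>p^i\<close>, under which \<open>c\<close> is invariant because \<phi>(p) = 1,
  both arguments approximate the same p-adic points; the \<open>f\<close> digits give the same
  factor \<open>f\<close> for logarithms and valuations, so it cancels in the ratio. The Gauss sums
  live twice. In \<open>'k\<close>, Dwork's series gives their size and logarithm; in C, the copies
  \<open>gauss_c\<close> carry the Galois action, and the exponents \<open>theta_exp\<close> tie the
  two together. That action is controlled only up to roots of unity of order dividing
  \<open>N\<close>, whence the powers g(r)^N. Oddness of \<phi> enters three times: \<open>c\<close>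
  sums to 0 over a period, so its sums over classes modulo p^n can be regularised to a measure; the
  masses become partial sums of \<open>c\<close>; and complex conjugation acts by -1 on the
  eigenspace.\<close>

no_notation vec_index (infixl "$" 100)
hide_const (open) up_ring.coeff up_ring.monom module.smult Coset.order

abbreviation (input) seq_limit (infix "\<leadsto>" 60) where "X \<leadsto> l \<equiv> (X \<longlongrightarrow> l) sequentially"

section \<open>The absolute value of \<open>'k\<close>, limits, and complete subfields\<close>

context padic_closure begin

definition av :: "'k => real" where "av x = dist x 0"

lemma dist_av: "dist x y = av (x - y)"
 using dist_translate[of x "- y" y] by (simp add: av_def)

lemma av_0 [simp]: "av 0 = 0" by (simp add: av_def)
lemma av_nonneg [simp]: "0 \<le> av x" by (simp add: av_def)
lemma av_eq_0 [simp]: "av x = 0 \<longleftrightarrow> x = 0" by (simp add: av_def)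
lemma av_pos [simp]: "0 < av x \<longleftrightarrow> x ~= 0" by (simp add: av_def)
lemma av_mult [simp]: "av (x * y) = av x * av y" by (simp add: av_def abs_mult)

lemma av_1 [simp]: "av 1 = 1"
 using av_mult[of 1 1] av_eq_0[of 1] by (metis mult_cancel_right1 mult_1 zero_neq_one)

lemma av_minus [simp]: "av (- x) = av x"
proof -
 have "(av (-1))\<^sup>2 = 1" using av_mult[of "-1" "-1"] by (simp add: power2_eq_square)
 hence "av (-1) = 1" using av_nonneg[of "-1"] by (simp add: power2_eq_1_iff)
 thus ?thesis using av_mult[of "-1" x] by simp
qed

lemma av_minus_commute: "av (x - y) = av (y - x)"
 using av_minus[of "x - y"] by simp

lemma av_add_max: "av (x + y) \<le> max (av x) (av y)"
 using ultrametric[of x "- y" 0] by (simp add: dist_av)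

lemma av_add_le: "av x \<le> c ==> av y \<le> c ==> av (x + y) \<le> c"
 using av_add_max[of x y] by simp

lemma av_add_less: "av x < c ==> av y < c ==> av (x + y) < c"
 using av_add_max[of x y] by simp

lemma av_diff_le: "av x \<le> c ==> av y \<le> c ==> av (x - y) \<le> c"
 using av_add_le[of x c "- y"] by simp

lemma av_diff_less: "av x < c ==> av y < c ==> av (x - y) < c"
 using av_add_less[of x c "- y"] by simp

lemma av_triangle: "av (x + y) \<le> av x + av y"
 using av_add_max[of x y] av_nonneg[of x] av_nonneg[of y] by linarith

lemma av_add_eq: "av x < av y ==> av (x + y) = av y"
 using av_add_max[of x y] av_add_max[of "x + y" "- x"] by auto

lemma av_eq_if_close: "av (x - y) < av y ==> av x = av y"
 using av_add_eq[of "x - y" y] by simp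

lemma av_power [simp]: "av (x^n) = av x^n"
 by (induction n) auto

lemma av_inverse [simp]: "av (inverse x) = inverse (av x)"
proof (cases "x = 0")
 case False
 hence "av (inverse x) * av x = 1" using av_mult[of "inverse x" x] by simp
 thus ?thesis by (metis inverse_unique mult.commute)
qed simp

lemma av_divide [simp]: "av (x / y) = av x / av y"
 by (simp add: divide_inverse)

lemma av_power_int [simp]: "av (x powi n) = av x powi n"
 by (cases n rule: int_cases3) (auto simp: power_int_minus)

lemma av_prod [simp]: "av (prod f A) = (\<Prod>i\<in>A. av (f i))"
 by (induction A rule: infinite_finite_induct) auto

lemma av_sum_le: "(!!i. i \<in> A ==> av (f i) \<le> c) ==> 0 \<le> c ==> av (sum f A) \<le> c"
 by (induction A rule: infinite_finite_induct) (auto intro: av_add_le)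

lemma av_sum_less: "(!!i. i \<in> A ==> av (f i) < c) ==> 0 < c ==> av (sum f A) < c"
 by (induction A rule: infinite_finite_induct) (auto intro: av_add_less)

lemma p_gt_1: "p > 1" using prime_p prime_gt_1_nat by blast

lemma p_gt_0 [simp]: "p > 0" using p_gt_1 by simp

lemma av_of_int: "n ~= 0 ==> av (of_int n) = 1 / real p^multiplicity (int p) n"
 using abs_of_int by (simp add: av_def)

lemma av_of_int_le: "av (of_int n) \<le> 1"
proof (cases "n = 0")
 case False
 thus ?thesis using p_gt_1 by (simp add: av_of_int)
qed simp

lemma av_of_nat_le: "av (of_nat n) \<le> 1"
 using av_of_int_le[of "int n"] by simp

lemma av_of_int_dvd:
 assumes "int p^k dvd n" shows "av (of_int n) \<le> 1 / real p^k"
proof (cases "n = 0")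
 case False
 have "\<not> is_unit (int p)" using p_gt_1 by simp
 hence "k \<le> multiplicity (int p) n" using assms False by (intro multiplicity_geI) auto
 hence "real p^k \<le> real p^multiplicity (int p) n"
  using p_gt_1 by (intro power_increasing) auto
 thus ?thesis using False p_gt_1 by (simp add: av_of_int field_simps)
qed simp

lemma av_p [simp]: "av (of_nat p) = 1 / real p"
proof -
 have "multiplicity (int p) (int p) = 1"
  using p_gt_1 by (intro multiplicity_self) auto
 thus ?thesis using av_of_int[of "int p"] p_gt_1 by simp
qed

lemma av_of_int_unit: "\<not> int p dvd n ==> av (of_int n) = 1"
 by (cases "n = 0") (auto simp: av_of_int not_dvd_imp_multiplicity_0)

lemma av_of_nat_unit: "\<not> p dvd n ==> av (of_nat n) = 1"
 using av_of_int_unit[of "int n"] by simp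

lemma av_of_int_less_iff: "av (of_int n) < 1 \<longleftrightarrow> int p dvd n"
proof
 assume "int p dvd n"
 hence "av (of_int n) \<le> 1 / real p" using av_of_int_dvd[of 1 n] by simp
 also have "... < 1" using p_gt_1 by simp
 finally show "av (of_int n) < 1" .
qed (use av_of_int_unit in force)

text \<open>\<open>metric_space\<close> alone does not tie the field operations to the distance, so
  the limit laws for them are derived from the absolute value through this equivalence.\<close>

lemma lim_iff: "(X \<longlongrightarrow> L) F \<longleftrightarrow> ((%n. av (X n - L)) \<longlongrightarrow> 0) F"
 by (subst tendsto_dist_iff) (simp add: dist_av)

lemma lim_zeroI:
 assumes "eventually (%n. av (X n - L) \<le> g n) F" "(g \<longlongrightarrow> 0) F"
 shows "(X \<longlongrightarrow> L) F"
 unfolding lim_iff using assms by (intro tendsto_sandwich[OF _ assms(1) tendsto_const assms(2)]) auto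

lemma lim_add:
 fixes X Y :: "_ => 'k"
 assumes "(X \<longlongrightarrow> a) F" "(Y \<longlongrightarrow> b) F" shows "((%n. X n + Y n) \<longlongrightarrow> a + b) F"
proof (rule lim_zeroI)
 show "((%n. av (X n - a) + av (Y n - b)) \<longlongrightarrow> 0) F"
  using tendsto_add[OF assms[unfolded lim_iff]] by simp
 show "\<forall>\<^sub>F n in F. av (X n + Y n - (a + b)) \<le> av (X n - a) + av (Y n - b)"
 proof (rule always_eventually, rule allI)
  fix n show "av (X n + Y n - (a + b)) \<le> av (X n - a) + av (Y n - b)"
   using av_triangle[of "X n - a" "Y n - b"] by (simp add: algebra_simps)
 qed
qed

lemma lim_mult:
 fixes X Y :: "_ => 'k"
 assumes "(X \<longlongrightarrow> a) F" "(Y \<longlongrightarrow> b) F" shows "((%n. X n * Y n) \<longlongrightarrow> a * b) F"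
proof (rule lim_zeroI)
 let ?g = "%n. av (X n - a) * av (Y n - b) + (av a * av (Y n - b) + av (X n - a) * av b)"
 have "(?g \<longlongrightarrow> 0 * 0 + (av a * 0 + 0 * av b)) F"
  by (intro tendsto_intros assms[unfolded lim_iff])
 thus "(?g \<longlongrightarrow> 0) F" by simp
 show "\<forall>\<^sub>F n in F. av (X n * Y n - a * b) \<le> ?g n"
 proof (rule always_eventually, rule allI)
  fix n
  have "X n * Y n - a * b = (X n - a) * (Y n - b) + (a * (Y n - b) + (X n - a) * b)"
   by (simp add: algebra_simps)
  hence "av (X n * Y n - a * b) \<le> av ((X n - a) * (Y n - b)) + av (a * (Y n - b) + (X n - a) * b)"
   using av_triangle by metis
  also have "av (a * (Y n - b) + (X n - a) * b) \<le> av (a * (Y n - b)) + av ((X n - a) * b)"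
   by (rule av_triangle)
  finally show "av (X n * Y n - a * b) \<le> ?g n" by simp
 qed
qed

lemma lim_const: "((%n. c) \<longlongrightarrow> (c :: 'k)) F" by simp

lemma lim_minus: "(X \<longlongrightarrow> (a :: 'k)) F ==> ((%n. - X n) \<longlongrightarrow> - a) F"
 using lim_mult[OF lim_const[of "-1"], of X a F] by simp

lemma lim_diff: "(X \<longlongrightarrow> (a :: 'k)) F ==> (Y \<longlongrightarrow> b) F ==> ((%n. X n - Y n) \<longlongrightarrow> a - b) F"
 using lim_add[OF _ lim_minus, of X a F Y b] by simp

lemma lim_sum: "(!!i. i \<in> A ==> (X i \<longlongrightarrow> (a i :: 'k)) F) ==> ((%n. \<Sum>i\<in>A. X i n) \<longlongrightarrow> (\<Sum>i\<in>A. a i)) F"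
 by (induction A rule: infinite_finite_induct) (auto intro!: lim_add)

lemma lim_prod: "(!!i. i \<in> A ==> (X i \<longlongrightarrow> (a i :: 'k)) F) ==> ((%n. \<Prod>i\<in>A. X i n) \<longlongrightarrow> (\<Prod>i\<in>A. a i)) F"
 by (induction A rule: infinite_finite_induct) (auto intro!: lim_mult)


lemma lim_av: "(X \<longlongrightarrow> a) F ==> ((%n. av (X n)) \<longlongrightarrow> av a) F"
 unfolding av_def by (intro tendsto_intros)

lemma lim_inverse:
 fixes X :: "_ => 'k"
 assumes "(X \<longlongrightarrow> a) F" "a ~= 0" shows "((%n. inverse (X n)) \<longlongrightarrow> inverse a) F"
proof (rule lim_zeroI)
 have "((%n. av (X n - a)) \<longlongrightarrow> 0) F" using assms(1) by (simp add: lim_iff)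
 hence ev: "\<forall>\<^sub>F n in F. av (X n - a) < av a"
  using assms(2) by (intro order_tendstoD(2)) auto
 show "((%n. av (X n - a) / (av a)\<^sup>2) \<longlongrightarrow> 0) F"
  using tendsto_divide[OF assms(1)[unfolded lim_iff] tendsto_const, of "(av a)\<^sup>2"] assms(2) by simp
 show "\<forall>\<^sub>F n in F. av (inverse (X n) - inverse a) \<le> av (X n - a) / (av a)\<^sup>2"
  using ev
 proof eventually_elim
  case (elim n)
  \<comment> \<open>The ultrametric inequality freezes the absolute value near a nonzero limit, so
    the denominators \<open>X n * a\<close> have constant size.\<close>
  hence e: "av (X n) = av a" by (rule av_eq_if_close)
  hence "X n ~= 0" using assms(2) by (metis av_eq_0)
  hence "inverse (X n) - inverse a = - ((X n - a) / (X n * a))"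
   using assms(2) by (simp add: field_simps)
  thus ?case using e by (simp add: power2_eq_square)
 qed
qed

lemma lim_divide: "(X \<longlongrightarrow> (a :: 'k)) F ==> (Y \<longlongrightarrow> b) F ==> b ~= 0 ==> ((%n. X n / Y n) \<longlongrightarrow> a / b) F"
 by (simp add: divide_inverse lim_mult lim_inverse)

lemma lim_av_le:
 assumes "(X \<longlongrightarrow> a) F" "eventually (%n. av (X n) \<le> c) F" "F ~= bot" shows "av a \<le> c"
 using tendsto_upperbound[OF lim_av[OF assms(1)] assms(2,3)] .

lemma sums_add_k: "f sums (s :: 'k) ==> g sums t ==> (%n. f n + g n) sums (s + t)"
 unfolding sums_def sum.distrib by (rule lim_add)

lemma sums_diff_k: "f sums (s :: 'k) ==> g sums t ==> (%n. f n - g n) sums (s - t)"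
 unfolding sums_def sum_subtractf by (rule lim_diff)

lemma sums_mult_k: "f sums (s :: 'k) ==> (%n. c * f n) sums (c * s)"
 unfolding sums_def sum_distrib_left[symmetric] by (intro lim_mult lim_const)

lemma sums_sum_k: "(!!i. i \<in> A ==> f i sums (s i :: 'k)) ==> (%n. \<Sum>i\<in>A. f i n) sums (\<Sum>i\<in>A. s i)"
proof (induction A rule: infinite_finite_induct)
 case (insert x A)
 thus ?case by (simp add: sums_add_k)
qed auto

lemma sums_av_le:
 assumes "f sums (s :: 'k)" "!!n. av (f n) \<le> c" shows "av s \<le> c"
proof (rule lim_av_le)
 have "0 \<le> c" using assms(2)[of 0] av_nonneg order_trans by blast
 thus "\<forall>\<^sub>F n in sequentially. av (\<Sum>i<n. f i) \<le> c" using assms(2) by (intro always_eventually allI av_sum_le)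
qed (use assms(1) in \<open>auto simp: sums_def\<close>)

lemma sums_imp_lim_0:
 assumes "f sums (s :: 'k)" shows "f \<leadsto> 0"
proof -
 have "(%n. \<Sum>i<n. f i) \<leadsto> s" using assms by (simp add: sums_def)
 from lim_diff[OF LIMSEQ_Suc[OF this] this] show ?thesis by simp
qed


lemma sums_Suc_k:
 assumes "f sums (s :: 'k)" shows "(%n. f (Suc n)) sums (s - f 0)"
proof -
 have "(%n. \<Sum>i<Suc n. f i) \<leadsto> s" using assms unfolding sums_def by (rule LIMSEQ_Suc)
 hence "(%n. f 0 + (\<Sum>i<n. f (Suc i))) \<leadsto> s" by (simp only: sum.lessThan_Suc_shift)
 from lim_diff[OF this lim_const[of "f 0"]] show ?thesis unfolding sums_def by simp
qed

text \<open>By the ultrametric inequality a difference of distant terms is no larger than the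
  largest step between them, so steps tending to 0 suffice.\<close>

lemma Cauchy_av:
 assumes "(%n. X (Suc n) - X n) \<leadsto> (0 :: 'k)" shows "Cauchy X"
proof (rule metric_CauchyI)
 fix e :: real assume "e > 0"
 have "(%n. av (X (Suc n) - X n)) \<leadsto> 0" using assms by (simp add: lim_iff)
 hence "\<forall>\<^sub>F n in sequentially. av (X (Suc n) - X n) < e" using \<open>e > 0\<close> by (intro order_tendstoD(2))
 then obtain M where M: "!!n. n >= M ==> av (X (Suc n) - X n) < e" by (auto simp: eventually_sequentially)
 have *: "av (X (M + n) - X M) < e" for n
 proof (induction n)
  case (Suc n)
  have "X (M + Suc n) - X M = (X (Suc (M + n)) - X (M + n)) + (X (M + n) - X M)" by simp
  thus ?case using av_add_less[OF M[of "M + n"] Suc] by simp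
 qed (use \<open>e > 0\<close> in simp)
 have **: "av (X n - X M) < e" if "n >= M" for n using *[of "n - M"] that by simp
 have "dist (X m) (X n) < e" if "m >= M" "n >= M" for m n
  using av_diff_less[OF **[OF that(1)] **[OF that(2)]] by (simp add: dist_av)
 thus "\<exists>M. \<forall>m\<ge>M. \<forall>n\<ge>M. dist (X m) (X n) < e" by blast
qed

text \<open>
 \<open>'k\<close> is not complete, so every limit is taken inside a complete subfield: each finite set lies
 in one, because a finite-dimensional space over \<open>\<rat>\<^sub>p\<close> is complete.
\<close>

definition complete_subfield :: "'k set => bool"
 where "complete_subfield R \<longleftrightarrow> \<rat> \<subseteq> R & (\<forall>x\<in>R. \<forall>y\<in>R. x + y \<in> R & x * y \<in> R) &
  (\<forall>x\<in>R. inverse x \<in> R) & complete R"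

lemma complete_subfieldD:
 assumes "complete_subfield R"
 shows "r \<in> \<rat> ==> r \<in> R" "x \<in> R ==> y \<in> R ==> x + y \<in> R" "x \<in> R ==> y \<in> R ==> x * y \<in> R"
  "x \<in> R ==> inverse x \<in> R" "complete R"
 using assms by (auto simp: complete_subfield_def)

context
 fixes R assumes R: "complete_subfield R"
begin

lemmas csD = complete_subfieldD[OF R]

lemma cs_0 [simp]: "0 \<in> R" and cs_1 [simp]: "1 \<in> R" and cs_of_nat [simp]: "of_nat n \<in> R"
 and cs_of_int [simp]: "of_int i \<in> R"
 using csD(1) by auto

lemma cs_minus [simp]: "x \<in> R ==> - x \<in> R"
 using csD(3)[of "of_int (-1)" x] by (simp del: of_int_minus) simp

lemma cs_diff [simp]: "x \<in> R ==> y \<in> R ==> x - y \<in> R"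
 using csD(2)[of x "- y"] by simp

lemma cs_divide [simp]: "x \<in> R ==> y \<in> R ==> x / y \<in> R"
 by (simp add: divide_inverse csD)

lemma cs_power [simp]: "x \<in> R ==> x^n \<in> R"
 by (induction n) (auto simp: csD)

lemma cs_sum: "(!!i. i \<in> A ==> f i \<in> R) ==> sum f A \<in> R"
 by (induction A rule: infinite_finite_induct) (auto simp: csD)


lemma cs_lim:
 assumes "(%n. X (Suc n) - X n) \<leadsto> 0" "!!n. X n \<in> R"
 obtains L where "L \<in> R" "X \<leadsto> L"
 using csD(5) Cauchy_av[OF assms(1)] assms(2) unfolding complete_def by blast

lemma cs_sums:
 assumes "f \<leadsto> 0" "!!n. f n \<in> R"
 obtains s where "s \<in> R" "f sums s"
 using cs_lim[of "%n. \<Sum>i<n. f i"] assms by (auto simp: sums_def intro: cs_sum)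

lemma cs_closed: "(!!n. X n \<in> R) ==> X \<leadsto> L ==> L \<in> R"
 using csD(5) complete_imp_closed closed_sequential_limits by blast

text \<open>Induction on \<open>d\<close>. If \<open>v d\<close> lies outside the span
  \<open>V\<close> of the earlier vectors, then \<open>V\<close>, being complete, is closed and
  misses a ball of radius \<delta> around \<open>v d\<close>. Hence
  \<open>\<delta> * av a \<le> av (w + a * v d)\<close>: the last coefficients of a Cauchy sequence
  are Cauchy in \<open>R\<close>, and the remaining parts are Cauchy in \<open>V\<close>.\<close>

lemma complete_finite_span:
 fixes v :: "nat => 'k"
 shows "complete {(\<Sum>i<d. c i * v i) | c. \<forall>i. c i \<in> R}"
proof (induction d)
 case 0
 have "{(\<Sum>i<0. c i * v i) | c. \<forall>i. c i \<in> R} \<subseteq> {0}" by auto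
 thus ?case by (metis (no_types, lifting) complete_def ex_in_conv subset_singletonD compact_imp_complete compact_empty compact_sing)
next
 case (Suc d)
 define V where "V = {(\<Sum>i<d. c i * v i) | c. \<forall>i. c i \<in> R}"
 define W where "W = {(\<Sum>i<Suc d. c i * v i) | c. \<forall>i. c i \<in> R}"
 have V: "complete V" using Suc by (simp add: V_def)
 have Vadd: "x + y \<in> V" if xy: "x \<in> V" "y \<in> V" for x y
 proof -
  obtain c c' where "x = (\<Sum>i<d. c i * v i)" "\<forall>i. c i \<in> R" "y = (\<Sum>i<d. c' i * v i)" "\<forall>i. c' i \<in> R"
   using xy by (auto simp: V_def)
  hence "x + y = (\<Sum>i<d. (c i + c' i) * v i) & (\<forall>i. c i + c' i \<in> R)"
   by (simp add: sum.distrib algebra_simps csD)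
  thus ?thesis unfolding V_def by (intro CollectI exI[of _ "%i. c i + c' i"])
 qed
 have Vmult: "a * x \<in> V" if ax: "a \<in> R" "x \<in> V" for a x
 proof -
  obtain c where "x = (\<Sum>i<d. c i * v i)" "\<forall>i. c i \<in> R" using ax by (auto simp: V_def)
  hence "a * x = (\<Sum>i<d. (a * c i) * v i) & (\<forall>i. a * c i \<in> R)"
   using ax by (simp add: sum_distrib_left algebra_simps csD)
  thus ?thesis unfolding V_def by (intro CollectI exI[of _ "%i. a * c i"])
 qed
 have W_iff: "x \<in> W \<longleftrightarrow> (\<exists>w\<in>V. \<exists>a\<in>R. x = w + a * v d)" for x
 proof
  assume "x \<in> W"
  then obtain c where "x = (\<Sum>i<Suc d. c i * v i)" "\<forall>i. c i \<in> R" by (auto simp: W_def)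
  thus "\<exists>w\<in>V. \<exists>a\<in>R. x = w + a * v d"
   by (intro bexI[of _ "\<Sum>i<d. c i * v i"] bexI[of _ "c d"]) (auto simp: V_def)
 next
  assume "\<exists>w\<in>V. \<exists>a\<in>R. x = w + a * v d"
  then obtain c a where c: "x = (\<Sum>i<d. c i * v i) + a * v d" "\<forall>i. c i \<in> R" "a \<in> R" by (auto simp: V_def)
  have "x = (\<Sum>i<Suc d. (c(d := a)) i * v i)" using c by simp
  moreover have "\<forall>i. (c(d := a)) i \<in> R" using c by simp
  ultimately show "x \<in> W" unfolding W_def by blast
 qed
 have "complete W"
 proof (cases "v d \<in> V")
  case True
  have "W = V"
  proof (intro equalityI subsetI)
   fix x assume "x \<in> V" thus "x \<in> W" unfolding W_iff by (intro bexI[of _ x] bexI[of _ 0]) auto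
  qed (auto simp: W_iff intro!: Vadd Vmult True)
  thus ?thesis using V by simp
 next
  case False
  have "closed V" using V by (rule complete_imp_closed)
  then obtain \<delta> where \<delta>: "\<delta> > 0" "ball (v d) \<delta> \<subseteq> - V"
   using False by (metis Compl_iff open_Compl open_contains_ball)
  have key: "\<delta> * av a \<le> av (w + a * v d)" if "w \<in> V" "a \<in> R" for w a
  proof (cases "a = 0")
   case False
   have "(- inverse a) * w \<in> V" using that by (intro Vmult cs_minus csD(4))
   hence "\<delta> \<le> dist (v d) ((- inverse a) * w)" using \<delta>(2) by (force simp: subset_iff)
   also have "... = av ((w + a * v d) / a)" using False by (simp add: dist_av field_simps)
   finally show ?thesis using False by (simp add: field_simps)
  qed simp
  show ?thesis unfolding complete_def
  proof (intro allI impI)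
   fix X assume X: "(\<forall>n. X n \<in> W) & Cauchy X"
   hence "\<forall>n. \<exists>w a. w \<in> V & a \<in> R & X n = w + a * v d" using W_iff by meson
   then obtain w a where wa: "!!n. w n \<in> V" "!!n. a n \<in> R" "!!n. X n = w n + a n * v d" by metis
   have le: "\<delta> * av (a m - a n) \<le> av (X m - X n)" for m n
   proof -
    have "X m - X n = (w m + (- 1) * w n) + (a m - a n) * v d" by (simp add: wa algebra_simps)
    moreover have "w m + (- 1) * w n \<in> V" using wa by (intro Vadd Vmult) auto
    ultimately show ?thesis using key wa(2) by simp
   qed
   have "Cauchy a"
   proof (rule metric_CauchyI)
    fix e :: real assume "e > 0"
    then obtain M where "\<forall>m\<ge>M. \<forall>n\<ge>M. dist (X m) (X n) < e * \<delta>"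
     using X \<delta>(1) metric_CauchyD[of X "e * \<delta>"] by (meson mult_pos_pos)
    hence "\<forall>m\<ge>M. \<forall>n\<ge>M. av (a m - a n) * \<delta> < e * \<delta>"
     using le by (metis dist_av mult.commute order_le_less_trans)
    thus "\<exists>M. \<forall>m\<ge>M. \<forall>n\<ge>M. dist (a m) (a n) < e" using \<delta>(1) by (auto simp: dist_av)
   qed
   then obtain a0 where a0: "a0 \<in> R" "a \<leadsto> a0" using csD(5) wa(2) by (auto simp: complete_def)
   have "Cauchy w"
   proof (rule Cauchy_av)
    have "Cauchy X" using X by simp
    have "(%n. X (Suc n) - X n) \<leadsto> 0"
    proof (rule metric_LIMSEQ_I)
     fix r :: real assume "r > 0"
     then obtain M where "\<forall>m\<ge>M. \<forall>n\<ge>M. dist (X m) (X n) < r" using metric_CauchyD[OF \<open>Cauchy X\<close>] by blast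
     thus "\<exists>no. \<forall>n\<ge>no. dist (X (Suc n) - X n) 0 < r"
      by (intro exI[of _ M]) (simp add: dist_av)
    qed
    moreover have "(%n. (a (Suc n) - a n) * v d) \<leadsto> (a0 - a0) * v d"
     by (intro lim_mult lim_diff lim_const LIMSEQ_Suc a0)
    ultimately have "(%n. (X (Suc n) - X n) - (a (Suc n) - a n) * v d) \<leadsto> 0 - (a0 - a0) * v d"
     by (rule lim_diff)
    thus "(%n. w (Suc n) - w n) \<leadsto> 0" by (simp add: wa(3) algebra_simps)
   qed
   then obtain w0 where w0: "w0 \<in> V" "w \<leadsto> w0" using V wa(1) by (auto simp: complete_def)
   have "X \<leadsto> w0 + a0 * v d"
    unfolding wa(3) by (intro lim_add lim_mult lim_const w0 a0)
   thus "\<exists>l\<in>W. X \<leadsto> l" using w0 a0 W_iff by blast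
  qed
 qed
 thus ?case by (simp add: W_def)
qed


end

lemma complete_subfield_padic: "complete_subfield padic_numbers"
 unfolding complete_subfield_def
proof (intro conjI ballI)
 show "\<rat> \<subseteq> (padic_numbers :: 'k set)" by (simp add: padic_numbers_def closure_subset)
 show "complete (padic_numbers :: 'k set)" by (rule complete_padic_numbers)
next
 fix x y :: 'k assume "x \<in> padic_numbers" "y \<in> padic_numbers"
 then obtain X Y where "\<forall>n. X n \<in> \<rat>" "X \<leadsto> x" "\<forall>n. Y n \<in> \<rat>" "Y \<leadsto> y"
  by (auto simp: padic_numbers_def closure_sequential)
 thus "x + y \<in> padic_numbers" "x * y \<in> padic_numbers"
  unfolding padic_numbers_def closure_sequential
  by (intro exI[of _ "%n. X n + Y n"] conjI lim_add, auto,
    intro exI[of _ "%n. X n * Y n"] conjI lim_mult, auto)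
next
 fix x :: 'k assume "x \<in> padic_numbers"
 then obtain X where X: "\<forall>n. X n \<in> \<rat>" "X \<leadsto> x"
  by (auto simp: padic_numbers_def closure_sequential)
 show "inverse x \<in> padic_numbers"
 proof (cases "x = 0")
  case True
  thus ?thesis unfolding padic_numbers_def using closure_subset[of "\<rat> :: 'k set"] by auto
 next
  case False
  with X show ?thesis unfolding padic_numbers_def closure_sequential
   by (intro exI[of _ "%n. inverse (X n)"] conjI lim_inverse) auto
 qed
qed

lemma padic_subset: "complete_subfield R ==> padic_numbers \<subseteq> R"
 unfolding padic_numbers_def using cs_closed[of R] complete_subfieldD(1) closure_sequential by (metis subsetI)

definition adjoin :: "'k set => 'k => 'k set"
 where "adjoin R x = {poly g x | g. \<forall>i. coeff g i \<in> R}"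

lemma adjoin_closed:
 assumes "complete_subfield R" "y \<in> adjoin R x" "z \<in> adjoin R x"
 shows "y + z \<in> adjoin R x" "y * z \<in> adjoin R x" "y - z \<in> adjoin R x"
proof -
 obtain g h where gh: "y = poly g x" "z = poly h x" "\<forall>i. coeff g i \<in> R" "\<forall>i. coeff h i \<in> R"
  using assms by (auto simp: adjoin_def)
 show "y + z \<in> adjoin R x" unfolding adjoin_def
  using gh assms(1) by (intro CollectI exI[of _ "g + h"]) (auto intro: complete_subfieldD)
 show "y - z \<in> adjoin R x" unfolding adjoin_def
  using gh assms(1) by (intro CollectI exI[of _ "g - h"]) auto
 show "y * z \<in> adjoin R x" unfolding adjoin_def
  using gh assms(1) by (intro CollectI exI[of _ "g * h"]) (auto simp: coeff_mult intro!: cs_sum complete_subfieldD(3)[OF assms(1)])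
qed

lemma adjoin_base: "complete_subfield R ==> y \<in> R ==> y \<in> adjoin R x"
 unfolding adjoin_def by (intro CollectI exI[of _ "[:y:]"]) (auto simp: coeff_pCons split: nat.split)

lemma adjoin_gen: "complete_subfield R ==> x \<in> adjoin R x"
 unfolding adjoin_def by (intro CollectI exI[of _ "[:0, 1:]"]) (auto simp: coeff_pCons split: nat.split)

lemma adjoin_poly:
 assumes R: "complete_subfield R" and "y \<in> adjoin R x" "!!i. coeff h i \<in> R"
 shows "poly h y \<in> adjoin R x"
 using assms(3)
proof (induction h)
 case 0
 show ?case using adjoin_base[OF R, of 0] R by simp
next
 case (pCons a h)
 have "a \<in> R" using pCons(3)[of 0] by simp
 moreover have "poly h y \<in> adjoin R x"
  using pCons(2) pCons(3) by (metis coeff_pCons_Suc)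
 ultimately show ?case using adjoin_closed[OF R] adjoin_base[OF R] assms(2) by simp
qed

text \<open>Algebraicity gives a relation for \<open>y\<close>; stripping the factor
  \<open>X^k\<close> leaves one with nonzero constant term, which is solved for
  \<open>inverse y\<close> as a polynomial in \<open>y\<close>. Such polynomials stay in
  \<open>adjoin R x\<close>.\<close>

lemma adjoin_inverse:
 assumes R: "complete_subfield R" and y: "y \<in> adjoin R x" shows "inverse y \<in> adjoin R x"
proof (cases "y = 0")
 case False
 obtain f where f: "f ~= 0" "!!i. coeff f i \<in> padic_numbers" "poly f y = 0"
  using algebraic_over_padic_numbers[of y] by blast
 obtain g where g: "f = [:- 0, 1:]^order 0 f * g" "\<not> [:- 0, 1:] dvd g"
  using order_decomp[OF f(1)] by blast
 define k where "k = order 0 f"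
 have fg: "f = monom 1 k * g" using g(1) by (simp add: monom_altdef k_def)
 have "coeff g i = coeff f (i + k)" for i
  unfolding fg by (simp add: coeff_monom_mult)
 hence gR: "coeff g i \<in> R" for i using f(2) padic_subset[OF R] by auto
 have "poly g y = 0" using f(3) False unfolding fg by (simp add: poly_monom)
 have g0: "coeff g 0 ~= 0" using g(2) poly_eq_0_iff_dvd[of g 0] by (simp add: poly_0_coeff_0)
 obtain a h where ah: "g = pCons a h" by (cases g)
 have hR: "coeff h i \<in> R" for i using gR[of "Suc i"] ah by simp
 have "a + y * poly h y = 0" using \<open>poly g y = 0\<close> ah by simp
 hence "inverse y = (- inverse a) * poly h y"
  using False g0 ah by (simp add: field_simps eq_neg_iff_add_eq_0)
 moreover have "- inverse a \<in> adjoin R x"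
  using gR[of 0] ah R by (intro adjoin_base cs_minus) (auto intro: complete_subfieldD)
 ultimately show ?thesis using adjoin_closed(2)[OF R] adjoin_poly[OF R y hR] by metis
qed (use adjoin_base[OF R, of 0] R in simp)

text \<open>A relation of degree \<open>d\<close> over Q_p, which \<open>R\<close> contains,
  rewrites every power of \<open>x\<close> through the first \<open>d\<close> powers. So the ring is
  a finite span over \<open>R\<close>, and \<open>complete_finite_span\<close> applies.\<close>

lemma complete_subfield_adjoin:
 assumes R: "complete_subfield R" shows "complete_subfield (adjoin R x)"
proof -
 obtain f where f: "f ~= 0" "!!i. coeff f i \<in> padic_numbers" "poly f x = 0"
  using algebraic_over_padic_numbers[of x] by blast
 have fR: "coeff f i \<in> R" for i using f(2) padic_subset[OF R] by auto
 define d where "d = degree f"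
 define V where "V = {(\<Sum>i<d. c i * x^i) | c. \<forall>i. c i \<in> R}"
 have lc: "coeff f d ~= 0" using f(1) by (simp add: d_def)
 have V0: "0 \<in> V" unfolding V_def using R by (intro CollectI exI[of _ "%i. 0"]) auto
 have Vadd: "y + z \<in> V" if yz: "y \<in> V" "z \<in> V" for y z
 proof -
  obtain c c' where "y = (\<Sum>i<d. c i * x^i)" "\<forall>i. c i \<in> R" "z = (\<Sum>i<d. c' i * x^i)" "\<forall>i. c' i \<in> R"
   using yz by (auto simp: V_def)
  hence "y + z = (\<Sum>i<d. (c i + c' i) * x^i) & (\<forall>i. c i + c' i \<in> R)"
   using R by (simp add: sum.distrib algebra_simps complete_subfieldD)
  thus ?thesis unfolding V_def by (intro CollectI exI[of _ "%i. c i + c' i"])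
 qed
 have Vmult: "a * y \<in> V" if ay: "a \<in> R" "y \<in> V" for a y
 proof -
  obtain c where "y = (\<Sum>i<d. c i * x^i)" "\<forall>i. c i \<in> R" using ay by (auto simp: V_def)
  hence "a * y = (\<Sum>i<d. (a * c i) * x^i) & (\<forall>i. a * c i \<in> R)"
   using ay R by (simp add: sum_distrib_left algebra_simps complete_subfieldD)
  thus ?thesis unfolding V_def by (intro CollectI exI[of _ "%i. a * c i"])
 qed
 have Vsum: "sum g A \<in> V" if "!!i. i \<in> A ==> g i \<in> V" for g and A :: "nat set"
  using that by (induction A rule: infinite_finite_induct) (auto intro: Vadd V0)
 have Vpow: "x^n \<in> V" for n
 proof (induction n rule: less_induct)
  case (less n)
  show ?case
  proof (cases "n < d")
   case True
   have "x^n = (\<Sum>i<d. (if i = n then 1 else 0) * x^i)"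
    using True by (simp add: if_distrib[of "%a. a * _"] cong: if_cong)
   thus ?thesis unfolding V_def
    using R by (intro CollectI exI[of _ "%i. if i = n then 1 else 0"]) auto
  next
   case False
   have "(\<Sum>i\<le>d. coeff f i * x^i) = 0" using f(3) by (simp add: poly_altdef d_def)
   hence "(\<Sum>i<d. coeff f i * x^i) + coeff f d * x^d = 0"
    by (simp add: lessThan_Suc_atMost[symmetric])
   hence "x^d = (\<Sum>i<d. - (coeff f i / coeff f d) * x^i)"
    using lc by (simp add: sum_negf sum_divide_distrib[symmetric] field_simps eq_neg_iff_add_eq_0)
   hence "x^(n - d) * x^d = x^(n - d) * (\<Sum>i<d. - (coeff f i / coeff f d) * x^i)" by (rule arg_cong)
   also have "... = (\<Sum>i<d. - (coeff f i / coeff f d) * x^(n - d + i))"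
    by (simp only: sum_distrib_left power_add mult_ac)
   also have "x^(n - d) * x^d = x^n" using False by (simp only: power_add[symmetric]) simp
   finally have "x^n = (\<Sum>i<d. - (coeff f i / coeff f d) * x^(n - d + i))" .
   also have "... \<in> V" using False less fR R by (intro Vsum Vmult) auto
   finally show ?thesis .
  qed
 qed
 have "adjoin R x = V"
 proof (intro equalityI subsetI)
  fix y assume "y \<in> adjoin R x"
  then obtain g where "y = poly g x" "\<forall>i. coeff g i \<in> R" by (auto simp: adjoin_def)
  thus "y \<in> V" unfolding poly_altdef by (auto intro!: Vsum Vmult Vpow)
 next
  fix y assume "y \<in> V"
  then obtain c where c: "y = (\<Sum>i<d. c i * x^i)" "\<forall>i. c i \<in> R" by (auto simp: V_def)
  have "(\<Sum>i\<in>A. c i * x^i) \<in> adjoin R x" if "finite A" for A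
   using that
  proof induction
   case empty thus ?case using adjoin_base[OF R, of 0] R by simp
  next
   case (insert i A)
   have "x^i \<in> adjoin R x" for i
    by (induction i) (use adjoin_base[OF R, of 1] R adjoin_gen[OF R] adjoin_closed(2)[OF R] in auto)
   thus ?case using insert c adjoin_closed[OF R] adjoin_base[OF R] by simp
  qed
  thus "y \<in> adjoin R x" using c by simp
 qed
 moreover have "complete V" unfolding V_def by (rule complete_finite_span[OF R])
 ultimately have "complete (adjoin R x)" by simp
 moreover have "\<rat> \<subseteq> adjoin R x" using adjoin_base[OF R] complete_subfieldD(1)[OF R] by blast
 ultimately show ?thesis unfolding complete_subfield_def
  by (intro conjI ballI adjoin_closed[OF R] adjoin_inverse[OF R])
qed

lemma finite_complete_subfield:
 assumes "finite S" obtains R where "complete_subfield R" "S \<subseteq> R"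
 using assms
proof (induction S arbitrary: thesis)
 case empty
 thus ?case using complete_subfield_padic by blast
next
 case (insert x S)
 obtain R where R: "complete_subfield R" "S \<subseteq> R" using insert(3) by blast
 hence "insert x S \<subseteq> adjoin R x" using adjoin_gen adjoin_base by blast
 thus ?case using complete_subfield_adjoin[OF R(1)] insert(4) by blast
qed


section \<open>Value group and residue field of \<open>'k\<close>\<close>

lemma av_rat:
 assumes "r \<in> \<rat>" "r ~= 0" obtains m where "av r = real p powi m"
proof -
 obtain a b where ab: "r = of_int a / of_int b" "b ~= 0" "a ~= 0"
  using assms by (elim Rats_cases') auto
 have "av r = real p powi (int (multiplicity (int p) b) - int (multiplicity (int p) a))"
  using ab p_gt_1 by (simp add: av_of_int power_int_diff)
 thus ?thesis by (rule that)
qed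

lemma padic_approx:
 assumes "y \<in> padic_numbers" "e > 0" obtains r where "r \<in> \<rat>" "av (y - r) < e"
 using assms unfolding padic_numbers_def closure_approachable
 by (metis dist_av dist_commute)

lemma av_padic:
 assumes "y \<in> padic_numbers" "y ~= 0" obtains m where "av y = real p powi m"
proof -
 obtain r where r: "r \<in> \<rat>" "av (y - r) < av y" using padic_approx[of y "av y"] assms by auto
 hence "av y = av r" using av_eq_if_close[of r y] av_minus_commute by metis
 thus ?thesis using av_rat[OF r(1)] assms(2) that by (metis av_0 av_eq_0)
qed

text \<open>A sum in which one term strictly dominates cannot vanish, so the maximum of the absolute
  values is attained at least twice.\<close>

lemma sum_zero_imp_equal_av:
 assumes "finite A" "sum f A = 0" "i \<in> A" "f i ~= 0"
 obtains j k where "j \<in> A" "k \<in> A" "j ~= k" "av (f j) = av (f k)" "f j ~= 0"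
proof -
 have A: "A ~= {}" using assms by auto
 define M where "M = Max ((%i. av (f i)) ` A)"
 have "M \<in> (%i. av (f i)) ` A" unfolding M_def using assms A by (intro Max_in) auto
 then obtain j where j: "j \<in> A" "av (f j) = M" by auto
 have le: "av (f k) \<le> M" if "k \<in> A" for k unfolding M_def using that assms by (intro Max_ge) auto
 have M: "M > 0" using le[OF assms(3)] assms(4) by (metis av_pos order_less_le_trans)
 have "\<exists>k\<in>A - {j}. \<not> av (f k) < M"
 proof (rule ccontr)
  assume "\<not> ?thesis"
  hence "av (\<Sum>k\<in>A - {j}. f k) < M" using M by (intro av_sum_less) auto
  hence "av (\<Sum>k\<in>A - {j}. f k) < av (f j)" using j by simp
  from av_add_eq[OF this] have "av (sum f A) = av (f j)"
   using sum.remove[OF assms(1) j(1), of f] by (simp add: add.commute)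
  thus False using M j assms(2) by simp
 qed
 then obtain k where "k \<in> A" "k ~= j" "av (f k) = M" using le by force
 thus ?thesis using that[of j k] j M by force
qed

text \<open>Two terms of a polynomial relation for \<open>x\<close> have equal absolute value. Their
  quotient expresses a power of \<open>av x\<close> through absolute values of coefficients, and
  these are powers of \<open>p\<close> because Q_p is the closure of the rationals.\<close>

lemma value_group:
 assumes "x ~= 0" obtains n m where "n > 0" "av x^n = real p powi m"
proof -
 obtain f where f: "f ~= 0" "!!i. coeff f i \<in> padic_numbers" "poly f x = 0"
  using algebraic_over_padic_numbers[of x] by blast
 have "(\<Sum>i\<le>degree f. coeff f i * x^i) = 0" using f(3) by (simp add: poly_altdef)
 then obtain j k where jk: "j ~= k" "av (coeff f j * x^j) = av (coeff f k * x^k)" "coeff f j * x^j ~= 0"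
  using assms f(1) by (elim sum_zero_imp_equal_av[OF finite_atMost, of _ _ "degree f"]) auto
 have "coeff f k * x^k ~= 0" using jk by (metis av_eq_0)
 hence "\<exists>j k. j < k & av (coeff f j * x^j) = av (coeff f k * x^k) & coeff f j ~= 0"
  using jk by (cases "j < k") (metis mult_zero_left, metis mult_zero_left nat_neq_iff)
 then obtain j k where jk: "j < k" "av (coeff f j * x^j) = av (coeff f k * x^k)" "coeff f j ~= 0" by blast
 hence ck: "coeff f k ~= 0" using assms by (metis av_eq_0 mult_eq_0_iff power_not_zero)
 obtain a b where ab: "av (coeff f j) = real p powi a" "av (coeff f k) = real p powi b"
  using av_padic f(2) jk(3) ck by metis
 have "av (coeff f j) * av x^j = av (coeff f k) * (av x^(k - j) * av x^j)"
  using jk by (simp add: power_add[symmetric])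
 hence "av (coeff f j) = av (coeff f k) * av x^(k - j)" using assms by simp
 hence "av x^(k - j) = real p powi (a - b)"
  using ab p_gt_1 by (simp add: power_int_diff field_simps)
 thus ?thesis using that[of "k - j"] jk(1) by simp
qed

lemma av_padic_integer: "s \<in> padic_integers ==> av s \<le> 1"
proof -
 assume "s \<in> padic_integers"
 then obtain X where X: "\<forall>n. X n \<in> \<int>" "X \<leadsto> s" by (auto simp: padic_integers_def closure_sequential)
 have "av (X n) \<le> 1" for n using X(1)[rule_format, of n] av_of_int_le by (auto elim!: Ints_cases)
 thus ?thesis using lim_av_le[OF X(2)] by simp
qed

text \<open>After approximation by a rational \<open>r\<close> in lowest terms,
  \<open>av r \<le> 1\<close> forces the denominator to be prime to \<open>p\<close>, and it is
  inverted modulo \<open>p\<close>.\<close>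

lemma residue_integer:
 assumes "y \<in> padic_numbers" "av y \<le> 1" obtains m :: nat where "m < p" "av (y - of_nat m) < 1"
proof -
 obtain r where r: "r \<in> \<rat>" "av (y - r) < 1" using padic_approx[of y 1] assms by auto
 have r1: "av r \<le> 1" using av_diff_le[of y 1 "y - r"] assms r by simp
 obtain a b where ab: "r = of_int a / of_int b" "b > 0" "coprime a b"
  using r(1) by (elim Rats_cases') auto
 have pb: "\<not> int p dvd b"
 proof
  assume *: "int p dvd b"
  hence "\<not> int p dvd a" using coprime_common_divisor[OF ab(3), of "int p"] p_gt_1 by auto
  hence "av (of_int a) = 1" "av (of_int b) < 1" using * av_of_int_less_iff av_of_int_unit by auto
  thus False using r1 ab by (simp add: divide_le_eq)
 qed
 hence cop: "coprime b (int p)"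
  using prime_p by (metis coprime_commute prime_imp_coprime prime_nat_int_transfer)
 obtain c where c: "[b * c = 1] (mod int p)" using cong_solve_coprime_int[OF cop] by blast
 define m where "m = (a * c) mod int p"
 have m: "0 \<le> m" "m < int p" using p_gt_1 by (auto simp: m_def)
 have "[b * m = b * (a * c)] (mod int p)" unfolding m_def by (simp add: cong_def mod_mult_right_eq)
 also have "[b * (a * c) = a * 1] (mod int p)" using cong_scalar_left[OF c, of a] by (simp add: mult_ac)
 finally have "int p dvd b * m - a" by (simp add: cong_iff_dvd_diff)
 hence "av (of_int (b * m - a)) < 1" using av_of_int_less_iff by blast
 moreover have "av (of_int b) = 1" using av_of_int_unit[OF pb] .
 moreover have "r - of_int m = - (of_int (b * m - a) / of_int b)" using ab by (simp add: field_simps)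
 ultimately have "av (r - of_int m) < 1" by simp
 hence "av (y - of_int m) < 1" using av_add_less[OF r(2), of "r - of_int m"] by simp
 thus ?thesis using that[of "nat m"] m by simp
qed

text \<open>A polynomial relation for \<open>x\<close> reduces to a monic one with integer coefficients, of degree \<open>d\<close> say; so each power of \<open>x\<close>
 is close to one of the \<open>p\<^sup>d\<close> combinations of \<open>1, x, ..., x\<^sup>d\<^sup>-\<^sup>1\<close> with digits as coefficients.\<close>

lemma unit_power_close_1:
 assumes x: "av x = 1" obtains n where "n > 0" "av (x^n - 1) < 1"
proof -
 obtain f where f: "f ~= 0" "!!i. coeff f i \<in> padic_numbers" "poly f x = 0"
  using algebraic_over_padic_numbers[of x] by blast
 define A where "A = {i. i \<le> degree f & (\<forall>j\<le>degree f. av (coeff f j) \<le> av (coeff f i))}"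
 have "\<exists>i. is_arg_min (%i. - av (coeff f i)) (%i. i \<in> {..degree f}) i" by (rule ex_is_arg_min_if_finite) auto
 hence "finite A" "A ~= {}" by (auto simp: A_def is_arg_min_linorder)
 note MA = Max_in[OF this] Max_ge[OF this(1)]
 \<comment> \<open>\<open>d\<close> is the last index at which the coefficients reach their maximal
   size. After division by this coefficient the later ones reduce to 0 and the \<open>d\<close>-th
   to 1, so the reduced relation is monic of degree \<open>d\<close>.\<close>
 define d where "d = Max A"
 have d: "d \<le> degree f" and le: "!!i. i \<le> degree f ==> av (coeff f i) \<le> av (coeff f d)" using MA(1) by (auto simp: A_def d_def)
 have above: "av (coeff f i) < av (coeff f d)" if "d < i" "i \<le> degree f" for i
 proof (rule ccontr)
  assume "\<not> ?thesis"
  hence "i \<in> A" using that by (auto simp: A_def not_less intro: order_trans[OF le])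
  thus False using MA(2)[of i] that by (simp add: d_def)
 qed
 have nz: "av (coeff f d) > 0" using le[of "degree f"] f(1) by (metis av_pos leading_coeff_neq_0 less_le_trans order_refl)
 define c where "c i = coeff f i / coeff f d" for i
 have c: "c i \<in> padic_numbers" "i \<le> degree f ==> av (c i) \<le> 1" for i
  using f(2) complete_subfield_padic le[of i] nz by (auto simp: c_def divide_le_eq intro!: cs_divide)
 have "\<forall>i. \<exists>m::nat. i \<le> degree f --> av (c i - of_nat m) < 1" using residue_integer[OF c] by metis
 then obtain e :: "nat => nat" where e: "!!i. i \<le> degree f ==> av (c i - of_nat (e i)) < 1" by metis
 define b :: "nat => 'k" where "b i = (if i < d then of_nat (e i) else if i = d then 1 else 0)" for i
 have "av (b i - c i) < 1" if "i \<le> degree f" for i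
  using e[OF that] above[of i] that nz by (auto simp: b_def c_def av_minus_commute)
 hence "av (\<Sum>i\<le>degree f. (b i - c i) * x^i) < 1" using x by (intro av_sum_less) auto
 moreover have "(\<Sum>i\<le>degree f. c i * x^i) = 0"
  using f(3) by (simp add: poly_altdef c_def flip: sum_divide_distrib)
 moreover have "(\<Sum>i\<le>degree f. b i * x^i) = (\<Sum>i<Suc d. b i * x^i)"
  using d by (intro sum.mono_neutral_right) (auto simp: b_def)
 ultimately have xd: "av (x^d - (\<Sum>i<d. of_int (- int (e i)) * x^i)) < 1"
  by (simp add: left_diff_distrib sum_subtractf b_def sum_negf add.commute)
 \<comment> \<open>Agreement, up to elements of absolute value below 1, with an integer combination
   of the first \<open>d\<close> powers of \<open>x\<close>. The relation \<open>xd\<close> makes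
   this stable under multiplication by \<open>x\<close>.\<close>
 define near where "near y \<longleftrightarrow> (\<exists>z::nat => int. av (y - (\<Sum>i<d. of_int (z i) * x^i)) < 1)" for y
 have close: "near y'" if near: "near y" "av (y' - y) < 1" for y y'
 proof -
  obtain z :: "nat => int" where "av (y - (\<Sum>i<d. of_int (z i) * x^i)) < 1" using near by (auto simp: near_def)
  from av_add_less[OF near(2) this] show ?thesis unfolding near_def by (intro exI[of _ z]) simp
 qed
 have add: "near (y + of_int k * y')" if near: "near y" "near y'" for k y y'
 proof -
  obtain z z' :: "nat => int" where z: "av (y - (\<Sum>i<d. of_int (z i) * x^i)) < 1" "av (y' - (\<Sum>i<d. of_int (z' i) * x^i)) < 1"
   using near by (auto simp: near_def)
  have "av (of_int k * (y' - (\<Sum>i<d. of_int (z' i) * x^i))) < 1"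
   using mult_right_mono[OF av_of_int_le[of k] av_nonneg[of "y' - (\<Sum>i<d. of_int (z' i) * x^i)"]] z(2) by simp
  from av_add_less[OF z(1) this] show ?thesis unfolding near_def
   by (intro exI[of _ "%i. z i + k * z' i"]) (simp add: algebra_simps sum.distrib sum_distrib_left)
 qed
 have near0: "near 0" unfolding near_def by (intro exI[of _ "%_. 0"]) simp
 have pow: "near (x^i)" if "i \<le> d" for i
 proof (cases "i = d")
  case False
  have "(\<Sum>j<d. of_int (of_bool (j = i)) * x^j) = (\<Sum>j<d. if j = i then x^i else 0)" by (intro sum.cong) auto
  thus ?thesis using that False unfolding near_def by (intro exI[of _ "%j. of_bool (j = i)"]) simp
 qed (use xd in \<open>unfold near_def, intro exI[of _ "%i. - int (e i)"], simp\<close>)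
 have shift: "near (x * y)" if y: "near y" for y
 proof -
  obtain z :: "nat => int" where z: "av (y - (\<Sum>i<d. of_int (z i) * x^i)) < 1" using y by (auto simp: near_def)
  have "k \<le> d ==> near (\<Sum>i<k. of_int (z i) * x^Suc i)" for k
  proof (induction k)
   case (Suc k)
   show ?case using add[OF Suc.IH pow[OF Suc.prems], of "z k"] Suc.prems by simp
  qed (simp add: near0)
  moreover have "x * y - (\<Sum>i<d. of_int (z i) * x^Suc i) = x * (y - (\<Sum>i<d. of_int (z i) * x^i))"
   by (simp add: right_diff_distrib sum_distrib_left mult_ac)
  hence "av (x * y - (\<Sum>i<d. of_int (z i) * x^Suc i)) < 1" using z x by (simp only: av_mult mult_1)
  ultimately show ?thesis using close by blast
 qed
 define F where "F = (%c. \<Sum>i<d. of_nat (c i) * x^i) ` ({..<d} \<rightarrow>\<^sub>E {..<p})"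
 have finF: "finite F" unfolding F_def by (intro finite_imageI finite_PiE) auto
 have "\<exists>y\<in>F. av (x^n - y) < 1" for n
 proof -
  have "near (x^n)" by (induction n) (use pow[of 0] shift in simp_all)
  then obtain z :: "nat => int" where z: "av (x^n - (\<Sum>i<d. of_int (z i) * x^i)) < 1" by (auto simp: near_def)
  define y where "y = (\<Sum>i<d. of_nat ((\<lambda>i\<in>{..<d}. nat (z i mod int p)) i) * x^i)"
  have "(\<Sum>i<d. of_int (z i) * x^i) - y = (\<Sum>i<d. of_int (z i - z i mod int p) * x^i)"
   using p_gt_1 by (simp add: y_def sum_subtractf[symmetric] algebra_simps)
  moreover have "av (of_int (z i - z i mod int p)) < 1" for i
   unfolding av_of_int_less_iff by (simp add: minus_mod_eq_mult_div)
  ultimately have "av ((\<Sum>i<d. of_int (z i) * x^i) - y) < 1" using x by (auto intro!: av_sum_less)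
  from av_add_less[OF z this] have "av (x^n - y) < 1" by simp
  moreover have "y \<in> F" unfolding F_def y_def using p_gt_1 by (intro imageI PiE_I) (auto simp: nat_less_iff)
  ultimately show ?thesis by blast
 qed
 then obtain g where g: "!!n. g n \<in> F" "!!n. av (x^n - g n) < 1" by metis
 have "\<not> inj g" using finF g(1) finite_imageD[of g UNIV] finite_subset[of "range g" F] infinite_UNIV_nat by blast
 then obtain m n where mn: "m < n" "g m = g n" unfolding inj_def by (metis linorder_neqE_nat)
 have "av (x^n - x^m) < 1" using av_diff_less[OF g(2)[of n] g(2)[of m]] mn by simp
 moreover have "x^n - x^m = x^m * (x^(n - m) - 1)"
  using power_add[of x m "n - m"] mn by (simp add: right_diff_distrib)
 ultimately show ?thesis using that[of "n - m"] mn x by simp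
qed

end

section \<open>The p-adic logarithm\<close>

context padic_closure begin

text \<open>The square of partial sums exceeds the triangular sum by terms \<open>a i * b j\<close>
  with \<open>i + j \<ge> M\<close>. For \<open>M \<ge> 2 * K\<close> one index is at least
  \<open>K\<close>, so each such term is small, and by the ultrametric inequality so is their
  sum.\<close>

lemma cauchy_product_k:
 fixes a b :: "nat => 'k"
 assumes a: "a sums A" and b: "b sums B"
 shows "(%n. \<Sum>i\<le>n. a i * b (n - i)) sums (A * B)"
proof -
 have a0: "(%n. av (a n)) \<leadsto> 0" and b0: "(%n. av (b n)) \<leadsto> 0"
  using sums_imp_lim_0[OF a] sums_imp_lim_0[OF b] by (auto simp: lim_iff)
 have "Bseq (%n. av (a n))" "Bseq (%n. av (b n))"
  using a0 b0 convergent_imp_Bseq convergentI by blast+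
 then obtain C D where C: "C > 0" "!!n. av (a n) \<le> C" and D: "D > 0" "!!n. av (b n) \<le> D"
  unfolding Bseq_def by auto
 have "(%M. (\<Sum>i<M. a i) * (\<Sum>j<M. b j) - (\<Sum>n<M. \<Sum>i\<le>n. a i * b (n - i))) \<leadsto> 0"
  unfolding lim_iff
 proof (rule LIMSEQ_I)
  fix r :: real assume "r > 0"
  have "\<forall>\<^sub>F n in sequentially. av (a n) < r / D" "\<forall>\<^sub>F n in sequentially. av (b n) < r / C"
   using order_tendstoD(2)[OF a0] order_tendstoD(2)[OF b0] \<open>r > 0\<close> C D by auto
  hence "\<forall>\<^sub>F n in sequentially. av (a n) < r / D & av (b n) < r / C" by (rule eventually_conj)
  then obtain K where K: "!!n. n >= K ==> av (a n) < r / D" "!!n. n >= K ==> av (b n) < r / C"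
   by (auto simp: eventually_sequentially)
  show "\<exists>no. \<forall>M\<ge>no. norm (av ((\<Sum>i<M. a i) * (\<Sum>j<M. b j) - (\<Sum>n<M. \<Sum>i\<le>n. a i * b (n - i)) - 0) - 0) < r"
  proof (intro exI allI impI)
   fix M assume M: "M >= 2 * K"
   define T where "T = {(i, j). i + j < M}"
   have fin: "finite ({..<M} \<times> {..<M})" and sub: "T \<subseteq> {..<M} \<times> {..<M}" by (auto simp: T_def)
   have "(\<Sum>i<M. a i) * (\<Sum>j<M. b j) - (\<Sum>n<M. \<Sum>i\<le>n. a i * b (n - i))
    = (\<Sum>(i, j)\<in>{..<M} \<times> {..<M}. a i * b j) - (\<Sum>(i, j)\<in>T. a i * b j)"
    unfolding T_def sum.triangle_reindex by (simp add: sum_product sum.cartesian_product)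
   also have "... = (\<Sum>(i, j)\<in>{..<M} \<times> {..<M} - T. a i * b j)"
    by (simp only: sum_diff[OF fin sub])
   also have "av ... < r"
   proof (rule av_sum_less[OF _ \<open>r > 0\<close>])
    fix x assume x: "x \<in> {..<M} \<times> {..<M} - T"
    obtain i j where ij: "x = (i, j)" by force
    hence "i + j >= M" using x by (auto simp: T_def)
    then consider "i >= K" | "j >= K" using M by linarith
    hence "av (a i) * av (b j) < r"
    proof cases
     case 1
     have "av (a i) * av (b j) \<le> av (a i) * D" using D by (intro mult_left_mono) auto
     also have "... < r" using K(1)[OF 1] D(1) by (simp add: pos_less_divide_eq)
     finally show ?thesis .
    next
     case 2
     have "av (a i) * av (b j) \<le> C * av (b j)" using C by (intro mult_right_mono) auto
     also have "... < r" using K(2)[OF 2] C(1) by (simp add: pos_less_divide_eq mult.commute)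
     finally show ?thesis .
    qed
    thus "av (case x of (i, j) => a i * b j) < r" by (simp add: ij)
   qed
   finally show "norm (av ((\<Sum>i<M. a i) * (\<Sum>j<M. b j) - (\<Sum>n<M. \<Sum>i\<le>n. a i * b (n - i)) - 0) - 0) < r"
    by simp
  qed
 qed
 moreover have "(%M. (\<Sum>i<M. a i) * (\<Sum>j<M. b j)) \<leadsto> A * B"
  using a b by (intro lim_mult) (auto simp: sums_def)
 ultimately have "(%M. (\<Sum>i<M. a i) * (\<Sum>j<M. b j) - ((\<Sum>i<M. a i) * (\<Sum>j<M. b j) - (\<Sum>n<M. \<Sum>i\<le>n. a i * b (n - i)))) \<leadsto> A * B - 0"
  by (intro lim_diff)
 thus ?thesis by (simp add: sums_def)
qed

lemma av_of_nat_ge: assumes "n > 0" shows "1 / real n \<le> av (of_nat n)"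
proof -
 have "int p^multiplicity (int p) (int n) \<le> int n"
  using multiplicity_dvd[of "int p" "int n"] assms by (intro zdvd_imp_le) auto
 hence "p^multiplicity (int p) (int n) \<le> n" by (metis of_nat_le_iff of_nat_power)
 hence "real p^multiplicity (int p) (int n) \<le> real n" by (metis of_nat_le_iff of_nat_power)
 thus ?thesis using av_of_int[of "int n"] assms p_gt_1 by (simp add: frac_le)
qed

lemma av_p_power [simp]: "av (of_nat (p^n)) = (1 / real p)^n"
 by simp

lemma inv_p_power_lim: "(%n. (1 / real p)^n) \<leadsto> 0"
 using p_gt_1 by (intro LIMSEQ_power_zero) auto

lemma p_power_lim: "(%n. of_nat (p^n) :: 'k) \<leadsto> 0"
 unfolding lim_iff using inv_p_power_lim by simp

definition log_term :: "'k => nat => 'k" where "log_term x n = (-1)^n * x^Suc n / of_nat (Suc n)"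
definition log_sum :: "'k => 'k" where "log_sum x = suminf (log_term x)"

lemma av_log_term_le: "av (log_term x n) \<le> real (Suc n) * av x^Suc n"
proof -
 have "av x^Suc n / av (of_nat (Suc n)) \<le> av x^Suc n / (1 / real (Suc n))"
  using av_of_nat_ge[of "Suc n"] by (intro divide_left_mono mult_pos_pos) (auto simp del: of_nat_Suc)
 thus ?thesis by (simp add: log_term_def mult.commute del: of_nat_Suc)
qed

lemma mult_power_lim:
 assumes "0 \<le> r" "r < (1::real)" shows "(%n. real (Suc n) * r^Suc n) \<leadsto> 0"
 using LIMSEQ_Suc[OF powser_times_n_limit_0[of r]] assms by simp

lemma log_sums: assumes "av x < 1" shows "log_term x sums log_sum x"
proof -
 have l0: "log_term x \<leadsto> 0"
  by (rule lim_zeroI[OF _ mult_power_lim[OF av_nonneg assms]]) (use av_log_term_le in auto)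
 obtain R where R: "complete_subfield R" "{x} \<subseteq> R" using finite_complete_subfield[of "{x}"] by auto
 have mem: "log_term x n \<in> R" for n
  unfolding log_term_def using R by (intro cs_divide complete_subfieldD(3)[OF R(1)]) (auto simp del: of_nat_Suc power_Suc)
 obtain s where "log_term x sums s" by (rule cs_sums[OF R(1) l0 mem])
 thus ?thesis unfolding log_sum_def by (metis sums_unique)
qed

text \<open>As \<open>p^n\<close> tends to 0, the upper argument tends to -1, whose binomial
  coefficients are \<open>(-1)^k\<close>. Pascal's rule reduces the induction step to
  \<open>p^n choose Suc k\<close> tending to 0.\<close>

lemma binomial_pred_lim: "(%n. of_nat ((p^n - 1) choose k) :: 'k) \<leadsto> (-1)^k"
proof (induction k)
 case (Suc k)
 have "(%n. of_nat (p^n choose Suc k) :: 'k) \<leadsto> 0"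
 proof (rule lim_zeroI)
  have "(%n. (1 / real p)^n * real (Suc k)) \<leadsto> 0 * real (Suc k)"
   by (intro tendsto_mult inv_p_power_lim tendsto_const)
  thus "(%n. (1 / real p)^n * real (Suc k)) \<leadsto> 0" by simp
  have "av (of_nat (p^n choose Suc k)) \<le> (1 / real p)^n * real (Suc k)" for n
  proof -
   have "Suc k * (p^n choose Suc k) = p^n * ((p^n - 1) choose k)"
    by (rule binomial_absorption)
   hence "of_nat (Suc k) * of_nat (p^n choose Suc k) = (of_nat (p^n) * of_nat ((p^n - 1) choose k) :: 'k)"
    by (metis of_nat_mult)
   hence "av (of_nat (Suc k)) * av (of_nat (p^n choose Suc k)) = (1 / real p)^n * av (of_nat ((p^n - 1) choose k))"
    by (metis av_mult av_p_power)
   also have "... \<le> (1 / real p)^n * 1" using av_of_nat_le by (intro mult_left_mono) auto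
   finally have le: "av (of_nat (Suc k)) * av (of_nat (p^n choose Suc k)) \<le> (1 / real p)^n" by simp
   have "(1 / real (Suc k)) * av (of_nat (p^n choose Suc k)) \<le> av (of_nat (Suc k)) * av (of_nat (p^n choose Suc k))"
    by (intro mult_right_mono av_of_nat_ge) auto
   hence "av (of_nat (p^n choose Suc k)) / real (Suc k) \<le> (1 / real p)^n" using le by simp
   thus ?thesis by (subst (asm) pos_divide_le_eq) auto
  qed
  thus "\<forall>\<^sub>F n in sequentially. av (of_nat (p^n choose Suc k) - 0) \<le> (1 / real p)^n * real (Suc k)" by simp
 qed
 from lim_diff[OF this Suc]
 have "(%n. of_nat (p^n choose Suc k) - of_nat ((p^n - 1) choose k) :: 'k) \<leadsto> (-1)^Suc k" by simp
 moreover have "of_nat (p^n choose Suc k) - of_nat ((p^n - 1) choose k) = (of_nat ((p^n - 1) choose Suc k) :: 'k)" for n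
 proof -
  have "p^n choose Suc k = ((p^n - 1) choose k) + ((p^n - 1) choose Suc k)"
   using binomial_Suc_Suc[of "p^n - 1" k] p_gt_1 by simp
  thus ?thesis by simp
 qed
 ultimately show ?case by simp
qed simp

lemma power_diff_sum:
 "((1 + x)^(p^n) - 1) / of_nat (p^n) = (\<Sum>k<p^n. of_nat ((p^n - 1) choose k) * x^Suc k / of_nat (Suc k) :: 'k)"
proof -
 define P where "P = p^n"
 have P: "P > 0" by (simp add: P_def)
 then obtain P' where P': "P = Suc P'" using gr0_conv_Suc by blast
 have "(1 + x)^P = (\<Sum>k\<le>P. of_nat (P choose k) * x^k)"
  using binomial_ring[of x 1 P] by (simp add: add.commute)
 also have "... = 1 + (\<Sum>k<P. of_nat (P choose Suc k) * x^Suc k)"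
  unfolding lessThan_Suc_atMost[symmetric] sum.lessThan_Suc_shift by simp
 finally have "((1 + x)^P - 1) / of_nat P = (\<Sum>k<P. of_nat (P choose Suc k) * x^Suc k / of_nat P)"
  by (simp add: sum_divide_distrib)
 also have "... = (\<Sum>k<P. of_nat ((P - 1) choose k) * x^Suc k / of_nat (Suc k))"
 proof (rule sum.cong[OF refl])
  fix k
  have "Suc k * (P choose Suc k) = P * ((P - 1) choose k)" by (rule binomial_absorption)
  hence e: "of_nat (Suc k) * of_nat (P choose Suc k) = (of_nat P * of_nat ((P - 1) choose k) :: 'k)"
   by (metis of_nat_mult)
  have nz: "(of_nat (Suc k) :: 'k) ~= 0" "(of_nat P :: 'k) ~= 0" using P by (auto simp del: of_nat_Suc)
  have "of_nat (P choose Suc k) / of_nat P = (of_nat ((P - 1) choose k) / of_nat (Suc k) :: 'k)"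
   using e nz by (metis frac_eq_eq mult.commute)
  thus "of_nat (P choose Suc k) * x^Suc k / of_nat P = of_nat ((P - 1) choose k) * x^Suc k / of_nat (Suc k)"
   by (metis times_divide_eq_left mult.commute)
 qed
 finally show ?thesis by (simp add: P_def)
qed

text \<open>By \<open>power_diff_sum\<close> the quotient is the logarithm series truncated at
  \<open>p^n\<close>, with \<open>(-1)^k\<close> replaced by \<open>(p^n - 1) choose k\<close>,
  which tends to it. The first \<open>K\<close> terms converge one by one, the others are small
  uniformly in \<open>n\<close>. This form of the logarithm makes its functional equation a short
  computation.\<close>

lemma log_lim:
 assumes "av x < 1" shows "(%n. ((1 + x)^(p^n) - 1) / of_nat (p^n)) \<leadsto> log_sum x"
proof -
 have pinf: "filterlim (%n. p^n) at_top sequentially"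
  using p_gt_1 by (intro filterlim_subseq) (simp add: strict_mono_def power_strict_increasing)
 have "(%n. \<Sum>k<n. log_term x k) \<leadsto> log_sum x" using log_sums[OF assms] by (simp add: sums_def)
 from filterlim_compose[OF this pinf] have 1: "(%n. \<Sum>k<p^n. log_term x k) \<leadsto> log_sum x" .
 define u where "u n k = (of_nat ((p^n - 1) choose k) - (-1)^k) * (x^Suc k / of_nat (Suc k))" for n k
 have "(%n. \<Sum>k<p^n. u n k) \<leadsto> 0"
  unfolding lim_iff
 proof (rule LIMSEQ_I)
  fix r :: real assume r: "r > 0"
  from order_tendstoD(2)[OF mult_power_lim[OF av_nonneg assms] r]
  obtain K where K: "!!k. k >= K ==> real (Suc k) * av x^Suc k < r" by (auto simp: eventually_sequentially)
  have "\<forall>\<^sub>F n in sequentially. \<forall>k\<in>{..<K}. av (u n k) < r"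
  proof (rule eventually_ball_finite, simp, intro ballI)
   fix k
   have "(%n. u n k) \<leadsto> ((-1)^k - (-1)^k) * (x^Suc k / of_nat (Suc k))"
    unfolding u_def by (intro lim_mult lim_diff binomial_pred_lim lim_const)
   hence "(%n. av (u n k)) \<leadsto> 0" by (simp add: lim_iff)
   thus "\<forall>\<^sub>F n in sequentially. av (u n k) < r" using r by (rule order_tendstoD(2))
  qed
  then obtain n0 where n0: "!!n k. n >= n0 ==> k < K ==> av (u n k) < r" by (auto simp: eventually_sequentially)
  have "av (u n k) < r" if "n >= n0" for n k
  proof (cases "k < K")
   case False
   have "of_nat ((p^n - 1) choose k) - (-1)^k = (of_int (int ((p^n - 1) choose k) - (-1)^k) :: 'k)" by simp
   hence "av (of_nat ((p^n - 1) choose k) - (-1)^k) \<le> 1" by (metis av_of_int_le)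
   hence "av (u n k) \<le> 1 * av (log_term x k)"
    unfolding u_def av_mult by (intro mult_mono) (auto simp: log_term_def)
   also have "... \<le> real (Suc k) * av x^Suc k" using av_log_term_le by simp
   also have "... < r" using K False by simp
   finally show ?thesis .
  qed (use n0 that in simp)
  thus "\<exists>no. \<forall>n\<ge>no. norm (av ((\<Sum>k<p^n. u n k) - 0) - 0) < r"
   using r by (intro exI[of _ n0]) (auto intro!: av_sum_less)
 qed
 from lim_add[OF 1 this]
 have "(%n. (\<Sum>k<p^n. log_term x k) + (\<Sum>k<p^n. u n k)) \<leadsto> log_sum x" by simp
 moreover have "(\<Sum>k<p^n. log_term x k) + (\<Sum>k<p^n. u n k) = ((1 + x)^(p^n) - 1) / of_nat (p^n)" for n
  unfolding power_diff_sum sum.distrib[symmetric] u_def log_term_def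
  by (intro sum.cong refl) (simp add: left_diff_distrib diff_divide_distrib del: of_nat_Suc power_Suc)
 ultimately show ?thesis by simp
qed

lemma av_mult_close_1:
 assumes "av (u - 1) < 1" "av (v - 1) < 1" shows "av (u * v - 1) < 1"
proof -
 have "av u = 1" using av_eq_if_close[of u 1] assms by simp
 hence "av (u * (v - 1)) < 1" using assms by simp
 from av_add_less[OF this assms(1)] show ?thesis by (simp only: right_diff_distrib) simp
qed

text \<open>Put \<open>P = p^n\<close>, \<open>U = (u^P - 1) / P\<close> and
  \<open>V = (v^P - 1) / P\<close>. The quotient for \<open>u * v\<close> is
  \<open>U + V + P * U * V\<close>, and \<open>P\<close> tends to 0.\<close>

lemma log_sum_add:
 assumes "av (u - 1) < 1" "av (v - 1) < 1" shows "log_sum (u * v - 1) = log_sum (u - 1) + log_sum (v - 1)"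
proof -
 have "av (u * v - 1) < 1" using assms by (rule av_mult_close_1)
 from log_lim[OF this] have 1: "(%n. ((u * v)^(p^n) - 1) / of_nat (p^n)) \<leadsto> log_sum (u * v - 1)" by simp
 have U: "(%n. (u^(p^n) - 1) / of_nat (p^n)) \<leadsto> log_sum (u - 1)" using log_lim[OF assms(1)] by simp
 have V: "(%n. (v^(p^n) - 1) / of_nat (p^n)) \<leadsto> log_sum (v - 1)" using log_lim[OF assms(2)] by simp
 have "(%n. (u^(p^n) - 1) / of_nat (p^n) + (v^(p^n) - 1) / of_nat (p^n)
   + of_nat (p^n) * ((u^(p^n) - 1) / of_nat (p^n)) * ((v^(p^n) - 1) / of_nat (p^n)))
   \<leadsto> log_sum (u - 1) + log_sum (v - 1) + 0 * log_sum (u - 1) * log_sum (v - 1)"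
  by (intro lim_add lim_mult U V p_power_lim)
 moreover have "(u^(p^n) - 1) / of_nat (p^n) + (v^(p^n) - 1) / of_nat (p^n)
   + of_nat (p^n) * ((u^(p^n) - 1) / of_nat (p^n)) * ((v^(p^n) - 1) / of_nat (p^n))
   = ((u * v)^(p^n) - 1) / of_nat (p^n)" for n
 proof -
  have "(of_nat (p^n) :: 'k) ~= 0" by simp
  thus ?thesis by (simp add: field_simps power_mult_distrib)
 qed
 ultimately have "(%n. ((u * v)^(p^n) - 1) / of_nat (p^n)) \<leadsto> log_sum (u - 1) + log_sum (v - 1)" by simp
 from LIMSEQ_unique[OF 1 this] show ?thesis .
qed

lemma log_sum_0 [simp]: "log_sum 0 = 0"
 using log_sum_add[of 1 1] by simp

lemma av_power_close_1: "av (u - 1) < 1 ==> av (u^n - 1) < 1"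
 by (induction n) (auto intro: av_mult_close_1)

lemma log_sum_power: "av (u - 1) < 1 ==> log_sum (u^n - 1) = of_nat n * log_sum (u - 1)"
 by (induction n) (simp_all add: log_sum_add av_power_close_1 algebra_simps)

text \<open>By \<open>value_group\<close> some power of \<open>x\<close> times a power of
  \<open>p\<close> has absolute value 1, and by \<open>unit_power_close_1\<close> a further power is
  close to 1. Together with the value 0 at \<open>p\<close> this determines a logarithm on all
  nonzero elements.\<close>

lemma power_times_p_close_1:
 assumes "x ~= 0" obtains n m where "n > 0" "av (x^n * of_nat p powi m - 1) < 1"
proof -
 obtain n m where nm: "n > 0" "av x^n = real p powi m" using value_group[OF assms] .
 have "av (x^n * of_nat p powi m) = 1"
  using nm p_gt_1 by (simp add: power_int_divide_distrib)
 then obtain k where k: "k > 0" "av ((x^n * of_nat p powi m)^k - 1) < 1" by (rule unit_power_close_1)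
 have "(x^n * of_nat p powi m)^k = x^(n * k) * of_nat p powi (m * int k)"
  by (simp add: power_mult_distrib power_mult power_int_mult)
 thus ?thesis using that[of "n * k" "m * int k"] nm k by simp
qed

definition log_ext :: "'k => 'k" where
 "log_ext x = (if x = 0 then 0 else
   (let nm = (SOME nm. fst nm > 0 & av (x^fst nm * of_nat p powi snd nm - 1) < 1)
   in log_sum (x^fst nm * of_nat p powi snd nm - 1) / of_nat (fst nm)))"

text \<open>Raising each expression to the exponent of the other gives the same power of
  \<open>x\<close>. Comparing absolute values then forces equal powers of \<open>p\<close>, so
  \<open>u^n' = v^n\<close>.\<close>

lemma close_1_unique:
 assumes "x ~= 0" "n > 0" "av (x^n * of_nat p powi m - 1) < 1" "n' > 0" "av (x^n' * of_nat p powi m' - 1) < 1"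
 shows "log_sum (x^n * of_nat p powi m - 1) / of_nat n = log_sum (x^n' * of_nat p powi m' - 1) / of_nat n'"
proof -
 define u where "u = x^n * of_nat p powi m"
 define v where "v = x^n' * of_nat p powi m'"
 have uv1: "av u = 1" "av v = 1" using av_eq_if_close[of u 1] av_eq_if_close[of v 1] assms
  by (simp_all only: u_def v_def av_1)
 have e: "u^n' * of_nat p powi (m' * int n) = v^n * of_nat p powi (m * int n')"
  by (simp add: u_def v_def power_mult_distrib power_mult[symmetric] power_int_mult mult_ac)
 hence "av (u^n' * of_nat p powi (m' * int n)) = av (v^n * of_nat p powi (m * int n'))" by simp
 hence "(1 / real p) powi (m' * int n) = (1 / real p) powi (m * int n')" using uv1 by simp
 hence "real p powi (m' * int n) = real p powi (m * int n')" by (simp add: power_int_divide_distrib)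
 hence "m' * int n = m * int n'" using p_gt_1 power_int_strict_increasing[of _ _ "real p"] by (metis less_irrefl linorder_neqE of_nat_1 of_nat_less_iff)
 hence "u^n' = v^n" using e p_gt_1 by simp
 hence "log_sum (u^n' - 1) = log_sum (v^n - 1)" by simp
 hence "of_nat n' * log_sum (u - 1) = of_nat n * log_sum (v - 1)"
  using log_sum_power assms by (simp add: u_def v_def)
 thus ?thesis using assms by (simp add: u_def v_def field_simps)
qed

lemma log_ext_eq:
 assumes "x ~= 0" "n > 0" "av (x^n * of_nat p powi m - 1) < 1"
 shows "log_ext x = log_sum (x^n * of_nat p powi m - 1) / of_nat n"
proof -
 define nm where "nm = (SOME nm. fst nm > 0 & av (x^fst nm * of_nat p powi snd nm - 1) < 1)"
 have "\<exists>nm :: nat \<times> int. fst nm > 0 & av (x^fst nm * of_nat p powi snd nm - 1) < 1"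
  using assms by (intro exI[of _ "(n, m)"]) auto
 from someI_ex[OF this] have "fst nm > 0" "av (x^fst nm * of_nat p powi snd nm - 1) < 1"
  by (auto simp: nm_def)
 from close_1_unique[OF assms(1) this assms(2,3)] show ?thesis
  using assms(1) by (simp add: log_ext_def nm_def[symmetric] Let_def)
qed

lemma log_ext_1p: "av x < 1 ==> log_ext (1 + x) = log_sum x"
proof -
 assume "av x < 1"
 moreover from this have "1 + x ~= 0" by (metis add_eq_0_iff av_1 av_minus less_irrefl)
 ultimately show ?thesis using log_ext_eq[of "1 + x" 1 0] by simp
qed

lemma log_ext_mult:
 assumes "x ~= 0" "y ~= 0" shows "log_ext (x * y) = log_ext x + log_ext y"
proof -
 obtain n m where nm: "n > 0" "av (x^n * of_nat p powi m - 1) < 1" using power_times_p_close_1[OF assms(1)] .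
 obtain n' m' where nm': "n' > 0" "av (y^n' * of_nat p powi m' - 1) < 1" using power_times_p_close_1[OF assms(2)] .
 define u where "u = x^n * of_nat p powi m"
 define v where "v = y^n' * of_nat p powi m'"
 have e: "(x * y)^(n * n') * of_nat p powi (m * int n' + m' * int n) = u^n' * v^n"
  using p_gt_1 by (simp add: u_def v_def power_mult_distrib power_mult power_int_mult power_int_add)
    (metis mult.commute power_mult mult.assoc mult.left_commute)
 have uv: "av (u^n' - 1) < 1" "av (v^n - 1) < 1" using nm nm' by (auto simp: u_def v_def intro: av_power_close_1)
 hence "av (u^n' * v^n - 1) < 1" by (rule av_mult_close_1)
 hence "log_ext (x * y) = log_sum (u^n' * v^n - 1) / of_nat (n * n')"
  using log_ext_eq[of "x * y" "n * n'" "m * int n' + m' * int n"] assms nm nm' e by simp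
 also have "... = (of_nat n' * log_sum (u - 1) + of_nat n * log_sum (v - 1)) / of_nat (n * n')"
  using uv nm nm' by (simp add: log_sum_add log_sum_power u_def v_def)
 also have "... = log_sum (u - 1) / of_nat n + log_sum (v - 1) / of_nat n'" using nm nm' by (simp add: field_simps)
 finally show ?thesis using log_ext_eq[OF assms(1) nm] log_ext_eq[OF assms(2) nm'] by (simp add: u_def v_def)
qed

lemma hom_power:
 assumes "!!x y. x ~= 0 ==> y ~= 0 ==> L (x * y) = L x + (L y :: 'k)" "(x :: 'k) ~= 0"
 shows "L (x^n) = of_nat n * L x" "L (x powi m) = of_int m * L x"
proof -
 have L1: "L 1 = 0" using assms(1)[of 1 1] by simp
 have nat: "L (y^n) = of_nat n * L y" if "y ~= 0" for y n
  by (induction n) (use L1 that in \<open>auto simp: assms(1) algebra_simps\<close>)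
 have inv: "L (inverse x) = - L x" using assms(1)[of "inverse x" x] assms(2) L1 by (simp add: eq_neg_iff_add_eq_0)
 show "L (x^n) = of_nat n * L x" using nat assms(2) .
 show "L (x powi m) = of_int m * L x"
  using assms(2) nat[of "inverse x"] nat[of x] inv by (cases "m >= 0") (auto simp: power_int_def power_inverse)
qed

text \<open>For uniqueness, additivity and the value 0 at \<open>p\<close> reduce \<open>L x\<close>
  to the value of \<open>L\<close> at an element close to 1, which the series prescribes.\<close>

lemma padic_log_eq: "padic_log p = log_ext"
 unfolding padic_log_def
proof (rule the_equality)
 have "log_ext (of_nat p) = 0" using log_ext_eq[of "of_nat p" 1 "-1"] p_gt_1 by simp
 moreover have "(%n. (-1)^n * x^Suc n / of_nat (Suc n)) sums log_ext (1 + x)" if "dist x 0 < 1" for x :: 'k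
 proof -
  have "av x < 1" using that by (simp add: av_def)
  thus ?thesis using log_sums log_ext_1p by (simp add: log_term_def[abs_def])
 qed
 ultimately show "(\<forall>x y. x ~= 0 --> y ~= 0 --> log_ext (x * y) = log_ext x + log_ext y) &
  (\<forall>x. dist x 0 < 1 --> (%n. (-1)^n * x^Suc n / of_nat (Suc n)) sums log_ext (1 + x)) &
  log_ext (of_nat p) = 0 & log_ext 0 = 0"
  using log_ext_mult by (simp add: log_ext_def)
next
 fix L :: "'k => 'k"
 assume L: "(\<forall>x y. x ~= 0 --> y ~= 0 --> L (x * y) = L x + L y) &
  (\<forall>x. dist x 0 < 1 --> (%n. (-1)^n * x^Suc n / of_nat (Suc n)) sums L (1 + x)) &
  L (of_nat p) = 0 & L 0 = 0"
 show "L = log_ext"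
 proof
  fix x
  show "L x = log_ext x"
  proof (cases "x = 0")
   case False
   obtain n m where nm: "n > 0" "av (x^n * of_nat p powi m - 1) < 1" using power_times_p_close_1[OF False] .
   have "log_term (x^n * of_nat p powi m - 1) sums L (1 + (x^n * of_nat p powi m - 1))"
    using L nm(2) unfolding av_def log_term_def[abs_def] by blast
   hence "L (x^n * of_nat p powi m) = log_sum (x^n * of_nat p powi m - 1)"
    using log_sums[OF nm(2)] sums_unique2 by (metis add_diff_cancel_left' diff_add_cancel add.commute)
   moreover have "L (x^n * of_nat p powi m) = of_nat n * L x"
    using L False hom_power[of L] p_gt_1 by simp
   ultimately have "L x * of_nat n = log_ext x * of_nat n"
    using log_ext_eq[OF False nm] nm(1) by (simp add: mult.commute)
   thus ?thesis using nm(1) by simp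
  qed (use L in \<open>simp add: log_ext_def\<close>)
 qed
qed

abbreviation lg :: "'k => 'k" where "lg \<equiv> padic_log p"

lemma lg_mult: "x ~= 0 ==> y ~= 0 ==> lg (x * y) = lg x + lg y"
 by (simp add: padic_log_eq log_ext_mult)

lemma lg_1 [simp]: "lg 1 = 0" using lg_mult[of 1 1] by simp
lemma lg_0 [simp]: "lg 0 = 0" by (simp add: padic_log_eq log_ext_def)
lemma lg_p [simp]: "lg (of_nat p) = 0"
 unfolding padic_log_eq using log_ext_eq[of "of_nat p" 1 "-1"] p_gt_1 by simp
lemma lg_1p: "av x < 1 ==> lg (1 + x) = log_sum x" by (simp add: padic_log_eq log_ext_1p)
lemma lg_power: "x ~= 0 ==> lg (x^n) = of_nat n * lg x" using hom_power[of lg] lg_mult by blast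
lemma lg_power_int: "x ~= 0 ==> lg (x powi n) = of_int n * lg x" using hom_power[of lg] lg_mult by blast
lemma lg_inverse: "x ~= 0 ==> lg (inverse x) = - lg x" using lg_power_int[of x "-1"] by simp
lemma lg_divide: "x ~= 0 ==> y ~= 0 ==> lg (x / y) = lg x - lg y"
 by (simp add: divide_inverse lg_mult lg_inverse)
lemma lg_prod: "(!!i. i \<in> A ==> f i ~= 0) ==> lg (prod f A) = (\<Sum>i\<in>A. lg (f i))"
 by (induction A rule: infinite_finite_induct) (auto simp: lg_mult)
lemma lg_root: assumes "x^n = 1" "n > 0" shows "lg x = 0"
proof -
 have "x ~= 0" using assms by (metis power_0_left neq0_conv zero_neq_one)
 thus ?thesis using lg_power[of x n] assms by simp
qed
lemma lg_minus: "lg (- x) = lg x"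
proof (cases "x = 0")
 case False
 have "lg (-1) = 0" by (rule lg_root[of _ 2]) auto
 thus ?thesis using lg_mult[of "-1" x] False by simp
qed simp


section \<open>Logarithm and exponential on the disc of radius 1/\<open>qq\<close>, and the sizes of
  factorials\<close>

definition qq :: nat where "qq = (if p = 2 then 4 else p)"

lemma qq_ge_3: "qq >= 3" using p_gt_1 by (auto simp: qq_def)

lemma av_qq: "av (of_nat qq) = 1 / real qq"
proof (cases "p = 2")
 case True
 hence q: "qq = p^2" unfolding qq_def by simp
 have "av (of_nat qq) = (1 / real p)^2" unfolding q by (metis av_p_power)
 thus ?thesis unfolding q by (simp add: power_divide)
qed (simp add: qq_def)

lemma three_power_bound: "3 * (n + 2) \<le> 2 * (3::nat)^(n + 1)"
 by (induction n) auto

text \<open>With \<open>av (1 / n) \<le> n\<close> and \<open>av x \<le> 1 / 3\<close>, the terms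
  after the first are at most \<open>av x\<close> times (n + 2) / 3^(n + 1), whose maximum 2/3 is
  attained at n = 0. Any constant below 1 makes the logarithm an isometry here.\<close>

lemma av_log_sum_diff:
 assumes "av x \<le> 1 / real qq" shows "av (log_sum x - x) \<le> 2 / 3 * av x"
proof (rule sums_av_le)
 have "1 / real qq \<le> 1 / 3" using qq_ge_3 by (intro divide_left_mono) auto
 hence x3: "av x \<le> 1 / 3" using assms by simp
 hence "log_term x sums log_sum x" by (intro log_sums) simp
 thus "(%n. log_term x (Suc n)) sums (log_sum x - x)"
  using sums_Suc_k by (fastforce simp: log_term_def)
 fix n
 have "av (log_term x (Suc n)) \<le> real (Suc (Suc n)) * av x^Suc (Suc n)" by (rule av_log_term_le)
 also have "... = real (n + 2) * av x^(n + 1) * av x" by simp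
 also have "... \<le> real (n + 2) * (1 / 3)^(n + 1) * av x"
  using x3 by (intro mult_right_mono mult_left_mono power_mono) auto
 also have "real (n + 2) * (1 / 3)^(n + 1) \<le> 2 / 3"
 proof -
  have "real (3 * (n + 2)) \<le> real (2 * 3^(n + 1))" using three_power_bound of_nat_le_iff by blast
  thus ?thesis by (simp add: field_simps)
 qed
 finally show "av (log_term x (Suc n)) \<le> 2 / 3 * av x" by (simp add: mult_right_mono)
qed

text \<open>The linear term of the series dominates. For \<open>p = 2\<close> the radius 1/4 keeps
  the element -1, whose logarithm is 0, outside the disc.\<close>

lemma av_lg_close:
 assumes "av (x - 1) \<le> 1 / real qq" shows "av (lg x) = av (x - 1)"
proof -
 have "1 / real qq < 1" using qq_ge_3 by simp
 hence lt: "av (x - 1) < 1" using assms by linarith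
 have "lg x = log_sum (x - 1)" using lg_1p[OF lt] by simp
 moreover have "av (log_sum (x - 1)) = av (x - 1)"
 proof (cases "x = 1")
  case False
  hence "av (x - 1) > 0" by simp
  hence "av (log_sum (x - 1) - (x - 1)) < av (x - 1)"
   using av_log_sum_diff[OF assms] by linarith
  thus ?thesis by (rule av_eq_if_close)
 qed simp
 ultimately show ?thesis by simp
qed

lemma lim_lg:
 assumes "(X \<longlongrightarrow> (a :: 'k)) F" "a ~= 0" shows "((%n. lg (X n)) \<longlongrightarrow> lg a) F"
proof (rule lim_zeroI)
 have q: "((%n. X n / a) \<longlongrightarrow> a / a) F" using assms by (intro lim_divide lim_const)
 hence q1: "((%n. av (X n / a - 1)) \<longlongrightarrow> 0) F" using assms(2) by (simp add: lim_iff)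
 thus "((%n. av (X n / a - 1)) \<longlongrightarrow> 0) F" .
 have "\<forall>\<^sub>F n in F. av (X n / a - 1) < 1 / real qq" using q1 qq_ge_3 by (intro order_tendstoD(2)) auto
 thus "\<forall>\<^sub>F n in F. av (lg (X n) - lg a) \<le> av (X n / a - 1)"
 proof eventually_elim
  case (elim n)
  have "X n ~= 0"
  proof
   assume "X n = 0"
   thus False using elim qq_ge_3 by simp
  qed
  hence "lg (X n) - lg a = lg (X n / a)" using assms(2) by (simp add: lg_divide)
  thus ?case using av_lg_close[of "X n / a"] elim by simp
 qed
qed

lemma padic_ord_exists:
 assumes "x ~= 0" shows "av x = real p powr (- of_rat (padic_ord p x))"
proof -
 obtain n m where nm: "n > 0" "av x^n = real p powi m" using value_group[OF assms] .
 have "av x = real p powr (- of_rat (of_int (- m) / of_nat n))"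
 proof -
  have "(real p powr (real_of_int m / real n))^n = real p powr real_of_int m"
   using nm(1) p_gt_1 by (simp add: powr_realpow[symmetric] powr_powr)
  also have "... = av x^n" using nm(2) p_gt_1 by (simp add: powr_real_of_int')
  finally have "av x = real p powr (real_of_int m / real n)"
   using nm(1) by (intro power_eq_imp_eq_base[of "av x" n]) auto
  thus ?thesis by (simp add: of_rat_divide of_rat_minus)
 qed
 hence "\<exists>r. dist x 0 = real p powr (- of_rat r)" by (auto simp: av_def)
 moreover have "r = r'" if "dist x 0 = real p powr (- of_rat r)" "dist x 0 = real p powr (- of_rat r')" for r r'
  using that p_gt_1 powr_inj[of "real p"] by simp
 ultimately have "dist x 0 = real p powr (- of_rat (padic_ord p x))"
  unfolding padic_ord_def by (rule_tac theI') blast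
 thus ?thesis by (simp add: av_def)
qed

lemma padic_ord_unique:
 assumes "x ~= 0" "av x = real p powr (- of_rat r)" shows "padic_ord p x = r"
 using padic_ord_exists[OF assms(1)] assms(2) p_gt_1 powr_inj[of "real p"] by simp

lemma padic_ord_mult: "x ~= 0 ==> y ~= 0 ==> padic_ord p (x * y) = padic_ord p x + padic_ord p (y :: 'k)"
 using padic_ord_exists[of x] padic_ord_exists[of y]
 by (intro padic_ord_unique) (auto simp: of_rat_add powr_add[symmetric])

lemma padic_ord_eq_0_iff: "x ~= 0 ==> padic_ord p x = 0 \<longleftrightarrow> av (x :: 'k) = 1"
 using padic_ord_exists[of x] padic_ord_unique[of x 0] p_gt_1 by auto

text \<open>\<open>rp\<close> is the absolute value of a root \<open>\<pi>\<close> of \<open>\<pi>\<^sup>p\<^sup>-\<^sup>1 = - p\<close>; \<open>rfact n\<close> is that of \<open>\<pi>\<^sup>n / n!\<close>, so that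
 \<open>rfact n = rp^s\<close> with \<open>s\<close> the sum of the digits of \<open>n\<close> in base \<open>p\<close>.\<close>

definition rp :: real where "rp = root (p - 1) (1 / real p)"
definition rfact :: "nat => real" where "rfact n = rp^n / av (fact n)"

lemma rp_power: "rp^(p - 1) = 1 / real p"
 unfolding rp_def using p_gt_1 by (intro real_root_pow_pos2) auto

lemma rp_pos: "rp > 0" unfolding rp_def using p_gt_1 by simp

lemma rp_less_1: "rp < 1"
proof (rule ccontr)
 assume "\<not> rp < 1"
 hence "rp^(p - 1) >= 1" by (intro one_le_power) simp
 thus False using p_gt_1 by (simp add: rp_power[simplified])
qed

lemma av_fact: "av (fact n) = (1 / real p)^(n div p) * av (fact (n div p))"
proof (induction n)
 case (Suc n)
 show ?case
 proof (cases "p dvd Suc n")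
  case True
  hence d: "Suc n div p = Suc (n div p)" using div_Suc[of n p] by (simp add: dvd_eq_mod_eq_0)
  have "Suc n = p * Suc (n div p)" using True d by (metis dvd_mult_div_cancel)
  hence "av (of_nat (Suc n)) = av (of_nat p) * av (of_nat (Suc (n div p)))" by (metis av_mult of_nat_mult)
  thus ?thesis using Suc unfolding d fact_Suc by (simp del: of_nat_Suc)
 next
  case False
  hence d: "Suc n div p = n div p" using div_Suc[of n p] by (simp add: dvd_eq_mod_eq_0)
  show ?thesis using Suc av_of_nat_unit[OF False] unfolding d fact_Suc by (simp del: of_nat_Suc)
 qed
qed simp

text \<open>Legendre's formula, one digit at a time. By \<open>av_fact\<close> the factor
  \<open>p^(n div p)\<close> splits off the factorial, and since \<open>rp^(p - 1) = 1 / p\<close>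
  it cancels against all but \<open>n mod p + n div p\<close> of the factors
  \<open>rp\<close>.\<close>

lemma rfact_rec: "rfact n = rp^(n mod p) * rfact (n div p)"
proof -
 have "rp^n = rp^(n mod p) * rp^(p * (n div p))" by (metis mod_mult_div_eq power_add)
 also have "rp^(p * (n div p)) = (rp^(p - 1) * rp)^(n div p)"
  using p_gt_1 by (metis power_mult power_minus_mult mult.commute p_gt_0)
 finally have "rp^n = rp^(n mod p) * (1 / real p)^(n div p) * rp^(n div p)"
  by (simp only: rp_power power_mult_distrib mult.assoc)
 moreover define c where "c = (1 / real p)^(n div p)"
 moreover have "c ~= 0" using p_gt_1 by (simp add: c_def)
 ultimately show ?thesis unfolding rfact_def av_fact[of n] c_def[symmetric] by simp
qed

lemma rfact_pos: "rfact n > 0" by (simp add: rfact_def rp_pos)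

lemma rfact_le: "n > 0 ==> rfact n \<le> rp"
proof (induction n rule: less_induct)
 case (less n)
 show ?case
 proof (cases "n mod p = 0")
  case True
  hence "n div p < n" "n div p > 0" using less(2) p_gt_1 by (auto simp: div_greater_zero_iff dest: mod_less)
  thus ?thesis using less(1) True rfact_rec[of n] by simp
 next
  case False
  have "rfact (n div p) \<le> 1"
  proof (cases "n div p = 0")
   case False
   moreover have "n div p < n" using less(2) p_gt_1 by simp
   ultimately show ?thesis using less(1)[of "n div p"] rp_less_1 by simp
  qed (simp add: rfact_def)
  hence "rfact n \<le> rp^(n mod p) * 1" unfolding rfact_rec[of n] using rp_pos by (intro mult_left_mono) auto
  also have "... \<le> rp^1" using False rp_pos rp_less_1 by (simp only: mult_1_right) (intro power_decreasing, auto)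
  finally show ?thesis by simp
 qed
qed

lemma rfact_le_1: "rfact n \<le> 1"
proof (cases "n = 0")
 case False
 thus ?thesis using rfact_le[of n] rp_less_1 by linarith
qed (simp add: rfact_def)

text \<open>Each base-\<open>p\<close> digit costs at most a factor \<open>p\<close>, since
  \<open>(1 / rp)^(p - 1) = p\<close>, and the number of digits is logarithmic in \<open>n\<close>.
  The geometric decay of Dwork's coefficients will beat this polynomial bound.\<close>

lemma inverse_rfact_le: "1 / rfact n \<le> real p * real (n + 1)"
proof (cases "n = 0")
 case False
 hence "1 / rfact n \<le> real p * real n"
 proof (induction n rule: less_induct)
  case (less n)
  have "rp^(p - 1) \<le> rp^(n mod p)" using rp_pos rp_less_1 p_gt_1
   by (intro power_decreasing) (auto simp: less_Suc_eq_le[symmetric])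
  hence r: "1 / rp^(n mod p) \<le> real p"
   unfolding rp_power using rp_pos p_gt_1 by (simp add: field_simps)
  have "1 / rfact n = (1 / rp^(n mod p)) * (1 / rfact (n div p))" by (simp add: rfact_rec[of n])
  also have "... \<le> real p * (1 / rfact (n div p))"
   using r rfact_pos[of "n div p"] by (intro mult_right_mono) auto
  also have "1 / rfact (n div p) \<le> real n"
  proof (cases "n div p = 0")
   case True
   thus ?thesis using less(2) by (simp add: rfact_def)
  next
   case F: False
   have "n div p < n" using less(2) p_gt_1 by simp
   hence "1 / rfact (n div p) \<le> real p * real (n div p)" using less(1) F by blast
   also have "... \<le> real n" by (metis div_times_less_eq_dividend mult.commute of_nat_le_iff of_nat_mult)
   finally show ?thesis .
  qed
  finally show ?case using p_gt_1 by (simp add: mult_left_mono)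
 qed
 thus ?thesis using p_gt_1 by (simp add: algebra_simps)
qed (use p_gt_1 in \<open>simp add: rfact_def\<close>)

text \<open>The disc of radius \<open>1 / qq\<close> lies strictly inside the disc of radius
  \<open>rp\<close> on which the exponential converges: for \<open>p = 2\<close> the radii are 1/4
  and 1/2, and for odd \<open>p\<close> one has
  \<open>(p * rp)^(p - 1) = p^(p - 2) > 1\<close>.\<close>

lemma qq_rp: "1 / (real qq * rp) < 1"
proof -
 have "real qq * rp > 1"
 proof (cases "p = 2")
  case True
  have "qq = 4" unfolding qq_def using True by simp
  moreover have "rp^1 = 1 / 2"
  proof -
   have "p - 1 = 1" using True by simp
   thus ?thesis using rp_power True by (metis of_nat_numeral)
  qed
  ultimately show ?thesis by simp
 next
  case False
  hence p3: "p >= 3" using p_gt_1 by simp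
  have "(real p * rp)^(p - 1) = real p^(p - 1) / real p" by (simp add: power_mult_distrib rp_power[simplified])
  also have "... = real p^(p - 2)"
  proof -
   have "p - 1 = Suc (p - 2)" using p3 by simp
   thus ?thesis by simp
  qed
  also have "... > 1" using p3 by (intro one_less_power) auto
  finally have gt: "(real p * rp)^(p - 1) > 1" .
  have "\<not> real p * rp \<le> 1"
  proof
   assume "real p * rp \<le> 1"
   hence "(real p * rp)^(p - 1) \<le> 1" using rp_pos by (intro power_le_one) auto
   with gt show False by simp
  qed
  thus ?thesis using False by (simp add: qq_def)
 qed
 thus ?thesis by simp
qed

lemma av_exp_term:
 assumes "av z \<le> 1 / real qq"
 shows "av (z^n / fact n) \<le> (1 / (real qq * rp))^n" "n > 0 ==> av (z^n / fact n) \<le> av z"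
proof -
 have e: "av (z^n / fact n) = (av z / rp)^n * rfact n"
  using rp_pos by (simp add: rfact_def power_divide)
 have b: "av z / rp \<le> 1 / (real qq * rp)" using assms rp_pos by (simp add: divide_right_mono flip: divide_divide_eq_left)
 have "(av z / rp)^n \<le> (1 / (real qq * rp))^n" using b rp_pos by (intro power_mono) auto
 thus "av (z^n / fact n) \<le> (1 / (real qq * rp))^n"
  unfolding e using mult_mono[OF _ rfact_le_1[of n], of "(av z / rp)^n"] rfact_pos[of n] rp_pos by simp
 assume n: "n > 0"
 have "(av z / rp)^n = (av z / rp)^(n - 1) * (av z / rp)" using n by (metis power_minus_mult)
 also have "... \<le> 1 * (av z / rp)"
  using order_trans[OF b less_imp_le[OF qq_rp]] rp_pos by (intro mult_right_mono power_le_one) auto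
 finally have "(av z / rp)^n * rfact n \<le> (av z / rp) * rp"
  using rfact_le[OF n] rp_pos rfact_pos[of n] by (intro mult_mono) auto
 thus "av (z^n / fact n) \<le> av z" unfolding e using rp_pos by simp
qed

definition exp_sum :: "'k => 'k" where "exp_sum z = suminf (%n. z^n / fact n)"

lemma geometric_lim: "(%n. (1 / (real qq * rp))^n) \<leadsto> 0"
 using qq_rp rp_pos by (intro LIMSEQ_power_zero) auto

lemma cs_fact: "complete_subfield R ==> fact n \<in> R"
 using cs_of_nat[of R "fact n"] by simp

lemma exp_sums: assumes "av z \<le> 1 / real qq" shows "(%n. z^n / fact n) sums exp_sum z"
proof -
 have l0: "(%n. z^n / fact n) \<leadsto> 0"
  by (rule lim_zeroI[OF _ geometric_lim]) (use av_exp_term[OF assms] in auto)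
 obtain R where R: "complete_subfield R" "{z} \<subseteq> R" using finite_complete_subfield[of "{z}"] by auto
 have mem: "z^n / fact n \<in> R" for n
  using R by (intro cs_divide[OF R(1)] cs_power[OF R(1)] cs_fact[OF R(1)]) auto
 obtain s where "(%n. z^n / fact n) sums s" by (rule cs_sums[OF R(1) l0 mem])
 thus ?thesis unfolding exp_sum_def by (metis sums_unique)
qed

lemma exp_sum_add:
 assumes "av z \<le> 1 / real qq" "av w \<le> 1 / real qq" shows "exp_sum (z + w) = exp_sum z * exp_sum w"
proof -
 have "(\<Sum>i\<le>n. (z^i / fact i) * (w^(n - i) / fact (n - i))) = (z + w)^n / fact n" for n
 proof -
  have "fps_nth (fps_exp (z + w)) n = fps_nth (fps_exp z * fps_exp w) n" by (simp add: fps_exp_add_mult)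
  thus ?thesis by (simp add: fps_mult_nth atLeast0AtMost)
 qed
 hence "(%n. (z + w)^n / fact n) sums (exp_sum z * exp_sum w)"
  using cauchy_product_k[OF exp_sums[OF assms(1)] exp_sums[OF assms(2)]] by simp
 moreover have "(%n. (z + w)^n / fact n) sums exp_sum (z + w)" using assms by (intro exp_sums av_add_le)
 ultimately show ?thesis using sums_unique2 by blast
qed

lemma exp_sum_0 [simp]: "exp_sum 0 = 1"
proof -
 have "(%n. 0^n / fact n) sums exp_sum 0" using qq_ge_3 by (intro exp_sums) auto
 moreover have "(%n. 0^n / fact n) sums (1 :: 'k)"
  using sums_single[of 0 "%n. 1 :: 'k"] by (rule sums_cong[THEN iffD1, rotated]) (auto simp: power_0_left)
 ultimately show ?thesis using sums_unique2 by blast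
qed

lemma exp_sum_of_nat_mult:
 assumes "av z \<le> 1 / real qq" shows "exp_sum (of_nat n * z) = exp_sum z^n"
proof (induction n)
 case (Suc n)
 have "av (of_nat n * z) \<le> 1 / real qq"
  using assms mult_mono[OF av_of_nat_le[of n] assms] by simp
 from exp_sum_add[OF assms this] have "exp_sum (z + of_nat n * z) = exp_sum z * exp_sum z^n" using Suc by simp
 moreover have "z + of_nat n * z = of_nat (Suc n) * z" by (simp add: algebra_simps)
 ultimately show ?case by simp
qed simp

lemma av_exp_sum_close:
 assumes "av z \<le> 1 / real qq" shows "av (exp_sum z - 1) \<le> av z"
proof (rule sums_av_le)
 show "(%n. z^Suc n / fact (Suc n)) sums (exp_sum z - 1)" using sums_Suc_k[OF exp_sums[OF assms]] by simp
qed (use av_exp_term(2)[OF assms] in blast)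

text \<open>In \<open>log_lim\<close> the power \<open>exp_sum z^(p^n)\<close> is
  \<open>exp_sum (p^n * z)\<close>, whose terms from the quadratic one on carry a factor
  \<open>p^(2 * n)\<close>. After division by \<open>p^n\<close> the quotients differ from
  \<open>z\<close> by at most \<open>(1 / p)^n\<close>.\<close>

lemma lg_exp_sum:
 assumes "av z \<le> 1 / real qq" shows "lg (exp_sum z) = z"
proof -
 have "1 / real qq < 1" using qq_ge_3 by simp
 hence lt: "av (exp_sum z - 1) < 1" using av_exp_sum_close[OF assms] assms by linarith
 have "(%n. ((1 + (exp_sum z - 1))^(p^n) - 1) / of_nat (p^n)) \<leadsto> lg (1 + (exp_sum z - 1))"
  using log_lim[OF lt] lg_1p[OF lt] by simp
 hence L: "(%n. (exp_sum z^(p^n) - 1) / of_nat (p^n)) \<leadsto> lg (exp_sum z)" by simp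
 have "(%n. (exp_sum z^(p^n) - 1) / of_nat (p^n)) \<leadsto> z"
 proof (rule lim_zeroI[OF _ inv_p_power_lim], intro always_eventually allI)
  fix n
  define P where "P = p^n"
  have P0: "(of_nat P :: 'k) ~= 0" by (simp add: P_def)
  have Pz: "av (of_nat P * z) \<le> 1 / real qq"
   using mult_mono[OF av_of_nat_le[of P] assms] by simp
  have "(%k. (of_nat P * z)^Suc (Suc k) / fact (Suc (Suc k))) sums (exp_sum (of_nat P * z) - 1 - of_nat P * z)"
   using sums_Suc_k[OF sums_Suc_k[OF exp_sums[OF Pz]]] by simp
  hence "(%k. inverse (of_nat P) * ((of_nat P * z)^Suc (Suc k) / fact (Suc (Suc k)))) sums
    (inverse (of_nat P) * (exp_sum (of_nat P * z) - 1 - of_nat P * z))" by (rule sums_mult_k)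
  also have "inverse (of_nat P) * (exp_sum (of_nat P * z) - 1 - of_nat P * z) = (exp_sum z^P - 1) / of_nat P - z"
   using P0 unfolding exp_sum_of_nat_mult[OF assms] by (simp add: field_simps)
  finally have s: "(%k. inverse (of_nat P) * ((of_nat P * z)^Suc (Suc k) / fact (Suc (Suc k)))) sums
    ((exp_sum z^P - 1) / of_nat P - z)" .
  have "av ((exp_sum z^P - 1) / of_nat P - z) \<le> (1 / real p)^n"
  proof (rule sums_av_le[OF s])
   fix k
   have "inverse (of_nat P) * ((of_nat P * z)^Suc (Suc k) / fact (Suc (Suc k)))
    = of_nat P * (of_nat P^k * (z^Suc (Suc k) / fact (Suc (Suc k))))"
    using P0 by (simp add: power_mult_distrib field_simps)
   hence "av (inverse (of_nat P) * ((of_nat P * z)^Suc (Suc k) / fact (Suc (Suc k))))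
    = av (of_nat P) * (av (of_nat P)^k * av (z^Suc (Suc k) / fact (Suc (Suc k))))"
    by (metis av_mult av_power)
   also have "... \<le> av (of_nat P) * (1 * 1)"
   proof (intro mult_left_mono mult_mono power_le_one av_of_nat_le)
    have "1 / real qq \<le> 1" using qq_ge_3 by simp
    thus "av (z^Suc (Suc k) / fact (Suc (Suc k))) \<le> 1"
     using av_exp_term(2)[OF assms, of "Suc (Suc k)"] assms by linarith
   qed auto
   finally show "av (inverse (of_nat P) * ((of_nat P * z)^Suc (Suc k) / fact (Suc (Suc k)))) \<le> (1 / real p)^n"
    by (simp add: P_def)
  qed
  thus "av ((exp_sum z^(p^n) - 1) / of_nat (p^n) - z) \<le> (1 / real p)^n" by (simp add: P_def)
 qed
 from LIMSEQ_unique[OF L this] show ?thesis .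
qed

text \<open>The quotient \<open>w\<close> of the two sides has logarithm 0 and lies in the disc
  where the logarithm is an isometry, so \<open>w = 1\<close>.\<close>

lemma exp_sum_lg:
 assumes "av (y - 1) \<le> 1 / real qq" shows "exp_sum (lg y) = y"
proof -
 have l: "av (lg y) \<le> 1 / real qq" using av_lg_close assms by simp
 define w where "w = exp_sum (lg y) / y"
 have lt: "1 / real qq < 1" using qq_ge_3 by simp
 have y1: "av y = 1" using av_eq_if_close[of y 1] assms lt by simp
 hence y0: "y ~= 0" by auto
 have c: "av (exp_sum (lg y) - 1) \<le> 1 / real qq" using av_exp_sum_close[OF l] l by simp
 have "av (exp_sum (lg y)) = 1" using av_eq_if_close[of "exp_sum (lg y)" 1] c lt by simp
 hence e0: "exp_sum (lg y) ~= 0" by auto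
 have "lg w = 0" using lg_exp_sum[OF l] y0 e0 by (simp add: w_def lg_divide)
 moreover have "av (w - 1) \<le> 1 / real qq"
 proof -
  have "w - 1 = ((exp_sum (lg y) - 1) - (y - 1)) / y" using y0 by (simp add: w_def field_simps)
  thus ?thesis using av_diff_le[OF c assms] y1 by simp
 qed
 ultimately have "av (w - 1) = 0" using av_lg_close[of w] by simp
 thus ?thesis using y0 by (simp add: w_def field_simps)
qed

end

section \<open>Values of Dirichlet L-functions at non-positive integers\<close>

text \<open>For such \<open>c\<close> and \<open>P\<close> prime to \<open>N\<close>, the power
  series in t with coefficients \<open>c (a + P * j)\<close> is a rational function with denominator
  1 - t^N and no pole at t = 1. Its value there, by l'Hopital's rule, is the expression
  \<open>reg_sum\<close>.\<close>

definition mean_zero :: "nat => (int => 'a::comm_ring_1) => bool"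
 where "mean_zero N c \<longleftrightarrow> (\<forall>a. c (a + int N) = c a) & (\<Sum>j<N. c (int j)) = 0"

text \<open>The regularised value of \<open>\<Sum>\<^sub>j\<^sub>\<ge>\<^sub>0 c (a + P j)\<close>.\<close>

definition reg_sum :: "nat => (int => 'a::field_char_0) => int => int => 'a"
 where "reg_sum N c P a = - (\<Sum>j<N. of_nat j * c (a + P * int j)) / of_nat N"

lemma mean_zero_period:
 assumes "mean_zero N c" shows "c (a + int N * k) = c a"
proof -
 have n: "c (b + int N * int m) = c b" for b m
 proof (induction m)
  case (Suc m)
  have "c (b + int N * int (Suc m)) = c ((b + int N * int m) + int N)" by (simp add: algebra_simps)
  thus ?case using Suc assms by (simp add: mean_zero_def)
 qed simp
 show ?thesis
 proof (cases "k >= 0")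
  case True
  thus ?thesis using n[of a "nat k"] by simp
 next
  case False
  thus ?thesis using n[of "a + int N * k" "nat (- k)"] by simp
 qed
qed

lemma mean_zero_cong: "mean_zero N c ==> [a = b] (mod int N) ==> c a = c b"
 using mean_zero_period[of N c a] by (metis cong_iff_lin)

lemma mean_zero_mod: "mean_zero N c ==> c (a mod int N) = c a"
 by (rule mean_zero_cong) (auto simp: cong_def)

lemma sum_residues:
 fixes c :: "int => 'a::comm_monoid_add"
 assumes N: "N > 0" and cop: "coprime P (int N)" and per: "!!a b. [a = b] (mod int N) ==> c a = c b"
 shows "(\<Sum>j<N. c (a + P * int j)) = (\<Sum>j<N. c (int j))"
proof -
 define h where "h j = nat ((a + P * int j) mod int N)" for j
 have inj: "inj_on h {..<N}"
 proof (rule inj_onI)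
  fix i j assume ij: "i \<in> {..<N}" "j \<in> {..<N}" "h i = h j"
  hence "(a + P * int i) mod int N = (a + P * int j) mod int N" using N by (simp add: nat_eq_iff h_def)
  hence "[a + P * int i = a + P * int j] (mod int N)" by (simp add: cong_def)
  hence "[P * int i = P * int j] (mod int N)" by (simp add: cong_add_lcancel)
  hence "[int i = int j] (mod int N)" using cop by (simp add: cong_mult_lcancel)
  hence "[i = j] (mod N)" by (simp add: cong_int_iff)
  thus "i = j" using ij by (simp add: cong_def)
 qed
 have "h ` {..<N} = {..<N}"
 proof (rule card_subset_eq)
  show "h ` {..<N} \<subseteq> {..<N}" using N by (auto simp: nat_less_iff h_def)
  show "card (h ` {..<N}) = card {..<N}" by (rule card_image[OF inj])
 qed simp
 hence "(\<Sum>j<N. c (int j)) = (\<Sum>j<N. c (int (h j)))" using sum.reindex[OF inj, of "%j. c (int j)"] by simp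
 also have "... = (\<Sum>j<N. c (a + P * int j))"
  using N by (intro sum.cong refl per) (simp add: cong_def h_def)
 finally show ?thesis ..
qed

lemma mean_zero_sum:
 assumes N: "N > 0" and c: "mean_zero N c" and cop: "coprime P (int N)"
 shows "(\<Sum>j<N. c (a + P * int j)) = 0"
proof -
 have "(\<Sum>j<N. c (a + P * int j)) = (\<Sum>j<N. c (int j))"
  by (rule sum_residues[OF N cop mean_zero_cong[OF c]])
 thus ?thesis using c unfolding mean_zero_def by metis
qed

lemma mean_zero_shift: assumes "N > 0" "mean_zero N c" shows "mean_zero N (%n. c (n + k))"
 unfolding mean_zero_def
proof (intro conjI allI)
 show "c (a + int N + k) = c (a + k)" for a
  using mean_zero_period[OF assms(2), of "a + k" 1] by (simp add: algebra_simps)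
 show "(\<Sum>j<N. c (int j + k)) = 0"
  using mean_zero_sum[OF assms, of 1 k] by (simp add: add.commute)
qed

lemma reg_sum_diff:
 assumes N: "N > 0" and c: "mean_zero N c" and cop: "coprime P (int N)"
 shows "reg_sum N c P a - reg_sum N c P (a + P) = c a"
proof -
 define S where "S j = c (a + P * int j)" for j
 have SN: "S N = S 0" using mean_zero_period[OF c, of a P] by (simp add: S_def mult.commute)
 have S1: "c (a + P + P * int j) = S (Suc j)" for j by (simp add: S_def algebra_simps)
 have "(\<Sum>j<N. S (Suc j)) = (\<Sum>j<N. S j)"
 proof -
  have "S 0 + (\<Sum>j<N. S (Suc j)) = (\<Sum>j<N. S j) + S N" using sum.lessThan_Suc_shift[of S N] by simp
  thus ?thesis using SN by simp
 qed
 also have "... = 0" unfolding S_def by (rule mean_zero_sum[OF N c cop])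
 finally have z: "(\<Sum>j<N. S (Suc j)) = 0" .
 have "(\<Sum>j<N. of_nat (Suc j) * S (Suc j)) = (\<Sum>j<N. of_nat j * S j) + of_nat N * S N"
  using sum.lessThan_Suc_shift[of "%j. of_nat j * S j" N] by simp
 hence "(\<Sum>j<N. of_nat j * S (Suc j)) = (\<Sum>j<N. of_nat j * S j) + of_nat N * S 0"
  using z SN by (simp add: algebra_simps sum.distrib)
 thus ?thesis using N unfolding reg_sum_def S1 S_def[symmetric] by (simp add: field_simps) (simp add: S_def)
qed

lemma mean_zero_reg_sum:
 assumes N: "N > 0" and c: "mean_zero N c" shows "mean_zero N (reg_sum N c P)"
proof -
 have "(\<Sum>a<N. \<Sum>j<N. of_nat j * c (int a + P * int j)) = (\<Sum>j<N. of_nat j * (\<Sum>a<N. c (int a + P * int j)))"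
  by (subst sum.swap) (simp add: sum_distrib_left)
 also have "... = 0"
 proof -
  have "(\<Sum>a<N. c (int a + P * int j)) = 0" for j
   using mean_zero_sum[OF N c, of 1 "P * int j"] by (simp add: add.commute)
  thus ?thesis by simp
 qed
 finally have "(\<Sum>a<N. reg_sum N c P (int a)) = 0"
  by (simp add: reg_sum_def sum_divide_distrib[symmetric] sum_negf)
 moreover have "reg_sum N c P (a + int N) = reg_sum N c P a" for a
 proof -
  have "c (a + int N + P * int j) = c (a + P * int j)" for j
   using mean_zero_period[OF c, of "a + P * int j" 1] by (simp add: algebra_simps)
  thus ?thesis by (simp add: reg_sum_def)
 qed
 ultimately show ?thesis by (simp add: mean_zero_def)
qed

text \<open>Two solutions differ by a function \<open>D\<close> with period \<open>P\<close>. As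
  \<open>P\<close> generates the residues modulo \<open>N\<close>, \<open>D\<close> is constant, and
  its mean is 0.\<close>

lemma reg_sum_unique:
 assumes N: "N > 0" and V: "mean_zero N V" and cop: "coprime P (int N)"
  and c: "!!a. V a - V (a + P) = c a"
 shows "V a = reg_sum N c P a"
proof -
 have cV: "c = (%a. V a - V (a + P))" using c by auto
 have mc: "mean_zero N c" using V mean_zero_shift[OF N V, of P] by (simp add: cV mean_zero_def sum_subtractf)
 define D where "D a = V a - reg_sum N c P a" for a
 have "D (b + P) = D b" for b using reg_sum_diff[OF N mc cop, of b] c[of b] by (simp add: D_def algebra_simps)
 hence "D (a + P * int j) = D a" for j
 proof (induction j)
  case (Suc j)
  from Suc(2)[of "a + P * int j"] show ?case using Suc(1)[OF Suc(2)] by (simp add: algebra_simps)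
 qed simp
 moreover have "mean_zero N D" using V mean_zero_reg_sum[OF N mc, of P] by (simp add: D_def mean_zero_def sum_subtractf)
 ultimately have "of_nat N * D a = 0" using mean_zero_sum[OF N _ cop, of D a] by simp
 thus ?thesis using N by (simp add: D_def)
qed

text \<open>\<open>iter_reg N c (Suc i) n\<close> stands for the regularised sum of
  \<open>iter_reg N c i j\<close> over \<open>j > n\<close>. The argument \<open>n + 1\<close> makes
  this inequality strict, which fits the terms \<open>w (Suc n)\<close> of summation by
  parts.\<close>

primrec iter_reg :: "nat => (int => 'a::field_char_0) => nat => int => 'a" where
 "iter_reg N c 0 = c"
| "iter_reg N c (Suc i) = (%n. reg_sum N (iter_reg N c i) 1 (n + 1))"

lemma mean_zero_iter_reg: "N > 0 ==> mean_zero N c ==> mean_zero N (iter_reg N c i)"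
 by (induction i) (auto intro: mean_zero_shift mean_zero_reg_sum)

lemma iter_reg_shift: "iter_reg N c (Suc i) = iter_reg N (iter_reg N c 1) i"
 by (induction i) auto

definition fdiff :: "('b::{plus,one} => 'a::minus) => 'b => 'a" where "fdiff f x = f (x + 1) - f x"


lemma fdiff_add: "(fdiff ^^ i) (%n. f n + g n :: 'a::ab_group_add) n = (fdiff ^^ i) f n + (fdiff ^^ i) g n"
 by (induction i arbitrary: n) (auto simp: fdiff_def)

lemma fdiff_shift: "(fdiff ^^ i) (%n. f (n + 1)) n = (fdiff ^^ i) f (n + 1)"
 by (induction i arbitrary: n) (auto simp: fdiff_def)


lemma fdiff_linear_mult:
 fixes f :: "nat => int"
 shows "(fdiff ^^ m) f = (%n. 0) ==> (fdiff ^^ Suc m) (%n. (int n + 1) * f n) = (%n. 0)"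
proof (induction m arbitrary: f)
 case 0
 thus ?case by (auto simp: fdiff_def)
next
 case (Suc m)
 have f: "(fdiff ^^ m) (fdiff f) = (%n. 0)" using Suc(2) by (simp add: funpow_swap1)
 have "fdiff (%n. (int n + 1) * f n) = (%n. (int n + 1) * fdiff f n + f (n + 1))"
  by (auto simp: fdiff_def algebra_simps)
 hence "(fdiff ^^ Suc (Suc m)) (%n. (int n + 1) * f n) = (fdiff ^^ Suc m) (%n. (int n + 1) * fdiff f n + f (n + 1))"
  by (simp only: funpow_Suc_right o_apply)
 also have "... = (%n. (fdiff ^^ Suc m) (%n. (int n + 1) * fdiff f n) n + (fdiff ^^ Suc m) f (n + 1))"
  by (simp only: fdiff_add fdiff_shift fun_eq_iff) simp
 also have "... = (%n. 0)" using Suc(1)[OF f] Suc(2) by (simp only: fun_eq_iff) simp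
 finally show ?case .
qed

lemma fdiff_power: "(fdiff ^^ Suc k) (%n. (int n + 1)^k) = (%n. 0)"
proof (induction k)
 case (Suc k)
 from fdiff_linear_mult[OF this] show ?case by simp
qed (auto simp: fdiff_def)

lemma sum_by_parts:
 fixes w h :: "nat => 'a::comm_ring_1"
 shows "(\<Sum>n<M. (w n - w (Suc n)) * h n) = w 0 * h 0 - w M * h M + (\<Sum>n<M. w (Suc n) * (h (Suc n) - h n))"
 by (induction M) (auto simp: algebra_simps)

abbreviation zpow :: "complex => complex => complex" where "zpow s \<equiv> (%z. z powr (- s))"

lemma fdiff_zpow_deriv:
 "Re z > 0 ==> ((fdiff ^^ m) (zpow s) has_field_derivative - s * (fdiff ^^ m) (zpow (s + 1)) z) (at z)"
proof (induction m arbitrary: z)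
 case 0
 hence "z \<notin> \<real>\<^sub>\<le>\<^sub>0" by (auto simp: complex_nonpos_Reals_iff)
 moreover have "- s - 1 = - (s + 1)" by simp
 ultimately show ?case using has_field_derivative_powr[of z "- s"] by (metis funpow_0)
next
 case (Suc m)
 have 1: "((fdiff ^^ m) (zpow s) has_field_derivative - s * (fdiff ^^ m) (zpow (s + 1)) z) (at z)"
  using Suc by blast
 have "((fdiff ^^ m) (zpow s) has_field_derivative - s * (fdiff ^^ m) (zpow (s + 1)) (z + 1)) (at (z + 1))"
  using Suc by simp
 hence 2: "((%z. (fdiff ^^ m) (zpow s) (z + 1)) has_field_derivative - s * (fdiff ^^ m) (zpow (s + 1)) (z + 1)) (at z)"
  by (simp only: DERIV_shift)
 have "(fdiff ^^ Suc m) (zpow s) = (%z. (fdiff ^^ m) (zpow s) (z + 1) - (fdiff ^^ m) (zpow s) z)"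
  by (simp add: fdiff_def[abs_def])
 moreover have "- s * (fdiff ^^ m) (zpow (s + 1)) (z + 1) - - s * (fdiff ^^ m) (zpow (s + 1)) z
  = - s * (fdiff ^^ Suc m) (zpow (s + 1)) z" by (simp only: funpow.simps o_apply fdiff_def right_diff_distrib)
 ultimately show ?case using DERIV_diff[OF 2 1] by (simp only:)
qed

text \<open>The mean value inequality on a real ray turns a difference into a derivative, and
  differentiating \<open>zpow s\<close> gives \<open>- s\<close> times \<open>zpow (s + 1)\<close>.
  So each difference gains one power of decay, and each summation by parts extends the half plane of
  convergence by 1.\<close>

lemma fdiff_zpow_bound:
 assumes "x > 0" "Re s + real m >= 0"
 shows "norm ((fdiff ^^ m) (zpow s) (of_real x)) \<le> (\<Prod>i<m. norm (s + of_nat i)) * x powr (- (Re s + real m))"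
 using assms
proof (induction m arbitrary: s x)
 case 0
 thus ?case by (simp add: norm_powr_real_powr)
next
 case (Suc m)
 define h where "h = (fdiff ^^ m) (zpow s)"
 define C where "C = (\<Prod>i<m. norm (s + 1 + of_nat i))"
 define B where "B = norm s * (C * x powr (- (Re s + 1 + real m)))"
 have "norm (h (of_real x + 1) - h (of_real x)) \<le> B * norm (complex_of_real x + 1 - of_real x)"
 proof (rule field_differentiable_bound)
  show "convex (complex_of_real ` {x..})" by (intro convex_linear_image bounded_linear.linear[OF bounded_linear_of_real]) simp
  fix z assume "z \<in> complex_of_real ` {x..}"
  then obtain y where y: "z = of_real y" "y >= x" by auto
  show "(h has_field_derivative - s * (fdiff ^^ m) (zpow (s + 1)) z) (at z within complex_of_real ` {x..})"
  proof (rule has_field_derivative_at_within)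
   have "Re z > 0" using y Suc(2) by simp
   from fdiff_zpow_deriv[OF this, of m s]
   show "(h has_field_derivative - s * (fdiff ^^ m) (zpow (s + 1)) z) (at z)" unfolding h_def .
  qed
  have e: "Re (s + 1) + real m = Re s + 1 + real m" by simp
  have C0: "C >= 0" unfolding C_def by (intro prod_nonneg) simp
  have "norm ((fdiff ^^ m) (zpow (s + 1)) (of_real y)) \<le> C * y powr (- (Re s + 1 + real m))"
   using Suc(1)[of y "s + 1"] y Suc(2,3) unfolding C_def e by simp
  also have "... \<le> C * x powr (- (Re s + 1 + real m))"
   using y Suc(2,3) C0 by (intro mult_left_mono powr_mono2') simp_all
  finally show "norm (- s * (fdiff ^^ m) (zpow (s + 1)) z) \<le> B"
   unfolding B_def y(1) by (simp add: norm_mult mult_left_mono)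
 next
  show "complex_of_real x + 1 \<in> complex_of_real ` {x..}"
   by (rule image_eqI[of _ _ "x + 1"]) auto
 qed auto
 hence "norm ((fdiff ^^ Suc m) (zpow s) (of_real x)) \<le> B" by (simp add: h_def fdiff_def)
 also have "B = (\<Prod>i<Suc m. norm (s + of_nat i)) * x powr (- (Re s + real (Suc m)))"
  unfolding prod.lessThan_Suc_shift by (simp add: B_def C_def add_ac)
 finally show ?case .
qed

lemma fdiff_zpow_nat_bound:
 assumes "Re s + real m >= e" "norm s \<le> B" "e >= 0"
 shows "norm ((fdiff ^^ m) (zpow s) (of_nat (Suc n))) \<le> (B + real m)^m * real (Suc n) powr (- e)"
proof -
 have "(\<Prod>i<m. norm (s + of_nat i)) \<le> (\<Prod>i<m. B + real m)"
 proof (rule prod_mono, rule conjI)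
  fix i assume "i \<in> {..<m}"
  have "norm (s + of_nat i) \<le> norm s + norm (of_nat i :: complex)" by (rule norm_triangle_ineq)
  thus "norm (s + of_nat i) \<le> B + real m" using assms(2) \<open>i \<in> {..<m}\<close> by simp
 qed simp
 hence p: "(\<Prod>i<m. norm (s + of_nat i)) \<le> (B + real m)^m" by simp
 have "norm ((fdiff ^^ m) (zpow s) (of_nat (Suc n))) \<le> (\<Prod>i<m. norm (s + of_nat i)) * real (Suc n) powr (- (Re s + real m))"
  using fdiff_zpow_bound[of "real (Suc n)" s m] assms by simp
 also have "... \<le> (B + real m)^m * real (Suc n) powr (- e)"
  using p assms by (intro mult_mono powr_mono) (auto intro!: prod_nonneg order_trans[OF prod_nonneg p])
 finally show ?thesis .
qed

definition boundary_sum :: "nat => (int => complex) => nat => complex => complex"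
 where "boundary_sum N c m s = (\<Sum>i<m. iter_reg N c (Suc i) (-1) * (fdiff ^^ i) (zpow s) 1)"

definition tail_term :: "nat => (int => complex) => nat => complex => nat => complex"
 where "tail_term N c m s n = iter_reg N c m (int n) * (fdiff ^^ m) (zpow s) (of_nat (Suc n))"

definition L_part :: "nat => (int => complex) => nat => complex => complex"
 where "L_part N c m s = boundary_sum N c m s + suminf (tail_term N c m s)"

lemma mean_zero_bounded:
 fixes c :: "int => complex"
 assumes "N > 0" "mean_zero N c" shows "norm (c a) \<le> (\<Sum>j<N. norm (c (int j)))"
proof -
 have "norm (c a) = norm (c (int (nat (a mod int N))))"
  using assms mean_zero_mod[of N c a] by simp
 also have "... \<le> (\<Sum>j<N. norm (c (int j)))"
  using assms(1) by (intro member_le_sum) (auto simp: nat_less_iff)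
 finally show ?thesis .
qed

lemma summable_inverse_powr: "e > 1 ==> summable (%n. real (Suc n) powr (- e))"
 using summable_real_powr_iff[of "- e"] summable_Suc_iff[of "%n. real n powr (- e)"] by simp

context
 fixes N :: nat and c :: "int => complex"
 assumes N: "N > 0" and c: "mean_zero N c"
begin

definition coef_bound :: "nat => real" where "coef_bound m = (\<Sum>j<N. norm (iter_reg N c m (int j)))"

lemma coef_bound: "norm (iter_reg N c m a) \<le> coef_bound m"
 unfolding coef_bound_def by (intro mean_zero_bounded N mean_zero_iter_reg c)

lemma tail_term_bound:
 assumes "Re s + real m >= e" "norm s \<le> B" "e >= 0"
 shows "norm (tail_term N c m s n) \<le> coef_bound m * ((B + real m)^m * real (Suc n) powr (- e))"
 unfolding tail_term_def norm_mult by (intro mult_mono coef_bound fdiff_zpow_nat_bound assms) (auto intro: order_trans[OF norm_ge_zero coef_bound])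

lemma tail_term_sums:
 assumes "Re s + real m > 1" shows "tail_term N c m s sums suminf (tail_term N c m s)"
proof -
 have "summable (tail_term N c m s)"
 proof (rule summable_comparison_test')
  show "summable (%n. coef_bound m * ((norm s + real m)^m * real (Suc n) powr (- (Re s + real m))))"
   using assms by (intro summable_mult summable_inverse_powr)
 qed (use tail_term_bound[of "Re s + real m" s m] assms in auto)
 thus ?thesis by (rule summable_sums)
qed

text \<open>One summation by parts: the coefficients are differences \<open>w n - w (Suc n)\<close>,
  and the difference operator passes to the other factor. The boundary term at 0 joins
  \<open>boundary_sum\<close>; the one at \<open>M\<close> tends to 0.\<close>

lemma L_part_Suc:
 assumes "Re s + real m > 1" shows "L_part N c (Suc m) s = L_part N c m s"
proof -
 define w where "w n = reg_sum N (iter_reg N c m) 1 (int n)" for n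
 define h where "h n = (fdiff ^^ m) (zpow s) (of_nat (Suc n))" for n
 have it: "iter_reg N c m (int n) = w n - w (Suc n)" for n
  using reg_sum_diff[OF N mean_zero_iter_reg[OF N c, of m], of 1 "int n"] by (simp add: w_def add.commute)
 have ws: "iter_reg N c (Suc m) (int n) = w (Suc n)" for n by (simp add: w_def add.commute)
 have hs: "(fdiff ^^ Suc m) (zpow s) (of_nat (Suc n)) = h (Suc n) - h n" for n
  by (simp add: h_def fdiff_def add.commute add.left_commute)
 have "(%M. \<Sum>n<M. (w n - w (Suc n)) * h n) \<leadsto> suminf (tail_term N c m s)"
  using tail_term_sums[OF assms] by (simp add: sums_def tail_term_def it h_def)
 moreover have "(%M. \<Sum>n<M. w (Suc n) * (h (Suc n) - h n)) \<leadsto> suminf (tail_term N c (Suc m) s)"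
  using tail_term_sums[of s "Suc m"] assms by (simp add: sums_def tail_term_def ws hs del: iter_reg.simps funpow.simps of_nat_Suc)
 moreover have "(%M. w M * h M) \<leadsto> 0"
 proof (rule Lim_null_comparison)
  define K where "K = coef_bound (Suc m) * (norm s + real m)^m"
  have "(%M. real (Suc M) powr (- (Re s + real m))) \<leadsto> 0"
   using summable_LIMSEQ_zero[OF summable_inverse_powr[of "Re s + real m"]] assms by simp
  from tendsto_mult_right_zero[OF this, of K]
  show "(%M. K * real (Suc M) powr (- (Re s + real m))) \<leadsto> 0" .
  have "norm (w M * h M) \<le> K * real (Suc M) powr (- (Re s + real m))" for M
  proof -
   have "norm (w M) \<le> coef_bound (Suc m)" using coef_bound[of "Suc m" "int M - 1"] by (simp add: w_def)
   moreover have "norm (h M) \<le> (norm s + real m)^m * real (Suc M) powr (- (Re s + real m))"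
    unfolding h_def using assms by (intro fdiff_zpow_nat_bound) auto
   ultimately have "norm (w M) * norm (h M) \<le> coef_bound (Suc m) * ((norm s + real m)^m * real (Suc M) powr (- (Re s + real m)))"
    by (intro mult_mono) (auto intro: order_trans[OF norm_ge_zero])
   thus ?thesis by (simp add: norm_mult K_def mult_ac)
  qed
  thus "\<forall>\<^sub>F M in sequentially. norm (w M * h M) \<le> K * real (Suc M) powr (- (Re s + real m))" by simp
 qed
 ultimately have "(%M. w 0 * h 0 - w M * h M + (\<Sum>n<M. w (Suc n) * (h (Suc n) - h n)))
   \<leadsto> w 0 * h 0 - 0 + suminf (tail_term N c (Suc m) s)"
  by (intro tendsto_intros)
 hence "(%M. \<Sum>n<M. (w n - w (Suc n)) * h n) \<leadsto> w 0 * h 0 + suminf (tail_term N c (Suc m) s)"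
  by (simp add: sum_by_parts)
 hence "suminf (tail_term N c m s) = w 0 * h 0 + suminf (tail_term N c (Suc m) s)"
  using LIMSEQ_unique \<open>(%M. \<Sum>n<M. (w n - w (Suc n)) * h n) \<leadsto> suminf (tail_term N c m s)\<close> by blast
 thus ?thesis by (simp add: L_part_def boundary_sum_def w_def h_def)
qed

lemma L_part_mono: "m \<le> m' ==> Re s + real m > 1 ==> L_part N c m' s = L_part N c m s"
 by (induction m' rule: dec_induct) (auto simp: L_part_Suc)

lemma fdiff_zpow_holomorphic: "z ~= 0 ==> Re z > 0 ==> (%s. (fdiff ^^ i) (zpow s) z) holomorphic_on A"
proof (induction i arbitrary: z)
 case (Suc i)
 have "z + 1 ~= 0" "Re (z + 1) > 0" using Suc(3) by (auto simp: complex_eq_iff)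
 thus ?case using Suc by (simp add: fdiff_def holomorphic_on_diff)
qed (auto intro!: holomorphic_intros)

lemma L_part_holomorphic: "L_part N c m holomorphic_on {s. Re s + real m > 1}"
proof -
 have "(%s. suminf (tail_term N c m s)) holomorphic_on {s. Re s + real m > 1}"
 proof (rule holomorphic_uniform_sequence)
  have "{s. Re s + real m > 1} = {s. Re s > 1 - real m}" by auto
  thus "open {s. Re s + real m > 1}" using open_halfspace_Re_gt[of "1 - real m"] by simp
  show "(%s. \<Sum>i<n. tail_term N c m s i) holomorphic_on {s. Re s + real m > 1}" for n
   unfolding tail_term_def
   by (intro holomorphic_intros fdiff_zpow_holomorphic) (auto simp del: of_nat_Suc simp: of_nat_Suc[symmetric])
  fix x assume x: "x \<in> {s. Re s + real m > 1}"
  define d where "d = (Re x + real m - 1) / 2"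
  have d: "d > 0" using x by (simp add: d_def)
  have Re: "Re y + real m >= 1 + d" if "y \<in> cball x d" for y
  proof -
   have "Re x - Re y \<le> d" using that abs_Re_le_cmod[of "x - y"] by (simp add: dist_norm)
   thus ?thesis by (simp add: d_def field_simps)
  qed
  have nrm: "norm y \<le> norm x + d" if "y \<in> cball x d" for y
   using that norm_triangle_ineq2[of y x] by (simp add: dist_norm norm_minus_commute)
  have "uniform_limit (cball x d) (%n s. \<Sum>i<n. tail_term N c m s i) (%s. suminf (tail_term N c m s)) sequentially"
  proof (rule Weierstrass_m_test)
   fix n y assume "y \<in> cball x d"
   thus "norm (tail_term N c m y n) \<le> coef_bound m * ((norm x + d + real m)^m * real (Suc n) powr (- (1 + d)))"
    using Re nrm d by (intro tail_term_bound) auto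
  next
   show "summable (%n. coef_bound m * ((norm x + d + real m)^m * real (Suc n) powr (- (1 + d))))"
    using d by (intro summable_mult summable_inverse_powr) auto
  qed
  thus "\<exists>d>0. cball x d \<subseteq> {s. Re s + real m > 1} &
    uniform_limit (cball x d) (%n s. \<Sum>i<n. tail_term N c m s i) (%s. suminf (tail_term N c m s)) sequentially"
   using d Re by (intro exI[of _ d]) force
 qed
 moreover have "boundary_sum N c m holomorphic_on {s. Re s + real m > 1}"
  unfolding boundary_sum_def[abs_def] by (intro holomorphic_intros fdiff_zpow_holomorphic) auto
 ultimately show ?thesis unfolding L_part_def[abs_def] by (intro holomorphic_intros)
qed

text \<open>The ceiling ensures \<open>Re s + m \<ge> 2\<close>, within the half plane where
  \<open>L_part N c m\<close> converges; by \<open>L_part_mono\<close> all admissible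
  \<open>m\<close> give the same value.\<close>

definition L_entire :: "complex => complex"
 where "L_entire s = L_part N c (nat \<lceil>2 - Re s\<rceil>) s"

lemma L_entire_eq: assumes "Re s + real m > 1" shows "L_entire s = L_part N c m s"
proof -
 define m' where "m' = nat \<lceil>2 - Re s\<rceil>"
 have "real m' >= 2 - Re s" unfolding m'_def by linarith
 hence "Re s + real m' > 1" by simp
 hence "L_part N c (max m m') s = L_part N c m' s" "L_part N c (max m m') s = L_part N c m s"
  using assms by (auto intro!: L_part_mono)
 thus ?thesis by (simp add: L_entire_def m'_def)
qed

lemma L_entire_holomorphic: "L_entire holomorphic_on UNIV"
proof -
 have "L_entire holomorphic_on (\<Union>m. {s. Re s + real m > 1})"
 proof (rule holomorphic_on_UN_open)
  fix m
  have e: "{s. Re s + real m > 1} = {s. Re s > 1 - real m}" by auto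
  show "open {s. Re s + real m > 1}" unfolding e by (rule open_halfspace_Re_gt)
  show "L_entire holomorphic_on {s. Re s + real m > 1}"
   using L_part_holomorphic by (rule holomorphic_transform) (auto simp: L_entire_eq)
 qed
 moreover have "(\<Union>m. {s. Re s + real m > 1}) = UNIV"
 proof (intro equalityI subsetI UNIV_I)
  fix s :: complex
  obtain m where "real m > 1 - Re s" using reals_Archimedean2 by blast
  thus "s \<in> (\<Union>m. {s. Re s + real m > 1})" by (auto intro!: exI[of _ m])
 qed
 ultimately show ?thesis by simp
qed

end

lemma dirichlet_L_eq:
 assumes N: "N > 0" and \<phi>: "mean_zero N \<phi>"
 shows "dirichlet_L \<phi> = L_entire N (%n. \<phi> (n + 1))"
proof -
 let ?c = "%n. \<phi> (n + 1)"
 have c: "mean_zero N ?c" using mean_zero_shift[OF N \<phi>] .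
 have sums: "(%n. \<phi> (int (Suc n)) / of_nat (Suc n) powr s) sums L_entire N ?c s" if "Re s > 1" for s
 proof -
  have "tail_term N ?c 0 s sums L_part N ?c 0 s"
   using tail_term_sums[OF N c, of s 0] that by (simp add: L_part_def boundary_sum_def)
  moreover have "tail_term N ?c 0 s = (%n. \<phi> (int (Suc n)) / of_nat (Suc n) powr s)"
   by (auto simp: tail_term_def powr_minus divide_inverse add.commute)
  ultimately show ?thesis using L_entire_eq[OF N c, of s 0] that by simp
 qed
 show ?thesis unfolding dirichlet_L_def
 proof (rule the_equality)
  show "L_entire N ?c holomorphic_on UNIV & (\<forall>s. 1 < Re s --> (%n. \<phi> (int (Suc n)) / of_nat (Suc n) powr s) sums L_entire N ?c s)"
   using L_entire_holomorphic[OF N c] sums by blast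
  fix f assume f: "f holomorphic_on UNIV & (\<forall>s. 1 < Re s --> (%n. \<phi> (int (Suc n)) / of_nat (Suc n) powr s) sums f s)"
  show "f = L_entire N ?c"
  proof
   fix s
   show "f s = L_entire N ?c s"
   proof (rule analytic_continuation_open[of "{s. Re s > 1}" UNIV f "L_entire N ?c"])
    show "open {s. Re s > 1}" by (rule open_halfspace_Re_gt)
    show "{s :: complex. 1 < Re s} ~= {}" by (auto intro!: exI[of _ 2])
    show "f holomorphic_on UNIV" "L_entire N ?c holomorphic_on UNIV" using f L_entire_holomorphic[OF N c] by auto
    show "f z = L_entire N ?c z" if "z \<in> {s. 1 < Re s}" for z
     using f sums[of z] that sums_unique2 by blast
   qed auto
  qed
 qed
qed

text \<open>At s = -k the function \<open>(n + 1)^k\<close> is a polynomial, so its difference of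
  order \<open>k + 2\<close> is 0 and only the boundary terms of \<open>L_part\<close> survive; this
  order also gives \<open>Re s + m = 2 > 1\<close>. Only field operations occur, so the same
  expression makes sense in \<open>'k\<close>.\<close>

definition L_value :: "nat => (int => 'a::field_char_0) => nat => 'a"
 where "L_value N c k = (\<Sum>i<k + 2. iter_reg N (%n. c (n + 1)) (Suc i) (-1) * of_int ((fdiff ^^ i) (%n. (int n + 1)^k) (0::nat)))"

lemma dirichlet_L_value:
 assumes N: "N > 0" and \<phi>: "mean_zero N \<phi>"
 shows "dirichlet_L \<phi> (- of_nat k) = L_value N \<phi> k"
proof -
 let ?c = "%n. \<phi> (n + 1)"
 have c: "mean_zero N ?c" using mean_zero_shift[OF N \<phi>] .
 have z: "(fdiff ^^ i) (zpow (- of_nat k)) (of_nat (Suc n)) = of_int ((fdiff ^^ i) (%n. (int n + 1)^k) n)" for i n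
 proof (induction i arbitrary: n)
  case 0
  show ?case by (simp add: powr_nat del: of_nat_Suc) (simp add: add.commute)
 next
  case (Suc i)
  have "complex_of_nat (Suc n) + 1 = of_nat (Suc (Suc n))" by simp
  thus ?case using Suc[of n] Suc[of "Suc n"] by (simp add: fdiff_def del: of_nat_Suc)
 qed
 have "tail_term N ?c (k + 2) (- of_nat k) n = 0" for n
 proof -
  have "(fdiff ^^ (k + 2)) (%n. (int n + 1)^k) n = fdiff ((fdiff ^^ Suc k) (%n. (int n + 1)^k)) n" by simp
  also have "... = 0" unfolding fdiff_power by (simp add: fdiff_def)
  finally show ?thesis unfolding tail_term_def z by simp
 qed
 hence "tail_term N ?c (k + 2) (- of_nat k) = (%n. 0)" by (rule ext)
 hence "suminf (tail_term N ?c (k + 2) (- of_nat k)) = 0" by (simp only: suminf_zero)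
 moreover have "dirichlet_L \<phi> (- of_nat k) = L_part N ?c (k + 2) (- of_nat k)"
  unfolding dirichlet_L_eq[OF N \<phi>] by (rule L_entire_eq[OF N c]) simp
 moreover have "boundary_sum N ?c (k + 2) (- of_nat k) = L_value N \<phi> k"
  unfolding boundary_sum_def L_value_def using z[of _ 0] by simp
 ultimately show ?thesis by (simp add: L_part_def)
qed

lemma reg_sum_shift: "reg_sum N c P (a + k) = reg_sum N (%n. c (n + k)) P a"
 by (simp add: reg_sum_def algebra_simps)

lemma reg_sum_minus: "reg_sum N (%n. c n - d n) P a = reg_sum N c P a - reg_sum N d P a"
 unfolding reg_sum_def diff_divide_distrib[symmetric] by (simp add: right_diff_distrib sum_subtractf)

lemma reg_sum_by_parts:
 assumes "N > 0" "mean_zero N c"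
 shows "reg_sum N c P a = reg_sum N (reg_sum N c 1) P a - reg_sum N (reg_sum N c 1) P (a + 1)"
proof -
 have "reg_sum N c P a = reg_sum N (%n. reg_sum N c 1 n - reg_sum N c 1 (n + 1)) P a"
  using reg_sum_diff[OF assms, of 1] by simp
 also have "... = reg_sum N (reg_sum N c 1) P a - reg_sum N (%n. reg_sum N c 1 (n + 1)) P a"
  by (rule reg_sum_minus)
 finally show ?thesis by (simp add: reg_sum_shift[where k = 1])
qed

lemma mean_zero_sum_family:
 assumes "!!i. i \<in> A ==> mean_zero N (f i)" shows "mean_zero N (%a. \<Sum>i\<in>A. f i a)"
 unfolding mean_zero_def
proof (intro conjI allI)
 show "(\<Sum>i\<in>A. f i (a + int N)) = (\<Sum>i\<in>A. f i a)" for a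
  using assms by (intro sum.cong) (auto simp: mean_zero_def)
 have "(\<Sum>j<N. \<Sum>i\<in>A. f i (int j)) = (\<Sum>i\<in>A. \<Sum>j<N. f i (int j))" by (rule sum.swap)
 also have "... = 0" using assms by (intro sum.neutral) (auto simp: mean_zero_def)
 finally show "(\<Sum>j<N. \<Sum>i\<in>A. f i (int j)) = 0" .
qed

lemma sum_lessThan_mult: "(\<Sum>x<P * m. h x) = (\<Sum>a<P. \<Sum>i<m. h (a + i * P :: nat))"
proof -
 have "(\<Sum>a<P. \<Sum>i<m. h (a + i * P)) = (\<Sum>i<m. \<Sum>a<P. h (a + i * P))" by (rule sum.swap)
 also have "... = (\<Sum>i<m. sum h {i * P..<i * P + P})"
 proof (rule sum.cong[OF refl])
  fix i
  show "(\<Sum>a<P. h (a + i * P)) = sum h {i * P..<i * P + P}"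
   using sum.shift_bounds_nat_ivl[of h 0 "i * P" P] by (simp add: atLeast0LessThan add.commute)
 qed
 also have "... = (\<Sum>x<P * m. h x)" by (simp add: sum.nat_group mult.commute)
 finally show ?thesis ..
qed

lemma sum_multiples:
 assumes "d > 0"
 shows "(\<Sum>a<d * m. if d dvd Suc a then h (Suc a) else 0) = (\<Sum>b<m. h (d * Suc b))"
proof -
 have "(\<Sum>a<d * m. if d dvd Suc a then h (Suc a) else 0) = (\<Sum>a\<in>{a. a < d * m & d dvd Suc a}. h (Suc a))"
  by (subst sum.inter_filter[symmetric]) (auto intro: sum.cong)
 also have "... = (\<Sum>b<m. h (d * Suc b))"
 proof (rule sum.reindex_bij_witness[of _ "%b. d * Suc b - 1" "%a. Suc a div d - 1"])
  fix a assume a: "a \<in> {a. a < d * m & d dvd Suc a}"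
  then obtain b where b: "Suc a = d * b" by (auto elim: dvdE)
  hence "b > 0" by (cases b) auto
  have "d * b \<le> d * m" using a b by (metis (no_types, lifting) Suc_leI mem_Collect_eq)
  hence "b \<le> m" using assms by (simp only: mult_le_cancel1)
  thus "d * Suc (Suc a div d - 1) - 1 = a" "Suc a div d - 1 \<in> {..<m}"
   "h (d * Suc (Suc a div d - 1)) = h (Suc a)"
   using b \<open>b > 0\<close> assms by auto
 next
  fix b assume b: "b \<in> {..<m}"
  have s: "Suc (d * Suc b - 1) = d * Suc b" using assms by simp
  thus "Suc (d * Suc b - 1) div d - 1 = b" using assms by simp
  have "d * Suc b \<le> d * m" using b by (intro mult_le_mono2) auto
  thus "d * Suc b - 1 \<in> {a. a < d * m & d dvd Suc a}" using s assms by auto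
 qed
 finally show ?thesis .
qed

section \<open>The p-adic measure attached to \<open>c\<close> and its Riemann sums\<close>

context padic_closure begin

text \<open>The class of \<open>a\<close> modulo \<open>p^n\<close> has as its mass the regularised
  sum of \<open>c\<close> over that class. Compatibility between the levels is
  \<open>reg_sum_distribution\<close>.\<close>

definition riemann :: "nat => (int => 'k) => (nat => 'k) => nat => 'k"
 where "riemann N c f n = (\<Sum>a<p^n. f a * reg_sum N c (int (p^n)) (int a))"

lemma coprime_power_N: "coprime N p ==> coprime (int (p^n)) (int N)"
 by (simp add: coprime_commute)

lemma av_N: assumes "coprime N p" shows "av (of_nat N) = 1"
proof -
 have "\<not> p dvd N"
  using assms p_gt_1 by (metis coprime_common_divisor_nat dvd_refl less_irrefl)
 thus ?thesis by (rule av_of_nat_unit)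
qed

lemma av_mean_zero:
 assumes "N > 0" "mean_zero N d" shows "av (d a) \<le> (\<Sum>j<N. av (d (int j)))"
proof -
 have "av (d a) = av (d (int (nat (a mod int N))))"
  using assms mean_zero_mod[of N d a] by simp
 also have "... \<le> (\<Sum>j<N. av (d (int j)))"
  using assms(1) by (intro member_le_sum[of _ _ "%j. av (d (int j))"]) (auto simp: nat_less_iff)
 finally show ?thesis .
qed

lemma av_reg_sum:
 assumes "N > 0" "coprime N p" "mean_zero N d"
 shows "av (reg_sum N d P a) \<le> (\<Sum>j<N. av (d (int j)))"
proof -
 have "av (\<Sum>j<N. of_nat j * d (a + P * int j)) \<le> (\<Sum>j<N. av (d (int j)))"
 proof (rule av_sum_le)
  fix j
  have "av (of_nat j * d (a + P * int j)) \<le> 1 * (\<Sum>j<N. av (d (int j)))"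
   unfolding av_mult using av_mean_zero[OF assms(1,3)] av_of_nat_le by (intro mult_mono) auto
  thus "av (of_nat j * d (a + P * int j)) \<le> (\<Sum>j<N. av (d (int j)))" by simp
 qed (simp add: sum_nonneg)
 thus ?thesis by (simp add: reg_sum_def av_N[OF assms(2)])
qed

text \<open>Summation by parts on level \<open>n\<close> mirrors \<open>L_part_Suc\<close>. The two
  boundary terms combine to \<open>V 0 * F 0\<close> and a multiple of \<open>F (p^n) - F 0\<close>;
  the latter is divisible by \<open>p^n\<close> and disappears in the limit. So complex and p-adic
  values are given by one expression.\<close>

lemma riemann_polynomial:
 assumes N: "N > 0" and cop: "coprime N p" and c: "mean_zero N c"
  and F: "!!a b. int a - int b dvd F a - F b" "(fdiff ^^ m) F = (%n. 0)"
 shows "riemann N c (%a. of_int (F a)) \<leadsto> (\<Sum>i<m. iter_reg N c (Suc i) (-1) * of_int ((fdiff ^^ i) F 0))"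
 using c F
proof (induction m arbitrary: c F)
 case 0
 hence "F = (%n. 0)" by simp
 thus ?case by (simp add: riemann_def)
next
 case (Suc m)
 define V where "V = reg_sum N c 1"
 define G where "G = fdiff F"
 have V: "mean_zero N V" unfolding V_def by (rule mean_zero_reg_sum[OF N Suc(2)])
 have V1: "iter_reg N c 1 = (%n. V (n + 1))" by (simp add: V_def)
 have V1m: "mean_zero N (iter_reg N c 1)" unfolding V1 by (rule mean_zero_shift[OF N V])
 have Gc: "int a - int b dvd G a - G b" for a b
 proof -
  have "int (a + 1) - int (b + 1) dvd F (a + 1) - F (b + 1)" by (rule Suc(3))
  hence 1: "int a - int b dvd F (a + 1) - F (b + 1)" by simp
  have 2: "int a - int b dvd F a - F b" by (rule Suc(3))
  have "int a - int b dvd (F (a + 1) - F (b + 1)) - (F a - F b)" by (rule dvd_diff[OF 1 2])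
  thus ?thesis by (simp add: G_def fdiff_def algebra_simps)
 qed
 have G0: "(fdiff ^^ m) G = (%n. 0)" using Suc(4) by (simp add: G_def funpow_swap1)
 define w where "w n a = reg_sum N V (int (p^n)) (int a)" for n a
 have rec: "riemann N c (%a. of_int (F a)) n = V 0 * of_int (F 0) - w n (p^n) * of_int (F (p^n) - F 0)
   + riemann N (iter_reg N c 1) (%a. of_int (G a)) n" for n
 proof -
  have "riemann N c (%a. of_int (F a)) n = (\<Sum>a<p^n. (w n a - w n (Suc a)) * of_int (F a))"
   unfolding riemann_def w_def V_def
   by (intro sum.cong refl) (simp only: reg_sum_by_parts[OF N Suc(2), of "int (p^n)"] of_nat_Suc mult.commute add.commute)
  also have "... = w n 0 * of_int (F 0) - w n (p^n) * of_int (F (p^n))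
    + (\<Sum>a<p^n. w n (Suc a) * (of_int (F (Suc a)) - of_int (F a)))" by (rule sum_by_parts)
  also have "(\<Sum>a<p^n. w n (Suc a) * (of_int (F (Suc a)) - of_int (F a))) = riemann N (iter_reg N c 1) (%a. of_int (G a)) n"
   unfolding riemann_def V1
  proof (rule sum.cong[OF refl])
   fix a
   have "w n (Suc a) = reg_sum N (%n. V (n + 1)) (int (p^n)) (int a)"
    unfolding w_def reg_sum_shift[symmetric] by (simp add: add.commute)
   thus "w n (Suc a) * (of_int (F (Suc a)) - of_int (F a)) = of_int (G a) * reg_sum N (%n. V (n + 1)) (int (p^n)) (int a)"
    by (simp add: G_def fdiff_def)
  qed
  also have "w n 0 * of_int (F 0) - w n (p^n) * of_int (F (p^n)) = V 0 * of_int (F 0) - w n (p^n) * of_int (F (p^n) - F 0)"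
  proof -
   have "w n 0 - w n (p^n) = V 0"
    using reg_sum_diff[OF N V coprime_power_N[OF cop, of n], of 0] by (simp add: w_def)
   hence "w n 0 = V 0 + w n (p^n)" by (simp add: algebra_simps)
   thus ?thesis by (simp add: algebra_simps)
  qed
  finally show ?thesis .
 qed
 have "(%n. w n (p^n) * of_int (F (p^n) - F 0)) \<leadsto> 0"
 proof (rule lim_zeroI)
  define B where "B = (\<Sum>j<N. av (V (int j)))"
  from tendsto_mult_right_zero[OF inv_p_power_lim, of B]
  show "(%n. B * (1 / real p)^n) \<leadsto> 0" .
  have "av (w n (p^n) * of_int (F (p^n) - F 0)) \<le> B * (1 / real p)^n" for n
  proof -
   have "int p^n dvd F (p^n) - F 0" using Suc(3)[of "p^n" 0] by simp
   hence "av (of_int (F (p^n) - F 0)) \<le> (1 / real p)^n" using av_of_int_dvd by (metis power_one_over)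
   moreover have "av (w n (p^n)) \<le> B" unfolding w_def B_def by (rule av_reg_sum[OF N cop V])
   ultimately show ?thesis unfolding av_mult by (intro mult_mono) (auto simp: B_def intro!: sum_nonneg)
  qed
  thus "\<forall>\<^sub>F n in sequentially. av (w n (p^n) * of_int (F (p^n) - F 0) - 0) \<le> B * (1 / real p)^n" by simp
 qed
 moreover have "riemann N (iter_reg N c 1) (%a. of_int (G a)) \<leadsto> (\<Sum>i<m. iter_reg N (iter_reg N c 1) (Suc i) (-1) * of_int ((fdiff ^^ i) G 0))"
  by (rule Suc(1)[OF V1m Gc G0])
 ultimately have "(%n. V 0 * of_int (F 0) - w n (p^n) * of_int (F (p^n) - F 0) + riemann N (iter_reg N c 1) (%a. of_int (G a)) n)
  \<leadsto> V 0 * of_int (F 0) - 0 + (\<Sum>i<m. iter_reg N (iter_reg N c 1) (Suc i) (-1) * of_int ((fdiff ^^ i) G 0))"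
  by (intro lim_add lim_diff lim_const)
 moreover have "(\<Sum>i<Suc m. iter_reg N c (Suc i) (-1) * of_int ((fdiff ^^ i) F 0)) = V 0 * of_int (F 0)
   + (\<Sum>i<m. iter_reg N (iter_reg N c 1) (Suc i) (-1) * of_int ((fdiff ^^ i) G 0))"
  unfolding sum.lessThan_Suc_shift G_def
  by (simp only: iter_reg_shift[of N c "Suc _"] funpow_Suc_right o_apply) (simp add: V_def)
 ultimately show ?case unfolding rec[symmetric] by simp
qed

definition on_units :: "(nat => 'k) => nat => 'k" where "on_units f a = (if p dvd a then 0 else f a)"

text \<open>As \<open>c (p * b) = c b\<close>, the multiples of \<open>p\<close> on level
  \<open>Suc n\<close> reproduce level \<open>n\<close> with the factor \<open>p^k\<close>; removing
  them produces the Euler factor.\<close>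

lemma riemann_units_power:
 assumes N: "N > 0" and cop: "coprime N p" and c: "mean_zero N c" and cp: "!!b. c (int p * b) = c b"
 shows "riemann N c (on_units (%a. of_nat a^k)) \<leadsto> (1 - of_nat p^k) * L_value N c k"
proof -
 define h where "h n a = of_nat a^k * reg_sum N c (int (p^n)) (int a)" for n a
 define S where "S n = (\<Sum>a<p^n. h n (Suc a))" for n
 have dvd: "int a - int b dvd (int a + 1)^k - (int b + 1)^k" for a b
 proof -
  have "[int a + 1 = int b + 1] (mod (int a - int b))" by (simp add: cong_iff_dvd_diff)
  hence "[(int a + 1)^k = (int b + 1)^k] (mod (int a - int b))" by (rule cong_pow)
  thus ?thesis by (simp add: cong_iff_dvd_diff)
 qed
 have "(fdiff ^^ (k + 2)) (%n. (int n + 1)^k) = (%n :: nat. 0)"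
 proof -
  have "(fdiff ^^ (k + 2)) (%n. (int n + 1)^k) = fdiff ((fdiff ^^ Suc k) (%n :: nat. (int n + 1)^k))" by simp
  also have "... = (%n. 0)" unfolding fdiff_power by (simp add: fdiff_def[abs_def])
  finally show ?thesis .
 qed
 from riemann_polynomial[OF N cop mean_zero_shift[OF N c, of 1] dvd this]
 have "riemann N (%n. c (n + 1)) (%a. of_int ((int a + 1)^k)) \<leadsto> L_value N c k"
  unfolding L_value_def .
 moreover have "riemann N (%n. c (n + 1)) (%a. of_int ((int a + 1)^k)) = S"
  unfolding riemann_def S_def h_def reg_sum_shift[symmetric] by (intro ext sum.cong) (auto simp: add.commute)
 ultimately have S: "S \<leadsto> L_value N c k" by simp
 have rec: "riemann N c (on_units (%a. of_nat a^k)) (Suc n) = S (Suc n) - of_nat p^k * S n" for n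
 proof -
  have shift: "(\<Sum>a<M. g a) = (\<Sum>a<M. g (Suc a))" if "g M = g 0" for M :: nat and g :: "nat => 'k"
  proof -
   have "g 0 + (\<Sum>a<M. g (Suc a)) = (\<Sum>a<M. g a) + g M" using sum.lessThan_Suc_shift[of g M] by simp
   thus ?thesis using that by simp
  qed
  have "riemann N c (on_units (%a. of_nat a^k)) (Suc n) = (\<Sum>a<p^Suc n. if p dvd a then 0 else h (Suc n) a)"
   unfolding riemann_def by (intro sum.cong) (auto simp: on_units_def h_def)
  \<comment> \<open>The index moves from \<open>a\<close> to \<open>Suc a\<close> to match
    \<open>L_value\<close>. Both end points 0 and \<open>p^Suc n\<close> are multiples of
    \<open>p\<close> and contribute 0.\<close>
  also have "... = (\<Sum>a<p^Suc n. if p dvd Suc a then 0 else h (Suc n) (Suc a))"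
   by (rule shift) simp
  also have "... = S (Suc n) - (\<Sum>a<p^Suc n. if p dvd Suc a then h (Suc n) (Suc a) else 0)"
   unfolding S_def sum_subtractf[symmetric] by (intro sum.cong) auto
  also have "(\<Sum>a<p^Suc n. if p dvd Suc a then h (Suc n) (Suc a) else 0) = (\<Sum>b<p^n. h (Suc n) (p * Suc b))"
   using sum_multiples[of p "h (Suc n)" "p^n"] by simp
  also have "... = of_nat p^k * S n"
   unfolding S_def sum_distrib_left
  proof (rule sum.cong[OF refl])
   fix b
   have "reg_sum N c (int (p^Suc n)) (int (p * Suc b)) = reg_sum N c (int (p^n)) (int (Suc b))"
   proof -
    have "c (int (p * Suc b) + int (p^Suc n) * int j) = c (int (Suc b) + int (p^n) * int j)" for j
     using cp[of "int (Suc b) + int (p^n) * int j"] by (simp add: algebra_simps)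
    thus ?thesis by (simp add: reg_sum_def)
   qed
   thus "h (Suc n) (p * Suc b) = of_nat p^k * h n (Suc b)"
    by (simp only: h_def of_nat_mult power_mult_distrib mult.assoc)
  qed
  finally show ?thesis .
 qed
 have "(%n. S (Suc n) - of_nat p^k * S n) \<leadsto> L_value N c k - of_nat p^k * L_value N c k"
  by (intro lim_diff lim_mult lim_const S LIMSEQ_Suc[OF S])
 hence "(%n. riemann N c (on_units (%a. of_nat a^k)) (Suc n)) \<leadsto> (1 - of_nat p^k) * L_value N c k"
  unfolding rec by (simp add: algebra_simps)
 thus ?thesis by (rule LIMSEQ_imp_Suc)
qed

text \<open>By telescoping, the sum over the \<open>p\<close> subclasses satisfies the difference
  equation with step \<open>P\<close> that characterises \<open>reg_sum\<close> in
  \<open>reg_sum_unique\<close>.\<close>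

lemma reg_sum_distribution:
 assumes N: "N > 0" and cop: "coprime N p" and c: "mean_zero N c"
 shows "reg_sum N c (int (p^n)) a = (\<Sum>i<p. reg_sum N c (int (p^Suc n)) (a + int i * int (p^n)))"
proof -
 define P where "P = int (p^n)"
 define g where "g = reg_sum N c (int (p^Suc n))"
 have g: "mean_zero N g" unfolding g_def by (rule mean_zero_reg_sum[OF N c])
 have "(\<Sum>i<p. g (a + int i * P)) = reg_sum N c P a"
 proof (rule reg_sum_unique[OF N, of "%a. \<Sum>i<p. g (a + int i * P)" P c a])
  show "mean_zero N (%a. \<Sum>i<p. g (a + int i * P))"
   by (intro mean_zero_sum_family mean_zero_shift[OF N g])
  show "coprime P (int N)" unfolding P_def by (rule coprime_power_N[OF cop])
  fix a
  have "(\<Sum>i<p. g (a + int i * P)) - (\<Sum>i<p. g (a + P + int i * P)) = (\<Sum>i<p. g (a + int i * P) - g (a + int (Suc i) * P))"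
   unfolding sum_subtractf[symmetric] by (intro sum.cong refl) (simp add: algebra_simps)
  also have "... = g a - g (a + int p * P)" using sum_lessThan_telescope'[of "%i. g (a + int i * P)" p] by simp
  also have "... = c a"
   using reg_sum_diff[OF N c coprime_power_N[OF cop, of "Suc n"], of a] by (simp add: g_def P_def)
  finally show "(\<Sum>i<p. g (a + int i * P)) - (\<Sum>i<p. g (a + P + int i * P)) = c a" .
 qed
 thus ?thesis by (simp add: g_def P_def)
qed

lemma riemann_Suc_diff:
 assumes N: "N > 0" and cop: "coprime N p" and c: "mean_zero N c"
 shows "riemann N c f (Suc n) - riemann N c f n =
  (\<Sum>a<p^n. \<Sum>i<p. (f (a + i * p^n) - f a) * reg_sum N c (int (p^Suc n)) (int (a + i * p^n)))"
proof -
 have "riemann N c f (Suc n) = (\<Sum>a<p^n. \<Sum>i<p. f (a + i * p^n) * reg_sum N c (int (p^Suc n)) (int (a + i * p^n)))"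
  unfolding riemann_def by (simp only: power_Suc2 sum_lessThan_mult)
 moreover have "riemann N c f n = (\<Sum>a<p^n. \<Sum>i<p. f a * reg_sum N c (int (p^Suc n)) (int (a + i * p^n)))"
  unfolding riemann_def reg_sum_distribution[OF N cop c, of n] by (simp add: sum_distrib_left)
 ultimately show ?thesis by (simp add: sum_subtractf[symmetric] left_diff_distrib)
qed

lemma riemann_av_le:
 assumes N: "N > 0" and cop: "coprime N p" and c: "mean_zero N c" and f: "!!a. av (f a) \<le> C"
 shows "av (riemann N c f n) \<le> C * (\<Sum>j<N. av (c (int j)))"
proof -
 have C: "C >= 0" using f[of 0] av_nonneg order_trans by blast
 show ?thesis unfolding riemann_def
 proof (rule av_sum_le)
  fix a show "av (f a * reg_sum N c (int (p^n)) (int a)) \<le> C * (\<Sum>j<N. av (c (int j)))"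
   unfolding av_mult using C by (intro mult_mono f av_reg_sum[OF N cop c]) auto
 qed (use C in \<open>auto intro!: mult_nonneg_nonneg sum_nonneg\<close>)
qed

lemma riemann_converges:
 assumes N: "N > 0" and cop: "coprime N p" and c: "mean_zero N c"
  and R: "complete_subfield R" "!!a. c a \<in> R" "!!a. f a \<in> R"
  and f: "!!a i n. n >= 2 ==> av (f (a + i * p^n) - f a) \<le> (1 / real p)^n"
 obtains L where "L \<in> R" "riemann N c f \<leadsto> L"
proof -
 define B where "B = (\<Sum>j<N. av (c (int j)))"
 have B: "B >= 0" by (simp add: B_def sum_nonneg)
 have d0: "(%n. riemann N c f (Suc n) - riemann N c f n) \<leadsto> 0"
 proof (rule lim_zeroI)
  from tendsto_mult_left_zero[OF inv_p_power_lim, of B]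
  show "(%n. (1 / real p)^n * B) \<leadsto> 0" .
  show "\<forall>\<^sub>F n in sequentially. av (riemann N c f (Suc n) - riemann N c f n - 0) \<le> (1 / real p)^n * B"
   using eventually_ge_at_top[of 2]
  proof eventually_elim
   case (elim n)
   have "av (riemann N c f (Suc n) - riemann N c f n) \<le> (1 / real p)^n * B"
    unfolding riemann_Suc_diff[OF N cop c]
   proof (intro av_sum_le)
    fix a i
    show "av ((f (a + i * p^n) - f a) * reg_sum N c (int (p^Suc n)) (int (a + i * p^n))) \<le> (1 / real p)^n * B"
     unfolding av_mult B_def by (intro mult_mono f elim av_reg_sum[OF N cop c]) auto
   qed (use B in auto)
   thus ?case by simp
  qed
 qed
 have mem: "riemann N c f n \<in> R" for n
  unfolding riemann_def reg_sum_def
  by (intro cs_sum[OF R(1)] complete_subfieldD(3)[OF R(1)] R(3) cs_divide[OF R(1)] cs_minus[OF R(1)] R(2) cs_of_nat[OF R(1)])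
 show ?thesis by (rule cs_lim[OF R(1) d0 mem]) (rule that)
qed

lemma av_p_le_qq: "1 / real p^2 \<le> 1 / real qq"
proof -
 have "qq \<le> p^2" using p_gt_1 by (auto simp: qq_def power2_eq_square)
 hence "real qq \<le> real p^2" by (metis of_nat_le_iff of_nat_power)
 thus ?thesis using qq_ge_3 by (intro divide_left_mono) auto
qed

text \<open>For odd \<open>p\<close> the power \<open>a^(p - 1)\<close> is close to 1 by Fermat; for
  \<open>p = 2\<close> one of \<open>a\<close> and \<open>- a\<close> is 1 modulo 4. Passing to them
  changes the logarithm by a unit factor or not at all.\<close>

lemma av_lg_int:
 assumes "\<not> int p dvd a" shows "av (lg (of_int a)) \<le> 1 / real qq"
proof (cases "p = 2")
 case True
 have q4: "qq = 4" using True unfolding qq_def by simp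
 have *: "av (lg (of_int b)) \<le> 1 / real qq" if "[b = 1] (mod 4)" for b
 proof -
  have "int p^2 dvd b - 1" using that True by (simp add: cong_iff_dvd_diff)
  hence "av (of_int (b - 1)) \<le> 1 / real p^2" by (rule av_of_int_dvd)
  also have "real p^2 = real (p^2)" by simp
  also have "p^2 = qq" unfolding q4 using True by simp
  finally have "av (of_int b - 1) \<le> 1 / real qq" by simp
  thus ?thesis using av_lg_close by simp
 qed
 have "odd a" using assms True by simp
 hence "[a = 1] (mod 4) \<or> [- a = 1] (mod 4)" unfolding cong_def by presburger
 thus ?thesis using *[of a] *[of "- a"] lg_minus[of "of_int a"] by auto
next
 case False
 have qp: "qq = p" using False unfolding qq_def by simp
 have "prime (int p)" using prime_p by simp
 hence "coprime a (int p)" using assms by (metis coprime_commute prime_imp_coprime)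
 define b where "b = nat (a mod int p)"
 have b: "[a = int b] (mod int p)" using p_gt_1 by (simp add: b_def cong_def)
 have "int p dvd a \<longleftrightarrow> int p dvd int b" using b unfolding cong_def dvd_eq_mod_eq_0 by simp
 hence "\<not> p dvd b" using assms by simp
 hence "[b^(p - 1) = 1] (mod p)" using prime_p fermat_theorem by blast
 hence "[int b^(p - 1) = 1] (mod int p)" by (metis cong_int_iff of_nat_1 of_nat_power)
 hence "[a^(p - 1) = 1] (mod int p)" using cong_pow[OF b] cong_trans by blast
 hence "int p^1 dvd a^(p - 1) - 1" by (simp add: cong_iff_dvd_diff)
 hence "av (of_int (a^(p - 1) - 1)) \<le> 1 / real p^1" by (rule av_of_int_dvd)
 hence "av (of_int a^(p - 1) - 1) \<le> 1 / real qq" by (simp add: qp)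
 hence l: "av (lg (of_int a^(p - 1))) \<le> 1 / real qq" using av_lg_close by simp
 have "(of_int a :: 'k) ~= 0" using assms by auto
 hence "lg (of_int a^(p - 1)) = of_nat (p - 1) * lg (of_int a)" by (rule lg_power)
 moreover have "av (of_nat (p - 1)) = 1"
  using p_gt_1 by (intro av_of_nat_unit) (auto dest: dvd_imp_le)
 ultimately show ?thesis using l by simp
qed

lemma av_lg_nat: "\<not> p dvd a ==> av (lg (of_nat a)) \<le> 1 / real qq"
 using av_lg_int[of "int a"] by simp

lemma inv_qq_le_1: "1 / real qq \<le> 1" "1 / real qq < 1" using qq_ge_3 by auto

lemma av_power_diff: "av x \<le> 1 ==> av y \<le> 1 ==> av (x^j - y^j) \<le> av (x - y)"
proof (induction j)
 case (Suc j)
 have "av (x * (x^j - y^j)) \<le> 1 * av (x - y)" unfolding av_mult using Suc by (intro mult_mono) auto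
 moreover have "av ((x - y) * y^j) \<le> av (x - y) * 1"
  unfolding av_mult av_power using Suc by (intro mult_left_mono power_le_one) auto
 ultimately have "av (x * (x^j - y^j) + (x - y) * y^j) \<le> av (x - y)" by (intro av_add_le) auto
 moreover have "x * (x^j - y^j) + (x - y) * y^j = x^Suc j - y^Suc j" by (simp add: algebra_simps)
 ultimately show ?case by metis
qed simp

text \<open>\<open>n \<ge> 2\<close> puts the quotient of the two arguments within
  \<open>1 / qq\<close> of 1, also for \<open>p = 2\<close>; there the logarithm is as small as the
  distance from 1.\<close>

lemma lg_locally_constant:
 assumes "\<not> p dvd a" "n >= 2" shows "av (lg (of_nat (a + i * p^n)) - lg (of_nat a)) \<le> (1 / real p)^n"
proof -
 have a0: "(of_nat a :: 'k) ~= 0" using assms by (auto intro!: gr0I)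
 have "p dvd i * p^n" using assms by (cases n) auto
 hence "\<not> p dvd a + i * p^n" using assms(1) dvd_add_left_iff by blast
 hence b0: "(of_nat (a + i * p^n) :: 'k) ~= 0" by (metis dvd_0_right of_nat_eq_0_iff)
 have e: "of_nat (a + i * p^n) / of_nat a - 1 = (of_nat i * of_nat (p^n) / of_nat a :: 'k)"
  using a0 by (simp add: field_simps)
 have "av (of_nat (a + i * p^n) / of_nat a - 1) = av (of_nat i) * (1 / real p)^n"
  unfolding e using av_of_nat_unit[OF assms(1)] by simp
 also have "... \<le> 1 * (1 / real p)^n" by (intro mult_right_mono av_of_nat_le) simp
 finally have le: "av (of_nat (a + i * p^n) / of_nat a - 1) \<le> (1 / real p)^n" by simp
 have "(1 / real p)^n \<le> (1 / real p)^2" using assms p_gt_1 by (intro power_decreasing) auto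
 also have "... \<le> 1 / real qq" using av_p_le_qq by (simp add: power_one_over)
 finally have "av (of_nat (a + i * p^n) / of_nat a - 1) \<le> 1 / real qq" using le by linarith
 from av_lg_close[OF this] show ?thesis using le a0 b0 by (simp add: lg_divide)
qed

lemma log_power_locally_constant:
 assumes "n >= 2"
 shows "av (on_units (%a. lg (of_nat a)^j) (a + i * p^n) - on_units (%a. lg (of_nat a)^j) a) \<le> (1 / real p)^n"
proof -
 have "p dvd i * p^n" using assms by (cases n) auto
 hence d: "p dvd a + i * p^n \<longleftrightarrow> p dvd a" using dvd_add_left_iff by blast
 show ?thesis
 proof (cases "p dvd a")
  case False
  have "av (lg (of_nat (a + i * p^n))^j - lg (of_nat a)^j) \<le> av (lg (of_nat (a + i * p^n)) - lg (of_nat a))"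
   using av_lg_nat[of a] av_lg_nat[of "a + i * p^n"] d False inv_qq_le_1 by (intro av_power_diff) auto
  also have "... \<le> (1 / real p)^n" using lg_locally_constant[OF False assms] .
  finally show ?thesis using False d by (simp add: on_units_def)
 qed (use d in \<open>simp add: on_units_def\<close>)
qed

definition log_moment :: "nat => (int => 'k) => nat => 'k"
 where "log_moment N c j = lim (riemann N c (on_units (%a. lg (of_nat a)^j)))"

text \<open>The power \<open>a^totient qq\<close> lies in the disc of the logarithm series, whose
  partial sums are in \<open>R\<close>, and \<open>totient qq\<close> can be divided out in
  \<open>R\<close>. This keeps all Riemann sums inside one complete field.\<close>

lemma log_in_subfield: assumes R: "complete_subfield R" and "\<not> p dvd a" shows "lg (of_nat a) \<in> R"
proof -
 define t where "t = totient qq"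
 have t: "t > 0" using qq_ge_3 by (simp add: t_def)
 have "coprime a p" using assms(2) prime_p by (metis coprime_commute prime_imp_coprime)
 moreover have "qq = p \<or> qq = p^2" by (simp add: qq_def)
 ultimately have "coprime a qq" by auto
 hence "[a^t = 1] (mod qq)" unfolding t_def by (rule euler_theorem)
 hence "int qq dvd int a^t - 1" by (metis cong_iff_dvd_diff cong_int_iff of_nat_1 of_nat_power)
 then obtain b where b: "int a^t - 1 = int qq * b" by (elim dvdE)
 have "of_nat a^t - 1 = (of_nat qq * of_int b :: 'k)" using arg_cong[OF b, of "of_int :: int => 'k"] by simp
 hence "av (of_nat a^t - 1) \<le> 1 / real qq"
  using mult_left_mono[OF av_of_int_le[of b], of "av (of_nat qq)"] by (simp add: av_qq)
 hence lt: "av (of_nat a^t - 1) < 1" using inv_qq_le_1 by linarith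
 have a0: "(of_nat a :: 'k) ~= 0" using assms(2) by (auto intro!: gr0I)
 have "log_sum (of_nat a^t - 1) \<in> R"
 proof (rule cs_closed[OF R])
  show "(%n. \<Sum>i<n. log_term (of_nat a^t - 1) i) \<leadsto> log_sum (of_nat a^t - 1)"
   using log_sums[OF lt] by (simp add: sums_def)
  show "(\<Sum>i<n. log_term (of_nat a^t - 1) i) \<in> R" for n unfolding log_term_def
   by (intro cs_sum[OF R] cs_divide[OF R] complete_subfieldD(3)[OF R] cs_power[OF R] cs_diff[OF R] cs_minus[OF R]) (auto simp: cs_of_nat[OF R] cs_1[OF R] simp del: of_nat_Suc)
 qed
 hence "of_nat t * lg (of_nat a) \<in> R" using lg_power[OF a0, of t] lg_1p[OF lt] by simp
 hence "of_nat t * lg (of_nat a) / of_nat t \<in> R" by (intro cs_divide[OF R] cs_of_nat[OF R])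
 thus ?thesis using t by simp
qed

end

text \<open>Inversion permutes the units, so the product times itself is a product of pairs
  \<open>a * g a\<close>. The square suffices because the logarithm of the product is half the
  logarithm of the square.\<close>

lemma prod_units_square:
 fixes Q :: nat
 assumes Q: "Q > 1"
 shows "[(\<Prod>a\<in>{a. a < Q & coprime a Q}. a)^2 = 1] (mod Q)"
proof -
 define M where "M = {a. a < Q & coprime a Q}"
 have "\<forall>a\<in>M. \<exists>b. b \<in> M & [a * b = 1] (mod Q)"
 proof
  fix a assume a: "a \<in> M"
  then obtain x where x: "[a * x = 1] (mod Q)" using cong_solve_coprime_nat by (auto simp: M_def)
  hence "[a * (x mod Q) = 1] (mod Q)" by (simp add: cong_def mod_mult_right_eq)
  moreover from this have "coprime (x mod Q) Q"
   by (metis coprime_iff_invertible_nat mult.commute One_nat_def)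
  ultimately show "\<exists>b. b \<in> M & [a * b = 1] (mod Q)" using Q by (intro exI[of _ "x mod Q"]) (auto simp: M_def)
 qed
 then obtain g where g: "!!a. a \<in> M ==> g a \<in> M" "!!a. a \<in> M ==> [a * g a = 1] (mod Q)" by metis
 have fin: "finite M" by (simp add: M_def)
 have inj: "inj_on g M"
 proof (rule inj_onI)
  fix a b assume ab: "a \<in> M" "b \<in> M" "g a = g b"
  have "[a * g a = b * g a] (mod Q)" using g(2)[OF ab(1)] g(2)[OF ab(2)] ab(3) by (metis cong_sym cong_trans)
  moreover have "coprime (g a) Q" using g(1)[OF ab(1)] by (simp add: M_def)
  ultimately have "[a = b] (mod Q)" by (simp add: cong_mult_rcancel_nat)
  thus "a = b" using ab by (simp add: M_def cong_def)
 qed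
 have "g ` M = M" using inj g(1) fin by (intro endo_inj_surj) auto
 hence "(\<Prod>a\<in>M. a) = (\<Prod>a\<in>M. g a)" using prod.reindex[OF inj, of "%a. a"] by simp
 hence "(\<Prod>a\<in>M. a)^2 = (\<Prod>a\<in>M. a * g a)" by (simp add: power2_eq_square prod.distrib)
 moreover have "[(\<Prod>a\<in>M. a * g a) = (\<Prod>a\<in>M. 1)] (mod Q)" using g(2) by (intro cong_prod) auto
 ultimately show ?thesis by (simp add: M_def)
qed

section \<open>The Teichmueller character and the p-adic L-function as a power series\<close>

context padic_closure begin

lemma coprime_p_iff: "coprime a p \<longleftrightarrow> \<not> p dvd a"
proof
 assume "coprime a p"
 thus "\<not> p dvd a" using coprime_common_divisor[of a p p] p_gt_1 by auto
next
 assume "\<not> p dvd a"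
 thus "coprime a p" using prime_imp_coprime[OF prime_p] by (simp add: coprime_commute)
qed

lemma power_p_not_dvd: "n > 0 ==> coprime a (p^n) \<longleftrightarrow> \<not> p dvd a"
 by (simp add: coprime_p_iff)

text \<open>The root of unity is \<open>a / exp_sum (lg a)\<close>: exponential and logarithm cancel
  on \<open>a^totient qq\<close>, which is close to 1 by Euler's theorem. Two candidates have as
  quotient a root of unity within \<open>1 / qq\<close> of 1; its logarithm is 0, so it is
  1.\<close>

lemma teichmuller_spec:
 assumes "coprime a (int p)"
 shows "(teichmuller p a :: 'k)^totient qq = 1" "av (teichmuller p a - of_int a) \<le> 1 / real qq"
proof -
 define t where "t = totient qq"
 have t: "t > 0" using qq_ge_3 by (simp add: t_def)
 have pa: "\<not> int p dvd a"
 proof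
  assume "int p dvd a"
  thus False using coprime_common_divisor[OF assms, of "int p"] p_gt_1 by auto
 qed
 have a1: "av (of_int a) = 1" by (rule av_of_int_unit[OF pa])
 hence a0: "(of_int a :: 'k) ~= 0" by auto
 define e where "e = exp_sum (lg (of_int a))"
 have l: "av (lg (of_int a)) \<le> 1 / real qq" by (rule av_lg_int[OF pa])
 have e1: "av (e - 1) \<le> 1 / real qq" using av_exp_sum_close[OF l] l by (simp add: e_def)
 hence eav: "av e = 1" using av_eq_if_close[of e 1] inv_qq_le_1 by simp
 hence e0: "e ~= 0" by auto
 have qor: "int qq = int p \<or> int qq = int p^2" by (simp add: qq_def)
 have "coprime a (int qq)" using assms qor by auto
 hence "[a^totient (nat (int qq)) = 1] (mod int qq)"
  using qq_ge_3 by (intro residues.euler_theorem) (auto simp: residues_def)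
 hence "int qq dvd a^t - 1" by (simp add: cong_iff_dvd_diff t_def)
 then obtain b where b: "a^t - 1 = int qq * b" by (elim dvdE)
 have "of_int a^t - 1 = (of_nat qq * of_int b :: 'k)" using arg_cong[OF b, of "of_int :: int => 'k"] by simp
 hence at: "av (of_int a^t - 1) \<le> 1 / real qq"
  using mult_left_mono[OF av_of_int_le[of b], of "av (of_nat qq)"] by (simp add: av_qq)
 have "e^t = exp_sum (of_nat t * lg (of_int a))" unfolding e_def by (rule exp_sum_of_nat_mult[OF l, symmetric])
 also have "... = exp_sum (lg (of_int a^t))" using lg_power[OF a0] by simp
 also have "... = of_int a^t" by (rule exp_sum_lg[OF at])
 finally have z1: "(of_int a / e)^t = 1" using e0 a0 by (simp add: power_divide)
 have z2: "av (of_int a / e - of_int a) \<le> 1 / real qq"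
 proof -
  have "of_int a / e - of_int a = - (of_int a * (e - 1) / e)" using e0 by (simp add: field_simps)
  thus ?thesis using e1 eav a1 by simp
 qed
 have uniq: "z = of_int a / e" if z: "z^t = 1" "av (z - of_int a) \<le> 1 / real qq" for z
 proof -
  define z' where "z' = of_int a / e"
  have z'1: "av z' = 1" using a1 eav by (simp add: z'_def)
  hence z'0: "z' ~= 0" by auto
  have "av (z - z') \<le> 1 / real qq"
   using av_diff_le[OF z(2) z2] by (simp add: z'_def)
  moreover have "z / z' - 1 = (z - z') / z'" using z'0 by (simp add: field_simps)
  ultimately have c: "av (z / z' - 1) \<le> 1 / real qq" using z'1 by simp
  have "z'^t = 1" using z1 by (simp only: z'_def)
  hence "(z / z')^t = 1" using z(1) by (simp add: power_divide)
  hence "lg (z / z') = 0" using t by (rule lg_root)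
  hence "av (z / z' - 1) = 0" using av_lg_close[OF c] by simp
  hence "z = z'" using z'0 by simp
  thus ?thesis by (simp only: z'_def)
 qed
 have "(teichmuller p a :: 'k) = (THE z. z^t = 1 & dist z (of_int a) \<le> dist (of_nat qq :: 'k) 0)"
  using assms by (simp add: teichmuller_def t_def qq_def)
 also have "... = of_int a / e"
 proof (rule the_equality)
  show "(of_int a / e)^t = 1 & dist (of_int a / e) (of_int a) \<le> dist (of_nat qq :: 'k) 0"
   unfolding dist_av using z1 z2 by (simp only: diff_zero av_qq conj_absorb simp_thms)
  fix z :: 'k assume "z^t = 1 & dist z (of_int a) \<le> dist (of_nat qq :: 'k) 0"
  thus "z = of_int a / e" unfolding dist_av by (intro uniq) (simp_all only: diff_zero av_qq)
 qed
 finally have e: "(teichmuller p a :: 'k) = of_int a / e" .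
 show "(teichmuller p a :: 'k)^totient qq = 1" "av (teichmuller p a - of_int a) \<le> 1 / real qq"
  using z1 z2 by (simp_all only: e t_def)
qed

lemma power_close_if_teichmuller:
 assumes w: "!!b. coprime b (int p) ==> (teichmuller p b :: 'k)^j = 1" and "\<not> p dvd a"
 shows "av (of_nat a^j - 1) \<le> 1 / real qq"
proof -
 have ca: "coprime (int a) (int p)" using assms(2) coprime_p_iff by simp
 note t = teichmuller_spec(2)[OF ca]
 have "av (teichmuller p (int a)) = 1"
  using av_eq_if_close[of "teichmuller p (int a)" "of_nat a"] t av_of_nat_unit[OF assms(2)] inv_qq_le_1 by simp
 hence "av (of_nat a^j - teichmuller p (int a)^j) \<le> av (of_nat a - teichmuller p (int a))"
  by (intro av_power_diff) (auto simp: av_of_nat_unit[OF assms(2)])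
 thus ?thesis using t w[OF ca] by (simp add: av_minus_commute)
qed

lemma power_series_coeff_bounded:
 assumes "(%n. a n * 1^n) sums (s :: 'k)" obtains D where "D > 0" "!!n. av (a n) \<le> D"
proof -
 have "(%n. av (a n)) \<leadsto> 0" using sums_imp_lim_0[OF assms] by (simp add: lim_iff)
 hence "Bseq (%n. av (a n))" using convergent_imp_Bseq convergentI by blast
 thus ?thesis using that unfolding Bseq_def by auto
qed

lemma one_padic_integer: "1 \<in> (padic_integers :: 'k set)" and zero_padic_integer: "0 \<in> (padic_integers :: 'k set)"
 unfolding padic_integers_def using closure_subset[of "\<int> :: 'k set"] by auto

lemma int_padic_integer: "of_int n \<in> (padic_integers :: 'k set)"
 unfolding padic_integers_def using closure_subset[of "\<int> :: 'k set"] by auto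

text \<open>If \<open>d m\<close> is the first nonzero coefficient of the difference, dividing its
  value 0 at \<open>X i\<close> by \<open>X i^m\<close> bounds \<open>av (d m)\<close> by a constant
  times \<open>av (X i)\<close>.\<close>

lemma power_series_unique:
 assumes f: "!!s. s \<in> padic_integers ==> (%n. a n * s^n) sums (f s :: 'k)"
  and g: "!!s. s \<in> padic_integers ==> (%n. b n * s^n) sums g s"
  and X: "!!i. X i \<in> padic_integers" "!!i. X i ~= 0" "X \<leadsto> 0" "!!i. f (X i) = g (X i)"
 shows "a = b"
proof (rule ccontr)
 assume "a ~= b"
 define d where "d n = a n - b n" for n
 have ex: "\<exists>n. d n ~= 0" using \<open>a ~= b\<close> by (auto simp: d_def fun_eq_iff)
 define m where "m = (LEAST n. d n ~= 0)"
 have m: "d m ~= 0" unfolding m_def using ex by (rule LeastI_ex)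
 have below: "d n = 0" if "n < m" for n using that not_less_Least unfolding m_def by blast
 have "(%n. a n * 1^n - b n * 1^n) sums (f 1 - g 1)"
  using one_padic_integer by (intro sums_diff_k f g)
 hence "(%n. d n * 1^n) sums (f 1 - g 1)" by (simp add: d_def)
 then obtain D where D: "D > 0" "!!n. av (d n) \<le> D" using power_series_coeff_bounded by blast
 have key: "av (d m) \<le> D * av (X i)" for i
 proof -
  let ?x = "X i"
  have "(%n. a n * ?x^n - b n * ?x^n) sums (f ?x - g ?x)" by (intro sums_diff_k f g X)
  hence s0: "(%n. d n * ?x^n) sums 0" using X(4) by (simp add: d_def left_diff_distrib)
  have drop: "(%n. d (n + k) * ?x^(n + k)) sums 0" if "k \<le> m" for k
   using that
  proof (induction k)
   case (Suc k)
   hence "(%n. d (Suc n + k) * ?x^(Suc n + k)) sums (0 - d (0 + k) * ?x^(0 + k))"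
    by (intro sums_Suc_k[of "%n. d (n + k) * ?x^(n + k)"]) simp
   thus ?case using below[of k] Suc(2) by simp
  qed (use s0 in simp)
  from sums_mult_k[OF drop[OF order_refl], of "inverse (?x^m)"]
  have "(%n. d (n + m) * ?x^n) sums 0" using X(2) by (simp add: power_add field_simps)
  from sums_Suc_k[OF this] have "(%n. d (Suc n + m) * ?x^Suc n) sums (- d m)" by simp
  hence "av (- d m) \<le> D * av ?x"
  proof (rule sums_av_le)
   fix n
   have "av ?x^n \<le> 1" using av_padic_integer[OF X(1)] by (intro power_le_one) auto
   hence "av (d (Suc n + m)) * (av ?x^n * av ?x) \<le> D * (1 * av ?x)"
    using D by (intro mult_mono) auto
   thus "av (d (Suc n + m) * ?x^Suc n) \<le> D * av ?x" by (simp add: mult_ac)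
  qed
  thus ?thesis by simp
 qed
 have "(%i. av (X i)) \<leadsto> 0" using X(3) by (simp add: lim_iff)
 from tendsto_mult_right_zero[OF this, of D] have "av (d m) \<le> 0"
  by (rule tendsto_lowerbound) (use key in auto)
 thus False using m by (metis av_pos not_le)
qed

lemma power_series_derivative:
 assumes f: "!!s. s \<in> padic_integers ==> (%n. a n * s^n) sums (f s :: 'k)"
 shows "(f has_padic_derivative a 1) 0"
proof -
 obtain D where D: "D > 0" "!!n. av (a n) \<le> D" using power_series_coeff_bounded[OF f[OF one_padic_integer]] by blast
 have "((%s :: 'k. s) \<longlongrightarrow> 0) (at 0 within padic_integers)" by (rule tendsto_ident_at)
 hence "(av \<longlongrightarrow> 0) (at 0 within padic_integers)" by (simp add: lim_iff)
 from tendsto_mult_right_zero[OF this, of D]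
 have lim: "((%s. D * av s) \<longlongrightarrow> 0) (at 0 within padic_integers)" .
 have f0: "f 0 = a 0"
 proof -
  have "(%n. a n * 0^n) sums a 0" using powser_sums_zero_iff sums_single[of 0 a]
   by (rule_tac sums_cong[THEN iffD1, OF _ sums_single[of 0 a]]) (auto simp: power_0_left)
  thus ?thesis using f[OF zero_padic_integer] sums_unique2 by blast
 qed
 have "av ((f s - f 0) / (s - 0) - a 1) \<le> D * av s" if s: "s ~= 0" "s \<in> padic_integers" for s
 proof -
  have "(%n. a (Suc (Suc n)) * s^Suc (Suc n)) sums (f s - a 0 - a 1 * s)"
   using sums_Suc_k[OF sums_Suc_k[OF f[OF s(2)]]] by simp
  from sums_mult_k[OF this, of "inverse s"]
  have "(%n. a (Suc (Suc n)) * s^Suc n) sums (inverse s * (f s - a 0 - a 1 * s))"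
   using s(1) by (simp add: field_simps)
  also have "inverse s * (f s - a 0 - a 1 * s) = (f s - f 0) / (s - 0) - a 1"
   using s(1) f0 by (simp add: field_simps)
  finally show ?thesis
  proof (rule sums_av_le)
   fix n
   have "av s^n \<le> 1" using av_padic_integer[OF s(2)] by (intro power_le_one) auto
   hence "av (a (Suc (Suc n))) * (av s^n * av s) \<le> D * (1 * av s)"
    using D by (intro mult_mono) auto
   thus "av (a (Suc (Suc n)) * s^Suc n) \<le> D * av s" by (simp add: mult_ac)
  qed
 qed
 hence "\<forall>\<^sub>F s in at 0 within padic_integers. av ((f s - f 0) / (s - 0) - a 1) \<le> D * av s"
  by (auto simp: eventually_at_filter)
 from lim_zeroI[OF this lim] show ?thesis unfolding has_padic_derivative_def .
qed

lemma mean_zero_subfield: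
 assumes "N > 0" "mean_zero N c" obtains R where "complete_subfield R" "!!a. c a \<in> (R :: 'k set)"
proof -
 obtain R where R: "complete_subfield R" "(%j. c (int j)) ` {..<N} \<subseteq> R"
  using finite_complete_subfield[of "(%j. c (int j)) ` {..<N}"] by auto
 have "c a \<in> R" for a
 proof -
  have "c a = c (int (nat (a mod int N)))" using assms mean_zero_mod[of N c a] by simp
  moreover have "nat (a mod int N) < N" using assms(1) by (simp add: nat_less_iff)
  ultimately show ?thesis using R(2) by auto
 qed
 thus ?thesis using that R(1) by blast
qed

context
 fixes N :: nat and c :: "int => 'k"
 assumes N: "N > 0" and cop: "coprime N p" and c: "mean_zero N c" and cp: "!!b. c (int p * b) = c b"
begin

definition c_bound :: real where "c_bound = (\<Sum>j<N. av (c (int j)))"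

lemma c_bound_nonneg: "c_bound >= 0" by (simp add: c_bound_def sum_nonneg)

lemma log_moment_lim:
 shows "riemann N c (on_units (%a. lg (of_nat a)^j)) \<leadsto> log_moment N c j"
  and "complete_subfield R ==> (!!a. c a \<in> R) ==> log_moment N c j \<in> R"
proof -
 have *: "riemann N c (on_units (%a. lg (of_nat a)^j)) \<leadsto> log_moment N c j & log_moment N c j \<in> R"
  if R: "complete_subfield R" "!!a. c a \<in> R" for R
 proof -
  have mem: "on_units (%a. lg (of_nat a)^j) a \<in> R" for a
   using log_in_subfield[OF R(1)] by (auto simp: on_units_def cs_0[OF R(1)] intro: cs_power[OF R(1)])
  obtain L where "L \<in> R" "riemann N c (on_units (%a. lg (of_nat a)^j)) \<leadsto> L"
   by (rule riemann_converges[OF N cop c R mem log_power_locally_constant])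
  thus ?thesis unfolding log_moment_def by (metis limI)
 qed
 obtain R0 where "complete_subfield R0" "!!a. c a \<in> R0" using mean_zero_subfield[OF N c] by blast
 thus "riemann N c (on_units (%a. lg (of_nat a)^j)) \<leadsto> log_moment N c j" using * by blast
 show "complete_subfield R ==> (!!a. c a \<in> R) ==> log_moment N c j \<in> R" using * by blast
qed

lemma av_log_moment: "av (log_moment N c j) \<le> (1 / real qq)^j * c_bound"
proof (rule lim_av_le[OF log_moment_lim(1)])
 have "av (on_units (%a. lg (of_nat a)^j) a) \<le> (1 / real qq)^j" for a
  using av_lg_nat[of a] by (auto simp: on_units_def intro!: power_mono)
 hence "av (riemann N c (on_units (%a. lg (of_nat a)^j)) n) \<le> (1 / real qq)^j * c_bound" for n
  unfolding c_bound_def by (rule riemann_av_le[OF N cop c])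
 thus "\<forall>\<^sub>F n in sequentially. av (riemann N c (on_units (%a. lg (of_nat a)^j)) n) \<le> (1 / real qq)^j * c_bound"
  by simp
qed simp

text \<open>The integral of exp (- s lg a) over the units, expanded in powers of \<open>s\<close>
  and integrated term by term.\<close>

definition L_coeff :: "nat => 'k" where "L_coeff j = (-1)^j * log_moment N c j / fact j"
definition padic_L :: "'k => 'k" where "padic_L s = suminf (%j. L_coeff j * s^j)"

lemma av_L_coeff: "av (L_coeff j) \<le> c_bound * (1 / (real qq * rp))^j"
proof -
 have "av (L_coeff j) \<le> (1 / real qq)^j * c_bound / av (fact j)"
  unfolding L_coeff_def using av_log_moment[of j] by (simp add: divide_right_mono)
 also have "... = (1 / (real qq * rp))^j * rfact j * c_bound"
  using rp_pos by (simp add: rfact_def power_divide power_mult_distrib)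
 also have "... \<le> (1 / (real qq * rp))^j * 1 * c_bound"
  using rfact_le_1 rp_pos c_bound_nonneg by (intro mult_right_mono mult_left_mono) auto
 finally show ?thesis by (simp add: mult.commute)
qed

lemma padic_L_sums: assumes "s \<in> padic_integers" shows "(%j. L_coeff j * s^j) sums padic_L s"
proof -
 obtain R where R: "complete_subfield R" "!!a. c a \<in> R" using mean_zero_subfield[OF N c] by blast
 have "padic_integers \<subseteq> (padic_numbers :: 'k set)"
  unfolding padic_integers_def padic_numbers_def by (rule closure_mono) (auto elim: Ints_cases)
 hence sR: "s \<in> R" using assms padic_subset[OF R(1)] by blast
 have l0: "(%j. L_coeff j * s^j) \<leadsto> 0"
 proof (rule lim_zeroI)
  show "(%j. c_bound * (1 / (real qq * rp))^j) \<leadsto> 0"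
   using geometric_lim by (rule tendsto_mult_right_zero)
  have "av (L_coeff j * s^j) \<le> c_bound * (1 / (real qq * rp))^j" for j
  proof -
   have "av s^j \<le> 1" using av_padic_integer[OF assms] by (intro power_le_one) auto
   hence "av (L_coeff j) * av s^j \<le> (c_bound * (1 / (real qq * rp))^j) * 1"
    using av_L_coeff by (intro mult_mono) (auto intro: order_trans[OF av_nonneg])
   thus ?thesis by simp
  qed
  thus "\<forall>\<^sub>F j in sequentially. av (L_coeff j * s^j - 0) \<le> c_bound * (1 / (real qq * rp))^j" by simp
 qed
 have mem: "L_coeff j * s^j \<in> R" for j unfolding L_coeff_def
  using sR by (intro complete_subfieldD(3)[OF R(1)] cs_divide[OF R(1)] cs_power[OF R(1)] cs_fact[OF R(1)] log_moment_lim(2) R cs_minus[OF R(1)] cs_1[OF R(1)])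
 obtain L where "(%j. L_coeff j * s^j) sums L" by (rule cs_sums[OF R(1) l0 mem])
 thus ?thesis unfolding padic_L_def by (metis sums_unique)
qed

text \<open>If \<open>a^l\<close> is within \<open>1 / qq\<close> of 1 for all units
  \<open>a\<close>, then \<open>a^l\<close> is the exponential of \<open>l * lg a\<close>.
  Truncating this series at \<open>J\<close> costs at most \<open>r^J\<close>, uniformly in
  \<open>a\<close>, so it may be integrated term by term, and \<open>riemann_units_power\<close>
  gives the integral of \<open>a^l\<close>.\<close>

lemma padic_L_value:
 assumes T: "!!a. \<not> p dvd a ==> av (of_nat a^l - 1) \<le> 1 / real qq"
 shows "padic_L (- of_nat l) = (1 - of_nat p^l) * L_value N c l"
proof -
 define L where "L = (1 - of_nat p^l) * L_value N c l"
 define f where "f j = on_units (%a. lg (of_nat a)^j)" for j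
 define h where "h = on_units (%a. of_nat a^l)"
 define r where "r = 1 / (real qq * rp)"
 have r: "0 \<le> r" "r < 1" using qq_rp rp_pos by (auto simp: r_def)
 have pw: "av (h a - (\<Sum>j<J. of_nat l^j / fact j * f j a)) \<le> r^J" for a J
 proof (cases "p dvd a")
  case False
  define z where "z = of_nat l * lg (of_nat a)"
  have "av z \<le> 1 * (1 / real qq)" unfolding z_def av_mult
   by (intro mult_mono av_of_nat_le av_lg_nat False) auto
  hence z: "av z \<le> 1 / real qq" by simp
  have a0: "(of_nat a :: 'k) ~= 0" using False by (auto intro!: gr0I)
  have "exp_sum z = of_nat a^l"
   using exp_sum_lg[OF T[OF False]] lg_power[OF a0, of l] by (simp add: z_def)
  hence s: "(%j. z^j / fact j) sums (of_nat a^l)" using exp_sums[OF z] by simp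
  have "(%j. z^(j + J) / fact (j + J)) sums (of_nat a^l - (\<Sum>j<J. z^j / fact j))"
  proof (induction J)
   case (Suc J)
   from sums_Suc_k[OF this] show ?case by (simp add: algebra_simps)
  qed (use s in simp)
  hence "av (of_nat a^l - (\<Sum>j<J. z^j / fact j)) \<le> r^J"
  proof (rule sums_av_le)
   fix j
   have "av (z^(j + J) / fact (j + J)) \<le> r^(j + J)" unfolding r_def by (rule av_exp_term(1)[OF z])
   also have "... \<le> r^J" using r by (intro power_decreasing) auto
   finally show "av (z^(j + J) / fact (j + J)) \<le> r^J" .
  qed
  moreover have "(\<Sum>j<J. of_nat l^j / fact j * f j a) = (\<Sum>j<J. z^j / fact j)"
   using False by (intro sum.cong) (auto simp: f_def on_units_def z_def power_mult_distrib)
  ultimately show ?thesis using False by (simp add: h_def on_units_def)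
 qed (simp add: h_def f_def on_units_def r)
 have tail: "av (L - (\<Sum>j<J. L_coeff j * (- of_nat l)^j)) \<le> c_bound * r^J" for J
 proof (rule lim_av_le)
  have "(%n. riemann N c h n - (\<Sum>j<J. of_nat l^j / fact j * riemann N c (f j) n))
    \<leadsto> L - (\<Sum>j<J. of_nat l^j / fact j * log_moment N c j)"
   unfolding L_def h_def f_def
   by (intro lim_diff lim_sum lim_mult lim_const riemann_units_power log_moment_lim(1) N cop c cp)
  moreover have "(\<Sum>j<J. of_nat l^j / fact j * log_moment N c j) = (\<Sum>j<J. L_coeff j * (- of_nat l)^j)"
   unfolding L_coeff_def by (intro sum.cong refl) (simp add: power_minus[of "of_nat l"])
  ultimately show "(%n. riemann N c h n - (\<Sum>j<J. of_nat l^j / fact j * riemann N c (f j) n))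
    \<leadsto> L - (\<Sum>j<J. L_coeff j * (- of_nat l)^j)" by simp
  have "av (riemann N c h n - (\<Sum>j<J. of_nat l^j / fact j * riemann N c (f j) n)) \<le> c_bound * r^J" for n
  proof -
   have "(\<Sum>j<J. of_nat l^j / fact j * riemann N c (f j) n) = riemann N c (%a. \<Sum>j<J. of_nat l^j / fact j * f j a) n"
    unfolding riemann_def sum_distrib_left sum_distrib_right by (subst sum.swap) (simp add: mult.assoc)
   hence "riemann N c h n - (\<Sum>j<J. of_nat l^j / fact j * riemann N c (f j) n)
    = riemann N c (%a. h a - (\<Sum>j<J. of_nat l^j / fact j * f j a)) n"
    by (simp add: riemann_def left_diff_distrib sum_subtractf)
   moreover have "av (riemann N c (%a. h a - (\<Sum>j<J. of_nat l^j / fact j * f j a)) n) \<le> r^J * c_bound"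
    unfolding c_bound_def by (rule riemann_av_le[OF N cop c pw])
   ultimately show ?thesis by (simp only: mult.commute[of c_bound])
  qed
  thus "\<forall>\<^sub>F n in sequentially. av (riemann N c h n - (\<Sum>j<J. of_nat l^j / fact j * riemann N c (f j) n)) \<le> c_bound * r^J"
   by simp
 qed simp
 have "(%j. L_coeff j * (- of_nat l)^j) sums L"
  unfolding sums_def
 proof (rule lim_zeroI)
  show "(%J. c_bound * r^J) \<leadsto> 0" unfolding r_def using geometric_lim by (rule tendsto_mult_right_zero)
 qed (use tail in \<open>auto simp: av_minus_commute\<close>)
 moreover have "- of_nat l \<in> (padic_integers :: 'k set)" using int_padic_integer[of "- int l"] by simp
 ultimately show ?thesis using padic_L_sums sums_unique2 unfolding L_def by blast
qed

lemma kubota_leopoldt_eq: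
 fixes \<iota> :: "complex => 'k"
 assumes val: "!!j. \<iota> ((1 - \<phi> (int p) * of_nat p^j) * dirichlet_L \<phi> (- of_nat j)) = (1 - of_nat p^j) * L_value N c j"
 shows "kubota_leopoldt p \<iota> \<phi> = restrict padic_L padic_integers"
 unfolding kubota_leopoldt_def
proof (rule the_equality)
 have val': "\<iota> ((1 - \<phi> (int p) * of_nat p^(k - 1)) * dirichlet_L \<phi> (1 - of_nat k)) = (1 - of_nat p^(k - 1)) * L_value N c (k - 1)"
  if "k >= 1" for k
 proof -
  have "1 - of_nat k = - (of_nat (k - 1) :: complex)" using that by (simp add: of_nat_diff)
  thus ?thesis using val[of "k - 1"] by metis
 qed
 have mem: "1 - of_nat k \<in> (padic_integers :: 'k set)" for k using int_padic_integer[of "1 - int k"] by simp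
 show "restrict padic_L padic_integers \<in> extensional padic_integers & padic_analytic (restrict padic_L padic_integers) &
  (\<forall>k\<ge>1. (\<forall>a. coprime a (int p) --> (teichmuller p a :: 'k)^(k - 1) = 1) -->
    restrict padic_L padic_integers (1 - of_nat k) =
     \<iota> ((1 - \<phi> (int p) * of_nat p^(k - 1)) * dirichlet_L \<phi> (1 - of_nat k)))"
 proof (intro conjI allI impI)
  show "padic_analytic (restrict padic_L padic_integers)"
   unfolding padic_analytic_def using padic_L_sums by (intro exI[of _ L_coeff]) auto
  fix k :: nat assume k: "k >= 1" and w: "\<forall>a. coprime a (int p) --> (teichmuller p a :: 'k)^(k - 1) = 1"
  have "padic_L (- of_nat (k - 1)) = (1 - of_nat p^(k - 1)) * L_value N c (k - 1)" using w by (intro padic_L_value power_close_if_teichmuller) auto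
  moreover have "- of_nat (k - 1) = (1 - of_nat k :: 'k)" using k by (simp add: of_nat_diff)
  ultimately show "restrict padic_L padic_integers (1 - of_nat k) =
     \<iota> ((1 - \<phi> (int p) * of_nat p^(k - 1)) * dirichlet_L \<phi> (1 - of_nat k))"
   using val'[OF k] mem[of k] by simp
 qed auto
 fix f :: "'k => 'k"
 assume f: "f \<in> extensional padic_integers & padic_analytic f &
  (\<forall>k\<ge>1. (\<forall>a. coprime a (int p) --> (teichmuller p a :: 'k)^(k - 1) = 1) -->
    f (1 - of_nat k) = \<iota> ((1 - \<phi> (int p) * of_nat p^(k - 1)) * dirichlet_L \<phi> (1 - of_nat k)))"
 then obtain a where a: "!!s. s \<in> padic_integers ==> (%n. a n * s^n) sums f s" by (auto simp: padic_analytic_def)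
 \<comment> \<open>For \<open>k - 1 = totient qq * p^i\<close> the condition on the Teichmueller
   character holds, and the points 1 - k tend to 0; two power series that agree there are
   equal.\<close>
 define X where "X i = (- of_nat (totient qq * p^i) :: 'k)" for i
 have X: "X i \<in> padic_integers" for i using int_padic_integer[of "- int (totient qq * p^i)"] by (simp add: X_def)
 have X0: "X i ~= 0" for i unfolding X_def using qq_ge_3 p_gt_1 by (simp del: of_nat_mult)
 have Xlim: "X \<leadsto> 0"
 proof (rule lim_zeroI[OF _ inv_p_power_lim], intro always_eventually allI)
  fix i
  have "av (X i - 0) = av (of_nat (totient qq)) * (1 / real p)^i" by (simp add: X_def power_one_over)
  also have "... \<le> 1 * (1 / real p)^i" by (intro mult_right_mono av_of_nat_le) simp
  finally show "av (X i - 0) \<le> (1 / real p)^i" by simp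
 qed
 have XL: "f (X i) = padic_L (X i)" for i
 proof -
  define j where "j = totient qq * p^i"
  have w: "(teichmuller p b :: 'k)^j = 1" if "coprime b (int p)" for b
   using teichmuller_spec(1)[OF that] by (simp add: j_def power_mult)
  have "f (1 - of_nat (Suc j)) = (1 - of_nat p^j) * L_value N c j"
   using f w val'[of "Suc j"] by (simp del: of_nat_Suc)
  moreover have "1 - of_nat (Suc j) = X i" by (simp add: X_def j_def)
  moreover have "padic_L (X i) = (1 - of_nat p^j) * L_value N c j"
   using padic_L_value[OF power_close_if_teichmuller[OF w]] by (simp add: X_def j_def)
  ultimately show ?thesis by simp
 qed
 have "a = L_coeff" by (rule power_series_unique[OF a padic_L_sums X X0 Xlim XL])
 hence "f s = padic_L s" if "s \<in> padic_integers" for s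
  using a[OF that] padic_L_sums[OF that] sums_unique2 by blast
 thus "f = restrict padic_L padic_integers"
  using f by (intro extensionalityI[of f padic_integers]) auto
qed

lemma padic_L_derivative: "(restrict padic_L padic_integers has_padic_derivative - log_moment N c 1) 0"
proof -
 have "(%n. L_coeff n * s^n) sums restrict padic_L padic_integers s" if "s \<in> padic_integers" for s
  using padic_L_sums[OF that] that by simp
 moreover have "L_coeff 1 = - log_moment N c 1" by (simp add: L_coeff_def)
 ultimately show ?thesis using power_series_derivative[of L_coeff] by metis
qed

end

end

section \<open>The first logarithmic moment and the Gamma function\<close>

context padic_closure begin

definition unit_log :: "nat => 'k" where "unit_log = on_units (%a. lg (of_nat a))"
text \<open>The logarithm of Morita's Gamma function at \<open>n + 1\<close>, whose sign
  \<open>lg\<close> does not see.\<close>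

definition log_sum_units :: "nat => 'k" where "log_sum_units n = (\<Sum>k\<le>n. unit_log k)"

lemma unit_log_shift: "n >= 2 ==> av (unit_log (a + i * p^n) - unit_log a) \<le> (1 / real p)^n"
 using log_power_locally_constant[of n 1 a i] by (simp add: unit_log_def)

lemma unit_log_mult:
 assumes "\<not> p dvd m" shows "unit_log (a * m) = unit_log a + lg (of_nat m) * on_units (%a. 1) a"
proof -
 have "m ~= 0" using assms by (metis dvd_0_right)
 moreover have "a ~= 0" if "\<not> p dvd a" using that by (metis dvd_0_right)
 ultimately show ?thesis
  using assms prime_dvd_mult_iff[OF prime_p, of a m] by (auto simp: unit_log_def on_units_def lg_mult)
qed

lemma prod_units_square_close:
 assumes "n > 0"
 defines "W \<equiv> \<Prod>a\<in>{a. a < p^n & \<not> p dvd a}. a"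
 shows "av (of_nat W^2 - 1) \<le> (1 / real p)^n" "W > 0"
proof -
 have p1: "p^n > 1" using assms p_gt_1 by (intro one_less_power) auto
 have "[W^2 = 1] (mod p^n)"
  using prod_units_square[OF p1] assms(1) by (simp add: W_def power_p_not_dvd del: coprime_power_right_iff)
 hence "int p^n dvd int W^2 - 1" by (metis cong_iff_dvd_diff cong_int_iff of_nat_1 of_nat_power)
 hence "av (of_int (int W^2 - 1)) \<le> 1 / real p^n" by (rule av_of_int_dvd)
 thus "av (of_nat W^2 - 1) \<le> (1 / real p)^n" by (simp add: power_one_over)
 show "W > 0" unfolding W_def by (intro prod_pos) (auto intro!: gr0I)
qed

lemma inv_p_power_le_qq: "n >= 2 ==> (1 / real p)^n \<le> 1 / real qq"
proof -
 assume "n >= 2"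
 hence "(1 / real p)^n \<le> (1 / real p)^2" using p_gt_1 by (intro power_decreasing) auto
 also have "... \<le> 1 / real qq" using av_p_le_qq by (simp add: power_one_over)
 finally show ?thesis .
qed

text \<open>The sum is the logarithm of the product of the units, that is half the logarithm of its
  square, which is close to 1. Halving costs the factor 2 in the bound when
  \<open>p = 2\<close>.\<close>

lemma sum_unit_log_small:
 assumes "n >= 2" shows "av (\<Sum>a<p^n. unit_log a) \<le> 2 * (1 / real p)^n"
proof -
 define M where "M = {a. a < p^n & \<not> p dvd a}"
 define W where "W = (\<Prod>a\<in>M. a)"
 have W: "av (of_nat W^2 - 1) \<le> (1 / real p)^n" "W > 0"
  using prod_units_square_close[of n] assms by (auto simp: W_def M_def)
 have "(\<Sum>a<p^n. unit_log a) = (\<Sum>a\<in>M. lg (of_nat a))"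
  unfolding M_def unit_log_def on_units_def
  by (simp add: sum.If_cases Int_def)
 also have "... = lg (\<Prod>a\<in>M. of_nat a)" by (intro lg_prod[symmetric]) (auto simp: M_def intro!: gr0I)
 also have "(\<Prod>a\<in>M. of_nat a) = (of_nat W :: 'k)" by (simp add: W_def)
 finally have e: "(\<Sum>a<p^n. unit_log a) = lg (of_nat W)" .
 have "av (lg (of_nat W^2)) = av (of_nat W^2 - 1)"
  using W(1) inv_p_power_le_qq[OF assms] by (intro av_lg_close) linarith
 moreover have "lg (of_nat W^2) = of_nat 2 * lg (of_nat W)" using W(2) by (intro lg_power) simp
 ultimately have "av (of_nat 2) * av (lg (of_nat W)) \<le> (1 / real p)^n" using W(1) by simp
 moreover have "1 / 2 * av (lg (of_nat W)) \<le> av (of_nat 2) * av (lg (of_nat W))"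
  using av_of_nat_ge[of 2] by (intro mult_right_mono) auto
 ultimately show ?thesis unfolding e by simp
qed

lemma sum_unit_log_shift:
 assumes "n >= 2" shows "av (\<Sum>i<p^n. unit_log (x + i)) \<le> 2 * (1 / real p)^n"
proof (induction x)
 case 0
 show ?case using sum_unit_log_small[OF assms] by simp
next
 case (Suc x)
 have "(\<Sum>i<p^n. unit_log (Suc x + i)) = (\<Sum>i<p^n. unit_log (x + i)) + (unit_log (x + 1 * p^n) - unit_log x)"
  using sum.lessThan_Suc_shift[of "%i. unit_log (x + i)" "p^n"] by (simp add: algebra_simps)
 moreover have "av (unit_log (x + 1 * p^n) - unit_log x) \<le> 2 * (1 / real p)^n"
  using unit_log_shift[OF assms, of x 1] zero_le_power[of "1 / real p" n] by (simp del: zero_le_power)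
 ultimately show ?case using Suc by (simp only: av_add_le)
qed

text \<open>Continuity of the logarithm of the Gamma function: raising the argument by
  \<open>p^n\<close> adds \<open>unit_log\<close> over \<open>p^n\<close> consecutive integers, a
  small sum.\<close>

lemma log_sum_units_shift:
 assumes "n >= 2" shows "av (log_sum_units (m + h * p^n) - log_sum_units m) \<le> 2 * (1 / real p)^n"
proof (induction h)
 case (Suc h)
 have add: "log_sum_units (x + y) = log_sum_units x + (\<Sum>i<y. unit_log (Suc x + i))" for x y
  by (induction y) (auto simp: log_sum_units_def)
 have "log_sum_units (m + Suc h * p^n) - log_sum_units m
  = (log_sum_units (m + h * p^n) - log_sum_units m) + (\<Sum>i<p^n. unit_log (Suc (m + h * p^n) + i))"
  using add[of "m + h * p^n" "p^n"] by (simp add: algebra_simps)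
 thus ?case using Suc sum_unit_log_shift[OF assms] by (simp only: av_add_le)
qed simp

lemma lim_0_if_geometric:
 assumes "f > 0" "!!s. f * s >= 2 ==> av (X s) \<le> C * (2 * (1 / real p)^(f * s))" shows "X \<leadsto> 0"
proof (rule lim_zeroI)
 have "(%s. (1 / real p)^(f * s)) \<leadsto> 0"
  using LIMSEQ_subseq_LIMSEQ[OF inv_p_power_lim, of "%s. f * s"] assms(1) by (simp add: o_def strict_mono_def)
 thus "(%s. C * (2 * (1 / real p)^(f * s))) \<leadsto> 0" by (intro tendsto_mult_right_zero)
 show "\<forall>\<^sub>F s in sequentially. av (X s - 0) \<le> C * (2 * (1 / real p)^(f * s))"
  using eventually_ge_at_top[of 2]
 proof eventually_elim
  case (elim s)
  hence "f * s >= 1 * 2" using assms(1) by (intro mult_le_mono) auto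
  thus ?case using assms(2)[of s] by simp
 qed
qed

lemma reg_sum_cong_1:
 assumes "mean_zero N c" "[P = 1] (mod int N)" shows "reg_sum N c P a = reg_sum N c 1 a"
proof -
 have "c (a + P * int j) = c (a + 1 * int j)" for j
  using assms(2) by (intro mean_zero_cong[OF assms(1)] cong_add cong_mult) auto
 thus ?thesis by (simp add: reg_sum_def)
qed

text \<open>The substitution \<open>a = kN mod Q\<close> turns the regularised sums into partial sums of \<open>c\<close>.\<close>

lemma log_moment_formula:
 assumes N: "N > 0" and cop: "coprime N p" and c: "mean_zero N c" and cp: "!!b. c (int p * b) = c b"
  and odd: "!!a. c (- a) = - c a" and f: "f > 0" "[p^f = 1] (mod N)"
 shows "(%s. \<Sum>r<N. c (int r) * log_sum_units ((r * p^(f * s)) div N)) \<leadsto> log_moment N c 1"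
proof -
 define B where "B = (\<Sum>r<N. of_nat r * c (int r)) / of_nat N"
 define T where "T t = (\<Sum>r\<in>{t<..<N}. c (int r))" for t
 define v where "v = on_units (%a. 1 :: 'k)"
 define Y where "Y s = (\<Sum>r<N. c (int r) * log_sum_units ((r * p^(f * s)) div N))" for s
 define cb where "cb = (\<Sum>j<N. av (c (int j)))"
 have cb: "cb >= 0" by (simp add: cb_def sum_nonneg)
 have pN: "\<not> p dvd N" using cop coprime_p_iff by blast
 have c0: "c 0 = 0"
 proof -
  have "of_nat 2 * c 0 = 0" using odd[of 0] by simp
  thus ?thesis by simp
 qed
 have T_le: "av (T t) \<le> cb" for t unfolding T_def
  by (rule av_sum_le) (use av_mean_zero[OF N c] cb in \<open>auto simp: cb_def\<close>)
 \<comment> \<open>At \<open>- t\<close> the regularised sum is a partial sum of \<open>c\<close> up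
   to the constant \<open>B\<close>; oddness turns each \<open>c (- t)\<close> into
   \<open>- c t\<close>.\<close>
 have W: "reg_sum N c 1 (- int t) = T t - B" if "t < N" for t
  using that
 proof (induction t)
  case 0
  have "(\<Sum>r<N. c (int r)) = c 0 + T 0"
  proof -
   have "{..<N} = insert 0 {0<..<N}" using N by auto
   thus ?thesis by (simp add: T_def)
  qed
  hence "T 0 = 0" using c c0 by (simp add: mean_zero_def)
  thus ?case by (simp add: reg_sum_def B_def)
 next
  case (Suc t)
  have "reg_sum N c 1 (- int (Suc t)) - reg_sum N c 1 (- int (Suc t) + 1) = c (- int (Suc t))"
   by (rule reg_sum_diff[OF N c]) simp
  hence "reg_sum N c 1 (- int (Suc t)) = reg_sum N c 1 (- int t) - c (int (Suc t))"
   using odd[of "int (Suc t)"] by (simp add: algebra_simps)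
  moreover have "T t = c (int (Suc t)) + T (Suc t)"
  proof -
   have "{t<..<N} = insert (Suc t) {Suc t<..<N}" using Suc(2) by auto
   thus ?thesis by (simp add: T_def)
  qed
  ultimately show ?case using Suc by simp
 qed
 define E where "E s = riemann N c unit_log (f * s) - Y s - lg (of_nat N) * riemann N c v (f * s)" for s
 have E_le: "av (E s) \<le> (cb + av B) * (2 * (1 / real p)^(f * s))" if s: "f * s >= 2" for s
 proof -
  define Q where "Q = p^(f * s)"
  define e where "e = (1 / real p)^(f * s)"
  have e0: "e >= 0" by (simp add: e_def)
  have Q: "Q > 0" by (simp add: Q_def)
  have Q1: "[Q = 1] (mod N)" using cong_pow[OF f(2), of s] by (simp add: Q_def power_mult)
  have Qi: "[int Q = 1] (mod int N)" using Q1 by (metis cong_int_iff of_nat_1)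
  have QN: "coprime N Q" using cop by (simp add: Q_def)
  define t where "t k = (k * N) div Q" for k
  define g where "g k = (k * N) mod Q" for k
  have gt: "k * N = g k + t k * Q" for k by (simp add: g_def t_def)
  have tN: "t k < N" if "k < Q" for k
   using that N by (simp add: t_def less_mult_imp_div_less)
  have "inj_on g {..<Q}"
  proof (rule inj_onI)
   fix i j assume ij: "i \<in> {..<Q}" "j \<in> {..<Q}" "g i = g j"
   hence "[i * N = j * N] (mod Q)" by (simp add: g_def cong_def)
   hence "[i = j] (mod Q)" using QN by (simp add: cong_mult_rcancel_nat)
   thus "i = j" using ij by (simp add: cong_def)
  qed
  moreover have "g ` {..<Q} \<subseteq> {..<Q}" using Q by (auto simp: g_def)
  ultimately have reindex: "(\<Sum>a<Q. h a) = (\<Sum>k<Q. h (g k))" for h :: "nat => 'k"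
   using sum.reindex[of g "{..<Q}" h] endo_inj_surj[of "{..<Q}" g] by simp
  \<comment> \<open>From \<open>k * N = g k + t k * Q\<close> and \<open>Q = 1\<close> modulo
    \<open>N\<close> follows \<open>g k = - t k\<close> modulo \<open>N\<close>, so the mass of the
    class of \<open>g k\<close> is one of the values in \<open>W\<close>.\<close>
  have wg: "reg_sum N c (int Q) (int (g k)) = T (t k) - B" if "k < Q" for k
  proof -
   have "reg_sum N c (int Q) (int (g k)) = reg_sum N c 1 (int (g k))"
    by (rule reg_sum_cong_1[OF c Qi])
   also have "... = reg_sum N c 1 (- int (t k))"
   proof (rule mean_zero_cong[OF mean_zero_reg_sum[OF N c]])
    have "[int (t k) * int Q = int (t k) * 1] (mod int N)"
     by (rule cong_scalar_left[OF Qi])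
    hence "int N dvd int (t k) * int Q - int (t k)" by (simp add: cong_iff_dvd_diff)
    moreover have "int (g k) - - int (t k) = int k * int N - (int (t k) * int Q - int (t k))"
     using arg_cong[OF gt[of k], of int] by simp
    ultimately show "[int (g k) = - int (t k)] (mod int N)"
     unfolding cong_iff_dvd_diff by (metis dvd_diff dvd_triv_right)
   qed
   also have "... = T (t k) - B" by (rule W[OF tN[OF that]])
   finally show ?thesis .
  qed
  have riem: "riemann N c h (f * s) = (\<Sum>k<Q. h (g k) * (T (t k) - B))" for h
   unfolding riemann_def Q_def[symmetric] reindex[of "%a. h a * reg_sum N c (int Q) (int a)"]
   by (intro sum.cong refl) (simp add: wg)
  have Ysum: "Y s = (\<Sum>k<Q. unit_log k * T (t k))"
  proof -
   \<comment> \<open>For \<open>0 < r\<close> the condition \<open>t k < r\<close> means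
     \<open>k \<le> (r * Q) div N\<close>, because \<open>r * Q\<close> leaves the remainder
     \<open>r\<close> modulo \<open>N\<close>.\<close>
   have "log_sum_units ((r * Q) div N) = (\<Sum>k<Q. if t k < r then unit_log k else 0)" if r: "r < N" for r
   proof (cases "r = 0")
    case True
    thus ?thesis by (simp add: log_sum_units_def unit_log_def on_units_def)
   next
    case False
    define m where "m = (r * Q) div N"
    have "[r * Q = r * 1] (mod N)" using Q1 by (intro cong_mult) auto
    hence "(r * Q) mod N = r" using r by (simp add: cong_def)
    hence m: "r * Q = N * m + r" using mult_div_mod_eq[of N "r * Q"] by (simp add: m_def)
    have "{k\<in>{..<Q}. t k < r} = {..m}"
    proof (intro equalityI subsetI)
     fix k assume "k \<in> {k\<in>{..<Q}. t k < r}"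
     hence "k * N < r * Q" using Q by (simp add: t_def div_less_iff_less_mult)
     hence "N * k < N * Suc m" using m r by (simp add: mult.commute)
     hence "k < Suc m" by (simp only: mult_less_cancel1)
     thus "k \<in> {..m}" by simp
    next
     fix k assume "k \<in> {..m}"
     hence "k * N \<le> N * m" by (simp add: mult.commute)
     hence lt: "k * N < r * Q" using m False by linarith
     also have "r * Q < N * Q" using r Q by simp
     finally have "k < Q" by (simp add: mult.commute)
     thus "k \<in> {k\<in>{..<Q}. t k < r}" using lt Q by (simp add: t_def div_less_iff_less_mult)
    qed
    thus ?thesis unfolding log_sum_units_def m_def[symmetric]
     by (subst sum.inter_filter[symmetric]) auto
   qed
   hence "Y s = (\<Sum>r<N. \<Sum>k<Q. if t k < r then unit_log k * c (int r) else 0)"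
    unfolding Y_def Q_def[symmetric] by (intro sum.cong refl) (auto simp: sum_distrib_left intro!: sum.cong)
   also have "... = (\<Sum>k<Q. \<Sum>r<N. if t k < r then unit_log k * c (int r) else 0)" by (rule sum.swap)
   also have "... = (\<Sum>k<Q. unit_log k * T (t k))"
   proof (rule sum.cong[OF refl])
    fix k
    have "{r\<in>{..<N}. t k < r} = {t k<..<N}" by auto
    hence "(\<Sum>r<N. if t k < r then unit_log k * c (int r) else 0) = (\<Sum>r\<in>{t k<..<N}. unit_log k * c (int r))"
     by (subst sum.inter_filter[symmetric]) auto
    thus "(\<Sum>r<N. if t k < r then unit_log k * c (int r) else 0) = unit_log k * T (t k)"
     by (simp add: T_def sum_distrib_left)
   qed
   finally show ?thesis .
  qed
  have vg: "v (g k) = v k" for k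
  proof -
   have "p dvd t k * Q" using s by (cases "f * s") (auto simp: Q_def)
   hence "p dvd g k \<longleftrightarrow> p dvd k * N" unfolding gt[of k] using dvd_add_left_iff by blast
   thus ?thesis using pN prime_dvd_mult_iff[OF prime_p, of k N] by (simp add: v_def on_units_def)
  qed
  define d where "d k = unit_log (g k) - unit_log (k * N)" for k
  have d: "av (d k) \<le> e" for k
   using unit_log_shift[OF s, of "g k" "t k"] unfolding gt[of k] d_def e_def Q_def by (simp add: av_minus_commute)
  have dk: "unit_log (g k) = unit_log k + lg (of_nat N) * v k + d k" for k
   using unit_log_mult[OF pN, of k] by (simp add: d_def v_def)
  define D where "D = (\<Sum>a<Q. unit_log a)"
  have D: "av D \<le> 2 * e" unfolding D_def Q_def e_def by (rule sum_unit_log_small[OF s])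
  have "(\<Sum>k<Q. unit_log (g k)) = D" using reindex[of unit_log] by (simp add: D_def)
  hence z: "(\<Sum>k<Q. lg (of_nat N) * v k) = - (\<Sum>k<Q. d k)"
   unfolding dk sum.distrib D_def[symmetric] by (simp add: eq_neg_iff_add_eq_0 add_ac)
  \<comment> \<open>By \<open>dk\<close>, \<open>unit_log (g k)\<close> is
    \<open>unit_log k + lg N * v k\<close> up to the small error \<open>d k\<close>. After
    cancellation only these errors and the small total \<open>D\<close> remain.\<close>
  have "E s = (\<Sum>k<Q. unit_log (g k) * (T (t k) - B) - unit_log k * T (t k) - lg (of_nat N) * (v k * (T (t k) - B)))"
   unfolding E_def riem Ysum vg by (simp add: sum_subtractf sum_distrib_left)
  also have "... = (\<Sum>k<Q. d k * (T (t k) - B) - unit_log k * B)"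
   unfolding dk by (intro sum.cong refl) (simp add: algebra_simps)
  also have "... = (\<Sum>k<Q. d k * (T (t k) - B)) - D * B"
   by (simp add: sum_subtractf D_def sum_distrib_right)
  also have "av ... \<le> (cb + av B) * (2 * e)"
  proof (rule av_diff_le)
   show "av (\<Sum>k<Q. d k * (T (t k) - B)) \<le> (cb + av B) * (2 * e)"
   proof (rule av_sum_le)
    fix k
    have "av (T (t k) - B) \<le> cb + av B" using av_triangle[of "T (t k)" "- B"] T_le[of "t k"] by simp
    hence "av (T (t k) - B) * av (d k) \<le> (cb + av B) * (2 * e)"
     using d[of k] e0 cb by (intro mult_mono) auto
    thus "av (d k * (T (t k) - B)) \<le> (cb + av B) * (2 * e)" by (simp add: mult.commute)
   qed (use cb e0 in auto)
   have "av B * av D \<le> (cb + av B) * (2 * e)" using D cb by (intro mult_mono) auto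
   thus "av (D * B) \<le> (cb + av B) * (2 * e)" by (simp add: mult.commute)
  qed
  finally show ?thesis by (simp add: e_def)
 qed
 have sub: "strict_mono (%s. f * s)" using f(1) by (simp add: strict_mono_def)
 have "E \<leadsto> 0" by (rule lim_0_if_geometric[OF f(1) E_le])
 moreover have "(%s. riemann N c unit_log (f * s)) \<leadsto> log_moment N c 1"
 proof -
  have "riemann N c unit_log \<leadsto> log_moment N c 1"
   using log_moment_lim(1)[OF N cop c cp, of 1] by (simp add: unit_log_def)
  from LIMSEQ_subseq_LIMSEQ[OF this sub] show ?thesis by (simp add: o_def)
 qed
 moreover have "(%s. lg (of_nat N) * riemann N c v (f * s)) \<leadsto> lg (of_nat N) * 0"
 proof (intro lim_mult lim_const)
  \<comment> \<open>The exponent 0 makes the Euler factor \<open>1 - p^0\<close> zero: the units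
    have total mass 0, so the constant \<open>lg N\<close> contributes nothing in the limit.\<close>
  have "riemann N c v \<leadsto> 0" using riemann_units_power[OF N cop c cp, of 0] by (simp add: v_def)
  from LIMSEQ_subseq_LIMSEQ[OF this sub] show "(%s. riemann N c v (f * s)) \<leadsto> 0" by (simp add: o_def)
 qed
 ultimately have "(%s. riemann N c unit_log (f * s) - lg (of_nat N) * riemann N c v (f * s) - E s)
  \<leadsto> log_moment N c 1 - lg (of_nat N) * 0 - 0" by (intro lim_diff)
 thus ?thesis by (simp add: E_def Y_def[abs_def])
qed

end

section \<open>Dwork's power series\<close>

lemma fps_X_power_comp: "m > 0 ==> l > 0 ==> (a :: 'a::idom fps) oo fps_X^l oo fps_X^m = a oo fps_X^(l * m)"
 by (subst fps_compose_assoc[symmetric]) (auto simp: fps_X_power_compose power_mult[symmetric] mult.commute)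

text \<open>The series exp (c (X - X^m)); for \<open>c = pi_k\<close> and \<open>m = p\<close> it is
  Dwork's splitting function.\<close>

definition dwork_fps :: "'a::field_char_0 => nat => 'a fps"
 where "dwork_fps c m = fps_exp c * (fps_exp (- c) oo fps_X^m)"

lemma dwork_fps_deriv:
 assumes "m > 0"
 shows "fps_deriv (dwork_fps c m) = fps_const c * dwork_fps c m - fps_const (of_nat m * c) * (fps_X^(m - 1) * dwork_fps c m)"
proof -
 have "(fps_X^m) $ 0 = (0 :: 'a)" using assms by simp
 hence "fps_deriv (fps_exp (- c) oo fps_X^m) = (fps_const (- c) * fps_exp (- c) oo fps_X^m) * fps_deriv (fps_X^m)"
  by (simp add: fps_compose_deriv)
 also have "fps_const (- c) * fps_exp (- c) oo fps_X^m = fps_const (- c) * (fps_exp (- c) oo fps_X^m)"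
  using assms by (simp add: fps_compose_mult_distrib)
 also have "fps_deriv (fps_X^m) = (fps_const (of_nat m) * fps_X^(m - 1) :: 'a fps)"
  using assms by (auto simp: fps_eq_iff)
 finally have *: "fps_deriv (fps_exp (- c) oo fps_X^m) = fps_const (- c) * (fps_exp (- c) oo fps_X^m) * (fps_const (of_nat m) * fps_X^(m - 1))" .
 show ?thesis unfolding dwork_fps_def fps_deriv_mult *
  by (simp add: algebra_simps flip: fps_const_mult fps_const_neg)
qed

lemma dwork_fps_rec:
 assumes "m > 0"
 shows "of_nat (Suc n) * dwork_fps c m $ Suc n = c * dwork_fps c m $ n - of_nat m * c * (if Suc n < m then 0 else dwork_fps c m $ (Suc n - m))"
proof -
 have "of_nat (Suc n) * dwork_fps c m $ Suc n = fps_deriv (dwork_fps c m) $ n" by simp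
 also have "... = c * dwork_fps c m $ n - of_nat m * c * (fps_X^(m - 1) * dwork_fps c m) $ n"
  unfolding dwork_fps_deriv[OF assms] by (simp del: fps_const_mult)
 also have "(fps_X^(m - 1) * dwork_fps c m) $ n = (if Suc n < m then 0 else dwork_fps c m $ (Suc n - m))"
  using assms by (auto simp: fps_X_power_mult_nth)
 finally show ?thesis .
qed

lemma dwork_fps_0: "m > 0 ==> dwork_fps c m $ 0 = 1"
 by (simp add: dwork_fps_def fps_compose_nth)

lemma dwork_fps_mult_exp:
 assumes "m > 0" shows "dwork_fps c m * (fps_exp c oo fps_X^m) = fps_exp c"
proof -
 have "(fps_exp (- c) oo fps_X^m) * (fps_exp c oo fps_X^m) = (fps_exp (- c) * fps_exp c) oo fps_X^m"
  using assms by (subst fps_compose_mult_distrib) auto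
 also have "... = 1" by (simp add: fps_exp_add_mult[symmetric])
 finally show ?thesis by (simp add: dwork_fps_def mult.assoc)
qed

text \<open>In the exponent, X - X^(ml) is X - X^m plus Y - Y^l at Y = X^m.\<close>

lemma dwork_fps_step:
 assumes "m > 0" "l > 0" shows "dwork_fps c (m * l) = dwork_fps c m * (dwork_fps c l oo fps_X^m)"
proof -
 have "dwork_fps c l oo fps_X^m = (fps_exp c oo fps_X^m) * (fps_exp (- c) oo fps_X^(m * l))"
  unfolding dwork_fps_def using assms
  by (subst fps_compose_mult_distrib) (auto simp: fps_X_power_comp mult.commute)
 hence "dwork_fps c m * (dwork_fps c l oo fps_X^m) = (dwork_fps c m * (fps_exp c oo fps_X^m)) * (fps_exp (- c) oo fps_X^(m * l))"
  by (simp add: mult.assoc)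
 thus ?thesis unfolding dwork_fps_mult_exp[OF assms(1)] by (simp add: dwork_fps_def)
qed

lemma dwork_fps_power:
 assumes "m > 0" shows "dwork_fps c m^k = dwork_fps (of_nat k * c) m"
proof -
 have "(fps_exp (- c) oo fps_X^m)^k = fps_exp (- (of_nat k * c)) oo fps_X^m"
  using assms by (subst fps_compose_power) (auto simp: fps_exp_power_mult)
 thus ?thesis by (simp add: dwork_fps_def power_mult_distrib fps_exp_power_mult)
qed

context padic_closure begin

lemma p_nonzero [simp]: "p ~= 0" using p_gt_0 by blast

definition pi_k :: 'k where "pi_k = (SOME x. x^(p - 1) = - of_nat p)"

lemma pi_k_power: "pi_k^(p - 1) = - of_nat p"
proof -
 have "\<exists>x :: 'k. x^(p - 1) = - of_nat p" using p_gt_1 by (intro nth_root_exists) simp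
 thus ?thesis unfolding pi_k_def by (rule someI_ex)
qed

lemma av_pi_k [simp]: "av pi_k = rp"
proof -
 have "av pi_k^(p - 1) = rp^(p - 1)"
  using arg_cong[OF pi_k_power, of av] rp_power by simp
 thus ?thesis using p_gt_1 rp_pos by (intro power_eq_imp_eq_base[of "av pi_k" "p - 1" rp]) auto
qed

lemma pi_k_nonzero [simp]: "pi_k ~= 0" using av_pi_k rp_pos by (metis av_0 less_irrefl)

lemma pi_k_power_p: "pi_k^p = - of_nat p * pi_k"
 using pi_k_power p_gt_1 by (metis mult.commute power_minus_mult p_gt_0)

lemma lg_pi_k: "lg pi_k = 0"
proof -
 have "of_nat (p - 1) * lg pi_k = lg (pi_k^(p - 1))" by (rule lg_power[symmetric]) simp
 also have "... = 0" unfolding pi_k_power by (simp add: lg_minus)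
 finally show ?thesis using p_gt_1 by simp
qed

text \<open>\<open>dwork_count n / n!\<close> is the \<open>n\<close>-th coefficient of \<open>exp (Y + Y\<^sup>p / p)\<close>, and \<open>dwork_count n\<close> is the number
 of permutations of order dividing \<open>p\<close>. Its divisibility by \<open>p\<close> is what makes Dwork's series
 \<open>exp (\<pi> (X - X\<^sup>p))\<close> converge beyond the unit disc.\<close>

function dwork_count :: "nat => int" where
 "dwork_count n = (if n = 0 then 1 else dwork_count (n - 1) + (if n >= p then (\<Prod>i\<in>{n - p + 1..<n}. int i) * dwork_count (n - p) else 0))"
 by auto
termination by (relation "Wellfounded.measure id") auto

declare dwork_count.simps [simp del]

text \<open>Since \<open>pi_k^p = - p * pi_k\<close>, the substitution Y = pi_k X turns the exponent
  pi_k (X - X^p) into Y + Y^p / p. The proof compares the two recurrences.\<close>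

lemma dwork_count_coeff: "dwork_fps pi_k p $ n = pi_k^n * of_int (dwork_count n) / fact n"
proof (induction n rule: less_induct)
 case (less n)
 show ?case
 proof (cases n)
  case 0
  thus ?thesis using dwork_fps_0[of p pi_k] by (simp add: dwork_count.simps[of 0])
 next
  case (Suc m)
  have IH1: "dwork_fps pi_k p $ m = pi_k^m * of_int (dwork_count m) / fact m" using less Suc by simp
  have ext: "- (of_nat p * pi_k) * (if Suc m < p then 0 else dwork_fps pi_k p $ (Suc m - p))
   = pi_k^Suc m * of_int (if Suc m >= p then (\<Prod>i\<in>{Suc m - p + 1..<Suc m}. int i) * dwork_count (Suc m - p) else 0) / fact m"
  proof (cases "Suc m < p")
   case False
   define l where "l = Suc m - p"
   have ml: "Suc m = l + p" using False by (simp add: l_def)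
   have IH2: "dwork_fps pi_k p $ l = pi_k^l * of_int (dwork_count l) / fact l"
    using less[of l] ml Suc p_gt_0 by simp
   have f: "fact m = (\<Prod>i\<in>{l + 1..<l + p}. of_nat i) * (fact l :: 'k)"
   proof -
    have "fact m = (\<Prod>i\<in>{1..m}. of_nat i :: 'k)" by (simp add: fact_prod)
    also have "{1..m} = {1..l} \<union> {l + 1..<l + p}" using ml p_gt_1 by auto
    also have "(\<Prod>i\<in>{1..l} \<union> {l + 1..<l + p}. of_nat i) = (\<Prod>i\<in>{1..l}. of_nat i) * (\<Prod>i\<in>{l + 1..<l + p}. of_nat i :: 'k)"
     by (intro prod.union_disjoint) auto
    finally show ?thesis by (simp add: fact_prod mult.commute)
   qed
   have nz: "(\<Prod>i\<in>{l + 1..<l + p}. of_nat i :: 'k) ~= 0" by simp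
   have "pi_k^Suc m = pi_k^l * (- of_nat p * pi_k)" unfolding ml power_add pi_k_power_p ..
   thus ?thesis using False nz unfolding l_def[symmetric] IH2 f
    by (simp add: ml field_simps)
  qed simp
  define X where "X = (if Suc m < p then 0 else dwork_fps pi_k p $ (Suc m - p))"
  define Z where "Z = (if Suc m >= p then (\<Prod>i\<in>{Suc m - p + 1..<Suc m}. int i) * dwork_count (Suc m - p) else 0)"
  have "of_nat (Suc m) * dwork_fps pi_k p $ Suc m = pi_k * dwork_fps pi_k p $ m - of_nat p * pi_k * X"
   unfolding X_def by (rule dwork_fps_rec[OF p_gt_0])
  also have "... = pi_k * dwork_fps pi_k p $ m + (- (of_nat p * pi_k) * X)" by simp
  also have "- (of_nat p * pi_k) * X = pi_k^Suc m * of_int Z / fact m" unfolding X_def Z_def by (rule ext)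
  also have "pi_k * dwork_fps pi_k p $ m = pi_k^Suc m * of_int (dwork_count m) / fact m" unfolding IH1 by simp
  also have "pi_k^Suc m * of_int (dwork_count m) / fact m + pi_k^Suc m * of_int Z / fact m
   = pi_k^Suc m * of_int (dwork_count m + Z) / fact m" by (simp only: of_int_add distrib_left add_divide_distrib)
  also have "dwork_count m + Z = dwork_count (Suc m)" unfolding Z_def by (subst (2) dwork_count.simps) simp
  finally have "of_nat (Suc m) * dwork_fps pi_k p $ Suc m = pi_k^Suc m * of_int (dwork_count (Suc m)) / fact m" .
  thus ?thesis unfolding Suc fact_Suc by (simp add: field_simps del: of_nat_Suc)
 qed
qed

lemma p_dvd_block:
 assumes "\<not> p dvd n" "n >= p" shows "int p dvd (\<Prod>i\<in>{n - p + 1..<n}. int i)"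
proof -
 define k where "k = p * (n div p)"
 define r where "r = n mod p"
 have "r ~= 0" using assms by (simp add: dvd_eq_mod_eq_0 r_def)
 moreover have "n = k + r" by (simp add: k_def r_def)
 moreover have "r < p" unfolding r_def by (rule mod_less_divisor[OF p_gt_0])
 ultimately have k: "k \<in> {n - p + 1..<n}" using assms(2) by auto
 have "int k dvd (\<Prod>i\<in>{n - p + 1..<n}. int i)" using k by (intro dvd_prodI) auto
 moreover have "int p dvd int k" by (simp add: k_def)
 ultimately show ?thesis by (rule dvd_trans[rotated])
qed

lemma block_wilson: "int p dvd 1 + (\<Prod>i\<in>{p * m + 1..<p * m + p}. int i)"
proof -
 have "(\<Prod>i\<in>{p * m + 1..<p * m + p}. int i) = (\<Prod>i\<in>{1..<p}. int (i + p * m))"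
  using prod.shift_bounds_nat_ivl[of int 1 "p * m" p] by (simp add: add.commute)
 moreover have "[(\<Prod>i\<in>{1..<p}. int (i + p * m)) = (\<Prod>i\<in>{1..<p}. int i)] (mod int p)"
  by (intro cong_prod) (simp add: cong_def)
 moreover have "(\<Prod>i\<in>{1..<p}. int i) = fact (p - 1)"
 proof -
  have "{1..<p} = {1..p - 1}" using p_gt_1 by auto
  thus ?thesis by (simp add: fact_prod)
 qed
 moreover have "[fact (p - 1) = - 1] (mod int p)" using wilson_theorem[OF prime_p] by simp
 ultimately have "[(\<Prod>i\<in>{p * m + 1..<p * m + p}. int i) = - 1] (mod int p)" by (metis cong_trans)
 thus ?thesis by (simp add: cong_iff_dvd_diff add.commute)
qed

text \<open>Induction along the recurrence. If \<open>p\<close> does not divide \<open>n\<close>,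
  the product of the \<open>p - 1\<close> integers before \<open>n\<close> contains a multiple of
  \<open>p\<close>, so both summands have the required power. If \<open>p\<close> divides
  \<open>n\<close>, then \<open>dwork_count (n - 1)\<close> may be replaced by
  \<open>dwork_count (n - p)\<close>, and the product is -1 modulo \<open>p\<close> by Wilson's
  theorem, so the two summands combine to a multiple of \<open>p * dwork_count (n - p)\<close>. One
  factor \<open>p\<close> is gained for every two blocks of length \<open>p\<close>.\<close>

lemma dwork_count_dvd: "int p^((n div p + 1) div 2) dvd dwork_count n"
proof (induction n rule: less_induct)
 case (less n)
 define m where "m = n div p"
 show ?case
 proof (cases "m = 0")
  case True
  thus ?thesis by (simp add: m_def)
 next
  case False
  hence np: "n >= p" by (simp add: m_def div_eq_0_iff)
  have n0: "n > 0" using less_le_trans[OF p_gt_0 np] .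
  have rec: "dwork_count k = dwork_count (k - 1) + (\<Prod>i\<in>{k - p + 1..<k}. int i) * dwork_count (k - p)" if "k >= p" for k
   using that p_gt_0 by (subst dwork_count.simps) auto
  have le: "int p^j dvd dwork_count k" if "k < n" "j \<le> (k div p + 1) div 2" for k j
   using less[OF that(1)] that(2) by (meson dvd_trans le_imp_power_dvd)
  define e where "e = (m + 1) div 2 - 1"
  have E: "(m + 1) div 2 = Suc e" using False by (simp add: e_def Suc_diff_Suc)
  have dvdm: "(n - p) div p = m - 1" using np by (simp add: m_def le_div_geq)
  show ?thesis
  proof (cases "p dvd n")
   case False
   have "(n - 1) div p = m"
   proof -
    have "Suc (n - 1) = n" using less_le_trans[OF p_gt_0 np] by simp
    thus ?thesis using div_Suc[of "n - 1" p] False by (auto simp: m_def dvd_eq_mod_eq_0)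
   qed
   hence 1: "int p^Suc e dvd dwork_count (n - 1)" using np n0 E by (intro le) auto
   have "int p^e dvd dwork_count (n - p)"
    using np n0 dvdm by (intro le) (auto simp: e_def)
   hence "int p^Suc e dvd (\<Prod>i\<in>{n - p + 1..<n}. int i) * dwork_count (n - p)"
    unfolding power_Suc using p_dvd_block[OF False np] by (intro mult_dvd_mono)
   thus ?thesis unfolding rec[OF np] m_def[symmetric] E using 1 by simp
  next
   case True
   hence n: "n = p * m" by (simp add: m_def)
   define l where "l = n - p"
   have nl: "n = l + p" "l = p * (m - 1)" using n np by (auto simp: l_def algebra_simps)
   have step: "int p^Suc e dvd dwork_count (l + i) - dwork_count l" if "i < p" for i
    using that
   proof (induction i)
    case (Suc i)
    define k where "k = l + Suc i"
    have kn: "k < n" using Suc(2) nl by (simp add: k_def)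
    have "\<not> p dvd Suc i" using Suc(2) nat_dvd_not_less by blast
    moreover have "p dvd l" unfolding nl(2) by (rule dvd_triv_left)
    ultimately have kd: "\<not> p dvd k" unfolding k_def using dvd_add_right_iff by blast
    have "int p^Suc e dvd dwork_count k - dwork_count (k - 1)"
    proof (cases "k < p")
     case True
     thus ?thesis by (subst dwork_count.simps) (simp add: k_def)
    next
     case False
     have kp: "k - p = p * (m - 2) + Suc i"
     proof -
      have "m >= 2"
      proof (rule ccontr)
       assume "\<not> m >= 2"
       hence "l = 0" using nl(2) by simp
       thus False using False Suc(2) by (simp add: k_def)
      qed
      hence "l = p * (m - 2) + p" using nl(2) by (metis Suc_diff_Suc Suc_le_lessD diff_Suc_1 mult_Suc_right add.commute numeral_2_eq_2 Suc_1)
      thus ?thesis by (simp add: k_def)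
     qed
     have kpd: "(k - p) div p = m - 2" unfolding kp div_mult_self4[OF p_nonzero] using Suc(2) div_less[of "Suc i" p] by simp
     have "int p^e dvd dwork_count (k - p)"
      using kn p_gt_0 kpd by (intro le) (auto simp: e_def)
     hence "int p^Suc e dvd (\<Prod>i\<in>{k - p + 1..<k}. int i) * dwork_count (k - p)"
      unfolding power_Suc using p_dvd_block[OF kd] False by (intro mult_dvd_mono) auto
     thus ?thesis using rec[of k] False by simp
    qed
    moreover have "k - 1 = l + i" by (simp add: k_def)
    ultimately have "int p^Suc e dvd (dwork_count k - dwork_count (l + i)) + (dwork_count (l + i) - dwork_count l)"
     using Suc by (intro dvd_add) auto
    thus ?case by (simp add: k_def)
   qed simp
   have "int p^Suc e dvd dwork_count (n - 1) - dwork_count l"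
   proof -
    have "n - 1 = l + (p - 1)" using nl(1) p_gt_1 by linarith
    moreover have "p - 1 < p" using p_gt_1 by linarith
    ultimately show ?thesis using step[of "p - 1"] by metis
   qed
   moreover have "int p^Suc e dvd (1 + (\<Prod>i\<in>{n - p + 1..<n}. int i)) * dwork_count l"
   proof -
    have "int p^e dvd dwork_count l"
     using np n0 dvdm unfolding l_def by (intro le) (auto simp: e_def)
    moreover have "int p dvd 1 + (\<Prod>i\<in>{n - p + 1..<n}. int i)"
     using block_wilson[of "m - 1"] nl by (simp add: l_def)
    ultimately show ?thesis unfolding power_Suc by (intro mult_dvd_mono)
   qed
   ultimately have "int p^Suc e dvd (dwork_count (n - 1) - dwork_count l) + (1 + (\<Prod>i\<in>{n - p + 1..<n}. int i)) * dwork_count l"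
    by (rule dvd_add)
   thus ?thesis unfolding rec[OF np] m_def[symmetric] E by (simp add: l_def algebra_simps)
  qed
 qed
qed

lemma av_dwork_coeff: "av (dwork_fps pi_k p $ n) \<le> rfact n * (1 / real p)^((n div p + 1) div 2)"
proof -
 have "av (of_int (dwork_count n)) \<le> (1 / real p)^((n div p + 1) div 2)"
  using av_of_int_dvd[OF dwork_count_dvd[of n]] by (simp add: power_one_over)
 hence "rfact n * av (of_int (dwork_count n)) \<le> rfact n * (1 / real p)^((n div p + 1) div 2)"
  using rfact_pos[of n] by (intro mult_left_mono) auto
 thus ?thesis by (simp add: dwork_count_coeff rfact_def)
qed

text \<open>Overconvergence: the radius of convergence exceeds 1, so the series can be evaluated at
  roots of unity.\<close>

definition decays :: "'k fps => bool"
 where "decays F \<longleftrightarrow> (\<exists>C r. C > 0 & 0 < r & r < 1 & (\<forall>n. av (F $ n) \<le> C * r^n))"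

lemma decays_mult: assumes "decays F" "decays G" shows "decays (F * G)"
proof -
 obtain C r D s where *: "C > 0" "0 < r" "r < 1" "!!n. av (F $ n) \<le> C * r^n" "D > 0" "0 < s" "s < 1" "!!n. av (G $ n) \<le> D * s^n"
  using assms unfolding decays_def by blast
 define t where "t = max r s"
 have "av ((F * G) $ n) \<le> C * D * t^n" for n
  unfolding fps_mult_nth
 proof (rule av_sum_le)
  fix i assume i: "i \<in> {0..n}"
  have "av (F $ i) \<le> C * t^i" using *(1,2) order_trans[OF *(4)[of i] mult_left_mono[OF power_mono[of r t i]]] by (simp add: t_def)
  moreover have "av (G $ (n - i)) \<le> D * t^(n - i)" using *(5,6) order_trans[OF *(8)[of "n - i"] mult_left_mono[OF power_mono[of s t "n - i"]]] by (simp add: t_def)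
  ultimately have "av (F $ i) * av (G $ (n - i)) \<le> (C * t^i) * (D * t^(n - i))"
   using * by (intro mult_mono) (auto simp: t_def)
  also have "... = C * D * (t^i * t^(n - i))" by simp
  also have "t^i * t^(n - i) = t^n" using i by (simp flip: power_add)
  finally show "av (F $ i * G $ (n - i)) \<le> C * D * t^n" by simp
 qed (use * in \<open>auto simp: t_def\<close>)
 thus ?thesis unfolding decays_def using * by (intro exI[of _ "C * D"] exI[of _ t]) (auto simp: t_def)
qed

lemma decays_compose_power: assumes "decays F" "m > 0" shows "decays (F oo fps_X^m)"
proof -
 obtain C r where *: "C > 0" "0 < r" "r < 1" "!!n. av (F $ n) \<le> C * r^n"
  using assms unfolding decays_def by blast
 define t where "t = root m r"
 have t: "0 < t" "t < 1" "t^m = r" using * assms(2) by (auto simp: t_def)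
 have "av ((F oo fps_X^m) $ n) \<le> C * t^n" for n
 proof (cases "m dvd n")
  case True
  hence "t^n = r^(n div m)" using t(3) by (metis dvd_mult_div_cancel power_mult)
  thus ?thesis using *(4)[of "n div m"] True by (simp add: fps_nth_compose_X_power)
 qed (use * t in \<open>simp add: fps_nth_compose_X_power\<close>)
 thus ?thesis unfolding decays_def using * t by blast
qed

lemma decays_one: "decays 1"
 unfolding decays_def by (intro exI[of _ 1] exI[of _ "1/2"]) auto

lemma decays_dwork_p: "decays (dwork_fps pi_k p)"
proof -
 \<comment> \<open>The exponent in \<open>av_dwork_coeff\<close> grows by one for every
   \<open>2 * p\<close> indices, whence the \<open>2 * p\<close>-th root of
   \<open>1 / p\<close>.\<close>
 define r where "r = root (2 * p) (1 / real p)"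
 have r: "0 < r" "r < 1" "r^(2 * p) = 1 / real p"
  using p_gt_1 by (auto simp: r_def)
 have "av (dwork_fps pi_k p $ n) \<le> 1 / r^p * r^n" for n
 proof -
  define g where "g = (n div p + 1) div 2"
  have "n div p \<le> 2 * g" by (simp add: g_def)
  have "n = p * (n div p) + n mod p" by simp
  also have "... \<le> p * (2 * g) + p" using \<open>n div p \<le> 2 * g\<close> by (intro add_mono mult_le_mono2) (auto simp: less_imp_le)
  finally have "n \<le> 2 * p * g + p" by (simp add: mult_ac)
  hence "r^(2 * p * g + p) \<le> r^n" using r by (intro power_decreasing) auto
  moreover have "r^(2 * p * g + p) = (1 / real p)^g * r^p"
   by (simp only: power_add power_mult[of r "2 * p" g] r(3))
  ultimately have "(1 / real p)^g * r^p \<le> r^n" by simp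
  hence le: "(1 / real p)^g \<le> 1 / r^p * r^n" using r by (simp add: field_simps)
  have "av (dwork_fps pi_k p $ n) \<le> rfact n * (1 / real p)^g" using av_dwork_coeff by (simp add: g_def)
  also have "... \<le> 1 * (1 / real p)^g" by (intro mult_right_mono rfact_le_1) simp
  finally show ?thesis using le by simp
 qed
 thus ?thesis unfolding decays_def using r by (intro exI[of _ "1 / r^p"] exI[of _ r]) auto
qed

lemma decays_dwork: "f > 0 ==> decays (dwork_fps pi_k (p^f))"
proof (induction f)
 case (Suc f)
 show ?case
 proof (cases "f = 0")
  case False
  have "dwork_fps pi_k (p^f * p) = dwork_fps pi_k (p^f) * (dwork_fps pi_k p oo fps_X^(p^f))"
   by (rule dwork_fps_step) auto
  thus ?thesis using Suc(1) False decays_dwork_p by (simp add: decays_mult decays_compose_power mult.commute)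
 qed (use decays_dwork_p in simp)
qed simp

text \<open>For \<open>n < p\<close> the bound comes from at least two factors \<open>rp\<close>,
  for \<open>n \<ge> p\<close> from one factor \<open>1 / p\<close> in \<open>dwork_count\<close>.
  Both bounds lie below \<open>rp\<close>, so the constant and linear terms determine a value to the
  precision that separates \<open>p\<close>-th roots of unity.\<close>

lemma av_dwork_coeff_small: "n >= 2 ==> av (dwork_fps pi_k p $ n) \<le> max (rp^2) (rp / real p)"
proof -
 assume n: "n >= 2"
 show ?thesis
 proof (cases "n < p")
  case True
  have "rfact n = rp^n" using rfact_rec[of n] True by (simp add: rfact_def)
  also have "... \<le> rp^2" using n rp_pos rp_less_1 by (intro power_decreasing) auto
  finally have "rfact n \<le> rp^2" .
  moreover have "rfact n * (1 / real p)^((n div p + 1) div 2) = rfact n" using True by simp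
  ultimately have "av (dwork_fps pi_k p $ n) \<le> rp^2" using av_dwork_coeff[of n] by linarith
  thus ?thesis by simp
 next
  case False
  hence "n div p >= 1" using p_gt_0 by (simp add: Suc_le_eq div_greater_zero_iff)
  hence "(n div p + 1) div 2 >= 1" by simp
  hence "(1 / real p)^((n div p + 1) div 2) \<le> (1 / real p)^1"
   using p_gt_1 by (intro power_decreasing) auto
  hence "rfact n * (1 / real p)^((n div p + 1) div 2) \<le> rp * (1 / real p)"
   using rfact_le[of n] n rp_pos rfact_pos[of n] by (intro mult_mono) auto
  thus ?thesis using av_dwork_coeff[of n] by simp
 qed
qed

end

section \<open>Evaluation of power series, the additive character, and p-adic integers\<close>

context padic_closure begin

definition fps_val :: "'k fps => 'k => 'k" where "fps_val F t = suminf (%n. F $ n * t^n)"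

text \<open>A value is a sum inside a complete field containing \<open>pi_k\<close> and the
  argument; this condition places all its terms there.\<close>

definition pi_coeffs :: "'k fps => bool"
 where "pi_coeffs F \<longleftrightarrow> (\<forall>R. complete_subfield R --> pi_k \<in> R --> (\<forall>n. F $ n \<in> R))"

lemma pi_coeffs_mult: "pi_coeffs F ==> pi_coeffs G ==> pi_coeffs (F * G)"
 unfolding pi_coeffs_def fps_mult_nth by (intro allI impI cs_sum complete_subfieldD(3)) auto

lemma pi_coeffs_compose_power: "pi_coeffs F ==> m > 0 ==> pi_coeffs (F oo fps_X^m)"
 unfolding pi_coeffs_def by (simp add: fps_nth_compose_X_power cs_0)

lemma pi_coeffs_exp:
 assumes "!!R. complete_subfield R ==> pi_k \<in> R ==> c \<in> R" shows "pi_coeffs (fps_exp c)"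
 unfolding pi_coeffs_def
proof (intro allI impI)
 fix R n assume R: "complete_subfield R" "pi_k \<in> R"
 have "c^n / fact n \<in> R" by (intro cs_divide[OF R(1)] cs_power[OF R(1)] cs_fact[OF R(1)] assms R)
 thus "fps_exp c $ n \<in> R" by simp
qed

lemma pi_coeffs_dwork: "m > 0 ==> pi_coeffs (dwork_fps pi_k m)"
 unfolding dwork_fps_def by (intro pi_coeffs_mult pi_coeffs_compose_power pi_coeffs_exp) (auto intro: cs_minus)

lemma fps_val_sums:
 assumes "decays F" "pi_coeffs F" "av t \<le> 1" shows "(%n. F $ n * t^n) sums fps_val F t"
proof -
 obtain C r where *: "C > 0" "0 < r" "r < 1" "!!n. av (F $ n) \<le> C * r^n"
  using assms(1) unfolding decays_def by blast
 have l0: "(%n. F $ n * t^n) \<leadsto> 0"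
 proof (rule lim_zeroI)
  have "(%n. r^n) \<leadsto> 0" using * by (intro LIMSEQ_power_zero) auto
  thus "(%n. C * r^n) \<leadsto> 0" by (rule tendsto_mult_right_zero)
  have "av (F $ n * t^n) \<le> C * r^n" for n
   using mult_mono[OF *(4)[of n] power_le_one[OF av_nonneg assms(3), of n]] * by simp
  thus "\<forall>\<^sub>F n in sequentially. av (F $ n * t^n - 0) \<le> C * r^n" by simp
 qed
 have "finite {pi_k, t}" by simp
 then obtain R where R: "complete_subfield R" "{pi_k, t} \<subseteq> R" using finite_complete_subfield by blast
 have mem: "F $ n * t^n \<in> R" for n
 proof (intro complete_subfieldD(3)[OF R(1)] cs_power[OF R(1)])
  show "F $ n \<in> R" using assms(2) R unfolding pi_coeffs_def by blast
  show "t \<in> R" using R(2) by simp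
 qed
 obtain L where "(%n. F $ n * t^n) sums L" by (rule cs_sums[OF R(1) l0 mem])
 thus ?thesis unfolding fps_val_def by (metis sums_unique)
qed

lemma fps_val_mult:
 assumes "decays F" "pi_coeffs F" "decays G" "pi_coeffs G" "av t \<le> 1"
 shows "fps_val (F * G) t = fps_val F t * fps_val G t"
proof -
 have "(%n. \<Sum>i\<le>n. (F $ i * t^i) * (G $ (n - i) * t^(n - i))) sums (fps_val F t * fps_val G t)"
  by (intro cauchy_product_k fps_val_sums assms)
 moreover have "(\<Sum>i\<le>n. (F $ i * t^i) * (G $ (n - i) * t^(n - i))) = (F * G) $ n * t^n" for n
 proof -
  have "(F * G) $ n * t^n = (\<Sum>i\<le>n. F $ i * G $ (n - i) * (t^i * t^(n - i)))"
   unfolding fps_mult_nth atLeast0AtMost sum_distrib_right by (intro sum.cong refl) (simp flip: power_add)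
  thus ?thesis by (simp add: mult_ac)
 qed
 ultimately have "(%n. (F * G) $ n * t^n) sums (fps_val F t * fps_val G t)" by simp
 moreover have "(%n. (F * G) $ n * t^n) sums fps_val (F * G) t"
  by (intro fps_val_sums decays_mult pi_coeffs_mult assms)
 ultimately show ?thesis using sums_unique2 by blast
qed

lemma fps_val_one: "fps_val 1 t = 1"
proof -
 have "(%n. (1 :: 'k fps) $ n * t^n) sums (\<Sum>n\<in>{0}. (1 :: 'k fps) $ n * t^n)"
  by (rule sums_finite) auto
 thus ?thesis unfolding fps_val_def by (simp add: sums_iff)
qed

lemma pi_coeffs_one: "pi_coeffs 1"
 unfolding pi_coeffs_def by (auto simp: cs_0 cs_1)

lemma fps_val_power:
 assumes "decays F" "pi_coeffs F" "av t \<le> 1"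
 shows "fps_val (F^k) t = fps_val F t^k" "decays (F^k)" "pi_coeffs (F^k)"
proof -
 have "fps_val (F^k) t = fps_val F t^k & decays (F^k) & pi_coeffs (F^k)"
  by (induction k) (use assms in \<open>auto simp: fps_val_one decays_one pi_coeffs_one fps_val_mult decays_mult pi_coeffs_mult\<close>)
 thus "fps_val (F^k) t = fps_val F t^k" "decays (F^k)" "pi_coeffs (F^k)" by auto
qed

lemma fps_val_compose_power:
 assumes F: "decays F" "pi_coeffs F" and t: "av t \<le> 1" and m: "m > 0"
 shows "fps_val (F oo fps_X^m) t = fps_val F (t^m)"
proof -
 define h where "h n = (F oo fps_X^m) $ n * t^n" for n
 have "strict_mono (%n. m * n)" using m by (simp add: strict_mono_def)
 moreover have "h n = 0" if "n \<notin> range (%n. m * n)" for n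
  using that by (auto simp: h_def fps_nth_compose_X_power elim!: dvdE)
 ultimately have "(%n. h (m * n)) sums s \<longleftrightarrow> h sums s" for s by (rule sums_mono_reindex)
 moreover have "h (m * n) = F $ n * (t^m)^n" for n
  using m by (simp add: h_def fps_nth_compose_X_power power_mult)
 moreover have "h sums fps_val (F oo fps_X^m) t"
  unfolding h_def by (intro fps_val_sums decays_compose_power pi_coeffs_compose_power F t m)
 ultimately have "(%n. F $ n * (t^m)^n) sums fps_val (F oo fps_X^m) t" by simp
 thus ?thesis unfolding fps_val_def[of F] by (simp add: sums_iff)
qed

text \<open>\<open>theta f\<close> is a nontrivial additive character on the residue field with \<open>p\<^sup>f\<close> elements,
 evaluated at Teichmueller representatives.\<close>

definition theta :: "nat => 'k => 'k" where "theta f t = fps_val (dwork_fps pi_k (p^f)) t"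

text \<open>The \<open>p\<close>-th power of Dwork's series is exp (p pi_k (X - X^q)) with q = p^f.
  Unlike exp (pi_k X), the series exp (p pi_k X) converges on the closed unit disc, so the power can
  be evaluated as two separate factors, which cancel when t^q = t.\<close>

lemma theta_root:
 assumes "f > 0" "av t \<le> 1" "t^(p^f) = t" shows "theta f t^p = 1"
proof -
 define c where "c = of_nat p * pi_k"
 have dec: "decays (fps_exp d)" if "d = c \<or> d = - c" for d
  unfolding decays_def
 proof (intro exI conjI allI)
  fix n
  have "av (fps_exp d $ n) = (1 / real p)^n * rfact n"
   using that by (auto simp: c_def rfact_def power_divide power_mult_distrib)
  also have "... \<le> (1 / real p)^n * 1" by (intro mult_left_mono rfact_le_1) simp
  finally show "av (fps_exp d $ n) \<le> 1 * (1 / real p)^n" by simp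
 qed (use p_gt_1 in auto)
 have pic: "pi_coeffs (fps_exp d)" if "d = c \<or> d = - c" for d
  by (rule pi_coeffs_exp) (use that in \<open>auto simp: c_def intro!: cs_minus complete_subfieldD(3) cs_of_nat\<close>)
 have "theta f t^p = fps_val (dwork_fps pi_k (p^f)^p) t"
  unfolding theta_def by (rule fps_val_power(1)[symmetric]) (use assms in \<open>auto intro: decays_dwork pi_coeffs_dwork\<close>)
 also have "dwork_fps pi_k (p^f)^p = fps_exp c * (fps_exp (- c) oo fps_X^(p^f))"
  by (subst dwork_fps_power) (auto simp: dwork_fps_def c_def)
 also have "fps_val ... t = fps_val (fps_exp c) t * fps_val (fps_exp (- c) oo fps_X^(p^f)) t"
  by (intro fps_val_mult dec pic decays_compose_power pi_coeffs_compose_power assms) auto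
 also have "fps_val (fps_exp (- c) oo fps_X^(p^f)) t = fps_val (fps_exp (- c)) t"
  by (subst fps_val_compose_power) (use assms dec pic in auto)
 also have "fps_val (fps_exp c) t * fps_val (fps_exp (- c)) t = fps_val (fps_exp c * fps_exp (- c)) t"
  by (intro fps_val_mult[symmetric] dec pic assms) auto
 also have "fps_exp c * fps_exp (- c) = (1 :: 'k fps)" by (simp flip: fps_exp_add_mult)
 finally show ?thesis by (simp add: fps_val_one)
qed

text \<open>The error allowed in the congruence of \<open>theta f t\<close> with 1 plus
  \<open>pi_k\<close> times the trace of \<open>t\<close>. It is below \<open>rp\<close>, the
  distance between distinct \<open>p\<close>-th roots of unity.\<close>

definition tdelta :: real where "tdelta = max (rp^2) (rp / real p)"

lemma tdelta: "0 \<le> tdelta" "tdelta < rp" "rp * rp \<le> tdelta"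
proof -
 show "0 \<le> tdelta" using rp_pos by (simp add: tdelta_def le_max_iff_disj)
 show "rp * rp \<le> tdelta" by (simp add: tdelta_def power2_eq_square)
 have "rp * rp < rp * 1" using rp_pos rp_less_1 by (intro mult_strict_left_mono) auto
 moreover have "rp / real p < rp / 1" using rp_pos p_gt_1 by (intro divide_strict_left_mono) auto
 ultimately show "tdelta < rp" by (simp add: tdelta_def power2_eq_square)
qed

lemma product_approx:
 assumes "av (x - 1 - a) \<le> tdelta" "av a \<le> rp" "av (y - 1 - b) \<le> tdelta" "av b \<le> rp"
 shows "av (x * y - 1 - (a + b)) \<le> tdelta"
proof -
 have y1: "av (y - 1) \<le> rp" using av_add_le[of "y - 1 - b" rp b] assms tdelta by simp
 have y: "av y \<le> 1" using av_add_le[of "y - 1" 1 1] y1 rp_less_1 by simp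
 have "av ((x - 1 - a) * y) \<le> tdelta" using mult_mono[OF assms(1) y] tdelta(1) by simp
 moreover have "av (a * (y - 1)) \<le> tdelta"
  using mult_mono[OF assms(2) y1] rp_pos tdelta(3) by simp
 ultimately have "av ((x - 1 - a) * y + (a * (y - 1) + (y - 1 - b))) \<le> tdelta" by (intro av_add_le assms)
 moreover have "(x - 1 - a) * y + (a * (y - 1) + (y - 1 - b)) = x * y - 1 - (a + b)" by (simp add: algebra_simps)
 ultimately show ?thesis by metis
qed

lemma power_approx:
 assumes "av (x - 1 - a) \<le> tdelta" "av a \<le> rp" shows "av (x^n - 1 - of_nat n * a) \<le> tdelta"
proof (induction n)
 case (Suc n)
 have "av (of_nat n * a) \<le> rp" using mult_mono[OF av_of_nat_le[of n] assms(2)] by simp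
 from product_approx[OF assms Suc this] show ?case by (simp add: algebra_simps)
qed (use tdelta in simp)

lemma theta_1_approx: assumes "av t \<le> 1" shows "av (fps_val (dwork_fps pi_k p) t - 1 - pi_k * t) \<le> tdelta"
proof (rule sums_av_le)
 let ?F = "dwork_fps pi_k p"
 have F1: "?F $ 1 = pi_k" using dwork_fps_rec[of p 0 pi_k] p_gt_1 by (simp add: dwork_fps_0)
 have "(%n. ?F $ n * t^n) sums fps_val ?F t" by (intro fps_val_sums decays_dwork_p pi_coeffs_dwork assms) simp
 from sums_Suc_k[OF sums_Suc_k[OF this]]
 show "(%n. ?F $ Suc (Suc n) * t^Suc (Suc n)) sums (fps_val ?F t - 1 - pi_k * t)"
  using F1 by (simp add: dwork_fps_0)
 fix n
 show "av (?F $ Suc (Suc n) * t^Suc (Suc n)) \<le> tdelta"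
  using mult_mono[OF av_dwork_coeff_small[of "Suc (Suc n)"] power_le_one[OF av_nonneg assms, of "Suc (Suc n)"]] tdelta(1)
  by (simp add: tdelta_def)
qed

lemma theta_approx:
 assumes "f > 0" "av t \<le> 1" shows "av (theta f t - 1 - pi_k * (\<Sum>i<f. t^(p^i))) \<le> tdelta"
 using assms(1)
proof (induction f)
 case (Suc f)
 show ?case
 proof (cases "f = 0")
  case True
  thus ?thesis using theta_1_approx[OF assms(2)] by (simp add: theta_def)
 next
  case False
  have tp: "av (t^(p^i)) \<le> 1" for i using assms(2) by (simp add: power_le_one)
  have "dwork_fps pi_k (p^Suc f) = dwork_fps pi_k (p^f) * (dwork_fps pi_k p oo fps_X^(p^f))"
   using dwork_fps_step[of "p^f" p pi_k] by (simp add: mult.commute)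
  hence "theta (Suc f) t = theta f t * fps_val (dwork_fps pi_k p oo fps_X^(p^f)) t"
   unfolding theta_def using False assms(2)
   by (simp add: fps_val_mult decays_dwork decays_compose_power decays_dwork_p pi_coeffs_dwork pi_coeffs_compose_power)
  also have "fps_val (dwork_fps pi_k p oo fps_X^(p^f)) t = fps_val (dwork_fps pi_k p) (t^(p^f))"
   by (intro fps_val_compose_power decays_dwork_p pi_coeffs_dwork assms) auto
  finally have e: "theta (Suc f) t = theta f t * fps_val (dwork_fps pi_k p) (t^(p^f))" .
  have "av (\<Sum>i<f. t^(p^i)) \<le> 1" by (rule av_sum_le) (use tp in auto)
  hence 1: "av (pi_k * (\<Sum>i<f. t^(p^i))) \<le> rp" using rp_pos by (simp add: mult_left_le)
  have 2: "av (pi_k * t^(p^f)) \<le> rp" using tp[of f] rp_pos by (simp add: mult_left_le)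
  have IH: "av (theta f t - 1 - pi_k * (\<Sum>i<f. t^(p^i))) \<le> tdelta" using Suc False by simp
  from product_approx[OF IH 1 theta_1_approx[OF tp[of f]] 2]
  show ?thesis unfolding e by (simp add: algebra_simps)
 qed
qed simp

text \<open>For \<open>h = x / y - 1\<close>, the term \<open>p * h\<close> in the expansion of
  \<open>(h + 1)^p = 1\<close> strictly dominates the others when \<open>av h < rp\<close>: the
  middle binomial coefficients are divisible by \<open>p\<close>, and
  \<open>av h^(p - 1) < 1 / p\<close>.\<close>

lemma p_root_unique:
 assumes "x^p = 1" "y^p = 1" "av (x - y) < rp" shows "x = y"
proof (rule ccontr)
 assume "x ~= y"
 have avy: "av y = 1"
 proof -
  have "av y^p = 1^p" using arg_cong[OF assms(2), of av] by simp
  thus ?thesis by (rule power_eq_imp_eq_base) auto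
 qed
 hence y0: "y ~= 0" by auto
 define h where "h = (x - y) / y"
 have h0: "h ~= 0" using \<open>x ~= y\<close> y0 by (simp add: h_def)
 have h: "av h < rp" using assms(3) avy by (simp add: h_def)
 have "(h + 1)^p = 1"
 proof -
  have "h + 1 = x / y" using y0 by (simp add: h_def field_simps)
  thus ?thesis using assms(1,2) by (simp add: power_divide)
 qed
 hence "(\<Sum>k\<le>p. of_nat (p choose k) * h^k) = 1" using binomial_ring[of h 1 p] by simp
 moreover have "{..p} = insert 0 (insert 1 {2..p})" using p_gt_1 by auto
 ultimately have rel: "of_nat p * h = - (\<Sum>k\<in>{2..p}. of_nat (p choose k) * h^k)"
  by (simp add: eq_neg_iff_add_eq_0 add.assoc)
 have "av (\<Sum>k\<in>{2..p}. of_nat (p choose k) * h^k) < av h / real p"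
 proof (rule av_sum_less)
  fix k assume k: "k \<in> {2..p}"
  then obtain j where j: "k = Suc j" "j > 0" by (cases k) auto
  have h1: "av h < 1" using h rp_less_1 by simp
  show "av (of_nat (p choose k) * h^k) < av h / real p"
  proof (cases "k = p")
   case True
   have "av h^(p - 1) < rp^(p - 1)" using h p_gt_1 by (intro power_strict_mono) auto
   moreover have "p - 1 = j" using True j(1) by simp
   ultimately have "av h^j < 1 / real p" using rp_power by metis
   hence "av h * av h^j < av h * (1 / real p)" using h0 by (intro mult_strict_left_mono) auto
   hence "av h^k < av h / real p" by (simp add: j(1))
   thus ?thesis unfolding True by simp
  next
   case False
   hence "p dvd p choose k" using k by (intro dvd_choose_prime prime_p) auto
   hence "int p^1 dvd int (p choose k)" by simp
   hence "av (of_nat (p choose k)) \<le> 1 / real p" using av_of_int_dvd[of 1 "int (p choose k)"] by simp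
   moreover have "av h^k < av h"
   proof -
    have "av h^j < 1" using h1 j power_less_one_iff[of "av h" j] by simp
    hence "av h * av h^j < av h * 1" using h0 by (intro mult_strict_left_mono) auto
    thus ?thesis using j by simp
   qed
   ultimately have 1: "av (of_nat (p choose k)) \<le> 1 / real p" and 2: "av h^k < av h" by auto
   have "av (of_nat (p choose k)) * av h^k \<le> 1 / real p * av h^k"
    by (intro mult_right_mono 1) simp
   also have "... < 1 / real p * av h" using p_gt_1 by (intro mult_strict_left_mono 2) simp
   finally show ?thesis by simp
  qed
 qed (use h0 p_gt_1 in simp)
 moreover have "av (of_nat p * h) = av h / real p" by simp
 ultimately show False unfolding rel by simp
qed

text \<open>Both sides are \<open>p\<close>-th roots of unity, and both are congruent to 1 plus
  \<open>n * pi_k\<close> times the trace of \<open>t\<close>, so \<open>p_root_unique\<close>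
  applies. This additivity along the prime field is what governs the Galois action on Gauss
  sums.\<close>

lemma theta_mult_unit:
 assumes f: "f > 0" and t: "av t \<le> 1" "t^(p^f) = t" and c: "c^p = c" "av (c - of_nat n) < 1"
 shows "theta f (c * t) = theta f t^n"
proof (rule p_root_unique)
 have cpow: "c^(p^i) = c" for i by (induction i) (simp_all add: power_mult c(1))
 have c1: "av c \<le> 1" using av_add_le[of "c - of_nat n" 1 "of_nat n"] c(2) av_of_nat_le by simp
 have ct: "av (c * t) \<le> 1" using mult_mono[OF c1 t(1)] by simp
 show "theta f (c * t)^p = 1"
  using ct t by (intro theta_root f) (auto simp: power_mult_distrib cpow)
 have "(theta f t^n)^p = (theta f t^p)^n" by (simp add: power_mult[symmetric] mult.commute)
 thus "(theta f t^n)^p = 1" using theta_root[OF f t] by simp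
 define T where "T = (\<Sum>i<f. t^(p^i))"
 have "av T \<le> 1" unfolding T_def by (rule av_sum_le) (use t in \<open>auto intro: power_le_one\<close>)
 hence T: "av (pi_k * T) \<le> rp" using rp_pos by (simp add: mult_left_le)
 have "(\<Sum>i<f. (c * t)^(p^i)) = c * T" by (simp add: T_def power_mult_distrib cpow sum_distrib_left)
 hence 1: "av (theta f (c * t) - 1 - pi_k * (c * T)) \<le> tdelta" using theta_approx[OF f ct] by simp
 have 2: "av (theta f t^n - 1 - of_nat n * (pi_k * T)) \<le> tdelta"
  using power_approx[OF theta_approx[OF f t(1)]] T by (simp add: T_def)
 have "av (c - of_nat n) * av (pi_k * T) \<le> av (c - of_nat n) * rp" using T by (intro mult_left_mono) auto
 also have "... < 1 * rp" using c(2) rp_pos by (intro mult_strict_right_mono) auto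
 finally have 3: "av ((c - of_nat n) * (pi_k * T)) < rp" by simp
 have "av ((theta f (c * t) - 1 - pi_k * (c * T)) - (theta f t^n - 1 - of_nat n * (pi_k * T)) + (c - of_nat n) * (pi_k * T)) < rp"
  using av_diff_le[OF 1 2] tdelta(2) by (intro av_add_less 3) simp
 thus "av (theta f (c * t) - theta f t^n) < rp" by (simp add: algebra_simps)
qed

definition padic_int :: "'k => bool" where "padic_int x \<longleftrightarrow> (\<exists>y :: nat => nat. (%n. of_nat (y n)) \<leadsto> x)"

lemma padic_int_add_nat: "padic_int x ==> padic_int (x + of_nat k)"
proof -
 assume "padic_int x"
 then obtain y :: "nat => nat" where "(%n. of_nat (y n)) \<leadsto> x" by (auto simp: padic_int_def)
 hence "(%n. of_nat (y n) + of_nat k) \<leadsto> x + of_nat k" by (intro lim_add lim_const)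
 thus ?thesis unfolding padic_int_def by (intro exI[of _ "%n. y n + k"]) simp
qed

lemma padic_int_minus_nat: "padic_int (- of_nat m)"
proof -
 have le: "m \<le> p^n * m" for n using p_gt_1 by simp
 have "(%n. of_nat (p^n) * of_nat m - of_nat m :: 'k) \<leadsto> 0 * of_nat m - of_nat m"
  by (intro lim_diff lim_mult p_power_lim lim_const)
 hence "(%n. of_nat (p^n * m - m) :: 'k) \<leadsto> - of_nat m"
  by (simp only: of_nat_diff[OF le] of_nat_mult) simp
 thus ?thesis unfolding padic_int_def by (rule exI[of _ "%n. p^n * m - m"])
qed

lemma lim_pochhammer: "(X \<longlongrightarrow> x) F ==> ((%n. pochhammer (X n) m) \<longlongrightarrow> pochhammer (x :: 'k) m) F"
 unfolding pochhammer_prod by (intro lim_prod lim_add lim_const)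

text \<open>At natural numbers the quotient by the factorial is a binomial coefficient, hence an
  integer, and the bound passes to limits.\<close>

lemma av_pochhammer_le: assumes "padic_int x" shows "av (pochhammer x m) \<le> av (fact m)"
proof -
 obtain y :: "nat => nat" where y: "(%n. of_nat (y n)) \<leadsto> x" using assms by (auto simp: padic_int_def)
 have "av (pochhammer (of_nat k) m) \<le> av (fact m)" for k :: nat
 proof (cases m)
  case (Suc m')
  have "(of_nat ((k + m') choose m) :: 'k) = pochhammer (of_nat (k + m') - of_nat m + 1) m / fact m"
   unfolding binomial_gbinomial by (rule gbinomial_pochhammer')
  moreover have "of_nat (k + m') - of_nat m + 1 = (of_nat k :: 'k)" by (simp add: Suc)
  ultimately have "(of_nat ((k + m') choose m) :: 'k) = pochhammer (of_nat k) m / fact m" by (simp only:)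
  hence "pochhammer (of_nat k) m = fact m * (of_nat ((k + m') choose m) :: 'k)"
   using fact_nonzero[of m, where 'a = 'k] by simp
  hence "av (pochhammer (of_nat k) m) = av (fact m) * av (of_nat ((k + m') choose m))" by simp
  also have "... \<le> av (fact m) * 1" by (intro mult_left_mono av_of_nat_le) simp
  finally show ?thesis by simp
 qed simp
 thus ?thesis using lim_av_le[OF lim_pochhammer[OF y, of m]] by simp
qed

text \<open>Tannery's theorem: the common bound \<open>e i\<close> tending to 0 reduces the
  comparison to finitely many terms, which converge separately.\<close>

lemma dominated_sums:
 assumes u: "!!s. (%i. u s i) sums (U s :: 'k)" and v: "!!i. (%s. u s i) \<leadsto> v i" "v sums V"
  and e: "!!s i. av (u s i) \<le> e i" "e \<leadsto> 0"
 shows "U \<leadsto> V"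
 unfolding lim_iff
proof (rule LIMSEQ_I)
 fix r :: real assume r: "r > 0"
 from order_tendstoD(2)[OF e(2), of "r / 2"] r
 obtain K where K: "!!i. i >= K ==> e i < r / 2" by (auto simp: eventually_sequentially)
 have ve: "av (v i) \<le> e i" for i using lim_av_le[OF v(1)[of i]] e(1) by simp
 have "\<forall>\<^sub>F s in sequentially. \<forall>i\<in>{..<K}. av (u s i - v i) < r / 2"
 proof (rule eventually_ball_finite, simp, intro ballI)
  fix i
  have "(%s. av (u s i - v i)) \<leadsto> 0" using v(1)[of i] by (simp add: lim_iff)
  thus "\<forall>\<^sub>F s in sequentially. av (u s i - v i) < r / 2" using r by (intro order_tendstoD(2)) auto
 qed
 then obtain s0 where s0: "!!s i. s >= s0 ==> i < K ==> av (u s i - v i) < r / 2" by (auto simp: eventually_sequentially)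
 have "av (U s - V) \<le> r / 2" if "s >= s0" for s
 proof (rule sums_av_le[OF sums_diff_k[OF u v(2)]])
  fix i
  show "av (u s i - v i) \<le> r / 2"
  proof (cases "i < K")
   case False
   hence "av (u s i) \<le> r / 2" "av (v i) \<le> r / 2" using K[of i] e(1)[of s i] ve[of i] by auto
   thus ?thesis by (rule av_diff_le)
  qed (use s0[OF that, of i] in simp)
 qed
 thus "\<exists>no. \<forall>n\<ge>no. norm (av (U n - V) - 0) < r" using r by (intro exI[of _ s0]) force
qed

end

section \<open>The formula of Gross and Koblitz\<close>

context padic_closure begin

text \<open>The base-\<open>p\<close> digits of \<open>a\<close> and \<open>m\<close> are
  concatenated, and \<open>rfact\<close> is multiplicative over the digits.\<close>

lemma rfact_add_mult: "a < p^f ==> rfact (a + p^f * m) = rfact a * rfact m"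
proof (induction f arbitrary: a)
 case 0
 thus ?case by (simp add: rfact_def)
next
 case (Suc f)
 define n where "n = a + p^Suc f * m"
 have e: "n = a + p * (p^f * m)" by (simp add: n_def)
 have 1: "n mod p = a mod p" unfolding e by simp
 have 2: "n div p = a div p + p^f * m" unfolding e using div_mult_self2[OF p_nonzero, of a "p^f * m"] by simp
 have "a div p < p^f" using Suc(2) by (simp add: less_mult_imp_div_less mult.commute)
 hence "rfact (n div p) = rfact (a div p) * rfact m" unfolding 2 by (rule Suc(1))
 thus ?case using rfact_rec[of n] rfact_rec[of a] unfolding n_def[symmetric] 1 by simp
qed

context
 fixes f :: nat and z :: 'k
 assumes f: "f > 0" and z: "z^(p^f - 1) = 1" "\<forall>n. z^n = 1 --> p^f - 1 dvd n"
begin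

definition qf :: nat where "qf = p^f"
definition dw :: "nat => 'k" where "dw n = dwork_fps pi_k qf $ n"

text \<open>\<open>z^j\<close> runs over the Teichmueller representatives of the nonzero residues,
  and \<open>qf - 1 - a\<close> stands for the exponent \<open>- a\<close> modulo
  \<open>qf - 1\<close>.\<close>

definition gauss :: "nat => 'k"
 where "gauss a = (\<Sum>j<qf - 1. z^((qf - 1 - a) * j) * theta f (z^j))"

lemma qf_ge_2: "qf >= 2"
proof -
 have "p^1 \<le> p^f" using f p_gt_1 by (intro power_increasing) auto
 thus ?thesis using p_gt_1 by (simp add: qf_def)
qed

lemma av_z: "av z = 1"
proof -
 have "av z^(qf - 1) = 1^(qf - 1)" using arg_cong[OF z(1), of av] by (simp add: qf_def)
 thus ?thesis using qf_ge_2 by (intro power_eq_imp_eq_base[of "av z" "qf - 1" 1]) auto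
qed

lemma dw_decay: obtains C r where "C > 0" "0 < r" "r < 1" "!!n. av (dw n) \<le> C * r^n"
 using decays_dwork[OF f] unfolding decays_def dw_def qf_def by blast

lemma geometric_roots: "(\<Sum>j<qf - 1. (z^n)^j) = (if qf - 1 dvd n then of_nat (qf - 1) else 0)"
proof (cases "z^n = 1")
 case True
 hence "qf - 1 dvd n" using z(2) by (simp add: qf_def)
 thus ?thesis using True by simp
next
 case False
 hence "\<not> qf - 1 dvd n"
 proof -
  have "z^n = 1" if dv: "qf - 1 dvd n"
  proof -
   obtain k where "n = (qf - 1) * k" using dv by (elim dvdE)
   thus ?thesis using z(1) by (simp add: power_mult qf_def)
  qed
  thus ?thesis using False by blast
 qed
 moreover have "(z^n)^(qf - 1) = 1"
  using z(1) by (simp add: power_mult[symmetric] mult.commute[of n] qf_def) (simp add: power_mult)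
 ultimately show ?thesis using False sum_gp_strict[of "z^n" "qf - 1"] by simp
qed

text \<open>Orthogonality of the powers of \<open>z\<close> keeps the coefficients whose index is
  congruent to \<open>a\<close> modulo \<open>qf - 1\<close>. They are the diagonal entries of the
  operator \<alpha> described below.\<close>

lemma gauss_sums:
 assumes a: "a < qf - 1" shows "(%j. dw (a + (qf - 1) * j) * of_nat (qf - 1)) sums gauss a"
proof -
 define M where "M = qf - 1"
 have M: "M > 0" "a < M" using a by (auto simp: M_def)
 define h where "h n = dw n * (if M dvd (M - a) + n then of_nat M else 0)" for n
 have "(%n. \<Sum>j<M. z^((M - a) * j) * (dw n * (z^j)^n)) sums gauss a"
  unfolding gauss_def M_def[symmetric]
 proof (intro sums_sum_k sums_mult_k)
  fix j
  have "av (z^j) \<le> 1" using av_z by simp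
  thus "(%n. dw n * (z^j)^n) sums theta f (z^j)"
   unfolding theta_def dw_def qf_def by (intro fps_val_sums decays_dwork f pi_coeffs_dwork) auto
 qed
 moreover have "(\<Sum>j<M. z^((M - a) * j) * (dw n * (z^j)^n)) = h n" for n
 proof -
  have "(\<Sum>j<M. z^((M - a) * j) * (dw n * (z^j)^n)) = dw n * (\<Sum>j<M. (z^((M - a) + n))^j)"
   unfolding sum_distrib_left by (intro sum.cong refl) (simp add: power_add power_mult[symmetric] power_mult_distrib mult_ac)
  thus ?thesis unfolding h_def M_def geometric_roots .
 qed
 ultimately have "h sums gauss a" by simp
 moreover have "strict_mono (%j. a + M * j)" using M by (simp add: strict_mono_def)
 moreover have "h n = 0" if "n \<notin> range (%j. a + M * j)" for n
 proof -
  have "\<not> M dvd (M - a) + n"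
  proof
   assume "M dvd (M - a) + n"
   then obtain k where k: "(M - a) + n = M * k" by (elim dvdE)
   then obtain k' where "k = Suc k'" using M by (cases k) auto
   hence "n = a + M * k'" using k M by simp
   thus False using that by blast
  qed
  thus ?thesis by (simp add: h_def)
 qed
 ultimately have "(%j. h (a + M * j)) sums gauss a" using sums_mono_reindex by blast
 moreover have "h (a + M * j) = dw (a + M * j) * of_nat M" for j
 proof -
  have "(M - a) + (a + M * j) = M * Suc j" using M by simp
  hence "M dvd (M - a) + (a + M * j)" by (metis dvd_triv_left)
  thus ?thesis by (simp add: h_def)
 qed
 ultimately show ?thesis by (simp add: M_def)
qed

text \<open>Extending the coefficients by 0 to negative indices makes the recurrence
  \<open>dwi_rec\<close> hold at every integer.\<close>

definition dwi :: "int => 'k" where "dwi x = (if x < 0 then 0 else dw (nat x))"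

lemma dwi_of_nat: "dwi (int n) = dw n" by (simp add: dwi_def)

lemma dwi_rec: "of_int x * dwi x = pi_k * dwi (x - 1) - of_nat qf * pi_k * dwi (x - int qf)"
proof (cases "x \<le> 0")
 case True
 thus ?thesis using qf_ge_2 by (cases "x = 0") (auto simp: dwi_def)
next
 case False
 then obtain n where n: "x = int (Suc n)" by (metis not_le zero_less_imp_eq_int gr0_conv_Suc)
 have "of_nat (Suc n) * dw (Suc n) = pi_k * dw n - of_nat qf * pi_k * (if Suc n < qf then 0 else dw (Suc n - qf))"
  unfolding dw_def using qf_ge_2 by (intro dwork_fps_rec) simp
 moreover have "dwi (int (Suc n)) = dw (Suc n)" unfolding dwi_def by (simp only: nat_int) simp
 moreover have "dwi (int (Suc n) - 1) = dw n" by (simp add: dwi_def)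
 moreover have "dwi (int (Suc n) - int qf) = (if Suc n < qf then 0 else dw (Suc n - qf))"
 proof -
  have "nat (int (Suc n) - int qf) = Suc n - qf" by arith
  moreover have "int (Suc n) - int qf < 0 \<longleftrightarrow> Suc n < qf" by arith
  ultimately show ?thesis unfolding dwi_def by (simp only:)
 qed
 ultimately show ?thesis unfolding n by (simp only: of_int_of_nat_eq)
qed

text \<open>The fixed point of \<open>x \<mapsto> (a + x) / qf\<close>; it is minus the p-adic
  number whose base-\<open>qf\<close> digits are all \<open>a\<close>.\<close>

definition zfix :: "nat => 'k" where "zfix a = of_nat a / of_nat (qf - 1)"
definition wcoef :: "'k => nat => 'k" where "wcoef x j = pochhammer x j * (- 1 / pi_k)^j"

text \<open>
 Let \<open>\<alpha>\<close> be the operator on power series whose value on \<open>X^j\<close> has the coefficients \<open>dwi (a + q i - j)\<close>; its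
 trace is the Gauss sum up to the factor \<open>q - 1\<close>. With \<open>D = X d/dX + \<pi> X + zfix a\<close> one has
 \<open>\<alpha> D = q D \<alpha>\<close>, and \<open>X^j\<close> is congruent to \<open>wcoef (zfix a) j\<close> modulo the image of \<open>D\<close>.
 If \<open>X^j = D g + wcoef (zfix a) j\<close>, then \<open>cohom a i j\<close> is the coefficient of \<open>X^i\<close> in \<open>\<alpha> g\<close>.
\<close>

primrec cohom :: "nat => int => nat => 'k" where
 "cohom a i 0 = 0"
| "cohom a i (Suc j) = (dwi (int a + int qf * i - int j) - (of_nat j + zfix a) * cohom a i j) / pi_k"

lemma zfix_eq: "of_nat qf * zfix a = of_nat a + zfix a"
proof -
 have "(of_nat (qf - 1) :: 'k) ~= 0" using qf_ge_2 by simp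
 moreover have "(of_nat qf :: 'k) = of_nat (qf - 1) + 1" using qf_ge_2 by (simp add: of_nat_diff)
 ultimately show ?thesis unfolding zfix_def by (simp add: field_simps)
qed

text \<open>If X^j = D g + w with the constant w = \<open>wcoef (zfix a) j\<close>, then \<alpha> D
  = q D \<alpha> gives \<alpha> (X^j) = q D (\<alpha> g) + w \<alpha> (1); this is its coefficient
  at X^i. The induction step is \<open>dwi_rec\<close>, after multiplication by
  \<open>pi_k\<close>.\<close>

lemma cohom_relation:
 "dwi (int a + int qf * i - int j) = of_nat qf * (of_int i + zfix a) * cohom a i j + of_nat qf * pi_k * cohom a (i - 1) j
   + wcoef (zfix a) j * dwi (int a + int qf * i)"
proof (induction j)
 case 0
 show ?case by (simp add: wcoef_def)
next
 case (Suc j)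
 define x where "x = int a + int qf * i - int j"
 define s where "s = of_nat j + zfix a"
 define A where "A = cohom a i j"
 define B where "B = cohom a (i - 1) j"
 define w where "w = wcoef (zfix a) j * dwi (int a + int qf * i)"
 have x1: "int a + int qf * i - int (Suc j) = x - 1" by (simp add: x_def)
 have xq: "int a + int qf * (i - 1) - int j = x - int qf" by (simp add: x_def algebra_simps)
 have IH: "dwi x = of_nat qf * (of_int i + zfix a) * A + of_nat qf * pi_k * B + w"
  using Suc by (simp add: x_def A_def B_def w_def)
 have cA: "pi_k * cohom a i (Suc j) = dwi x - s * A" by (simp add: x_def s_def A_def)
 have cB: "pi_k * cohom a (i - 1) (Suc j) = dwi (x - int qf) - s * B" unfolding xq[symmetric] by (simp add: s_def B_def)
 have cw: "pi_k * (wcoef (zfix a) (Suc j) * dwi (int a + int qf * i)) = - s * w"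
  by (simp add: wcoef_def pochhammer_Suc w_def s_def algebra_simps)
 have ix: "of_nat qf * (of_int i + zfix a) - s = of_int x"
  using zfix_eq[of a] by (simp add: x_def s_def algebra_simps)
 have "pi_k * (of_nat qf * (of_int i + zfix a) * cohom a i (Suc j) + of_nat qf * pi_k * cohom a (i - 1) (Suc j)
   + wcoef (zfix a) (Suc j) * dwi (int a + int qf * i))
  = of_nat qf * (of_int i + zfix a) * (pi_k * cohom a i (Suc j)) + of_nat qf * pi_k * (pi_k * cohom a (i - 1) (Suc j))
   + pi_k * (wcoef (zfix a) (Suc j) * dwi (int a + int qf * i))" by (simp add: algebra_simps)
 also have "... = of_nat qf * (of_int i + zfix a) * dwi x + of_nat qf * pi_k * dwi (x - int qf)
   - s * (of_nat qf * (of_int i + zfix a) * A + of_nat qf * pi_k * B + w)"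
  unfolding cA cB cw by (simp add: algebra_simps)
 also have "... = (of_nat qf * (of_int i + zfix a) - s) * dwi x + of_nat qf * pi_k * dwi (x - int qf)"
  unfolding IH[symmetric] by (simp add: algebra_simps)
 also have "... = pi_k * dwi (x - 1)" unfolding ix dwi_rec[of x] by simp
 finally show ?case unfolding x1 by simp
qed

text \<open>The relation is taken on the diagonal \<open>j = i\<close> and summed. The recursion for
  \<open>cohom\<close> rewrites \<open>(i + zfix a) * cohom a i i\<close>, so the terms with
  \<open>cohom\<close> telescope to one boundary term.\<close>

lemma trace_formula:
 assumes a: "a < qf"
 shows "(\<Sum>i<n. dw (a + (qf - 1) * i)) = of_nat qf * (\<Sum>i<n. dw (a + (qf - 1) * i))
  + (\<Sum>i<n. wcoef (zfix a) i * dw (a + qf * i)) - of_nat qf * pi_k * cohom a (int n - 1) n"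
proof -
 have idx: "int a + int qf * int i - int i = int (a + (qf - 1) * i)" for i
 proof -
  have "int (qf - 1) = int qf - 1" using qf_ge_2 by (simp add: of_nat_diff)
  thus ?thesis by (simp only: of_nat_add of_nat_mult) (simp add: algebra_simps)
 qed
 have d1: "dwi (int a + int qf * int i - int i) = dw (a + (qf - 1) * i)" for i
  unfolding idx by (rule dwi_of_nat)
 have d2: "dwi (int a + int qf * int i) = dw (a + qf * i)" for i
 proof -
  have "int a + int qf * int i = int (a + qf * i)" by simp
  thus ?thesis by (simp only: dwi_of_nat)
 qed
 have rel: "dw (a + (qf - 1) * i) = of_nat qf * dw (a + (qf - 1) * i) + wcoef (zfix a) i * dw (a + qf * i)
   - of_nat qf * pi_k * (cohom a (int i) (Suc i) - cohom a (int i - 1) i)" for i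
 proof -
  have "pi_k * cohom a (int i) (Suc i) = dwi (int a + int qf * int i - int i) - (of_nat i + zfix a) * cohom a (int i) i" by simp
  hence s: "(of_nat i + zfix a) * cohom a (int i) i = dw (a + (qf - 1) * i) - pi_k * cohom a (int i) (Suc i)"
   unfolding d1 by (simp add: algebra_simps)
  have "dw (a + (qf - 1) * i) = of_nat qf * ((of_nat i + zfix a) * cohom a (int i) i) + of_nat qf * pi_k * cohom a (int i - 1) i
   + wcoef (zfix a) i * dw (a + qf * i)"
   using cohom_relation[of a "int i" i] unfolding d1 d2 by (simp add: mult.assoc)
  thus ?thesis unfolding s by (simp add: algebra_simps)
 qed
 show ?thesis
 proof (induction n)
  case (Suc n)
  have "int (Suc n) - 1 = int n" by simp
  have lin: "S + d = q * (S + d) + (W + w) - r * K'"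
   if "S = q * S + W - r * K" "d = q * d + w - r * (K' - K)" for S d q W w r K K' :: 'k
  proof -
   have "S + d = (q * S + W - r * K) + (q * d + w - r * (K' - K))" using that by simp
   also have "... = q * (S + d) + (W + w) - r * K'" by (simp add: algebra_simps)
   finally show ?thesis .
  qed
  show ?case unfolding sum.lessThan_Suc \<open>int (Suc n) - 1 = int n\<close> by (rule lin[OF Suc rel[of n]])
 qed simp
qed

lemma qf_geometric: "(qf - 1) * (\<Sum>i<s. qf^i) = qf^s - 1"
proof -
 obtain M where M: "qf = Suc M" using qf_ge_2 by (cases qf) auto
 have "M * (\<Sum>i<s. Suc M^i) = Suc M^s - 1"
 proof (induction s)
  case (Suc s)
  define Q where "Q = Suc M^s"
  have "Q >= 1" by (simp add: Q_def)
  thus ?case using Suc by (simp add: distrib_left flip: Q_def)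
 qed simp
 thus ?thesis unfolding M by simp
qed

lemma padic_int_zfix: "a \<le> qf - 1 ==> padic_int (zfix a)"
 unfolding padic_int_def
proof (intro exI)
 assume a: "a \<le> qf - 1"
 define M where "M = qf - 1"
 have M: "M > 0" "qf = M + 1" using qf_ge_2 by (auto simp: M_def)
 have dvd: "M dvd qf^s - 1" for s using qf_geometric[of s] by (metis M_def dvd_triv_left)
 have le: "a * ((qf^s - 1) div M) \<le> qf^s" for s
 proof -
  have "a * ((qf^s - 1) div M) \<le> M * ((qf^s - 1) div M)" using a by (simp add: M_def)
  also have "... = qf^s - 1" using dvd[of s] by simp
  finally show ?thesis by simp
 qed
 have e: "(of_nat (qf^s - a * ((qf^s - 1) div M)) :: 'k) = of_nat (p^(f * s)) - of_nat a * ((of_nat (p^(f * s)) - 1) / of_nat M)" for s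
 proof -
  have "(of_nat ((qf^s - 1) div M) :: 'k) = of_nat (qf^s - 1) / of_nat M"
  proof -
   obtain k where k: "qf^s - 1 = M * k" using dvd[of s] by (elim dvdE)
   show ?thesis unfolding k using M(1) by simp
  qed
  thus ?thesis using le[of s] qf_ge_2 by (simp add: of_nat_diff qf_def power_mult)
 qed
 have sub: "strict_mono (%s. f * s)" using f by (simp add: strict_mono_def)
 have P: "(%s. of_nat (p^(f * s)) :: 'k) \<leadsto> 0" using LIMSEQ_subseq_LIMSEQ[OF p_power_lim sub] by (simp add: o_def)
 have "(%s. of_nat (p^(f * s)) - of_nat a * ((of_nat (p^(f * s)) - 1) / of_nat M)) \<leadsto> 0 - of_nat a * ((0 - 1) / (of_nat M :: 'k))"
  using M by (intro lim_diff lim_mult lim_divide lim_const P) auto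
 thus "(%s. of_nat (qf^s - a * ((qf^s - 1) div M))) \<leadsto> zfix a"
  unfolding e by (simp add: zfix_def M_def)
qed

lemma av_wcoef_le: "padic_int x ==> av (wcoef x j) \<le> real p * real (j + 1)"
proof -
 assume "padic_int x"
 hence "av (wcoef x j) \<le> av (fact j) * (1 / rp)^j"
  unfolding wcoef_def using rp_pos by (auto simp: power_divide intro!: mult_right_mono av_pochhammer_le divide_right_mono)
 also have "... = 1 / rfact j" by (simp add: rfact_def power_divide)
 also have "... \<le> real p * real (j + 1)" by (rule inverse_rfact_le)
 finally show ?thesis .
qed


lemma cohom_explicit:
 "cohom a i j = (\<Sum>l<j. inverse pi_k * wcoef (zfix a + of_nat (Suc l)) (j - Suc l) * dwi (int a + int qf * i - int l))"
proof (induction j)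
 case (Suc j)
 define t where "t l = inverse pi_k * dwi (int a + int qf * i - int l)" for l
 have "cohom a i (Suc j) = t j + (- (of_nat j + zfix a) / pi_k) * cohom a i j"
  by (simp add: t_def divide_inverse algebra_simps)
 also have "(- (of_nat j + zfix a) / pi_k) * cohom a i j
   = (\<Sum>l<j. t l * wcoef (zfix a + of_nat (Suc l)) (Suc j - Suc l))"
  unfolding Suc sum_distrib_left
 proof (rule sum.cong[OF refl])
  fix l assume l: "l \<in> {..<j}"
  hence "Suc j - Suc l = Suc (j - Suc l)" by auto
  moreover have "zfix a + of_nat (Suc l) + of_nat (j - Suc l) = (of_nat j + zfix a :: 'k)"
   using l by (simp add: of_nat_diff)
  ultimately have W: "wcoef (zfix a + of_nat (Suc l)) (Suc j - Suc l)
   = wcoef (zfix a + of_nat (Suc l)) (j - Suc l) * ((of_nat j + zfix a) * (- 1 / pi_k))"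
   by (simp add: wcoef_def pochhammer_Suc mult_ac)
  show "(- (of_nat j + zfix a) / pi_k) * (inverse pi_k * wcoef (zfix a + of_nat (Suc l)) (j - Suc l) * dwi (int a + int qf * i - int l))
   = t l * wcoef (zfix a + of_nat (Suc l)) (Suc j - Suc l)"
   unfolding t_def W by (simp only: divide_inverse mult_minus_left mult_minus_right mult_1 mult_ac)
 qed
 also have "t j + (\<Sum>l<j. t l * wcoef (zfix a + of_nat (Suc l)) (Suc j - Suc l))
  = (\<Sum>l<Suc j. inverse pi_k * wcoef (zfix a + of_nat (Suc l)) (Suc j - Suc l) * dwi (int a + int qf * i - int l))"
  by (simp add: t_def wcoef_def[of _ 0] mult_ac)
 finally show ?case .
qed simp

lemma poly_geometric_lim:
 assumes "0 < r" "r < (1::real)" shows "(%n. C * (real n + 1) * r^n) \<leadsto> 0"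
proof -
 have "(%n. real n * r^n) \<leadsto> 0" using assms by (intro powser_times_n_limit_0) auto
 moreover have "(%n. r^n) \<leadsto> 0" using assms by (intro LIMSEQ_power_zero) auto
 ultimately have "(%n. C * (real n * r^n + r^n)) \<leadsto> C * (0 + 0)" by (intro tendsto_mult tendsto_const tendsto_add)
 thus ?thesis by (simp add: algebra_simps)
qed

text \<open>In \<open>cohom_explicit\<close> with \<open>i = n - 1\<close> and \<open>j = n\<close>
  every index of \<open>dwi\<close> is at least \<open>n - 1\<close>, as \<open>qf \<ge> 2\<close>.
  Its geometric decay beats the polynomial growth of \<open>wcoef\<close>.\<close>

lemma cohom_boundary_lim: assumes a: "a < qf - 1" shows "(%n. cohom a (int n - 1) n) \<leadsto> 0"
proof -
 obtain C r where *: "C > 0" "0 < r" "r < 1" "!!n. av (dw n) \<le> C * r^n" using dw_decay by blast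
 have bound: "av (cohom a (int (Suc n) - 1) (Suc n)) \<le> (C * (1 / rp) * real p) * (real (Suc n) + 1) * r^n" for n
  unfolding cohom_explicit
 proof (rule av_sum_le)
  fix l assume l: "l \<in> {..<Suc n}"
  have ln: "l \<le> n" using l by simp
  have n2: "2 * n \<le> qf * n" using qf_ge_2 by (intro mult_le_mono1)
  have le: "l \<le> a + qf * n" using ln n2 by linarith
  hence idx: "int a + int qf * (int (Suc n) - 1) - int l = int (a + qf * n - l)" by (simp add: of_nat_diff)
  have "n \<le> a + qf * n - l" using ln n2 by linarith
  hence "r^(a + qf * n - l) \<le> r^n" using * by (intro power_decreasing) auto
  hence "av (dw (a + qf * n - l)) \<le> C * r^n"
   using order_trans[OF *(4)] mult_left_mono[of "r^(a + qf * n - l)" "r^n" C] * by simp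
  hence d: "av (dwi (int a + int qf * (int (Suc n) - 1) - int l)) \<le> C * r^n"
   unfolding idx dwi_of_nat .
  have "padic_int (zfix a + of_nat (Suc l))" using a by (intro padic_int_add_nat padic_int_zfix) simp
  hence "av (wcoef (zfix a + of_nat (Suc l)) (Suc n - Suc l)) \<le> real p * real (Suc n - Suc l + 1)" by (rule av_wcoef_le)
  also have "... \<le> real p * (real (Suc n) + 1)" by (intro mult_left_mono) auto
  finally have w: "av (wcoef (zfix a + of_nat (Suc l)) (Suc n - Suc l)) \<le> real p * (real (Suc n) + 1)" .
  have "av (wcoef (zfix a + of_nat (Suc l)) (Suc n - Suc l)) * av (dwi (int a + int qf * (int (Suc n) - 1) - int l))
    \<le> (real p * (real (Suc n) + 1)) * (C * r^n)" by (intro mult_mono d w) auto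
  hence "(1 / rp) * (av (wcoef (zfix a + of_nat (Suc l)) (Suc n - Suc l)) * av (dwi (int a + int qf * (int (Suc n) - 1) - int l)))
    \<le> (1 / rp) * ((real p * (real (Suc n) + 1)) * (C * r^n))" using rp_pos by (intro mult_left_mono) auto
  thus "av (inverse pi_k * wcoef (zfix a + of_nat (Suc l)) (Suc n - Suc l) * dwi (int a + int qf * (int (Suc n) - 1) - int l))
    \<le> (C * (1 / rp) * real p) * (real (Suc n) + 1) * r^n"
   by (simp add: inverse_eq_divide mult_ac)
 qed (use * rp_pos in auto)
 have "(%n. cohom a (int (Suc n) - 1) (Suc n)) \<leadsto> 0"
 proof (rule lim_zeroI)
  have "(%n. (C * (1 / rp) * real p / r) * (real (Suc n) + 1) * r^Suc n) \<leadsto> 0"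
   using LIMSEQ_Suc[OF poly_geometric_lim[OF *(2,3), of "C * (1 / rp) * real p / r"]] .
  thus "(%n. (C * (1 / rp) * real p) * (real (Suc n) + 1) * r^n) \<leadsto> 0"
   using * by (simp add: mult_ac)
 qed (use bound in \<open>simp del: cohom.simps\<close>)
 thus ?thesis by (rule LIMSEQ_imp_Suc)
qed

text \<open>In the limit, \<open>trace_formula\<close> says that the series is \<open>1 - qf\<close>
  times the diagonal sum, while \<open>gauss_sums\<close> makes the Gauss sum \<open>qf - 1\<close>
  times it; hence the sign. Modulo the image of \<open>D\<close> everything is a multiple of 1, and
  \<alpha> acts there by this series.\<close>

lemma dwork_sum:
 assumes a: "a < qf - 1" shows "(%i. wcoef (zfix a) i * dw (a + qf * i)) sums (- gauss a)"
proof -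
 define M :: 'k where "M = of_nat (qf - 1)"
 have qM: "(of_nat qf :: 'k) = M + 1" using qf_ge_2 by (simp add: M_def of_nat_diff)
 have "(%n. (\<Sum>i<n. dw (a + (qf - 1) * i) * M)) \<leadsto> gauss a"
  using gauss_sums[OF a] by (simp add: sums_def M_def)
 hence "(%n. of_nat qf * pi_k * cohom a (int n - 1) n - (\<Sum>i<n. dw (a + (qf - 1) * i) * M))
   \<leadsto> of_nat qf * pi_k * 0 - gauss a"
  by (intro lim_diff lim_mult lim_const cohom_boundary_lim a)
 moreover have "of_nat qf * pi_k * cohom a (int n - 1) n - (\<Sum>i<n. dw (a + (qf - 1) * i) * M)
   = (\<Sum>i<n. wcoef (zfix a) i * dw (a + qf * i))" for n
 proof -
  define S where "S = (\<Sum>i<n. dw (a + (qf - 1) * i))"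
  have "a < qf" using a by simp
  from trace_formula[OF this, of n] show ?thesis
   unfolding sum_distrib_right[symmetric] S_def[symmetric] qM by (simp add: algebra_simps)
 qed
 ultimately show ?thesis by (simp add: sums_def)
qed

text \<open>The number with \<open>s\<close> base-\<open>qf\<close> digits all equal to
  \<open>a\<close>; \<open>- rep a s\<close> tends to \<open>zfix a\<close>.\<close>

definition rep :: "nat => nat => nat" where "rep a s = a * (\<Sum>i<s. qf^i)"

lemma rep_Suc: "rep a (Suc s) = a + qf * rep a s"
 unfolding rep_def sum.lessThan_Suc_shift by (simp add: sum_distrib_left algebra_simps)

lemma rep_mult: "(qf - 1) * rep a s = a * (qf^s - 1)"
proof -
 have "(qf - 1) * rep a s = a * ((qf - 1) * (\<Sum>i<s. qf^i))" by (simp add: rep_def)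
 thus ?thesis unfolding qf_geometric .
qed

text \<open>With \<open>- m\<close> in place of \<open>zfix a\<close> the series terminates. Up to
  the factor \<open>fact m / pi_k^m\<close> it is the coefficient of X^(a + q m) in the product of
  Dwork's series with exp (pi_k X^q), and that product is exp (pi_k X).\<close>

lemma gauss_coeff_identity:
 assumes a: "a < qf"
 shows "(\<Sum>i\<le>m. wcoef (- of_nat m) i * dw (a + qf * i)) = fact m / pi_k^m * (pi_k^(a + qf * m) / fact (a + qf * m))"
proof -
 have q: "qf > 0" using qf_ge_2 by simp
 define E where "E = fps_exp pi_k oo fps_X^qf"
 have En: "E $ n = (if qf dvd n then pi_k^(n div qf) / fact (n div qf) else 0)" for n
  using q by (simp add: E_def fps_nth_compose_X_power)
 have "pi_k^(a + qf * m) / fact (a + qf * m) = (dwork_fps pi_k qf * E) $ (a + qf * m)"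
  unfolding E_def dwork_fps_mult_exp[OF q] by simp
 also have "... = (\<Sum>k=0..a + qf * m. dw k * E $ (a + qf * m - k))" by (simp add: fps_mult_nth dw_def)
 also have "... = (\<Sum>k\<in>(%i. a + qf * i) ` {..m}. dw k * E $ (a + qf * m - k))"
 proof (rule sum.mono_neutral_right)
  show "\<forall>k\<in>{0..a + qf * m} - (%i. a + qf * i) ` {..m}. dw k * E $ (a + qf * m - k) = 0"
  proof
   fix k assume k: "k \<in> {0..a + qf * m} - (%i. a + qf * i) ` {..m}"
   have "\<not> qf dvd a + qf * m - k"
   proof
    assume "qf dvd a + qf * m - k"
    then obtain j where j: "a + qf * m - k = qf * j" by (elim dvdE)
    hence e: "a + qf * m = k + qf * j" using k by auto
    have "j \<le> m"
    proof (rule ccontr)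
     assume "\<not> j \<le> m"
     hence "qf * Suc m \<le> qf * j" by (intro mult_le_mono2) auto
     thus False using e a by simp
    qed
    hence "qf * m = qf * (m - j) + qf * j" by (simp add: diff_mult_distrib2)
    hence "k = a + qf * (m - j)" using e by simp
    thus False using k by auto
   qed
   thus "dw k * E $ (a + qf * m - k) = 0" by (simp add: En)
  qed
 qed auto
 also have "... = (\<Sum>i\<le>m. dw (a + qf * i) * E $ (a + qf * m - (a + qf * i)))"
  using q by (subst sum.reindex) (auto simp: inj_on_def)
 also have "... = (\<Sum>i\<le>m. dw (a + qf * i) * (pi_k^(m - i) / fact (m - i)))"
 proof (rule sum.cong[OF refl])
  fix i assume "i \<in> {..m}"
  hence "a + qf * m - (a + qf * i) = qf * (m - i)" by (simp add: diff_mult_distrib2)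
  thus "dw (a + qf * i) * E $ (a + qf * m - (a + qf * i)) = dw (a + qf * i) * (pi_k^(m - i) / fact (m - i))"
   using q by (simp add: En)
 qed
 finally have "fact m / pi_k^m * (pi_k^(a + qf * m) / fact (a + qf * m))
  = (\<Sum>i\<le>m. fact m / pi_k^m * (pi_k^(m - i) / fact (m - i)) * dw (a + qf * i))"
  by (simp add: sum_distrib_left mult_ac)
 also have "... = (\<Sum>i\<le>m. wcoef (- of_nat m) i * dw (a + qf * i))"
 proof (rule sum.cong[OF refl])
  fix i assume i: "i \<in> {..m}"
  have "pochhammer (- of_nat m) i = (-1)^i * (fact m / fact (m - i) :: 'k)"
  proof -
   have "pochhammer (- of_nat m :: 'k) i = (-1)^i * pochhammer (of_nat m - of_nat i + 1) i" by (rule pochhammer_minus)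
   also have "pochhammer (of_nat m - of_nat i + 1 :: 'k) i = fact i * (of_nat m gchoose i)"
    unfolding gbinomial_pochhammer' by simp
   also have "(of_nat m gchoose i) = (of_nat (m choose i) :: 'k)" by (rule binomial_gbinomial[symmetric])
   also have "... = fact m / (fact i * fact (m - i))" using i by (intro binomial_fact) auto
   finally show ?thesis by simp
  qed
  hence "(- 1)^i * pochhammer (- of_nat m :: 'k) i = ((- 1)^i * (- 1)^i) * (fact m / fact (m - i))"
   by (simp only: mult.assoc)
  also have "(- 1)^i * (- 1)^i = (1 :: 'k)" by (simp flip: power_mult_distrib)
  finally have 1: "(- 1)^i * pochhammer (- of_nat m :: 'k) i = fact m / fact (m - i)" by simp
  have 2: "pi_k^m = pi_k^(m - i) * pi_k^i" using i by (simp flip: power_add)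
  have "wcoef (- of_nat m) i = ((- 1)^i * pochhammer (- of_nat m) i) / pi_k^i"
   unfolding wcoef_def power_divide by (simp only: times_divide_eq_right mult.commute)
  also have "... = fact m / pi_k^m * (pi_k^(m - i) / fact (m - i))" unfolding 1 2 by simp
  finally have "wcoef (- of_nat m) i = fact m / pi_k^m * (pi_k^(m - i) / fact (m - i))" .
  thus "fact m / pi_k^m * (pi_k^(m - i) / fact (m - i)) * dw (a + qf * i) = wcoef (- of_nat m) i * dw (a + qf * i)" by simp
 qed
 finally show ?thesis ..
qed

definition fact_ratio :: "nat => nat => 'k"
 where "fact_ratio a s = fact (rep a s) / pi_k^rep a s * (pi_k^rep a (Suc s) / fact (rep a (Suc s)))"

text \<open>The formula of Gross and Koblitz, with the values of the \<open>p\<close>-adic Gamma function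
 replaced by the quotients of factorials that approximate them.\<close>

lemma gross_koblitz: assumes a: "a < qf - 1" shows "fact_ratio a \<leadsto> - gauss a"
proof -
 obtain C r where *: "C > 0" "0 < r" "r < 1" "!!n. av (dw n) \<le> C * r^n" using dw_decay by blast
 show ?thesis
 proof (rule dominated_sums)
 show "(%i. wcoef (- of_nat (rep a s)) i * dw (a + qf * i)) sums fact_ratio a s" for s
 proof -
  have "wcoef (- of_nat (rep a s)) i * dw (a + qf * i) = 0" if "i \<notin> {..rep a s}" for i
   using that by (simp add: wcoef_def pochhammer_of_nat_eq_0_iff)
  hence "(%i. wcoef (- of_nat (rep a s)) i * dw (a + qf * i)) sums (\<Sum>i\<le>rep a s. wcoef (- of_nat (rep a s)) i * dw (a + qf * i))"
   by (intro sums_finite) auto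
  thus ?thesis unfolding fact_ratio_def rep_Suc using gauss_coeff_identity[of a "rep a s"] a by simp
 qed
 show "(%i. wcoef (zfix a) i * dw (a + qf * i)) sums (- gauss a)" by (rule dwork_sum[OF a])
 show "(%s. wcoef (- of_nat (rep a s)) i * dw (a + qf * i)) \<leadsto> wcoef (zfix a) i * dw (a + qf * i)" for i
 proof -
  have M: "(of_nat (qf - 1) :: 'k) ~= 0" using qf_ge_2 by simp
  have e: "- of_nat (rep a s) = of_nat a * (1 - of_nat (p^(f * s))) / (of_nat (qf - 1) :: 'k)" for s
  proof -
   have "of_nat (qf - 1) * of_nat (rep a s) = (of_nat (a * (qf^s - 1)) :: 'k)" using rep_mult[of a s] by (metis of_nat_mult)
   moreover have "(of_nat (qf^s - 1) :: 'k) = of_nat (p^(f * s)) - 1"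
    using qf_ge_2 by (simp add: of_nat_diff qf_def power_mult)
   ultimately show ?thesis using M by (simp add: field_simps)
  qed
  have sub: "strict_mono (%s. f * s)" using f by (simp add: strict_mono_def)
  have P: "(%s. of_nat (p^(f * s)) :: 'k) \<leadsto> 0" using LIMSEQ_subseq_LIMSEQ[OF p_power_lim sub] by (simp add: o_def)
  have "(%s. of_nat a * (1 - of_nat (p^(f * s))) / (of_nat (qf - 1) :: 'k)) \<leadsto> of_nat a * (1 - 0) / of_nat (qf - 1)"
   by (intro lim_divide lim_mult lim_diff lim_const P M)
  hence "(%s. - of_nat (rep a s)) \<leadsto> zfix a" unfolding e by (simp add: zfix_def)
  thus ?thesis unfolding wcoef_def by (intro lim_mult lim_const lim_pochhammer)
 qed
 show "(%i. (real p * C) * (real i + 1) * r^i) \<leadsto> 0" by (rule poly_geometric_lim[OF *(2,3)])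
 \<comment> \<open>The bound is uniform in \<open>s\<close> because every \<open>- rep a s\<close>
   is a p-adic integer.\<close>
 show "av (wcoef (- of_nat (rep a s)) i * dw (a + qf * i)) \<le> (real p * C) * (real i + 1) * r^i" for s i
 proof -
  have "2 * i \<le> qf * i" using qf_ge_2 by (intro mult_le_mono1)
  hence "i \<le> a + qf * i" by linarith
  hence "r^(a + qf * i) \<le> r^i" using * by (intro power_decreasing) auto
  hence "C * r^(a + qf * i) \<le> C * r^i" using * by (intro mult_left_mono) auto
  hence d: "av (dw (a + qf * i)) \<le> C * r^i" using order_trans[OF *(4)] by blast
  have "av (wcoef (- of_nat (rep a s)) i) * av (dw (a + qf * i)) \<le> (real p * real (i + 1)) * (C * r^i)"
   by (intro mult_mono d av_wcoef_le padic_int_minus_nat) auto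
  thus ?thesis by (simp add: mult_ac add.commute)
 qed
 qed
qed

lemma av_fact_ratio: assumes "a < qf" shows "av (fact_ratio a s) = rfact a"
proof -
 have "av (fact_ratio a s) = rfact (rep a (Suc s)) / rfact (rep a s)"
  by (simp add: fact_ratio_def rfact_def mult_ac)
 also have "rfact (rep a (Suc s)) = rfact a * rfact (rep a s)"
  unfolding rep_Suc using rfact_add_mult[of a f "rep a s"] assms by (simp add: qf_def)
 finally show ?thesis using rfact_pos[of "rep a s"] by simp
qed

text \<open>Stickelberger's theorem: \<open>rep a (Suc s)\<close> has just one more digit
  \<open>a\<close> than \<open>rep a s\<close>, so the approximating quotients of factorials have
  constant absolute value.\<close>

lemma av_gauss: assumes "a < qf - 1" shows "av (gauss a) = rfact a"
proof -
 have "(%s. av (fact_ratio a s)) \<leadsto> av (- gauss a)" by (rule lim_av[OF gross_koblitz[OF assms]])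
 moreover have "(%s. av (fact_ratio a s)) = (%s. rfact a)" using av_fact_ratio[of a] assms by auto
 ultimately have "(%s. rfact a) \<leadsto> av (gauss a)" by simp
 thus ?thesis using LIMSEQ_unique tendsto_const by blast
qed

lemma gauss_nonzero: "a < qf - 1 ==> gauss a ~= 0"
 using av_gauss[of a] rfact_pos[of a] by auto

lemma lg_gauss: assumes "a < qf - 1" shows "(%s. lg (fact (rep a s)) - lg (fact (rep a (Suc s)))) \<leadsto> lg (gauss a)"
proof -
 have "(%s. lg (fact_ratio a s)) \<leadsto> lg (- gauss a)"
  by (rule lim_lg[OF gross_koblitz[OF assms]]) (use gauss_nonzero[OF assms] in simp)
 moreover have "lg (fact_ratio a s) = lg (fact (rep a s)) - lg (fact (rep a (Suc s)))" for s
  by (simp add: fact_ratio_def lg_mult lg_divide lg_power lg_pi_k)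
 ultimately show ?thesis by (simp add: lg_minus)
qed

end

end

section \<open>Logarithms, valuations and products of Gauss sums\<close>

lemma div_complement:
 fixes a P :: nat
 assumes "P > 0" "a < P * M" shows "(P * M - 1 - a) div P = M - 1 - a div P"
proof -
 define d where "d = a div P"
 have a: "a = P * d + a mod P" and r: "a mod P < P" using assms(1) by (simp_all add: d_def)
 have "d < M" using assms by (simp add: d_def less_mult_imp_div_less mult.commute)
 then obtain k where k: "M = Suc (d + k)" by (metis add_Suc_right less_iff_Suc_add)
 have "P * M - 1 - a = P * k + (P - 1 - a mod P)" using a r by (simp add: k algebra_simps)
 moreover have "(P * k + (P - 1 - a mod P)) div P = k" using assms(1) by simp
 ultimately show ?thesis unfolding d_def[symmetric] by (simp add: k)
qed

text \<open>The number \<open>r * e / P\<close> lies below \<open>Q' * r / N\<close> by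
  \<open>r / (N * P)\<close>, which is less than \<open>1 / P\<close>. Being a multiple of
  \<open>1 / P\<close>, it has the same integer part.\<close>

lemma div_geometric:
 fixes P Q' N r :: nat
 assumes "r < N" "N * e + 1 = P * Q'" shows "r * e div P = Q' * r div N"
proof -
 define c where "c = Q' * r div N"
 define x where "x = Q' * r mod N"
 have x: "x < N" using assms(1) by (simp add: x_def)
 have "r * (N * e + 1) = P * (N * c + x)" unfolding assms(2) c_def x_def by simp
 hence eq: "N * (r * e) + r = N * (P * c) + P * x" by (simp add: algebra_simps)
 have "\<not> r * e < P * c"
 proof
  assume "r * e < P * c"
  hence "N * Suc (r * e) \<le> N * (P * c)" by (intro mult_le_mono) auto
  thus False using eq assms(1) by simp
 qed
 then obtain t where t: "r * e = P * c + t" by (metis le_Suc_ex not_less)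
 have P: "P > 0" using assms(2) by (intro gr0I) simp
 have "N * t + r = P * x" using eq unfolding t by (simp add: algebra_simps)
 also have "P * x < P * N" using x P by simp
 finally have "N * t < N * P" unfolding mult.commute[of P] by (rule add_lessD1)
 hence "t < P" by simp
 thus ?thesis unfolding t c_def[symmetric] using P by simp
qed

lemma sum_mult_mod:
 fixes g :: "nat => 'a::comm_monoid_add"
 assumes "coprime P N" "N > 0" shows "(\<Sum>x<N. g (P * x mod N)) = (\<Sum>x<N. g x)"
proof -
 have "inj_on (%x. P * x mod N) {..<N}"
 proof (rule inj_onI)
  fix i j assume ij: "i \<in> {..<N}" "j \<in> {..<N}" "P * i mod N = P * j mod N"
  hence "[i = j] (mod N)" using assms(1) by (simp add: cong_def[symmetric] cong_mult_lcancel_nat)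
  thus "i = j" using ij by (simp add: cong_def)
 qed
 moreover have "(%x. P * x mod N) ` {..<N} \<subseteq> {..<N}" using assms(2) by auto
 ultimately show ?thesis
  using sum.reindex[of "%x. P * x mod N" "{..<N}" g] endo_inj_surj[of "{..<N}" "%x. P * x mod N"] by simp
qed

context padic_closure begin

text \<open>As \<open>lg p = 0\<close>, the multiples of \<open>p\<close> up to \<open>n\<close>
  contribute just the logarithm of the factorial of \<open>n div p\<close>.\<close>

lemma lg_fact: "lg (fact n) = log_sum_units n + lg (fact (n div p))"
proof (induction n)
 case 0
 show ?case by (simp add: log_sum_units_def unit_log_def on_units_def)
next
 case (Suc n)
 have u: "log_sum_units (Suc n) = log_sum_units n + unit_log (Suc n)" by (simp add: log_sum_units_def)
 have s: "lg (fact (Suc n)) = lg (of_nat (Suc n)) + lg (fact n)"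
  unfolding fact_Suc by (rule lg_mult) (simp_all del: of_nat_Suc)
 show ?case
 proof (cases "p dvd Suc n")
  case True
  then obtain k where k: "Suc n = p * k" by (elim dvdE)
  then obtain j where j: "k = Suc j" by (cases k) auto
  have "n div p = j"
  proof -
   have "n = p * j + (p - 1)" using k p_gt_1 by (simp add: j)
   moreover have "(p * j + (p - 1)) div p = j" by simp
   ultimately show ?thesis by simp
  qed
  moreover have "Suc n div p = Suc j" unfolding k j by simp
  moreover have "lg (of_nat (Suc n)) = lg (of_nat (Suc j))" unfolding k j of_nat_mult by (subst lg_mult) (auto simp del: of_nat_Suc)
  moreover have "lg (fact (Suc j)) = lg (of_nat (Suc j)) + lg (fact j)"
   unfolding fact_Suc by (rule lg_mult) (simp_all del: of_nat_Suc)
  moreover have "unit_log (Suc n) = 0" using True by (simp add: unit_log_def on_units_def)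
  ultimately show ?thesis unfolding u s Suc by simp
 next
  case False
  hence "Suc n div p = n div p" by (simp add: div_Suc dvd_eq_mod_eq_0)
  moreover have "unit_log (Suc n) = lg (of_nat (Suc n))" using False by (simp add: unit_log_def on_units_def)
  ultimately show ?thesis unfolding u s Suc by simp
 qed
qed

lemma lg_fact_iterate: "lg (fact n) = (\<Sum>i<f. log_sum_units (n div p^i)) + lg (fact (n div p^f))"
proof (induction f)
 case (Suc f)
 have "n div p^f div p = n div p^Suc f" by (simp add: div_mult2_eq[symmetric] mult.commute)
 thus ?case using Suc lg_fact[of "n div p^f"] by simp
qed simp

lemma unit_log_reflect:
 assumes n: "n >= 2" and k: "k < p^n" shows "av (unit_log (p^n - k) - unit_log k) \<le> (1 / real p)^n"
proof (cases "p dvd k")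
 case True
 hence "p dvd p^n - k" using n by (intro dvd_diff_nat) auto
 thus ?thesis using True by (simp add: unit_log_def on_units_def)
next
 case False
 define P where "P = p^n"
 have P: "k < P" "p dvd P" using n k by (simp_all add: P_def)
 have nd: "\<not> p dvd P - k" using False P dvd_diffD1[of p P k] by auto
 hence nz: "(of_nat (P - k) :: 'k) ~= 0" "(of_nat k :: 'k) ~= 0" using False P(1) by (auto intro!: gr0I)
 define u where "u = - (of_nat (P - k) / of_nat k :: 'k)"
 have "u - 1 = - (of_nat P / of_nat k)" using nz P(1) by (simp add: u_def of_nat_diff field_simps)
 hence u: "av (u - 1) = (1 / real p)^n" using av_of_nat_unit[OF False] by (simp add: P_def)
 hence "av (lg u) = (1 / real p)^n" using av_lg_close[of u] inv_p_power_le_qq[OF n] by simp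
 moreover have "lg u = lg (of_nat (P - k)) - lg (of_nat k)" unfolding u_def lg_minus by (rule lg_divide[OF nz])
 ultimately show ?thesis using False nd by (simp add: unit_log_def on_units_def P_def)
qed

text \<open>The reflection formula of the Gamma function in logarithmic form: the sum over all
  \<open>k < p^n\<close> is small, and \<open>p^n - k\<close> has nearly the same logarithm as
  \<open>k\<close>.\<close>

lemma log_sum_units_reflect:
 assumes n: "n >= 2" and m: "m < p^n"
 shows "av (log_sum_units (p^n - 1 - m) + log_sum_units m) \<le> 2 * (1 / real p)^n"
proof -
 define P where "P = p^n"
 define e where "e = (1 / real p)^n"
 have e: "e >= 0" by (simp add: e_def)
 have m: "m < P" using assms by (simp add: P_def)
 have z: "log_sum_units k = (\<Sum>k\<in>{0<..k}. unit_log k)" for k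
 proof -
  have "{..k} = insert 0 {0<..k}" by auto
  thus ?thesis by (simp add: log_sum_units_def unit_log_def on_units_def)
 qed
 have r: "(\<Sum>k\<in>{m<..<P}. unit_log (P - k)) = log_sum_units (P - 1 - m)"
  unfolding z using m by (intro sum.reindex_bij_witness[of _ "%k. P - k" "%k. P - k"]) auto
 have "{..<P} = {..m} \<union> {m<..<P}" "{..m} \<inter> {m<..<P} = {}" using m by auto
 hence "(\<Sum>k<P. unit_log k) = log_sum_units m + (\<Sum>k\<in>{m<..<P}. unit_log k)"
  by (simp add: log_sum_units_def sum.union_disjoint)
 hence "log_sum_units (P - 1 - m) + log_sum_units m = (\<Sum>k<P. unit_log k) + (\<Sum>k\<in>{m<..<P}. unit_log (P - k) - unit_log k)"
  by (simp add: sum_subtractf r)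
 also have "av ... \<le> 2 * e"
 proof (rule av_add_le)
  show "av (\<Sum>k<P. unit_log k) \<le> 2 * e" unfolding P_def e_def by (rule sum_unit_log_small[OF n])
  show "av (\<Sum>k\<in>{m<..<P}. unit_log (P - k) - unit_log k) \<le> 2 * e"
  proof (rule av_sum_le)
   fix k assume "k \<in> {m<..<P}"
   hence "av (unit_log (P - k) - unit_log k) \<le> e"
    using unit_log_reflect[OF n, of k] by (simp add: P_def e_def)
   thus "av (unit_log (P - k) - unit_log k) \<le> 2 * e" using e by linarith
  qed (use e in simp)
 qed
 finally show ?thesis by (simp add: P_def e_def)
qed

text \<open>A power of \<open>x\<close> is close to 1, so its \<open>p^n\<close>-th powers tend to 1
  and reach the disc on which the logarithm is an isometry; there logarithm 0 means 1.\<close>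

lemma root_of_unity_if_lg_0:
 assumes "av x = 1" "lg x = 0" obtains n where "n > 0" "x^n = 1"
proof -
 obtain m where m: "m > 0" "av (x^m - 1) < 1" using unit_power_close_1[OF assms(1)] by blast
 define u where "u = x^m - 1"
 have "(%n. ((1 + u)^(p^n) - 1) / of_nat (p^n) * of_nat (p^n)) \<leadsto> log_sum u * 0"
  using m(2) by (intro lim_mult log_lim p_power_lim) (simp add: u_def)
 hence "(%n. (x^m)^(p^n) - 1) \<leadsto> 0" by (simp add: u_def)
 from lim_av[OF this] have "(%n. av ((x^m)^(p^n) - 1)) \<leadsto> 0" by simp
 hence "\<forall>\<^sub>F n in sequentially. av ((x^m)^(p^n) - 1) < 1 / real qq"
  using qq_ge_3 by (intro order_tendstoD(2)) auto
 then obtain n where n: "av ((x^m)^(p^n) - 1) < 1 / real qq" by (auto simp: eventually_sequentially)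
 have x: "x ~= 0" using assms(1) by auto
 have "lg ((x^m)^(p^n)) = 0" using x assms(2) by (simp add: lg_power flip: power_mult)
 moreover have "av (lg ((x^m)^(p^n))) = av ((x^m)^(p^n) - 1)" using n by (intro av_lg_close) simp
 ultimately have "x^(m * p^n) = 1" by (simp add: power_mult)
 thus thesis using that[of "m * p^n"] m(1) by simp
qed

lemma rfact_digits: "rfact a = rp^(\<Sum>i<f. (a div p^i) mod p) * rfact (a div p^f)"
proof (induction f)
 case (Suc f)
 have "a div p^f div p = a div p^Suc f" by (simp add: div_mult2_eq[symmetric] mult.commute)
 thus ?case using Suc rfact_rec[of "a div p^f"] by (simp add: power_add)
qed simp

lemma rp_powr: "rp = real p powr (- 1 / real (p - 1))"
proof -
 have "rp = (rp^(p - 1)) powr (1 / real (p - 1))"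
  using rp_pos p_gt_1 by (simp add: powr_powr flip: powr_realpow)
 also have "... = real p powr (- 1 / real (p - 1))"
  using p_gt_1 unfolding rp_power by (simp add: powr_minus_divide[symmetric] powr_divide)
 finally show ?thesis .
qed

text \<open>The index \<open>r\<close> corresponds to \<open>a = r(q - 1)/N\<close>.\<close>

lemma digit_sum_moment:
 fixes c :: "nat => 'a::field_char_0"
 assumes N: "N > 0" "coprime N p" and e: "N * e = p^f - 1" and c: "!!x. c (p * x mod N) = c x"
 shows "(\<Sum>r<N. c r * of_nat (\<Sum>i<f. (r * e div p^i) mod p)) = of_nat (p - 1) * of_nat f * (\<Sum>r<N. c r * of_nat r) / of_nat N"
proof -
 have Np: "N * e + 1 = p^f" using e by simp
 define x where "x j r = p^j * r mod N" for j r
 \<comment> \<open>As \<open>N * e + 1 = p^f\<close>, the floors \<open>r * e div p^i\<close> are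
   explicit in the residues \<open>x j r\<close>, so \<open>N\<close> times a digit is
   \<open>p\<close> times one residue minus the next one. The sum telescopes because
   \<open>p^f\<close> is 1 modulo \<open>N\<close>.\<close>
 have digits: "int N * int (\<Sum>i<f. (r * e div p^i) mod p) = int (p - 1) * (\<Sum>j<f. int (x j r))" if r: "r < N" for r
 proof -
  have A: "int N * int (r * e div p^i) = int (p^(f - i) * r) - int (x (f - i) r)" if "i \<le> f" for i
  proof -
   have PQ: "N * e + 1 = p^i * p^(f - i)" using Np that by (simp flip: power_add)
   have "N * (r * e div p^i) + x (f - i) r = p^(f - i) * r" unfolding div_geometric[OF r PQ] x_def by simp
   from arg_cong[OF this, of int] show ?thesis by simp
  qed
  have "int N * int ((r * e div p^i) mod p) = int p * int (x (f - Suc i) r) - int (x (Suc (f - Suc i)) r)" if "i < f" for i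
  proof -
   have "int ((r * e div p^i) mod p) = int (r * e div p^i) - int p * int (r * e div p^Suc i)"
    using arg_cong[OF mod_mult_div_eq[of "r * e div p^i" p], of int] by (simp add: div_mult2_eq[symmetric] mult.commute)
   hence "int N * int ((r * e div p^i) mod p) = int N * int (r * e div p^i) - int p * (int N * int (r * e div p^Suc i))"
    by (simp only: right_diff_distrib mult.left_commute)
   thus ?thesis unfolding A[OF less_imp_le[OF that]] A[OF Suc_leI[OF that]] Suc_diff_Suc[OF that, symmetric] by (simp add: algebra_simps)
  qed
  hence "int N * int (\<Sum>i<f. (r * e div p^i) mod p) = (\<Sum>i<f. int p * int (x (f - Suc i) r) - int (x (Suc (f - Suc i)) r))"
   by (simp add: sum_distrib_left)
  also have "... = (\<Sum>j<f. int p * int (x j r) - int (x (Suc j) r))"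
   by (rule sum.nat_diff_reindex[of "%j. int p * int (x j r) - int (x (Suc j) r)"])
  also have "... = int (p - 1) * (\<Sum>j<f. int (x j r)) - (\<Sum>j<f. int (x (Suc j) r) - int (x j r))"
   using p_gt_1 by (simp add: sum_subtractf sum_distrib_left[symmetric] of_nat_diff algebra_simps)
  also have "(\<Sum>j<f. int (x (Suc j) r) - int (x j r)) = 0"
   using r unfolding sum_lessThan_telescope[of "%j. int (x j r)"] by (simp add: x_def Np[symmetric] algebra_simps)
  finally show ?thesis by simp
 qed
 have c': "c (x j r) = c r" if "r < N" for j r
 proof (induction j)
  case (Suc j)
  have "x (Suc j) r = p * x j r mod N" by (simp add: x_def mod_mult_right_eq mult.assoc)
  thus ?case using Suc c by simp
 qed (use that in \<open>simp add: x_def\<close>)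
 have "of_nat N * (\<Sum>r<N. c r * of_nat (\<Sum>i<f. (r * e div p^i) mod p)) = (\<Sum>r<N. c r * of_int (int N * int (\<Sum>i<f. (r * e div p^i) mod p)))"
  by (simp add: sum_distrib_left mult_ac)
 also have "... = of_nat (p - 1) * (\<Sum>r<N. \<Sum>j<f. c (x j r) * of_nat (x j r))"
  by (simp add: digits c' sum_distrib_left mult_ac del: of_nat_sum)
 also have "(\<Sum>r<N. \<Sum>j<f. c (x j r) * of_nat (x j r)) = (\<Sum>j<f. \<Sum>r<N. c r * of_nat r)"
  unfolding x_def using N by (subst sum.swap) (intro sum.cong refl sum_mult_mod[of _ N "%r. c r * of_nat r"], auto simp: coprime_commute)
 finally show ?thesis using N(1) by (simp add: field_simps)
qed

lemma mod_sum_complement: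
 fixes x y :: nat
 assumes "x + y + 1 = p * M" shows "x mod p + y mod p = p - 1"
proof -
 define s where "s = x mod p + y mod p + 1"
 have "p * M = s + p * (x div p + y div p)"
  unfolding assms[symmetric] s_def using mult_div_mod_eq[of p x] mult_div_mod_eq[of p y] by (simp add: algebra_simps)
 hence "p dvd s" by (metis dvd_add_left_iff dvd_triv_left)
 then obtain k where k: "s = p * k" by (elim dvdE)
 have "x mod p < p" "y mod p < p" by simp_all
 hence "s < p * 2" "s > 0" unfolding s_def by linarith+
 hence "p * k < p * 2" "s > 0" using k by simp_all
 hence "k = 1" using k by (cases k) auto
 thus ?thesis using k by (simp add: s_def)
qed

context
 fixes f :: nat and z :: 'k
 assumes f: "f > 0" and z: "z^(p^f - 1) = 1" "\<forall>n. z^n = 1 --> p^f - 1 dvd n"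
begin

abbreviation gs :: "nat => 'k" where "gs \<equiv> gauss f z"

text \<open>Taking \<open>f\<close> steps of \<open>lg_fact\<close> strips one
  base-\<open>qf\<close> digit from \<open>rep f a (Suc s)\<close>, leaving
  \<open>rep f a s\<close>, so the logarithms of the factorials in \<open>lg_gauss\<close>
  cancel.\<close>

lemma gs_lim:
 assumes "a < p^f - 1"
 shows "(%s. - (\<Sum>i<f. log_sum_units (rep f a (Suc s) div p^i))) \<leadsto> lg (gs a)"
proof -
 have "lg (fact (rep f a s)) - lg (fact (rep f a (Suc s))) = - (\<Sum>i<f. log_sum_units (rep f a (Suc s) div p^i))" for s
 proof -
  have "rep f a (Suc s) = a + p^f * rep f a s" using rep_Suc[OF f z, of a s] by (simp add: qf_def[OF f z])
  hence "rep f a (Suc s) div p^f = rep f a s" using assms by simp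
  thus ?thesis using lg_fact_iterate[of "rep f a (Suc s)" f] by simp
 qed
 thus ?thesis using lg_gauss[OF f z, of a] assms unfolding qf_def[OF f z] by simp
qed

lemma gs_ord:
 assumes "a < p^f - 1" shows "padic_ord p (gs a) = of_nat (\<Sum>i<f. (a div p^i) mod p) / of_nat (p - 1)"
proof (rule padic_ord_unique)
 define d where "d = (\<Sum>i<f. (a div p^i) mod p)"
 have "av (gs a) = rfact a" using av_gauss[OF f z, of a] assms by (simp add: qf_def[OF f z])
 also have "... = rp^d" using rfact_digits[of a f] assms by (simp add: d_def rfact_def)
 also have "... = real p powr (- of_rat (of_nat d / of_nat (p - 1)))"
  unfolding rp_powr by (simp add: powr_power of_rat_divide)
 finally show "av (gs a) = real p powr (- of_rat (of_nat (\<Sum>i<f. (a div p^i) mod p) / of_nat (p - 1)))" by (simp add: d_def)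
 show "gs a ~= 0" using gauss_nonzero[OF f z, of a] assms by (simp add: qf_def[OF f z])
qed

lemma gs_ord_sum:
 fixes c :: "int => 'k"
 assumes N: "N > 0" "coprime N p" and c: "mean_zero N c" "!!b. c (int p * b) = c b" "c 0 = 0"
  and e: "N * e = p^f - 1"
 shows "(\<Sum>r<N. c (int r) * of_rat (padic_ord p (gs (r * e)))) = - of_nat f * L_value N c 0"
proof -
 have cm: "c (int (p * x mod N)) = c (int x)" for x
 proof -
  have "[int (p * x mod N) = int p * int x] (mod int N)" by (simp add: cong_def zmod_int)
  thus ?thesis using mean_zero_cong[OF c(1)] c(2) by metis
 qed
 have lt: "r * e < p^f - 1" if "r < N" for r
 proof -
  have "p^f > 1" using f p_gt_1 by (intro one_less_power) auto
  hence "e > 0" using e by (cases e) auto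
  thus ?thesis using that unfolding e[symmetric] by simp
 qed
 have p1: "(of_nat (p - 1) :: 'k) ~= 0" using p_gt_1 by simp
 have "(\<Sum>r<N. c (int r) * of_rat (padic_ord p (gs (r * e))))
  = (\<Sum>r<N. c (int r) * of_nat (\<Sum>i<f. (r * e div p^i) mod p)) / of_nat (p - 1)"
  unfolding sum_divide_distrib by (intro sum.cong refl) (simp add: gs_ord[OF lt] of_rat_divide del: of_nat_sum)
 also have "... = of_nat f * (\<Sum>r<N. c (int r) * of_nat r) / of_nat N"
  using p1 by (subst digit_sum_moment[OF N e, of "%r. c (int r)"]) (simp_all add: cm)
 also have "... = - of_nat f * L_value N c 0"
 proof -
  \<comment> \<open>\<open>L_value\<close> sums from 1 on, the digit formula from 0 on;
    \<open>c 0 = 0\<close> reconciles them.\<close>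
  have "reg_sum N c 1 0 - reg_sum N c 1 (0 + 1) = c 0" by (rule reg_sum_diff[OF N(1) c(1)]) simp
  hence "reg_sum N (%n. c (n + 1)) 1 0 = reg_sum N c 1 0"
   using c(3) reg_sum_shift[of N c 1 0 1] by simp
  hence "L_value N c 0 = reg_sum N c 1 0"
   by (simp add: L_value_def numeral_2_eq_2 fdiff_def)
  thus ?thesis by (simp add: reg_sum_def mult.commute)
 qed
 finally show ?thesis .
qed

text \<open>For each of the \<open>f\<close> shifts, multiplying the residue \<open>r\<close> by
  \<open>p^i\<close>, which leaves \<open>c\<close> unchanged, brings the arguments of
  \<open>log_sum_units\<close> to those in \<open>log_moment_formula\<close> modulo a high power of
  \<open>p\<close>. The \<open>f\<close> equal limits give the factor \<open>f\<close>.\<close>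

lemma gs_lg_sum:
 fixes c :: "int => 'k"
 assumes N: "N > 0" "coprime N p" and c: "mean_zero N c" "!!b. c (int p * b) = c b" "!!a. c (- a) = - c a"
  and e: "N * e = p^f - 1"
 shows "(\<Sum>r<N. c (int r) * lg (gs (r * e))) = - of_nat f * log_moment N c 1"
proof -
 have q1: "p^f > 1" using f p_gt_1 by (intro one_less_power) auto
 have lt: "r * e < p^f - 1" if "r < N" for r
 proof -
  have "e > 0" using e q1 by (cases e) auto
  thus ?thesis using that unfolding e[symmetric] by simp
 qed
 have cm: "c (int (p^i * x mod N)) = c (int x)" for x i
 proof -
  have "[int (p^i * x mod N) = int p^i * int x] (mod int N)" by (simp add: cong_def zmod_int)
  moreover have "c (int p^i * b) = c b" for b by (induction i) (simp_all add: mult.assoc c(2))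
  ultimately show ?thesis using mean_zero_cong[OF c(1)] by metis
 qed
 have fq: "[p^f = 1] (mod N)"
 proof -
  have "[1 + (p^f - 1) = 1 + 0] (mod N)" unfolding e[symmetric] by (intro cong_add) (simp_all add: cong_0_iff)
  thus ?thesis using q1 by simp
 qed
 define A where "A i s = (\<Sum>r<N. c (int r) * log_sum_units (rep f (r * e) (Suc s) div p^i))" for i s
 define cb where "cb = (\<Sum>j<N. av (c (int j)))"
 have cb: "cb >= 0" by (simp add: cb_def sum_nonneg)
 have A: "A i \<leadsto> log_moment N c 1" if i: "i < f" for i
 proof -
  define B where "B s = (\<Sum>r<N. c (int r) * log_sum_units ((r * p^(f * Suc s)) div N))" for s
  have "(%s. (\<Sum>r<N. c (int r) * log_sum_units ((r * p^(f * s)) div N))) \<leadsto> log_moment N c 1"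
   by (rule log_moment_formula[OF N c f fq])
  from LIMSEQ_Suc[OF this] have B: "B \<leadsto> log_moment N c 1" unfolding B_def .
  have bd: "av (A i s - B s) \<le> cb * (2 * (1 / real p)^(f * s))" if s: "f * s >= 2" for s
  proof -
   define P where "P = p^i"
   define m where "m = f * Suc s - i"
   define Q' where "Q' = p^m"
   have PQ: "p^(f * Suc s) = P * Q'" using i by (simp add: P_def Q'_def m_def flip: power_add)
   have ms: "m >= f * s" using i by (simp add: m_def)
   define E where "E = rep f e (Suc s)"
   have re: "rep f (r * e) (Suc s) = r * E" for r by (simp add: E_def rep_def[OF f z] mult.assoc)
   have E: "N * E = P * Q' - 1"
   proof -
    have "(p^f - 1) * (N * E) = (p^f - 1) * (P * Q' - 1)"
     using rep_mult[OF f z, of e "Suc s"] unfolding E_def qf_def[OF f z] PQ[symmetric] power_mult e[symmetric]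
     by (simp add: mult_ac)
    thus ?thesis using q1 by simp
   qed
   have "A i s = (\<Sum>x<N. c (int (P * x mod N)) * log_sum_units ((P * x mod N) * E div P))"
    unfolding A_def re P_def[symmetric]
    by (rule sum_mult_mod[symmetric]) (use N in \<open>simp_all add: P_def coprime_commute\<close>)
   also have "... = (\<Sum>x<N. c (int x) * log_sum_units ((P * x mod N) * E div P))" by (simp add: P_def cm)
   finally have "A i s - B s = (\<Sum>x<N. c (int x) * (log_sum_units ((P * x mod N) * E div P) - log_sum_units ((x * p^(f * Suc s)) div N)))"
    by (simp add: B_def right_diff_distrib sum_subtractf)
   also have "av ... \<le> cb * (2 * (1 / real p)^(f * s))"
   proof (rule av_sum_le)
    fix x assume "x \<in> {..<N}"
    hence x: "x < N" by simp
    have PQ0: "P > 0" "Q' > 0" by (simp_all add: P_def Q'_def)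
    define y where "y = (P * x mod N) * E div P"
    \<comment> \<open>The floor is evaluated by \<open>div_geometric\<close>; the argument occurring
      in \<open>log_moment_formula\<close> differs from it by a multiple of
      \<open>p^m\<close>.\<close>
    have "y = Q' * (P * x mod N) div N" unfolding y_def using N(1) PQ0 E by (intro div_geometric) auto
    moreover have "x * p^(f * Suc s) = Q' * (P * x mod N) + N * (Q' * (P * x div N))"
     unfolding PQ mult.left_commute[of N Q'] distrib_left[symmetric] mod_mult_div_eq by (simp add: mult_ac)
    ultimately have "(x * p^(f * Suc s)) div N = y + (P * x div N) * p^m"
     using N(1) by (simp add: Q'_def mult.commute)
    hence "av (log_sum_units y - log_sum_units ((x * p^(f * Suc s)) div N)) \<le> 2 * (1 / real p)^m"
     using log_sum_units_shift[of m y "P * x div N"] ms s by (simp add: av_minus_commute)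
    also have "... \<le> 2 * (1 / real p)^(f * s)" using ms p_gt_1 by (intro mult_left_mono power_decreasing) auto
    finally have 1: "av (log_sum_units y - log_sum_units ((x * p^(f * Suc s)) div N)) \<le> 2 * (1 / real p)^(f * s)" .
    have "av (c (int x)) \<le> cb" unfolding cb_def by (rule av_mean_zero[OF N(1) c(1)])
    thus "av (c (int x) * (log_sum_units y - log_sum_units ((x * p^(f * Suc s)) div N))) \<le> cb * (2 * (1 / real p)^(f * s))"
     unfolding av_mult using 1 cb by (intro mult_mono) auto
   qed (use cb in simp)
   finally show ?thesis .
  qed
  have "(%s. A i s - B s) \<leadsto> 0" by (rule lim_0_if_geometric[OF f bd])
  from lim_add[OF this B] show ?thesis by simp
 qed
 have "(%s. \<Sum>r<N. c (int r) * - (\<Sum>i<f. log_sum_units (rep f (r * e) (Suc s) div p^i))) \<leadsto> (\<Sum>r<N. c (int r) * lg (gs (r * e)))"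
  by (intro lim_sum lim_mult lim_const gs_lim lt) simp
 moreover have "(\<Sum>r<N. c (int r) * - (\<Sum>i<f. log_sum_units (rep f (r * e) (Suc s) div p^i))) = - (\<Sum>i<f. A i s)" for s
  unfolding A_def by (subst sum.swap) (simp add: sum_distrib_left sum_negf)
 moreover have "(%s. - (\<Sum>i<f. A i s)) \<leadsto> - (\<Sum>i<f. log_moment N c 1)"
  by (intro lim_minus lim_sum A) simp
 ultimately have "(\<Sum>r<N. c (int r) * lg (gs (r * e))) = - (\<Sum>i<f. log_moment N c 1)"
  using LIMSEQ_unique by (metis (no_types, lifting) LIMSEQ_unique ext)
 thus ?thesis by simp
qed

text \<open>The quotient \<open>g\<close> has absolute value 1, since corresponding digits of
  \<open>a\<close> and its complement add up to \<open>p - 1\<close>, and logarithm 0, by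
  reflection. So it is a root of unity. This is what makes the Gauss sums divide powers of
  \<open>p\<close>.\<close>

lemma gs_product:
 assumes a: "0 < a" "a < p^f - 1"
 obtains n where "n > 0" "(gs a * gs (p^f - 1 - a))^n = of_nat (p^f)^n"
proof -
 define b where "b = p^f - 1 - a"
 have b: "b < p^f - 1" "a + b = p^f - 1" using a by (simp_all add: b_def)
 have n0: "gs a ~= 0" "gs b ~= 0" using gauss_nonzero[OF f z] a b by (simp_all add: qf_def[OF f z])
 have compl: "a div p^i + b div p^i + 1 = p^(f - i)" if "i < f" for i
 proof -
  have e: "p^f = p^i * p^(f - i)" using that by (simp flip: power_add)
  have "b div p^i = p^(f - i) - 1 - a div p^i" unfolding b_def e by (rule div_complement) (use a e in auto)
  moreover have "a div p^i < p^(f - i)" using a e by (simp add: less_mult_imp_div_less mult.commute)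
  ultimately show ?thesis by simp
 qed
 define g where "g = gs a * gs b / of_nat (p^f)"
 have g0: "g ~= 0" using n0 by (simp add: g_def)
 have "(a div p^i) mod p + (b div p^i) mod p = p - 1" if "i < f" for i
 proof (rule mod_sum_complement)
  have "f - i = Suc (f - Suc i)" using that by simp
  thus "a div p^i + b div p^i + 1 = p * p^(f - Suc i)" using compl[OF that] by simp
 qed
 hence "(\<Sum>i<f. (a div p^i) mod p) + (\<Sum>i<f. (b div p^i) mod p) = f * (p - 1)"
  unfolding sum.distrib[symmetric] by simp
 hence "rfact a * rfact b = rp^(f * (p - 1))"
  using rfact_digits[of a f] rfact_digits[of b f] a b by (simp add: rfact_def flip: power_add)
 also have "... = (1 / real p)^f" unfolding mult.commute[of f] power_mult rp_power ..
 finally have "av (gs a * gs b) = (1 / real p)^f"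
  using av_gauss[OF f z] a b by (simp add: qf_def[OF f z])
 hence g1: "av g = 1" unfolding g_def av_divide av_p_power by simp
 have "lg g = 0"
 proof -
  define X where "X a s = - (\<Sum>i<f. log_sum_units (rep f a (Suc s) div p^i))" for a s
  have X: "(%s. X a s + X b s) \<leadsto> lg (gs a) + lg (gs b)"
   unfolding X_def by (intro lim_add gs_lim a b)
  have bd: "av (X a s + X b s) \<le> 2 * (1 / real p)^(f * s)" if s: "f * s >= 2" for s
  proof -
   have "(p^f - 1) * (rep f a (Suc s) + rep f b (Suc s)) = (a + b) * (p^(f * Suc s) - 1)"
    using rep_mult[OF f z, of a "Suc s"] rep_mult[OF f z, of b "Suc s"] unfolding qf_def[OF f z] power_mult
    by (simp only: distrib_left distrib_right)
   hence rs: "rep f a (Suc s) + rep f b (Suc s) = p^(f * Suc s) - 1" using a unfolding b(2) mult_cancel_left by linarith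
   have "X a s + X b s = - (\<Sum>i<f. log_sum_units (rep f a (Suc s) div p^i) + log_sum_units (rep f b (Suc s) div p^i))"
    by (simp add: X_def sum.distrib)
   also have "av ... \<le> 2 * (1 / real p)^(f * s)" unfolding av_minus
   proof (rule av_sum_le)
    fix i assume "i \<in> {..<f}"
    hence i: "i < f" by simp
    define m where "m = f * Suc s - i"
    have ms: "m >= f * s" using i by (simp add: m_def)
    have e: "p^(f * Suc s) = p^i * p^m" using i by (simp add: m_def flip: power_add)
    define y where "y = rep f a (Suc s) div p^i"
    have pos: "p^(f * Suc s) > 0" by simp
    have lt: "rep f a (Suc s) < p^i * p^m" using rs pos unfolding e by linarith
    have "rep f b (Suc s) = p^i * p^m - 1 - rep f a (Suc s)" using rs unfolding e by linarith
    hence yb: "rep f b (Suc s) div p^i = p^m - 1 - y" unfolding y_def using div_complement[OF _ lt] by simp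
    have "y < p^m" using lt by (simp add: y_def less_mult_imp_div_less mult.commute)
    hence "av (log_sum_units (p^m - 1 - y) + log_sum_units y) \<le> 2 * (1 / real p)^m"
     using ms s by (intro log_sum_units_reflect) auto
    also have "... \<le> 2 * (1 / real p)^(f * s)" using ms p_gt_1 by (intro mult_left_mono power_decreasing) auto
    finally show "av (log_sum_units (rep f a (Suc s) div p^i) + log_sum_units (rep f b (Suc s) div p^i)) \<le> 2 * (1 / real p)^(f * s)"
     unfolding yb y_def[symmetric] by (simp add: add.commute)
   qed simp
   finally show ?thesis .
  qed
  have "(%s. X a s + X b s) \<leadsto> 0" by (rule lim_0_if_geometric[OF f, of _ 1]) (use bd in simp)
  from LIMSEQ_unique[OF this X] have "lg (gs a) + lg (gs b) = 0" by simp
  thus ?thesis using n0 by (simp add: g_def lg_mult lg_divide lg_power)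
 qed
 then obtain n where n: "n > 0" "g^n = 1" using root_of_unity_if_lg_0[OF g1] by blast
 have "gs a * gs b = g * of_nat (p^f)" by (simp add: g_def)
 hence "(gs a * gs (p^f - 1 - a))^n = of_nat (p^f)^n"
  using n(2) unfolding b_def[symmetric] by (simp add: power_mult_distrib)
 thus thesis using that[OF n(1)] by blast
qed

end

end

section \<open>Extension of automorphisms\<close>

context
 fixes h :: "'r::idom => complex"
 assumes h: "inj_comm_ring_hom h"
begin

interpretation inj_comm_ring_hom h by (rule h)

definition span_over :: "complex set => complex set"
 where "span_over S = {(\<Sum>s\<in>S. h (c s) * s) | c. True}"

text \<open>With \<open>h = of_int\<close> these are the algebraic integers, with
  \<open>h = of_rat\<close> the algebraic numbers, so one argument serves both.\<close>

definition integral_over :: "complex => bool"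
 where "integral_over x \<longleftrightarrow> (\<exists>P. poly (map_poly h P) x = 0 & lead_coeff P = 1)"

lemma span_over_mult_add:
 assumes "x \<in> span_over S" "y \<in> span_over S" shows "h a * x + y \<in> span_over S"
proof -
 obtain c d where "x = (\<Sum>s\<in>S. h (c s) * s)" "y = (\<Sum>s\<in>S. h (d s) * s)" using assms by (auto simp: span_over_def)
 hence "h a * x + y = (\<Sum>s\<in>S. h (a * c s + d s) * s)" by (simp add: hom_add hom_mult sum.distrib sum_distrib_left algebra_simps)
 thus ?thesis unfolding span_over_def by (intro CollectI exI[of _ "%s. a * c s + d s"]) simp
qed

lemma span_over_base: assumes "finite S" "x \<in> S" shows "x \<in> span_over S"
proof -
 have "(\<Sum>s\<in>S. h (if s = x then 1 else 0) * s) = (\<Sum>s\<in>S. if s = x then s else 0)" by (intro sum.cong) auto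
 also have "... = x" using assms by simp
 finally have "x = (\<Sum>s\<in>S. h (if s = x then 1 else 0) * s)" ..
 thus ?thesis unfolding span_over_def by (intro CollectI exI[of _ "%s. if s = x then 1 else 0"]) simp
qed

lemma span_over_sum: "(!!i. i \<in> A ==> g i \<in> span_over S) ==> (\<Sum>i\<in>A. h (c i) * g i) \<in> span_over S"
proof (induction A rule: infinite_finite_induct)
 have "0 \<in> span_over S" unfolding span_over_def by (intro CollectI exI[of _ "%s. 0"]) simp
 thus "!!A. infinite A ==> (\<Sum>i\<in>A. h (c i) * g i) \<in> span_over S" "(\<Sum>i\<in>{}. h (c i) * g i) \<in> span_over S" by simp_all
qed (simp add: span_over_mult_add)

text \<open>Cayley--Hamilton for the matrix of multiplication by \<open>z\<close>.\<close>

lemma integral_over_if_stable: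
 assumes S: "finite S" "s\<^sub>0 \<in> S" "s\<^sub>0 ~= 0" and z: "!!s. s \<in> S ==> z * s \<in> span_over S"
 shows "integral_over z"
proof -
 define n where "n = card S"
 obtain b where b: "bij_betw b {0..<n} S" using ex_bij_betw_nat_finite[OF S(1)] by (auto simp: n_def)
 have "\<forall>i\<in>{0..<n}. \<exists>c. z * b i = (\<Sum>s\<in>S. h (c s) * s)"
  using z bij_betwE[OF b] by (fastforce simp: span_over_def)
 then obtain c where c: "!!i. i < n ==> z * b i = (\<Sum>s\<in>S. h (c i s) * s)" by (auto simp: bchoice_iff)
 define A where "A = mat n n (%(i, j). c i (b j))"
 define v where "v = vec n b"
 have A: "A \<in> carrier_mat n n" by (simp add: A_def)
 define A' where "A' = map_mat h A"
 have A': "A' \<in> carrier_mat n n" using A by (simp add: A'_def)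
 have "A' *\<^sub>v v = z \<cdot>\<^sub>v v"
 proof (rule eq_vecI)
  fix i assume "i < dim_vec (z \<cdot>\<^sub>v v)"
  hence i: "i < n" by (simp add: v_def)
  have "vec_index (A' *\<^sub>v v) i = (\<Sum>j\<in>{0..<n}. h (c i (b j)) * b j)"
   using i by (simp add: A'_def A_def v_def scalar_prod_def)
  also have "... = (\<Sum>s\<in>S. h (c i s) * s)" by (rule sum.reindex_bij_betw[OF b])
  finally show "vec_index (A' *\<^sub>v v) i = vec_index (z \<cdot>\<^sub>v v) i" using i c[OF i] by (simp add: v_def)
 qed (simp add: A'_def A_def v_def)
 moreover have "v ~= 0\<^sub>v n"
 proof
  assume v: "v = 0\<^sub>v n"
  obtain i where i: "i < n" "b i = s\<^sub>0" using S(2) b by (auto simp: bij_betw_def)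
  hence "s\<^sub>0 = vec_index v i" by (simp add: v_def)
  thus False using v i S(3) by simp
 qed
 ultimately have "eigenvector A' v z" using A' by (simp add: eigenvector_def v_def)
 hence "poly (char_poly A') z = 0" using eigenvalue_root_char_poly[OF A'] by (auto simp: eigenvalue_def)
 thus ?thesis unfolding A'_def char_poly_hom[OF A] integral_over_def using degree_monic_char_poly[OF A] by metis
qed

lemma integral_over_relation:
 assumes "integral_over x" obtains m c where "m > 0" "x^m = (\<Sum>i<m. h (c i) * x^i)"
proof -
 obtain P where P: "poly (map_poly h P) x = 0" "lead_coeff P = 1" using assms unfolding integral_over_def by blast
 define m where "m = degree P"
 have dm: "degree (map_poly h P) = m" by (simp add: m_def degree_map_poly)
 have "(\<Sum>i\<le>m. h (coeff P i) * x^i) = 0" using P(1) unfolding poly_altdef dm by (simp add: coeff_map_poly)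
 hence e: "(\<Sum>i<m. h (coeff P i) * x^i) + x^m = 0" using P(2) by (simp add: m_def lessThan_Suc_atMost[symmetric])
 hence "m > 0" by (intro gr0I) simp
 moreover have "x^m = (\<Sum>i<m. h (- coeff P i) * x^i)" using e by (simp add: hom_uminus sum_negf eq_neg_iff_add_eq_0 add.commute)
 ultimately show thesis by (rule that)
qed

lemma span_over_step:
 assumes "x^m = (\<Sum>i<m. h (c i) * x^i)" "!!i. i < m ==> x^i * w \<in> span_over S" "i < m"
 shows "x * (x^i * w) \<in> span_over S"
proof (cases "Suc i < m")
 case True
 thus ?thesis using assms(2)[of "Suc i"] by (simp add: mult.assoc)
next
 case False
 hence "Suc i = m" using assms(3) by simp
 hence "x * (x^i * w) = x^m * w" by (auto simp: mult.assoc)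
 also have "... = (\<Sum>i<m. h (c i) * (x^i * w))" unfolding assms(1) by (simp add: sum_distrib_right mult.assoc)
 finally show ?thesis using assms(2) by (auto intro!: span_over_sum)
qed

text \<open>The products \<open>x^i * y^j\<close> with exponents below the two degrees span a module
  stable under \<open>x\<close> and \<open>y\<close>, to which
  \<open>integral_over_if_stable\<close> applies.\<close>

lemma integral_over_add_mult:
 assumes x: "integral_over x" and y: "integral_over y" shows "integral_over (x + y)" "integral_over (x * y)"
proof -
 obtain m c where m: "m > 0" "x^m = (\<Sum>i<m. h (c i) * x^i)" using integral_over_relation[OF x] by blast
 obtain n d where n: "n > 0" "y^n = (\<Sum>i<n. h (d i) * y^i)" using integral_over_relation[OF y] by blast
 define S where "S = (%(i, j). x^i * y^j) ` ({..<m} \<times> {..<n})"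
 have S: "finite S" by (simp add: S_def)
 have in_S: "x^i * y^j \<in> span_over S" if "i < m" "j < n" for i j
  using that by (intro span_over_base S) (auto simp: S_def)
 have "x^0 * y^0 \<in> S" using m n unfolding S_def by (intro image_eqI[of _ _ "(0, 0)"]) auto
 hence 1: "1 \<in> S" by simp
 have X: "x * s \<in> span_over S" if s: "s \<in> S" for s
 proof -
  obtain i j where "s = x^i * y^j" "i < m" "j < n" using s by (auto simp: S_def)
  thus ?thesis using span_over_step[OF m(2), of "y^j" S i] in_S by simp
 qed
 have Y: "y * s \<in> span_over S" if s: "s \<in> S" for s
 proof -
  obtain i j where "s = x^i * y^j" "i < m" "j < n" using s by (auto simp: S_def)
  moreover from this(1) have "s = y^j * x^i" by simp
  moreover have "y^k * x^i \<in> span_over S" if "k < n" "i < m" for k using in_S[OF that(2,1)] by (simp add: mult.commute)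
  ultimately show ?thesis using span_over_step[OF n(2), of "x^i" S j] by simp
 qed
 show "integral_over (x + y)"
  using span_over_mult_add[OF X Y, where a = 1] by (intro integral_over_if_stable[OF S 1]) (simp_all add: distrib_right)
 have "x * t \<in> span_over S" if t: "t \<in> span_over S" for t
 proof -
  obtain c where "t = (\<Sum>s\<in>S. h (c s) * s)" using t by (auto simp: span_over_def)
  hence "x * t = (\<Sum>s\<in>S. h (c s) * (x * s))" by (simp only: sum_distrib_left mult.left_commute)
  thus ?thesis using span_over_sum[of S "%s. x * s" S c, OF X] by simp
 qed
 thus "integral_over (x * y)" using Y by (intro integral_over_if_stable[OF S 1]) (simp_all add: mult.assoc)
qed

end

section \<open>Closure properties of algebraic numbers and algebraic integers\<close>

lemma algebraic_int_add_mult: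
 assumes "algebraic_int (x :: complex)" "algebraic_int (y :: complex)" shows "algebraic_int (x + y)" "algebraic_int (x * y)"
proof -
 note i = of_int_hom.inj_comm_ring_hom_axioms
 have "algebraic_int z \<longleftrightarrow> integral_over of_int z" for z unfolding integral_over_def[OF i] by (rule algebraic_int_altdef_ipoly)
 thus "algebraic_int (x + y)" "algebraic_int (x * y)" using integral_over_add_mult[OF i] assms by simp_all
qed

lemma algebraic_add_mult:
 assumes "algebraic (x :: complex)" "algebraic (y :: complex)" shows "algebraic (x + y)" "algebraic (x * y)"
proof -
 note i = of_rat_hom.inj_comm_ring_hom_axioms
 have "algebraic z \<longleftrightarrow> integral_over of_rat z" for z :: complex
 proof
  assume "algebraic z"
  then obtain P where P: "P ~= 0" "poly (map_poly of_int P) z = 0" by (rule algebraicE')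
  define Q :: "rat poly" where "Q = smult (inverse (of_int (lead_coeff P))) (map_poly of_int P)"
  have "map_poly of_rat Q = smult (inverse (of_int (lead_coeff P))) (map_poly of_int P :: complex poly)"
   by (simp add: Q_def map_poly_smult of_rat_mult of_rat_inverse map_poly_map_poly o_def)
  hence "poly (map_poly of_rat Q) z = 0 & lead_coeff Q = 1" using P by (simp add: Q_def degree_map_poly coeff_map_poly)
  thus "integral_over of_rat z" unfolding integral_over_def[OF i] by blast
 next
  assume "integral_over of_rat z"
  then obtain P :: "rat poly" where P: "poly (map_poly of_rat P) z = 0" "lead_coeff P = 1" unfolding integral_over_def[OF i] by blast
  have "coeff (map_poly of_rat P) i \<in> (\<rat> :: complex set)" for i by (simp add: coeff_map_poly)
  moreover have "P ~= 0" using P(2) by auto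
  ultimately show "algebraic z" using P(1) by (intro algebraicI'[of "map_poly of_rat P"]) simp_all
 qed
 thus "algebraic (x + y)" "algebraic (x * y)" using integral_over_add_mult[OF i] assms by simp_all
qed

lemma algebraic_inverse: assumes "algebraic (x :: complex)" shows "algebraic (inverse x)"
proof (cases "x = 0")
 case False
 obtain P where P: "!!i. coeff P i \<in> \<int>" "P ~= 0" "poly P x = 0" using assms unfolding algebraic_def by blast
 show ?thesis
 proof (rule algebraicI[of "reflect_poly P"])
  show "coeff (reflect_poly P) i \<in> \<int>" for i using P by (simp add: coeff_reflect_poly)
  show "poly (reflect_poly P) (inverse x) = 0" using P False by (simp add: poly_reflect_poly_nz)
 qed (use P in simp)
qed auto

lemma Qbar_closed:
 "x \<in> Qbar ==> y \<in> Qbar ==> x + y \<in> Qbar" "x \<in> Qbar ==> y \<in> Qbar ==> x * y \<in> Qbar"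
 "x \<in> Qbar ==> inverse x \<in> Qbar" "x \<in> Qbar ==> - x \<in> Qbar" "r \<in> \<rat> ==> r \<in> Qbar"
 "x \<in> Qbar ==> x^n \<in> Qbar" "(!!i. i \<in> A ==> g i \<in> Qbar) ==> sum g A \<in> Qbar"
 "(!!i. i \<in> A ==> g i \<in> Qbar) ==> prod g A \<in> Qbar" "x \<in> Qbar ==> cnj x \<in> Qbar"
proof -
 show r: "r \<in> Qbar" if "r \<in> \<rat>" for r using that by (simp add: Qbar_def rat_imp_algebraic)
 show add: "x + y \<in> Qbar" if "x \<in> Qbar" "y \<in> Qbar" for x y using that by (simp add: Qbar_def algebraic_add_mult)
 show mult: "x * y \<in> Qbar" if "x \<in> Qbar" "y \<in> Qbar" for x y using that by (simp add: Qbar_def algebraic_add_mult)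
 show "inverse x \<in> Qbar" if "x \<in> Qbar" for x using that by (simp add: Qbar_def algebraic_inverse)
 show "- x \<in> Qbar" if "x \<in> Qbar" for x using mult[OF r[of "-1"] that] by simp
 show "x^n \<in> Qbar" if "x \<in> Qbar" for x n using that by (induction n) (auto intro: mult r)
 show "sum g A \<in> Qbar" if "!!i. i \<in> A ==> g i \<in> Qbar" for g :: "'b => complex" and A
  using that by (induction A rule: infinite_finite_induct) (auto intro: add r)
 show "prod g A \<in> Qbar" if "!!i. i \<in> A ==> g i \<in> Qbar" for g :: "'c => complex" and A
  using that by (induction A rule: infinite_finite_induct) (auto intro: mult r)
 show "cnj x \<in> Qbar" if "x \<in> Qbar" for x using that by (simp add: Qbar_def)
qed

lemma Zbar_closed:
 "x \<in> Zbar ==> y \<in> Zbar ==> x + y \<in> Zbar" "x \<in> Zbar ==> y \<in> Zbar ==> x * y \<in> Zbar" "r \<in> \<int> ==> r \<in> Zbar"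
 "x \<in> Zbar ==> x^n \<in> Zbar" "(!!i. i \<in> A ==> g i \<in> Zbar) ==> sum g A \<in> Zbar"
 "(!!i. i \<in> A ==> g i \<in> Zbar) ==> prod g A \<in> Zbar" "x \<in> Zbar ==> x \<in> Qbar"
proof -
 show r: "r \<in> Zbar" if "r \<in> \<int>" for r using that by (simp add: Zbar_def int_imp_algebraic_int)
 show add: "x + y \<in> Zbar" if "x \<in> Zbar" "y \<in> Zbar" for x y using that by (simp add: Zbar_def algebraic_int_add_mult)
 show mult: "x * y \<in> Zbar" if "x \<in> Zbar" "y \<in> Zbar" for x y using that by (simp add: Zbar_def algebraic_int_add_mult)
 show "x^n \<in> Zbar" if "x \<in> Zbar" for x n using that by (induction n) (auto intro: mult r)
 show "sum g A \<in> Zbar" if "!!i. i \<in> A ==> g i \<in> Zbar" for g :: "'b => complex" and A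
  using that by (induction A rule: infinite_finite_induct) (auto intro: add r)
 show "prod g A \<in> Zbar" if "!!i. i \<in> A ==> g i \<in> Zbar" for g :: "'c => complex" and A
  using that by (induction A rule: infinite_finite_induct) (auto intro: mult r)
 show "x \<in> Zbar ==> x \<in> Qbar" by (auto simp: Zbar_def Qbar_def)
qed

lemma root_of_unity_in_Zbar: assumes "z^n = 1" "n > 0" shows "z \<in> Zbar"
 using algebraic_int_root[of 1 "monom 1 n" z] assms by (simp add: Zbar_def poly_monom degree_monom_eq)

section \<open>Automorphisms of the field of algebraic numbers\<close>

hide_const (open) module.smult

text \<open>Partial homomorphisms are kept as relations: the relation generated by a new pair
  \<open>(x, y)\<close> always exists, and being single valued becomes the separate condition on
  pairs \<open>(0, b)\<close> in \<open>partial_iso\<close>.\<close>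

definition ring_rel :: "(complex \<times> complex) set => bool"
 where "ring_rel R \<longleftrightarrow> R \<subseteq> Qbar \<times> Qbar & (\<forall>r\<in>\<rat>. (r, r) \<in> R) &
  (\<forall>x y x' y'. (x, y) \<in> R --> (x', y') \<in> R --> (x + x', y + y') \<in> R & (x * x', y * y') \<in> R)"

definition partial_iso :: "(complex \<times> complex) set => bool"
 where "partial_iso R \<longleftrightarrow> ring_rel R & (\<forall>b. (0, b) \<in> R --> b = 0)"

definition poly_rel :: "(complex \<times> complex) set => complex poly => complex poly => bool"
 where "poly_rel R g h \<longleftrightarrow> (\<forall>i. (coeff g i, coeff h i) \<in> R)"

definition adjoin_rel :: "(complex \<times> complex) set => complex => complex => (complex \<times> complex) set"
 where "adjoin_rel R x y = {(poly g x, poly h y) | g h. poly_rel R g h}"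

lemma ring_relD:
 assumes "ring_rel R"
 shows "(x, y) \<in> R ==> x \<in> Qbar" "(x, y) \<in> R ==> y \<in> Qbar" "r \<in> \<rat> ==> (r, r) \<in> R"
  "(x, y) \<in> R ==> (x', y') \<in> R ==> (x + x', y + y') \<in> R" "(x, y) \<in> R ==> (x', y') \<in> R ==> (x * x', y * y') \<in> R"
 using assms unfolding ring_rel_def by blast+

lemma ring_rel_diff: assumes "ring_rel R" "(x, y) \<in> R" "(x', y') \<in> R" shows "(x - x', y - y') \<in> R"
proof -
 have "(- 1 * x', - 1 * y') \<in> R" using assms by (intro ring_relD(3,5)) auto
 from ring_relD(4)[OF assms(1,2) this] show ?thesis by simp
qed

lemma ring_rel_sum:
 assumes "ring_rel R" "!!i. i \<in> A ==> (f i, g i) \<in> R" shows "(sum f A, sum g A) \<in> R"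
 using assms(2) by (induction A rule: infinite_finite_induct) (auto intro: ring_relD(3,4)[OF assms(1)])

lemma ring_rel_power: "ring_rel R ==> (x, y) \<in> R ==> (x^n, y^n) \<in> R"
 by (induction n) (auto intro: ring_relD(3,5))

lemma ring_rel_converse: "ring_rel R ==> ring_rel (R\<inverse>)" unfolding ring_rel_def by blast

lemma ring_rel_poly:
 assumes "ring_rel R" "poly_rel R g h" "(x, y) \<in> R" shows "(poly g x, poly h y) \<in> R"
proof -
 define n where "n = max (degree g) (degree h)"
 have "poly g x = (\<Sum>i\<le>n. coeff g i * x^i)" "poly h y = (\<Sum>i\<le>n. coeff h i * y^i)"
  by (auto simp: n_def poly_altdef le_degree intro!: sum.mono_neutral_left)
 thus ?thesis using assms
  by (auto simp: poly_rel_def intro!: ring_rel_sum[OF assms(1)] ring_relD(5)[OF assms(1)] ring_rel_power[OF assms(1)])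
qed

text \<open>If \<open>(a, 0)\<close> is in the relation with \<open>a ~= 0\<close>, an integral equation of \<open>a\<close> with nonzero
 constant term \<open>c\<close> puts \<open>(0, c)\<close> into it.\<close>

lemma partial_iso_zero:
 assumes "partial_iso R" "(a, 0) \<in> R" shows "a = 0"
proof (rule ccontr)
 assume a: "a ~= 0"
 have R: "ring_rel R" using assms by (simp add: partial_iso_def)
 have "algebraic a" using ring_relD(1)[OF R assms(2)] by (simp add: Qbar_def)
 then obtain P where P: "P ~= 0" "coeff P 0 ~= 0" "poly (map_poly of_int P) a = 0" using a by (rule algebraicE'_nonzero)
 have "poly_rel R (map_poly of_int P) (map_poly of_int P)"
  unfolding poly_rel_def by (auto simp: coeff_map_poly intro!: ring_relD(3)[OF R])
 from ring_rel_poly[OF R this assms(2)] P(3) have "(0, of_int (coeff P 0)) \<in> R" by (simp add: poly_0_coeff_0 coeff_map_poly)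
 thus False using assms(1) P(2) by (auto simp: partial_iso_def)
qed

lemma partial_iso_converse: "partial_iso R ==> partial_iso (R\<inverse>)"
 using partial_iso_zero[of R] ring_rel_converse[of R] by (auto simp: partial_iso_def)

lemma poly_rel_mult: assumes "ring_rel R" "poly_rel R g h" "poly_rel R g' h'" shows "poly_rel R (g * g') (h * h')"
 using assms unfolding poly_rel_def coeff_mult by (auto intro!: ring_rel_sum[OF assms(1)] ring_relD(5)[OF assms(1)])

lemma poly_rel_pCons: assumes "ring_rel R" shows "poly_rel R (pCons a g) (pCons b h) \<longleftrightarrow> (a, b) \<in> R & poly_rel R g h"
proof
 assume "poly_rel R (pCons a g) (pCons b h)"
 hence "(coeff (pCons a g) 0, coeff (pCons b h) 0) \<in> R" "(coeff (pCons a g) (Suc i), coeff (pCons b h) (Suc i)) \<in> R" for i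
  unfolding poly_rel_def by blast+
 thus "(a, b) \<in> R & poly_rel R g h" by (simp add: poly_rel_def)
next
 assume "(a, b) \<in> R & poly_rel R g h"
 thus "poly_rel R (pCons a g) (pCons b h)" unfolding poly_rel_def by (auto simp: coeff_pCons split: nat.split)
qed

lemma poly_rel_diff_smult:
 assumes "ring_rel R" "poly_rel R g h" "(c, d) \<in> R" "!!i. coeff f i \<in> \<rat>"
 shows "poly_rel R (g - smult c f) (h - smult d f)"
 using assms unfolding poly_rel_def coeff_diff coeff_smult
 by (auto intro!: ring_rel_diff[OF assms(1)] ring_relD(3,5)[OF assms(1)])

text \<open>Division by a monic polynomial with rational coefficients uses ring operations only, so
  it can be carried out in parallel on both sides, one coefficient at a time.\<close>

lemma poly_rel_mod:
 assumes R: "partial_iso R" and f: "lead_coeff f = 1" "!!i. coeff f i \<in> \<rat>"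
 shows "poly_rel R g h ==> poly_rel R (g mod f) (h mod f)"
proof (induction g arbitrary: h rule: pCons_induct)
 case 0
 hence "h = 0" using R by (auto simp: poly_rel_def partial_iso_def poly_eq_iff)
 thus ?case using 0 by simp
next
 case (pCons a g)
 have ring: "ring_rel R" using R by (simp add: partial_iso_def)
 obtain b h' where h: "h = pCons b h'" by (cases h)
 have ab: "(a, b) \<in> R" "poly_rel R g h'" using pCons(3) poly_rel_pCons[OF ring] by (auto simp: h)
 define G where "G = pCons a (g mod f)"
 define H where "H = pCons b (h' mod f)"
 have GH: "poly_rel R G H" using pCons(2)[OF ab(2)] ab poly_rel_pCons[OF ring] by (simp add: G_def H_def)
 hence "poly_rel R (G - smult (coeff G (degree f)) f) (H - smult (coeff H (degree f)) f)"
  by (intro poly_rel_diff_smult[OF ring GH _ f(2)]) (simp add: poly_rel_def)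
 moreover have "f ~= 0" using f(1) by auto
 ultimately show ?case using f(1) by (simp add: h mod_pCons G_def H_def)
qed

lemma adjoin_rel:
 assumes R: "ring_rel R" and x: "x \<in> Qbar" "y \<in> Qbar"
 shows "ring_rel (adjoin_rel R x y)" "R \<subseteq> adjoin_rel R x y" "(x, y) \<in> adjoin_rel R x y"
proof -
 have sub: "(a, b) \<in> adjoin_rel R x y" if "(a, b) \<in> R" for a b
 proof -
  have "poly_rel R [:a:] [:b:]" using that ring_relD(3)[OF R, of 0] by (auto simp: poly_rel_def coeff_pCons split: nat.split)
  thus ?thesis unfolding adjoin_rel_def by (intro CollectI exI[of _ "[:a:]"] exI[of _ "[:b:]"]) simp
 qed
 thus "R \<subseteq> adjoin_rel R x y" by auto
 have "poly_rel R [:0, 1:] [:0, 1:]" using ring_relD(3)[OF R] by (auto simp: poly_rel_def coeff_pCons split: nat.split)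
 thus "(x, y) \<in> adjoin_rel R x y" unfolding adjoin_rel_def by (intro CollectI exI[of _ "[:0, 1:]"]) simp
 have Q: "poly g x \<in> Qbar & poly h y \<in> Qbar" if "poly_rel R g h" for g h
  using that x ring_relD(1,2)[OF R] unfolding poly_altdef poly_rel_def by (blast intro: Qbar_closed)
 have add: "poly_rel R (g + g') (h + h')" if "poly_rel R g h" "poly_rel R g' h'" for g h g' h'
  using that by (auto simp: poly_rel_def intro: ring_relD(4)[OF R])
 show "ring_rel (adjoin_rel R x y)" unfolding ring_rel_def
 proof (intro conjI allI impI ballI)
  show "adjoin_rel R x y \<subseteq> Qbar \<times> Qbar" using Q by (auto simp: adjoin_rel_def)
  show "(r, r) \<in> adjoin_rel R x y" if "r \<in> \<rat>" for r using sub ring_relD(3)[OF R that] by blast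
  fix a b a' b' assume "(a, b) \<in> adjoin_rel R x y" "(a', b') \<in> adjoin_rel R x y"
  then obtain g h g' h' where *: "a = poly g x" "b = poly h y" "a' = poly g' x" "b' = poly h' y" "poly_rel R g h" "poly_rel R g' h'"
   unfolding adjoin_rel_def by blast
  show "(a + a', b + b') \<in> adjoin_rel R x y" unfolding adjoin_rel_def
   using add[OF *(5,6)] by (intro CollectI exI[of _ "g + g'"] exI[of _ "h + h'"]) (simp add: *)
  show "(a * a', b * b') \<in> adjoin_rel R x y" unfolding adjoin_rel_def
   using poly_rel_mult[OF R *(5,6)] by (intro CollectI exI[of _ "g * g'"] exI[of _ "h * h'"]) (simp add: *)
 qed
qed

lemma monic_rational_poly:
 assumes "x \<in> Qbar" obtains f :: "complex poly" where "lead_coeff f = 1" "!!i. coeff f i \<in> \<rat>" "poly f x = 0"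
proof -
 obtain P where P: "!!i. coeff P i \<in> \<int>" "P ~= 0" "poly P x = 0" using assms unfolding Qbar_def mem_Collect_eq algebraic_def by blast
 have "coeff P i \<in> \<rat>" for i using P(1)[of i] Ints_subset_Rats by blast
 thus thesis using P(2,3) by (intro that[of "smult (inverse (lead_coeff P)) P"]) auto
qed

text \<open>Were the relation \<open>x \<mapsto> y\<close> contradictory for each root \<open>y\<close> of \<open>f\<close>, the product of the polynomials witnessing
 this would be divisible by \<open>f\<close> on one side only.\<close>

lemma partial_iso_extend:
 assumes R: "partial_iso R" and x: "x \<in> Qbar" obtains R' y where "partial_iso R'" "R \<subseteq> R'" "(x, y) \<in> R'"
proof -
 have ring: "ring_rel R" using R by (simp add: partial_iso_def)
 obtain f where f: "lead_coeff f = 1" "!!i. coeff f i \<in> \<rat>" "poly f x = 0" using monic_rational_poly[OF x] by blast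
 hence "f ~= 0" by auto
 then obtain A where A: "f = (\<Prod>y\<in>#A. [:-y, 1:])" using alg_closed_imp_factorization[of f] f(1) by auto
 have "\<exists>y\<in>#A. \<forall>g h. poly_rel R g h --> poly h y = 0 --> poly g x = 0"
 proof (rule ccontr)
  assume "\<not> ?thesis"
  hence "\<forall>y\<in>#A. \<exists>gh. poly_rel R (fst gh) (snd gh) & poly (snd gh) y = 0 & poly (fst gh) x ~= 0" by auto
  then obtain gh where gh: "!!y. y \<in># A ==> poly_rel R (fst (gh y)) (snd (gh y)) & poly (snd (gh y)) y = 0 & poly (fst (gh y)) x ~= 0"
   by metis
  define g where "g B = (\<Prod>y\<in>#B. fst (gh y))" for B
  define h where "h B = (\<Prod>y\<in>#B. snd (gh y))" for B
  have "poly_rel R (g B) (h B) & (\<Prod>y\<in>#B. [:-y, 1:]) dvd h B & poly (g B) x ~= 0" if "B \<subseteq># A" for B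
   using that
  proof (induction B)
   case empty
   have "poly_rel R 1 1" using ring_relD(3)[OF ring] by (auto simp: poly_rel_def coeff_1)
   thus ?case by (simp add: g_def h_def)
  next
   case (add y B)
   have y: "y \<in># A" using add(2) by (meson mset_subset_eqD union_single_eq_member)
   have B: "B \<subseteq># A" using add(2) by (metis add_mset_add_single mset_subset_eq_add_left subset_mset.order_trans)
   have "[:-y, 1:] dvd snd (gh y)" using gh[OF y] by (simp add: poly_eq_0_iff_dvd)
   thus ?case using add(1)[OF B] gh[OF y]
    by (auto simp: g_def h_def intro!: poly_rel_mult[OF ring] mult_dvd_mono simp del: mult_pCons_left)
  qed
  from this[of A] have *: "poly_rel R (g A) (h A)" "f dvd h A" "poly (g A) x ~= 0" using A by auto
  have "poly_rel R (g A mod f) 0" using poly_rel_mod[OF R f(1,2) *(1)] *(2) by (simp add: mod_eq_0_iff_dvd)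
  hence "g A mod f = 0" using partial_iso_zero[OF R] by (auto simp: poly_rel_def poly_eq_iff)
  hence "f dvd g A" by (simp add: mod_eq_0_iff_dvd)
  thus False using f(3) *(3) by (auto elim!: dvdE)
 qed
 then obtain y where y: "y \<in># A" "!!g h. poly_rel R g h ==> poly h y = 0 ==> poly g x = 0" by blast
 have "poly f y = 0" using y(1) unfolding A by (auto simp: poly_prod_mset prod_mset_zero_iff)
 hence "y \<in> Qbar" using f(2) \<open>f ~= 0\<close> algebraicI'[of f y] by (simp add: Qbar_def)
 note ad = adjoin_rel[OF ring x this]
 \<comment> \<open>The choice of \<open>y\<close> says that a pair with second entry 0 has first
   entry 0, which is the condition on the converse relation.\<close>
 have "partial_iso ((adjoin_rel R x y)\<inverse>)" using ring_rel_converse[OF ad(1)] y(2) by (auto simp: partial_iso_def adjoin_rel_def)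
 from partial_iso_converse[OF this] ad show thesis using that by auto
qed

text \<open>Zorn's lemma gives a maximal relation. By \<open>partial_iso_extend\<close> every
  algebraic number is in its domain, and the same argument for the converse gives
  surjectivity.\<close>

theorem partial_iso_automorphism:
 assumes R0: "partial_iso R0" obtains s where "s \<in> Gal Qbar" "!!x y. (x, y) \<in> R0 ==> s x = y"
proof -
 have "\<exists>M\<in>{R. partial_iso R & R0 \<subseteq> R}. \<forall>X\<in>{R. partial_iso R & R0 \<subseteq> R}. M \<subseteq> X --> X = M"
 proof (rule subset_Zorn_nonempty)
  fix C assume C: "C ~= {}" "subset.chain {R. partial_iso R & R0 \<subseteq> R} C"
  hence p: "!!R. R \<in> C ==> partial_iso R & R0 \<subseteq> R" and ch: "!!R S. R \<in> C ==> S \<in> C ==> R \<subseteq> S \<or> S \<subseteq> R"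
   unfolding subset_chain_def by blast+
  have ring: "ring_rel R" if "R \<in> C" for R using p[OF that] by (simp add: partial_iso_def)
  obtain R1 where R1: "R1 \<in> C" using C(1) by blast
  have "ring_rel (\<Union>C)" unfolding ring_rel_def
  proof (intro conjI allI impI ballI)
   show "\<Union>C \<subseteq> Qbar \<times> Qbar" using ring unfolding ring_rel_def by blast
   show "(r, r) \<in> \<Union>C" if "r \<in> \<rat>" for r using ring_relD(3)[OF ring[OF R1] that] R1 by blast
   fix x y x' y' assume "(x, y) \<in> \<Union>C" "(x', y') \<in> \<Union>C"
   then obtain R S where RS: "R \<in> C" "S \<in> C" "(x, y) \<in> R" "(x', y') \<in> S" by blast
   then obtain T where T: "T \<in> C" "(x, y) \<in> T" "(x', y') \<in> T" using ch[of R S] by blast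
   show "(x + x', y + y') \<in> \<Union>C" using ring_relD(4)[OF ring T(2,3)] T(1) by blast
   show "(x * x', y * y') \<in> \<Union>C" using ring_relD(5)[OF ring T(2,3)] T(1) by blast
  qed
  moreover have "b = 0" if "(0, b) \<in> \<Union>C" for b using that p unfolding partial_iso_def by blast
  moreover have "R0 \<subseteq> \<Union>C" using p R1 by blast
  ultimately show "\<Union>C \<in> {R. partial_iso R & R0 \<subseteq> R}" by (simp add: partial_iso_def)
 qed (use R0 in blast)
 then obtain M where M': "M \<in> {R. partial_iso R & R0 \<subseteq> R}" and mx: "\<forall>X\<in>{R. partial_iso R & R0 \<subseteq> R}. M \<subseteq> X --> X = M"
  by (rule bexE)
 have M: "partial_iso M" "R0 \<subseteq> M" using M' by simp_all
 have max: "X = M" if "partial_iso X" "R0 \<subseteq> X" "M \<subseteq> X" for X using mx that by simp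
 have ring: "ring_rel M" using M by (simp add: partial_iso_def)
 have dom: "\<exists>y. (x, y) \<in> M" if "x \<in> Qbar" for x
 proof -
  obtain R' y where "partial_iso R'" "M \<subseteq> R'" "(x, y) \<in> R'" using partial_iso_extend[OF M(1) \<open>x \<in> Qbar\<close>] by blast
  thus ?thesis using max[of R'] M(2) by blast
 qed
 have ran: "\<exists>x. (x, y) \<in> M" if "y \<in> Qbar" for y
 proof -
  obtain R' x where R': "partial_iso R'" "M\<inverse> \<subseteq> R'" "(y, x) \<in> R'" using partial_iso_extend[OF partial_iso_converse[OF M(1)] \<open>y \<in> Qbar\<close>] by blast
  have sub: "M \<subseteq> R'\<inverse>" using R'(2) by auto
  hence "R'\<inverse> = M" using max[OF partial_iso_converse[OF R'(1)]] M(2) by (meson order_trans)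
  thus ?thesis using R'(3) by blast
 qed
 have uniq: "y = y'" if "(x, y) \<in> M" "(x, y') \<in> M" for x y y'
  using ring_rel_diff[OF ring that] M(1) by (auto simp: partial_iso_def)
 have uniq': "x = x'" if "(x, y) \<in> M" "(x', y) \<in> M" for x x' y
  using ring_rel_diff[OF ring that] partial_iso_zero[OF M(1), of "x - x'"] by simp
 define s where "s = restrict (%x. THE y. (x, y) \<in> M) Qbar"
 have s: "s x = y" if "(x, y) \<in> M" for x y
  using that uniq ring_relD(1)[OF ring that] unfolding s_def by (auto intro!: the_equality)
 have sM: "(x, s x) \<in> M" if "x \<in> Qbar" for x using dom[OF that] s by blast
 have "bij_betw s Qbar Qbar"
 proof (rule bij_betwI')
  fix x y assume "x \<in> Qbar" "y \<in> Qbar"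
  thus "s x = s y \<longleftrightarrow> x = y" using sM uniq' by metis
 next
  fix x assume "x \<in> Qbar"
  thus "s x \<in> Qbar" using sM ring_relD(2)[OF ring] by blast
 next
  fix y assume "y \<in> Qbar"
  thus "\<exists>x\<in>Qbar. y = s x" using ran s ring_relD(1)[OF ring] by metis
 qed
 moreover have "s \<in> Qbar \<rightarrow>\<^sub>E Qbar" using sM ring_relD(2)[OF ring] by (auto simp: s_def)
 moreover have "s (x + y) = s x + s y & s (x * y) = s x * s y" if "x \<in> Qbar" "y \<in> Qbar" for x y
  using s ring_relD(4,5)[OF ring sM[OF that(1)] sM[OF that(2)]] by blast
 ultimately have "s \<in> Gal Qbar" by (simp add: Gal_def)
 thus thesis using that s M(2) by blast
qed

text \<open>Let \<open>f\<close> be monic with rational coefficients, of least degree with root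
  \<open>x\<close>. For any root \<open>y\<close> of \<open>f\<close>, sending \<open>x\<close> to
  \<open>y\<close> extends to an automorphism, so \<open>y = x\<close> and \<open>f\<close> is a
  power of X - x with some exponent n. Its coefficient next to the leading one is -n x, so
  \<open>x\<close> is rational.\<close>

lemma fixed_by_Gal_rational:
 assumes x: "x \<in> Qbar" "!!s. s \<in> Gal Qbar ==> s x = x" shows "x \<in> \<rat>"
proof -
 define F where "F = {f :: complex poly. lead_coeff f = 1 & (\<forall>i. coeff f i \<in> \<rat>) & poly f x = 0}"
 obtain f0 where "f0 \<in> F" using monic_rational_poly[OF x(1)] unfolding F_def by blast
 then obtain f where fF: "f \<in> F" and min: "!!g. g \<in> F ==> degree f \<le> degree g"
  using arg_min_nat_lemma[of "%f. f \<in> F" f0 degree] by blast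
 have f: "lead_coeff f = 1" "!!i. coeff f i \<in> \<rat>" "poly f x = 0" using fF by (auto simp: F_def)
 hence f0: "f ~= 0" by auto
 define Q where "Q = {(r, r) | r :: complex. r \<in> \<rat>}"
 have Q: "partial_iso Q" unfolding partial_iso_def ring_rel_def Q_def by (auto intro: Qbar_closed)
 have ringQ: "ring_rel Q" using Q by (simp add: partial_iso_def)
 have pQ: "g = h & (\<forall>i. coeff g i \<in> \<rat>)" if "poly_rel Q g h" for g h
  using that unfolding poly_rel_def Q_def by (auto simp: poly_eq_iff)
 have dvd: "f dvd g" if g: "!!i. coeff g i \<in> \<rat>" "poly g x = 0" for g
 proof -
  define r where "r = g mod f"
  have "poly_rel Q g g" using g by (auto simp: poly_rel_def Q_def)
  from pQ[OF poly_rel_mod[OF Q f(1,2) this]] have r: "!!i. coeff r i \<in> \<rat>" by (simp add: r_def)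
  have "poly g x = poly (g div f * f + r) x" by (simp add: r_def)
  hence rx: "poly r x = 0" using g(2) f(3) by simp
  have "r = 0"
  proof (rule ccontr)
   assume r0: "r ~= 0"
   hence "smult (inverse (lead_coeff r)) r \<in> F" using r rx by (auto simp: F_def)
   hence "degree f \<le> degree r" using min[of "smult (inverse (lead_coeff r)) r"] r0 by simp
   thus False using degree_mod_less'[of f g] f0 r0 by (simp add: r_def)
  qed
  thus ?thesis by (simp add: r_def mod_eq_0_iff_dvd)
 qed
 obtain A where A: "size A = degree f" "f = (\<Prod>y\<in>#A. [:-y, 1:])" using alg_closed_imp_factorization[OF f0] f(1) by auto
 have "y = x" if y: "y \<in># A" for y
 proof -
  have fy: "poly f y = 0" using y unfolding A(2) by (auto simp: poly_prod_mset prod_mset_zero_iff)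
  hence yQ: "y \<in> Qbar" using f(2) f0 algebraicI'[of f y] by (simp add: Qbar_def)
  note ad = adjoin_rel[OF ringQ x(1) yQ]
  have "b = 0" if b: "(0, b) \<in> adjoin_rel Q x y" for b
  proof -
   obtain g h where gh: "poly_rel Q g h" "poly g x = 0" "b = poly h y" using b unfolding adjoin_rel_def by auto
   hence "f dvd g" "g = h" using dvd pQ by blast+
   thus ?thesis using fy gh(3) by (auto elim!: dvdE)
  qed
  hence "partial_iso (adjoin_rel Q x y)" using ad(1) by (simp add: partial_iso_def)
  from partial_iso_automorphism[OF this] obtain s where s: "s \<in> Gal Qbar" "!!a b. (a, b) \<in> adjoin_rel Q x y ==> s a = b" by blast
  show ?thesis using x(2)[OF s(1)] s(2)[OF ad(3)] by simp
 qed
 hence "A = replicate_mset (size A) x" by (metis set_mset_subset_singletonD subsetI singleton_iff)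
 then obtain n where n: "A = replicate_mset n x" by blast
 hence fe: "f = [:-x, 1:]^n" using A(2) by simp
 have "n ~= 0" using f(3) fe by (intro notI) simp
 then obtain m where m: "n = Suc m" by (cases n) auto
 have "coeff ([:-x, 1:]^Suc k) k = - of_nat (Suc k) * x" for k
 proof (induction k)
  case (Suc k)
  have "coeff ([:-x, 1:]^Suc (Suc k)) (Suc k) = - x * coeff ([:-x, 1:]^Suc k) (Suc k) + coeff ([:-x, 1:]^Suc k) k"
   unfolding power_Suc[of _ "Suc k"] by simp
  thus ?case unfolding Suc coeff_linear_power by (simp add: algebra_simps)
 qed simp
 hence "- of_nat (Suc m) * x \<in> \<rat>" using f(2)[of m] unfolding fe m by simp
 hence "- of_nat (Suc m) * x / - of_nat (Suc m) \<in> \<rat>" by (rule Rats_divide) simp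
 thus ?thesis by (simp del: of_nat_Suc)
qed

definition subring_Qbar :: "complex set => bool"
 where "subring_Qbar F \<longleftrightarrow> \<rat> \<subseteq> F & F \<subseteq> Qbar & (\<forall>x\<in>F. \<forall>y\<in>F. x + y \<in> F & x * y \<in> F)"

lemma subring_QbarD:
 assumes "subring_Qbar F"
 shows "r \<in> \<rat> ==> r \<in> F" "x \<in> F ==> x \<in> Qbar" "x \<in> F ==> y \<in> F ==> x + y \<in> F" "x \<in> F ==> y \<in> F ==> x * y \<in> F"
  "x \<in> F ==> - x \<in> F" "x \<in> F ==> x^n \<in> F" "(!!i. i \<in> A ==> g i \<in> F) ==> sum g A \<in> F"
  "(!!i. i \<in> A ==> g i \<in> F) ==> prod g A \<in> F"
proof -
 show r: "r \<in> F" if "r \<in> \<rat>" for r using assms that by (auto simp: subring_Qbar_def)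
 show "x \<in> Qbar" if "x \<in> F" for x using assms that by (auto simp: subring_Qbar_def)
 show add: "x + y \<in> F" if "x \<in> F" "y \<in> F" for x y using assms that by (auto simp: subring_Qbar_def)
 show mult: "x * y \<in> F" if "x \<in> F" "y \<in> F" for x y using assms that by (auto simp: subring_Qbar_def)
 show "- x \<in> F" if "x \<in> F" for x using mult[OF r[of "-1"] that] by simp
 show "x^n \<in> F" if "x \<in> F" for x n using that by (induction n) (auto intro: mult r)
 show "sum g A \<in> F" if "!!i. i \<in> A ==> g i \<in> F" for g :: "'b => complex" and A
  using that by (induction A rule: infinite_finite_induct) (auto intro: add r)
 show "prod g A \<in> F" if "!!i. i \<in> A ==> g i \<in> F" for g :: "'c => complex" and A
  using that by (induction A rule: infinite_finite_induct) (auto intro: mult r)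
qed

lemma subring_Qbar_Qbar: "subring_Qbar Qbar" by (auto simp: subring_Qbar_def intro: Qbar_closed)

definition ring_hom_on :: "complex set => (complex => 'b::field_char_0) => bool"
 where "ring_hom_on F h \<longleftrightarrow> h 1 = 1 & (\<forall>x\<in>F. \<forall>y\<in>F. h (x + y) = h x + h y & h (x * y) = h x * h y)"

lemma ring_hom_onD:
 assumes F: "subring_Qbar F" and hom: "ring_hom_on F h"
 shows "h (of_rat r) = of_rat r" "x \<in> F ==> h (- x) = - h x"
  "x \<in> F ==> h (x^n) = h x^n" "(!!i. i \<in> A ==> g i \<in> F) ==> h (sum g A) = (\<Sum>i\<in>A. h (g i))"
  "(!!i. i \<in> A ==> g i \<in> F) ==> h (prod g A) = (\<Prod>i\<in>A. h (g i))" "h (of_nat k) = of_nat k" "h (of_int j) = of_int j"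
  "h 0 = 0" "x \<in> F ==> (!!i. coeff P i \<in> \<rat>) ==> h (poly P x) = (\<Sum>i\<le>degree P. h (coeff P i) * h x^i)"
proof -
 note D = subring_QbarD[OF F]
 have h: "h 1 = 1" "!!x y. x \<in> F ==> y \<in> F ==> h (x + y) = h x + h y"
  "!!x y. x \<in> F ==> y \<in> F ==> h (x * y) = h x * h y" using hom by (auto simp: ring_hom_on_def)
 have "h 0 + h 0 = h 0" using h(2)[of 0 0] D(1)[of 0] by simp
 thus 0: "h 0 = 0" by simp
 show nat: "h (of_nat k) = of_nat k" for k by (induction k) (simp_all add: 0 h D(1))
 show m: "h (- x) = - h x" if "x \<in> F" for x
  using h(2)[OF that D(5)[OF that]] 0 by (simp add: eq_neg_iff_add_eq_0 add.commute)
 show int: "h (of_int j) = of_int j" for j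
  by (cases j rule: int_cases2) (simp_all add: nat m D(1))
 show "h (of_rat r) = of_rat r"
 proof -
  obtain a b where q: "quotient_of r = (a, b)" by (cases "quotient_of r")
  have b: "b > 0" and r: "r = of_int a / of_int b" using q quotient_of_denom_pos quotient_of_div by blast+
  have "of_rat r * of_int b = (of_int a :: complex)" using b by (simp add: r of_rat_divide)
  hence "h (of_rat r) * of_int b = of_int a" using h(3)[of "of_rat r" "of_int b"] D(1) int by simp
  thus ?thesis using b by (simp add: r of_rat_divide field_simps)
 qed
 show pow: "h (x^n) = h x^n" if "x \<in> F" for x n using that by (induction n) (simp_all add: h D)
 show sum: "h (sum g A) = (\<Sum>i\<in>A. h (g i))" if "!!i. i \<in> A ==> g i \<in> F" for g :: "'c => complex" and A
  using that by (induction A rule: infinite_finite_induct) (simp_all add: 0 h D(7))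
 show "h (prod g A) = (\<Prod>i\<in>A. h (g i))" if "!!i. i \<in> A ==> g i \<in> F" for g :: "'d => complex" and A
  using that by (induction A rule: infinite_finite_induct) (simp_all add: h D(8))
 show "h (poly P x) = (\<Sum>i\<le>degree P. h (coeff P i) * h x^i)" if "x \<in> F" "!!i. coeff P i \<in> \<rat>" for P x
  unfolding poly_altdef using that by (subst sum) (simp_all add: h(3) pow D)
qed

lemma qbar_embedding_hom: "qbar_embedding h ==> ring_hom_on Qbar h" by (simp add: qbar_embedding_def ring_hom_on_def)

lemma GalD:
 assumes F: "subring_Qbar F" and "s \<in> Gal F"
 shows "x \<in> F ==> s x \<in> F" "x \<in> F ==> y \<in> F ==> s (x + y) = s x + s y" "x \<in> F ==> y \<in> F ==> s (x * y) = s x * s y"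
  "s 1 = 1" "x \<in> F ==> s x = 0 \<longleftrightarrow> x = 0"
proof -
 have *: "s \<in> F \<rightarrow>\<^sub>E F" "inj_on s F" "!!x y. x \<in> F ==> y \<in> F ==> s (x + y) = s x + s y & s (x * y) = s x * s y"
  using assms(2) by (auto simp: Gal_def bij_betw_def)
 thus "x \<in> F ==> s x \<in> F" "x \<in> F ==> y \<in> F ==> s (x + y) = s x + s y" "x \<in> F ==> y \<in> F ==> s (x * y) = s x * s y" by auto
 have in_F: "0 \<in> F" "1 \<in> F" using subring_QbarD(1)[OF F] by auto
 have "s 0 = 0" using *(3)[OF in_F(1) in_F(1)] by simp
 thus z: "s x = 0 \<longleftrightarrow> x = 0" if "x \<in> F" for x using inj_onD[OF *(2), of x 0] in_F that by auto
 show "s 1 = 1" using *(3)[OF in_F(2) in_F(2)] z[OF in_F(2)] by simp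
qed

lemma Gal_ring_hom: "subring_Qbar F ==> s \<in> Gal F ==> ring_hom_on F s"
 using GalD[of F s] by (simp add: ring_hom_on_def)

abbreviation GQ where "GQ \<equiv> Gal Qbar"

lemmas GQD = GalD[OF subring_Qbar_Qbar]
lemmas GQ_hom = ring_hom_onD[OF subring_Qbar_Qbar Gal_ring_hom[OF subring_Qbar_Qbar]]

lemma Gal_extend:
 assumes F: "subring_Qbar F" and t: "t \<in> Gal F" obtains s where "s \<in> GQ" "!!x. x \<in> F ==> s x = t x"
proof -
 define R where "R = {(x, t x) | x. x \<in> F}"
 note D = subring_QbarD[OF F] and G = GalD[OF F t]
 have r: "t r = r" if "r \<in> \<rat>" for r
  using that ring_hom_onD(1)[OF F Gal_ring_hom[OF F t]] by (auto elim!: Rats_cases)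
 have "partial_iso R" unfolding partial_iso_def ring_rel_def R_def
  using D G r by (auto 0 3)
 from partial_iso_automorphism[OF this] obtain s where s: "s \<in> GQ" "!!x y. (x, y) \<in> R ==> s x = y" by blast
 thus thesis using that[of s] by (auto simp: R_def)
qed

lemma Gal_compose: assumes "s \<in> GQ" "t \<in> GQ" shows "compose Qbar s t \<in> GQ"
proof -
 have "bij_betw (compose Qbar s t) Qbar Qbar" using assms by (intro bij_betw_compose[of t Qbar Qbar]) (auto simp: Gal_def)
 moreover have "compose Qbar s t \<in> Qbar \<rightarrow>\<^sub>E Qbar" using GQD(1)[OF assms(1)] GQD(1)[OF assms(2)] by (auto simp: compose_def)
 ultimately show ?thesis using GQD[OF assms(1)] GQD[OF assms(2)] Qbar_closed(1,2) by (auto simp: Gal_def compose_def)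
qed

lemma Gal_inverse:
 assumes s: "s \<in> GQ" obtains r where "r \<in> GQ" "!!x. x \<in> Qbar ==> r (s x) = x" "!!x. x \<in> Qbar ==> s (r x) = x"
proof -
 have b: "bij_betw s Qbar Qbar" using s by (simp add: Gal_def)
 define r where "r = restrict (inv_into Qbar s) Qbar"
 have b': "bij_betw r Qbar Qbar" unfolding r_def using bij_betw_inv_into[OF b] by (simp cong: bij_betw_cong)
 have 1: "r (s x) = x" if "x \<in> Qbar" for x using that b GQD(1)[OF s that] by (simp add: r_def bij_betw_def)
 have 2: "s (r x) = x" if "x \<in> Qbar" for x using that b by (auto simp: r_def bij_betw_def intro: f_inv_into_f)
 have c: "r x \<in> Qbar" if "x \<in> Qbar" for x using b' that by (auto simp: bij_betw_def)
 have "r (x + y) = r x + r y & r (x * y) = r x * r y" if "x \<in> Qbar" "y \<in> Qbar" for x y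
  using 1[of "r x + r y"] 1[of "r x * r y"] GQD(2,3)[OF s, of "r x" "r y"] 2 c that Qbar_closed(1,2) by simp
 hence "r \<in> GQ" using b' c by (auto simp: Gal_def r_def)
 thus thesis using that 1 2 by blast
qed

lemma cnj_in_Gal: "restrict cnj Qbar \<in> GQ"
proof -
 have "bij_betw cnj Qbar Qbar" by (rule bij_betw_byWitness[of _ cnj]) (auto intro: Qbar_closed)
 thus ?thesis by (auto simp: Gal_def intro: Qbar_closed cong: bij_betw_cong)
qed

lemma Gal_poly:
 assumes "s \<in> GQ" "x \<in> Qbar" "!!i. coeff P i \<in> \<rat>" shows "s (poly P x) = poly P (s x)"
proof -
 have "s (coeff P i) = coeff P i" for i
  using assms(3)[of i] GQ_hom(1)[OF assms(1)] by (auto elim!: Rats_cases)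
 thus ?thesis using GQ_hom(9)[OF assms(1) assms(2,3)] by (simp add: poly_altdef)
qed

lemma Gal_Zbar: assumes "s \<in> GQ" "x \<in> Zbar" shows "s x \<in> Zbar"
proof -
 have "algebraic_int x" using assms(2) by (simp add: Zbar_def)
 then obtain P where P: "lead_coeff P = 1" "\<forall>i. coeff P i \<in> \<int>" "poly P x = 0" by (auto simp: algebraic_int.simps)
 have "poly P (s x) = s (poly P x)"
  using P(2) Ints_subset_Rats Zbar_closed(7)[OF assms(2)] by (intro Gal_poly[symmetric] assms(1)) auto
 thus ?thesis using P GQ_hom(8)[OF assms(1)] by (auto simp: Zbar_def intro: algebraic_int.intros)
qed

lemma finite_orbit: assumes "w \<in> Qbar" shows "finite {s w | s. s \<in> GQ}"
proof -
 obtain P where P: "lead_coeff P = 1" "!!i. coeff P i \<in> \<rat>" "poly P w = 0" using monic_rational_poly[OF assms] by blast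
 have "poly P (s w) = 0" if "s \<in> GQ" for s
  using Gal_poly[OF that assms P(2)] P(3) GQ_hom(8)[OF that] by simp
 hence "{s w | s. s \<in> GQ} \<subseteq> {x. poly P x = 0}" by auto
 moreover have "P ~= 0" using P(1) by auto
 ultimately show ?thesis using poly_roots_finite finite_subset by blast
qed

text \<open>The power sums are integers bounded by \<open>card A\<close>, so a window of
  \<open>card A\<close> consecutive ones recurs at two positions \<open>k < l\<close>. Weighting by
  the polynomial \<open>Q\<close>, which vanishes on \<open>A\<close> except at \<open>w\<close>,
  isolates \<open>w^k = w^l\<close>.\<close>

lemma bounded_power_sums_root_of_unity:
 assumes O: "finite A" "w \<in> A" "w ~= 0" and s: "!!k. (\<Sum>v\<in>A. v^k) \<in> (\<int> :: complex set)" "!!v. v \<in> A ==> cmod v \<le> 1"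
 obtains n where "n > 0" "w^n = 1"
proof -
 define d where "d = card A"
 define s where "s k = (\<Sum>v\<in>A. v^k)" for k
 define B where "B = (of_int :: int => complex) ` {- int d..int d}"
 have sB: "s k \<in> B" for k
 proof -
  obtain m where m: "s k = of_int m" using s(1)[of k] by (auto simp: s_def elim: Ints_cases)
  have "cmod (s k) \<le> (\<Sum>v\<in>A. cmod v^k)" unfolding s_def norm_power[symmetric] by (rule norm_sum)
  also have "... \<le> (\<Sum>v\<in>A. 1)" using s(2) by (intro sum_mono power_le_one) auto
  finally have "\<bar>real_of_int m\<bar> \<le> real d" by (simp add: m d_def)
  hence "\<bar>m\<bar> \<le> int d" by linarith
  hence "m \<in> {- int d..int d}" by (simp add: abs_le_iff)
  thus ?thesis unfolding m B_def by (rule imageI)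
 qed
 define V where "V k = restrict (%i. s (k + i)) {..<d}" for k
 have "V ` UNIV \<subseteq> {..<d} \<rightarrow>\<^sub>E B" using sB by (auto simp: V_def split: if_splits)
 moreover have "finite ({..<d} \<rightarrow>\<^sub>E B)" by (intro finite_PiE) (auto simp: B_def)
 ultimately have "finite (range V)" using finite_subset by blast
 hence "\<not> inj V" using finite_imageD infinite_UNIV_nat by blast
 then obtain k l where kl: "k < l" "V k = V l" unfolding inj_def by (metis linorder_neqE_nat)
 have eq: "s (k + i) = s (l + i)" if "i < d" for i using fun_cong[OF kl(2), of i] that by (simp add: V_def)
 define Q where "Q = (\<Prod>u\<in>A - {w}. [:-u, 1:])"
 have "degree Q = (\<Sum>u\<in>A - {w}. degree [:-u, 1:])" unfolding Q_def by (rule degree_prod_eq_sum_degree) auto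
 moreover have "card A > 0" using O(1,2) card_gt_0_iff by blast
 ultimately have dQ: "degree Q < d" using O by (simp add: d_def card_Diff_singleton)
 have "(\<Sum>v\<in>A. poly Q v * (v^k - v^l)) = (\<Sum>i\<le>degree Q. coeff Q i * (s (k + i) - s (l + i)))"
  unfolding poly_altdef s_def sum_distrib_right sum_distrib_left sum_subtractf[symmetric]
  by (subst sum.swap) (simp add: sum_distrib_left power_add algebra_simps)
 also have "... = 0" using eq dQ by (intro sum.neutral) auto
 finally have "0 = (\<Sum>v\<in>A. poly Q v * (v^k - v^l))" ..
 also have "... = poly Q w * (w^k - w^l) + (\<Sum>v\<in>A - {w}. poly Q v * (v^k - v^l))" using O by (simp add: sum.remove)
 also have "(\<Sum>v\<in>A - {w}. poly Q v * (v^k - v^l)) = 0"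
  using O(1) by (intro sum.neutral) (auto simp: Q_def poly_prod)
 finally have "poly Q w * (w^k - w^l) = 0" by simp
 moreover have "poly Q w ~= 0" using O(1) by (auto simp: Q_def poly_prod)
 ultimately have "w^k = w^l" by simp
 moreover have "w^l = w^k * w^(l - k)" using kl(1) by (simp flip: power_add)
 ultimately have "w^k * 1 = w^k * w^(l - k)" by simp
 hence "w^(l - k) = 1" using O(3) by (simp only: mult_cancel_left) simp
 thus thesis using that[of "l - k"] kl(1) by simp
qed

context padic_closure begin

lemma integer_if_av_le_1:
 assumes "qbar_embedding (\<iota> :: complex => 'k)" "s \<in> \<rat>" "of_nat p^M * s \<in> Zbar" "av (\<iota> s) \<le> 1" shows "s \<in> \<int>"
proof -
 have "of_nat p^M * s \<in> \<int>" using assms(2,3) by (intro rational_algebraic_int_is_int) (simp_all add: Zbar_def)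
 then obtain a where a: "of_nat p^M * s = of_int a" by (auto elim: Ints_cases)
 note h = ring_hom_onD[OF subring_Qbar_Qbar qbar_embedding_hom[OF assms(1)]]
 have im: "\<iota> (x * y) = \<iota> x * \<iota> y" if "x \<in> Qbar" "y \<in> Qbar" for x y
  using assms(1) that by (auto simp: qbar_embedding_def)
 have "\<iota> (of_nat (p^M) * s) = of_nat (p^M) * \<iota> s"
  using im[of "of_nat (p^M)" s] h(6)[of "p^M"] assms(2) by (simp add: Qbar_closed(5))
 hence "of_int a = of_nat (p^M) * \<iota> s" using a h(7)[of a] by simp
 hence "av (of_int a :: 'k) = (1 / real p)^M * av (\<iota> s)" by simp
 hence le: "av (of_int a :: 'k) \<le> 1 / real p^M" using assms(4) by (simp add: power_one_over divide_right_mono)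
 have "int p^M dvd a"
 proof (cases "a = 0")
  case False
  hence "real p^M \<le> real p^multiplicity (int p) a" using le p_gt_1 by (simp add: av_of_int field_simps)
  hence "M \<le> multiplicity (int p) a" using p_gt_1 by simp
  thus ?thesis by (rule multiplicity_dvd')
 qed simp
 then obtain b where "a = int p^M * b" by (elim dvdE)
 hence "s = of_int b" using a p_gt_1 by simp
 thus ?thesis by simp
qed

text \<open>Kronecker's theorem for numbers with denominators at \<open>p\<close>: the power sums of
  the conjugates are rational by Galois invariance, their denominators are powers of
  \<open>p\<close>, and the bound on \<open>av\<close> removes these.\<close>

lemma kronecker:
 assumes i: "qbar_embedding (\<iota> :: complex => 'k)" and w: "w \<in> Qbar" "of_nat p^M * w \<in> Zbar"
  and 1: "!!s. s \<in> GQ ==> cmod (s w) = 1" "!!s. s \<in> GQ ==> av (\<iota> (s w)) \<le> 1"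
 obtains n where "n > 0" "w^n = 1"
proof -
 define A where "A = {s w | s. s \<in> GQ}"
 have fin: "finite A" unfolding A_def by (rule finite_orbit[OF w(1)])
 have AQ: "v \<in> Qbar" if "v \<in> A" for v using that w(1) GQD(1) by (auto simp: A_def)
 note h = ring_hom_onD[OF subring_Qbar_Qbar qbar_embedding_hom[OF i]]
 have im: "\<iota> (x * y) = \<iota> x * \<iota> y" if "x \<in> Qbar" "y \<in> Qbar" for x y
  using i that by (auto simp: qbar_embedding_def)
 have id: "restrict id Qbar \<in> GQ" by (auto simp: Gal_def Qbar_closed bij_betw_def inj_on_def)
 have wA: "w \<in> A" unfolding A_def using id w(1) by (intro CollectI exI[of _ "restrict id Qbar"]) simp
 have perm: "s ` A = A" if s: "s \<in> GQ" for s
 proof -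
  have "s ` A \<subseteq> A"
  proof
   fix v assume "v \<in> s ` A"
   then obtain t where t: "t \<in> GQ" "v = s (t w)" by (auto simp: A_def)
   hence "v = compose Qbar s t w" using w(1) by (simp add: compose_def)
   thus "v \<in> A" unfolding A_def using Gal_compose[OF s t(1)] by blast
  qed
  moreover have "inj_on s A" using s AQ by (auto simp: Gal_def bij_betw_def intro: inj_on_subset)
  ultimately show ?thesis using endo_inj_surj[OF fin] by blast
 qed
 have sQ: "(\<Sum>v\<in>A. v^k) \<in> Qbar" for k using AQ by (intro Qbar_closed(6,7)) auto
 have "(\<Sum>v\<in>A. v^k) \<in> \<int>" for k
 proof (rule integer_if_av_le_1[OF i])
  show "(\<Sum>v\<in>A. v^k) \<in> \<rat>"
  proof (rule fixed_by_Gal_rational[OF sQ])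
   fix s assume s: "s \<in> GQ"
   have "s (\<Sum>v\<in>A. v^k) = (\<Sum>v\<in>A. s v^k)"
    using GQ_hom(4)[OF s, of A "%v. v^k"] GQ_hom(3)[OF s] AQ by (simp add: Qbar_closed)
   also have "... = (\<Sum>v\<in>s ` A. v^k)"
    using s AQ by (subst sum.reindex) (auto simp: Gal_def bij_betw_def intro: inj_on_subset)
   finally show "s (\<Sum>v\<in>A. v^k) = (\<Sum>v\<in>A. v^k)" unfolding perm[OF s] .
  qed
  have "of_nat p^M * v \<in> Zbar" if "v \<in> A" for v
  proof -
   obtain s where s: "s \<in> GQ" "v = s w" using \<open>v \<in> A\<close> by (auto simp: A_def)
   have "s (of_nat (p^M) * w) = of_nat (p^M) * v"
    using GQD(3)[OF s(1), of "of_nat (p^M)" w] GQ_hom(6)[OF s(1), of "p^M"] w(1) s(2) by (simp add: Qbar_closed(5))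
   thus ?thesis using Gal_Zbar[OF s(1) w(2)] by simp
  qed
  hence "(\<Sum>v\<in>A. (of_nat p^M * v)^k) \<in> Zbar" by (intro Zbar_closed(4,5)) auto
  thus "of_nat p^(M * k) * (\<Sum>v\<in>A. v^k) \<in> Zbar"
   by (simp add: sum_distrib_left power_mult_distrib power_mult)
  have "\<iota> (\<Sum>v\<in>A. v^k) = (\<Sum>v\<in>A. \<iota> v^k)"
   using h(4)[of A "%v. v^k"] h(3) AQ by (simp add: Qbar_closed)
  moreover have "av (\<iota> v) \<le> 1" if "v \<in> A" for v using that 1(2) by (auto simp: A_def)
  ultimately show "av (\<iota> (\<Sum>v\<in>A. v^k)) \<le> 1" by (auto intro!: av_sum_le power_le_one)
 qed
 moreover have "cmod v \<le> 1" if "v \<in> A" for v using that 1(1) by (auto simp: A_def)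
 moreover have "w ~= 0" using 1(1)[OF id] w(1) by auto
 ultimately show thesis using bounded_power_sums_root_of_unity[OF fin wA, of thesis] that by blast
qed

end

section \<open>Tensors and the field cut out by a character\<close>

abbreviation sg :: "complex => 'k => (complex \<Rightarrow>\<^sub>0 'k::field)" where "sg \<equiv> Poly_Mapping.single"

lemma tensor_relations_add: "y \<in> tensor_relations U ==> x \<in> tensor_relations U ==> x + y \<in> tensor_relations U"
proof (induction y rule: tensor_relations.induct)
 case (step y u v c)
 thus ?case using tensor_relations.step[of "x + y" U u v c] by (simp add: add_ac)
qed simp

lemma tensor_relations_gen: "u \<in> U ==> v \<in> U ==> sg (u * v) c - sg u c - sg v c \<in> tensor_relations U"
 using tensor_relations.step[OF tensor_relations.zero, of u U v c] by simp

lemma lookup_tensor_scale: "Poly_Mapping.lookup (tensor_scale c x) u = c * Poly_Mapping.lookup x u"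
 by (simp add: tensor_scale_def map.rep_eq when_def)

lemma tensor_scale_add: "tensor_scale c (x + y) = tensor_scale c x + tensor_scale c y"
 by (rule poly_mapping_eqI) (simp add: lookup_tensor_scale lookup_add algebra_simps)

lemma tensor_scale_diff: "tensor_scale c (x - y) = tensor_scale c x - tensor_scale c y"
 by (rule poly_mapping_eqI) (simp add: lookup_tensor_scale lookup_minus algebra_simps)

lemma tensor_scale_single: "tensor_scale c (sg u d) = sg u (c * d)"
 by (rule poly_mapping_eqI) (simp add: lookup_tensor_scale lookup_single when_def)

lemma tensor_scale_0: "tensor_scale c 0 = 0"
 by (rule poly_mapping_eqI) (simp add: lookup_tensor_scale)

lemma tensor_scale_scale: "tensor_scale c (tensor_scale d x) = tensor_scale (c * d) x"
 by (rule poly_mapping_eqI) (simp add: lookup_tensor_scale)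

lemma tensor_scale_minus_1: "tensor_scale (- 1) x = - x" and tensor_scale_1: "tensor_scale 1 x = x"
 by (rule poly_mapping_eqI, simp add: lookup_tensor_scale)+

lemma tensor_relations_scale: "x \<in> tensor_relations U ==> tensor_scale c x \<in> tensor_relations U"
proof (induction x rule: tensor_relations.induct)
 case zero
 show ?case by (simp add: tensor_scale_0 tensor_relations.zero)
next
 case (step x u v d)
 show ?case unfolding tensor_scale_add tensor_scale_diff tensor_scale_single
  by (rule tensor_relations.step) (use step in simp_all)
qed

lemma tensor_relations_minus: "x \<in> tensor_relations U ==> - x \<in> tensor_relations U"
 using tensor_relations_scale[of x U "- 1"] by (simp add: tensor_scale_minus_1)

lemma tensor_eq_refl: "tensor_eq U x x" by (simp add: tensor_eq_def tensor_relations.zero)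

lemma tensor_eq_sym: "tensor_eq U x y ==> tensor_eq U y x"
 using tensor_relations_minus[of "x - y" U] by (simp add: tensor_eq_def)

lemma tensor_eq_trans: "tensor_eq U x y ==> tensor_eq U y z ==> tensor_eq U x z"
 using tensor_relations_add[of "x - y" U "y - z"] by (simp add: tensor_eq_def)

lemma tensor_eq_add: "tensor_eq U x y ==> tensor_eq U x' y' ==> tensor_eq U (x + x') (y + y')"
 using tensor_relations_add[of "x - y" U "x' - y'"] by (simp add: tensor_eq_def algebra_simps)

lemma tensor_eq_scale: "tensor_eq U x y ==> tensor_eq U (tensor_scale c x) (tensor_scale c y)"
 using tensor_relations_scale[of "x - y" U c] by (simp add: tensor_eq_def tensor_scale_diff)

lemma tensor_eq_minus: "tensor_eq U x y ==> tensor_eq U (- x) (- y)"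
 using tensor_eq_scale[of U x y "- 1"] by (simp add: tensor_scale_minus_1)

lemma tensor_eq_diff: "tensor_eq U x y ==> tensor_eq U x' y' ==> tensor_eq U (x - x') (y - y')"
 using tensor_eq_add[of U x y "- x'" "- y'"] tensor_eq_minus[of U x' y'] by simp

lemma tensor_eq_sum: "(!!i. i \<in> I ==> tensor_eq U (x i) (y i)) ==> tensor_eq U (sum x I) (sum y I)"
 by (induction I rule: infinite_finite_induct) (auto simp: tensor_eq_refl intro: tensor_eq_add)

lemma tensor_lift_scale: "tensor_lift f (tensor_scale c x) = c * tensor_lift f x"
proof -
 have "tensor_lift f (tensor_scale c x) = (\<Sum>u\<in>Poly_Mapping.keys x. f u * Poly_Mapping.lookup (tensor_scale c x) u)"
  unfolding tensor_lift_def by (rule sum.mono_neutral_left) (auto simp: in_keys_iff lookup_tensor_scale)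
 thus ?thesis by (simp add: tensor_lift_def lookup_tensor_scale sum_distrib_left mult_ac)
qed

lemma tensor_lift_0: "tensor_lift f 0 = 0" by (simp add: tensor_lift_def)

lemma tensor_lift_sum: "tensor_lift f (sum x I) = (\<Sum>i\<in>I. tensor_lift f (x i))"
 by (induction I rule: infinite_finite_induct) (simp_all add: tensor_lift_add tensor_lift_0)

lemma tensor_act_add: "tensor_act t (x + y) = tensor_act t x + tensor_act t y"
proof -
 let ?A = "Poly_Mapping.keys x \<union> Poly_Mapping.keys y"
 have *: "tensor_act t z = (\<Sum>u\<in>?A. sg (t u) (Poly_Mapping.lookup z u))" if "Poly_Mapping.keys z \<subseteq> ?A" for z
  unfolding tensor_act_def using that by (intro sum.mono_neutral_left) (auto simp: in_keys_iff)
 show ?thesis using Poly_Mapping.keys_add[of x y] by (simp add: * lookup_add single_add sum.distrib)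
qed

lemma tensor_act_single: "tensor_act t (sg u c) = sg (t u) c" by (simp add: tensor_act_def)

lemma tensor_act_sum: "tensor_act t (sum x I) = (\<Sum>i\<in>I. tensor_act t (x i))"
 by (induction I rule: infinite_finite_induct) (simp_all add: tensor_act_add, simp_all add: tensor_act_def)

lemma sum_singles: "(\<Sum>u\<in>Poly_Mapping.keys x. sg u (Poly_Mapping.lookup x u)) = x"
proof (rule poly_mapping_eqI)
 fix v
 have "Poly_Mapping.lookup (\<Sum>u\<in>Poly_Mapping.keys x. sg u (Poly_Mapping.lookup x u)) v
  = (\<Sum>u\<in>Poly_Mapping.keys x. if u = v then Poly_Mapping.lookup x u else 0)"
  by (simp add: lookup_sum lookup_single when_def)
 thus "Poly_Mapping.lookup (\<Sum>u\<in>Poly_Mapping.keys x. sg u (Poly_Mapping.lookup x u)) v = Poly_Mapping.lookup x v"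
  by (simp add: in_keys_iff)
qed

lemma tensor_lift_act: "tensor_lift f (tensor_act t x) = tensor_lift (%u. f (t u)) x"
 unfolding tensor_act_def tensor_lift_sum tensor_lift_single by (simp add: tensor_lift_def)

definition unit_group :: "complex set => bool"
 where "unit_group U \<longleftrightarrow> 0 \<notin> U & 1 \<in> U & (\<forall>u\<in>U. \<forall>v\<in>U. u * v \<in> U) & (\<forall>u\<in>U. inverse u \<in> U)"

context
 fixes U :: "complex set"
 assumes U: "unit_group U"
begin

lemma unit_groupD: "0 \<notin> U" "1 \<in> U" "u \<in> U ==> v \<in> U ==> u * v \<in> U" "u \<in> U ==> inverse u \<in> U" "u \<in> U ==> u^n \<in> U"
 "u \<in> U ==> u powi m \<in> U"
proof -
 show D: "0 \<notin> U" "1 \<in> U" "u \<in> U ==> v \<in> U ==> u * v \<in> U" "u \<in> U ==> inverse u \<in> U" for u v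
  using U by (auto simp: unit_group_def)
 show pow: "u^n \<in> U" if "u \<in> U" for u n using that by (induction n) (auto intro: D)
 show "u \<in> U ==> u powi m \<in> U" by (auto simp: power_int_def intro!: pow D)
qed

lemma tensor_mult: "u \<in> U ==> v \<in> U ==> tensor_eq U (sg (u * v) c) (sg u c + sg v c)"
 using tensor_relations_gen[of u U v c] by (simp add: tensor_eq_def algebra_simps)

lemma tensor_one: "tensor_eq U (sg 1 c) 0"
 using tensor_relations_minus[OF tensor_relations_gen[of 1 U 1 c]] unit_groupD(2) by (simp add: tensor_eq_def)

lemma tensor_inverse: assumes "u \<in> U" shows "tensor_eq U (sg (inverse u) c) (- sg u c)"
proof -
 have "u * inverse u = 1" using assms unit_groupD(1) by (intro right_inverse) auto
 hence "tensor_eq U (sg 1 c) (sg u c + sg (inverse u) c)" using tensor_mult[OF assms unit_groupD(4)[OF assms], of c] by simp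
 from tensor_eq_trans[OF tensor_eq_sym[OF this] tensor_one] have "tensor_eq U (sg u c + sg (inverse u) c) 0" .
 thus ?thesis by (simp add: tensor_eq_def add.commute)
qed

lemma tensor_power: assumes "u \<in> U" shows "tensor_eq U (sg (u^n) c) (sg u (of_nat n * c))"
proof (induction n)
 case 0
 show ?case using tensor_one by simp
next
 case (Suc n)
 have "tensor_eq U (sg (u * u^n) c) (sg u c + sg (u^n) c)" by (intro tensor_mult unit_groupD assms)
 moreover have "tensor_eq U (sg u c + sg (u^n) c) (sg u c + sg u (of_nat n * c))" by (intro tensor_eq_add tensor_eq_refl Suc)
 moreover have "sg u c + sg u (of_nat n * c) = sg u (of_nat (Suc n) * c)" by (simp add: algebra_simps flip: single_add)
 ultimately show ?case using tensor_eq_trans[of U "sg (u^Suc n) c"] by simp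
qed

lemma tensor_power_int: assumes "u \<in> U" shows "tensor_eq U (sg (u powi m) c) (sg u (of_int m * c))"
proof (cases "m >= 0")
 case True
 thus ?thesis using tensor_power[OF assms, of "nat m" c] by (simp add: power_int_def)
next
 case False
 hence "u powi m = inverse u^nat (- m)" "of_int m * c = of_nat (nat (- m)) * (- c)" by (simp_all add: power_int_def)
 moreover have "tensor_eq U (sg (inverse u^nat (- m)) c) (sg (inverse u) (of_nat (nat (- m)) * c))" by (intro tensor_power unit_groupD assms)
 moreover have "tensor_eq U (sg (inverse u) (of_nat (nat (- m)) * c)) (- sg u (of_nat (nat (- m)) * c))" by (rule tensor_inverse[OF assms])
 ultimately show ?thesis using tensor_eq_trans[of U "sg (inverse u^nat (- m)) c"] by (simp add: single_uminus)
qed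

text \<open>Induction on the number of terms. If the coefficients are linearly independent over the
 rationals, each term satisfies the hypotheses separately; otherwise a linear relation between them
 shortens the sum.\<close>

lemma tensor_vanishing:
 fixes c :: "'i => 'k::field_char_0" and L :: "'s => complex => rat"
 assumes W: "W \<subseteq> U" "!!u v m n. u \<in> W ==> v \<in> W ==> u^n * v powi m \<in> W"
  and L: "!!s u v. s \<in> S ==> u \<in> U ==> v \<in> U ==> L s (u * v) = L s u + L s v"
  and torsion: "!!u. u \<in> W ==> (!!s. s \<in> S ==> L s u = 0) ==> \<exists>n>0. u^n = 1"
 shows "finite I ==> (!!i. i \<in> I ==> w i \<in> W) ==>
  (!!s. s \<in> S ==> tensor_lift (%u. of_rat (L s u)) (\<Sum>i\<in>I. sg (w i) (c i)) = 0) ==> tensor_eq U (\<Sum>i\<in>I. sg (w i) (c i)) 0"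
proof (induction "card I" arbitrary: I w c)
 case 0
 thus ?case by (simp add: tensor_eq_refl)
next
 case (Suc n)
 have lift: "(\<Sum>i\<in>I. of_rat (L s (w i)) * c i) = 0" if "s \<in> S" for s
  using Suc.prems(3)[OF that] by (simp add: tensor_lift_sum tensor_lift_single)
 show ?case
 proof (cases "\<exists>q j. (\<Sum>i\<in>I. of_rat (q i) * c i) = 0 & j \<in> I & q j ~= 0")
  case False
  have "tensor_eq U (sg (w i) (c i)) 0" if i: "i \<in> I" for i
  proof -
   have "L s (w i) = 0" if "s \<in> S" for s using False lift[OF that] i by metis
   then obtain m where m: "m > 0" "w i^m = 1" using torsion[OF Suc.prems(2)[OF i]] by blast
   have "tensor_eq U (sg (w i^m) (c i / of_nat m)) (sg (w i) (of_nat m * (c i / of_nat m)))"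
    using Suc.prems(2)[OF i] W(1) by (intro tensor_power) auto
   hence "tensor_eq U (sg 1 (c i / of_nat m)) (sg (w i) (c i))" using m by simp
   from tensor_eq_trans[OF tensor_eq_sym[OF this] tensor_one] show ?thesis .
  qed
  thus ?thesis using tensor_eq_sum[of I U "%i. sg (w i) (c i)" "%i. 0"] by simp
 next
  case True
  then obtain q j where q: "(\<Sum>i\<in>I. of_rat (q i) * c i) = 0" and j: "j \<in> I" "q j ~= 0" by blast
  define J where "J = I - {j}"
  have J: "finite J" "card J = n" "j \<notin> J" using Suc.hyps(2) Suc.prems(1) j by (simp_all add: J_def)
  have I: "(\<Sum>i\<in>I. h i) = h j + (\<Sum>i\<in>J. h i)" for h :: "'i => 'x::ab_group_add"
   using Suc.prems(1) j by (simp add: J_def sum.remove)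
  \<comment> \<open>Writing \<open>q i / q j\<close> as the fraction \<open>a i / b i\<close> makes
    \<open>c j\<close> an integer combination of the numbers \<open>c i / b i\<close>.\<close>
  define a where "a i = fst (quotient_of (q i / q j))" for i
  define b where "b i = nat (snd (quotient_of (q i / q j)))" for i
  have b: "b i > 0" "q i / q j = of_int (a i) / of_nat (b i)" for i
  proof -
   have "snd (quotient_of (q i / q j)) > 0" by (rule quotient_of_denom_pos')
   moreover have "q i / q j = of_int (a i) / of_int (snd (quotient_of (q i / q j)))"
    unfolding a_def by (rule quotient_of_div) simp
   ultimately show "b i > 0" "q i / q j = of_int (a i) / of_nat (b i)" by (simp_all add: b_def)
  qed
  have "of_rat (q j) * c j + (\<Sum>i\<in>J. of_rat (q i) * c i) = 0" using q unfolding I .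
  hence "c j = - (\<Sum>i\<in>J. of_rat (q i) * c i) / of_rat (q j)" using j(2)
   by (simp add: field_simps eq_neg_iff_add_eq_0)
  also have "... = (\<Sum>i\<in>J. - of_int (a i) * (c i / of_nat (b i)))"
  proof -
   have "of_rat (q i) / of_rat (q j) = (of_int (a i) / of_nat (b i) :: 'k)" for i
    using arg_cong[OF b(2)[of i], of "of_rat :: rat => 'k"] by (simp add: of_rat_divide)
   hence "of_rat (q i) * c i / of_rat (q j) = of_int (a i) * (c i / of_nat (b i))" for i
    by (metis times_divide_eq_left times_divide_eq_right)
   thus ?thesis by (simp add: sum_divide_distrib sum_negf)
  qed
  finally have cj: "c j = (\<Sum>i\<in>J. of_int (- a i) * (c i / of_nat (b i)))" by simp
  \<comment> \<open>\<open>c i\<close> is \<open>b i\<close> times \<open>c' i\<close>, and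
    \<open>c j\<close> is the combination of the \<open>c' i\<close> with coefficients
    \<open>- a i\<close>. These integers move into the unit, which leaves one term for each
    \<open>i\<close> in \<open>J\<close>.\<close>
  define w' where "w' i = w i^b i * w j powi (- a i)" for i
  define c' where "c' i = c i / of_nat (b i)" for i
  have wU: "w i \<in> U" if "i \<in> I" for i using Suc.prems(2)[OF that] W(1) by blast
  have summand: "tensor_eq U (sg (w' i) (c' i)) (sg (w i) (c i) + sg (w j) (of_int (- a i) * c' i))" if "i \<in> J" for i
  proof -
   have i: "i \<in> I" using that by (simp add: J_def)
   have "tensor_eq U (sg (w i^b i) (c' i)) (sg (w i) (of_nat (b i) * c' i))" by (rule tensor_power[OF wU[OF i]])
   moreover have "of_nat (b i) * c' i = c i" using b(1)[of i] by (simp add: c'_def)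
   ultimately have "tensor_eq U (sg (w i^b i) (c' i) + sg (w j powi (- a i)) (c' i)) (sg (w i) (c i) + sg (w j) (of_int (- a i) * c' i))"
    using tensor_power_int[OF wU[OF j(1)], of "- a i" "c' i"] by (intro tensor_eq_add) auto
   moreover have "tensor_eq U (sg (w' i) (c' i)) (sg (w i^b i) (c' i) + sg (w j powi (- a i)) (c' i))"
    unfolding w'_def by (intro tensor_mult unit_groupD wU i j)
   ultimately show ?thesis by (rule tensor_eq_trans[rotated])
  qed
  have "(\<Sum>i\<in>J. sg (w j) (of_int (- a i) * c' i)) = sg (w j) (c j)"
  proof -
   have "(\<Sum>i\<in>J. sg u (h i)) = sg u (\<Sum>i\<in>J. h i)" for u and h :: "'i => 'k"
    by (induction J rule: infinite_finite_induct) (simp_all add: single_add)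
   thus ?thesis unfolding cj c'_def .
  qed
  hence eq: "tensor_eq U (\<Sum>i\<in>J. sg (w' i) (c' i)) (\<Sum>i\<in>I. sg (w i) (c i))"
   using tensor_eq_sum[of J U "%i. sg (w' i) (c' i)", OF summand] unfolding I sum.distrib by (simp add: add.commute)
  have "tensor_eq U (\<Sum>i\<in>J. sg (w' i) (c' i)) 0"
  proof (rule Suc.hyps(1))
   show "n = card J" "finite J" using J by simp_all
   show "w' i \<in> W" if "i \<in> J" for i unfolding w'_def
    using that j(1) by (intro W(2) Suc.prems(2)) (auto simp: J_def)
   show "tensor_lift (%u. of_rat (L s u)) (\<Sum>i\<in>J. sg (w' i) (c' i)) = 0" if "s \<in> S" for s
    using tensor_lift_cong[OF _ eq, of "%u. of_rat (L s u)"] Suc.prems(3)[OF that] L[OF that] by (simp add: of_rat_add)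
  qed
  thus ?thesis using tensor_eq_trans[OF tensor_eq_sym[OF eq]] by blast
 qed
qed

end

section \<open>Galois characters and the field they cut out\<close>

lemma cis_root:
 shows "M > 0 ==> cis (2 * pi / real M)^M = 1" and "cis (2 * pi / real M)^k = cis (2 * pi * real k / real M)"
 by (simp add: Complex.DeMoivre) (simp add: Complex.DeMoivre mult_ac)

lemma cis_root_exponent:
 assumes "M > 0" "z^M = 1" obtains a where "z = cis (2 * pi / real M)^a"
proof -
 have "z \<in> (%k. cis (2 * pi * real k / real M)) ` {..<M}" using Complex.bij_betw_roots_unity[OF assms(1)] assms(2) by (auto simp: bij_betw_def)
 thus thesis using that by (auto simp: cis_root(2))
qed

lemma cis_power_eq_iff:
 assumes "M > 0" shows "cis (2 * pi / real M)^a = cis (2 * pi / real M)^b \<longleftrightarrow> [a = b] (mod M)"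
proof
 assume "cis (2 * pi / real M)^a = cis (2 * pi / real M)^b"
 hence "cis (2 * pi * int a / M) = cis (2 * pi * int b / M)" by (simp add: cis_root(2))
 from cis_eq_cong[OF assms this] show "[a = b] (mod M)" by (simp add: cong_int_iff)
next
 have mod: "cis (2 * pi / real M)^a = cis (2 * pi / real M)^(a mod M)" for a
 proof -
  have "cis (2 * pi / real M)^(M * (a div M) + a mod M) = cis (2 * pi / real M)^(a mod M)"
   unfolding power_add power_mult cis_root(1)[OF assms] by simp
  thus ?thesis by simp
 qed
 assume "[a = b] (mod M)"
 thus "cis (2 * pi / real M)^a = cis (2 * pi / real M)^b" using mod[of a] mod[of b] by (simp add: cong_def)
qed

lemma cis_root_Zbar: "M > 0 ==> cis (2 * pi / real M)^a \<in> Zbar"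
 using root_of_unity_in_Zbar[OF cis_root(1), of M] by (intro Zbar_closed(4)) auto

lemma cis_root_Qbar: "M > 0 ==> cis (2 * pi / real M)^a \<in> Qbar"
 using Zbar_closed(7)[OF cis_root_Zbar] .

lemma Gal_cis_root:
 assumes "s \<in> GQ" "M > 0" obtains a where "s (cis (2 * pi / real M)) = cis (2 * pi / real M)^a"
proof (rule cis_root_exponent[OF assms(2)])
 show "s (cis (2 * pi / real M))^M = 1"
  using GQ_hom(3)[OF assms(1), of "cis (2 * pi / real M)" M] cis_root(1)[OF assms(2)] cis_root_Qbar[OF assms(2), of 1] GQD(4)[OF assms(1)] by simp
qed (use that in blast)

context
 fixes N :: nat and \<phi> :: "int => complex"
 assumes dchar: "dirichlet_character N \<phi>"
begin

abbreviation (input) "gchar \<equiv> galois_character N \<phi>"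
abbreviation (input) "H \<equiv> cut_out_field N \<phi>"
abbreviation (input) "\<zeta> \<equiv> cis (2 * pi / real N)"
definition ker_res :: "nat set" where "ker_res = {b. b < N & \<phi> (int b) = 1}"

lemma character_simps:
 "N > 0" "\<phi> (a * b) = \<phi> a * \<phi> b" "\<phi> a = 0 \<longleftrightarrow> \<not> coprime a (int N)" "\<phi> 1 = 1" "[a = b] (mod int N) ==> \<phi> a = \<phi> b"
proof -
 have "N > 0 & (\<forall>a b. \<phi> (a * b) = \<phi> a * \<phi> b) & (\<forall>a. \<phi> a = 0 \<longleftrightarrow> \<not> coprime a (int N))"
  using dchar unfolding dirichlet_character_def by (elim conjE, intro conjI)
 thus *: "N > 0" "\<phi> (a * b) = \<phi> a * \<phi> b" "\<phi> a = 0 \<longleftrightarrow> \<not> coprime a (int N)" for a b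
  by simp_all
 show "\<phi> 1 = 1" using *(2)[of 1 1] *(3)[of 1] by simp
 show "[a = b] (mod int N) ==> \<phi> a = \<phi> b" by (rule dirichlet_character_cong[OF dchar])
qed

lemma galois_character_eq:
 assumes "s \<zeta> = \<zeta>^a" shows "gchar s = \<phi> (int a)"
proof -
 have e: "s (cis (2 * pi / N)) = cis (2 * pi * int a / N)" using assms by (simp add: cis_root(2))
 show ?thesis unfolding galois_character_def
 proof (rule the_equality)
  show "\<exists>b::int. s (cis (2 * pi / N)) = cis (2 * pi * b / N) & \<phi> (int a) = \<phi> b" using e by blast
  fix y assume "\<exists>b::int. s (cis (2 * pi / N)) = cis (2 * pi * b / N) & y = \<phi> b"
  then obtain b :: int where "cis (2 * pi * b / N) = cis (2 * pi * int a / N)" "y = \<phi> b" using e by auto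
  thus "y = \<phi> (int a)" using cis_eq_cong[OF character_simps(1)] character_simps(5) by blast
 qed
qed

lemma zeta_Qbar: "\<zeta>^a \<in> Qbar" by (rule cis_root_Qbar[OF character_simps(1)])

lemma galois_character_compose:
 assumes "s \<in> GQ" "t \<in> GQ" shows "gchar (compose Qbar s t) = gchar s * gchar t"
proof -
 obtain a where a: "s \<zeta> = \<zeta>^a" using Gal_cis_root[OF assms(1) character_simps(1)] by blast
 obtain b where b: "t \<zeta> = \<zeta>^b" using Gal_cis_root[OF assms(2) character_simps(1)] by blast
 have "compose Qbar s t \<zeta> = \<zeta>^(a * b)"
  using a b GQ_hom(3)[OF assms(1), of \<zeta> b] zeta_Qbar[of 1] by (simp add: compose_def power_mult)
 thus ?thesis using galois_character_eq a b character_simps(2) by simp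
qed

lemma galois_character_inverse:
 assumes "s \<in> GQ" "r \<in> GQ" "!!x. x \<in> Qbar ==> r (s x) = x" shows "gchar r * gchar s = 1"
proof -
 have "compose Qbar r s \<zeta> = \<zeta>^1" using assms(3) zeta_Qbar[of 1] by (simp add: compose_def)
 from galois_character_eq[of "compose Qbar r s" 1, OF this] show ?thesis using galois_character_compose[OF assms(2,1)] character_simps(4) by simp
qed

lemma cut_outD: "x \<in> H ==> x \<in> Qbar" "x \<in> H ==> s \<in> GQ ==> gchar s = 1 ==> s x = x"
 by (auto simp: cut_out_field_def)

lemma subring_cut_out: "subring_Qbar H"
proof -
 have r: "s r = r" if "s \<in> GQ" "r \<in> \<rat>" for s r using that GQ_hom(1)[OF that(1)] by (auto elim!: Rats_cases)
 have "x + y \<in> H & x * y \<in> H" if xy: "x \<in> H" "y \<in> H" for x y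
 proof -
  note Q = cut_outD(1)[OF xy(1)] cut_outD(1)[OF xy(2)]
  have "s (x + y) = x + y" "s (x * y) = x * y" if "s \<in> GQ" "gchar s = 1" for s
   using GQD(2,3)[OF that(1) Q] cut_outD(2)[OF xy(1) that] cut_outD(2)[OF xy(2) that] by simp_all
  thus ?thesis using Qbar_closed(1,2)[OF Q] by (simp add: cut_out_field_def)
 qed
 moreover have "r \<in> H" if "r \<in> \<rat>" for r using r[OF _ that] Qbar_closed(5)[OF that] by (simp add: cut_out_field_def)
 ultimately show ?thesis using cut_outD(1) unfolding subring_Qbar_def by blast
qed

lemma cut_out_inverse: assumes "x \<in> H" shows "inverse x \<in> H"
proof (cases "x = 0")
 case False
 have "s (inverse x) = inverse x" if "s \<in> GQ" "gchar s = 1" for s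
 proof -
  have "s (x * inverse x) = x * s (inverse x)"
   using GQD(3)[OF that(1) cut_outD(1)[OF assms] Qbar_closed(3)[OF cut_outD(1)[OF assms]]] cut_outD(2)[OF assms that] by simp
  hence "1 = x * s (inverse x)" using False GQD(4)[OF that(1)] by simp
  thus ?thesis using False by (simp add: field_simps)
 qed
 thus ?thesis using Qbar_closed(3)[OF cut_outD(1)[OF assms]] by (simp add: cut_out_field_def)
qed (use assms in simp)

text \<open>Conjugating an automorphism of character value 1 by \<open>s\<close> gives another one,
  so \<open>s\<close> preserves what they fix.\<close>

lemma Gal_cut_out: assumes s: "s \<in> GQ" and x: "x \<in> H" shows "s x \<in> H"
proof -
 have xQ: "x \<in> Qbar" using cut_outD(1)[OF x] .
 obtain r where r: "r \<in> GQ" "!!x. x \<in> Qbar ==> r (s x) = x" "!!x. x \<in> Qbar ==> s (r x) = x"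
  using Gal_inverse[OF s] by blast
 have "k (s x) = s x" if k: "k \<in> GQ" "gchar k = 1" for k
 proof -
  define k' where "k' = compose Qbar r (compose Qbar k s)"
  have "k' \<in> GQ" unfolding k'_def by (intro Gal_compose r k s)
  moreover have "gchar k' = 1" unfolding k'_def
   using galois_character_inverse[OF s r(1,2)] k by (simp add: galois_character_compose Gal_compose r k s)
  ultimately have "k' x = x" using cut_outD(2)[OF x] by blast
  hence "r (k (s x)) = x" using xQ by (simp add: k'_def compose_def)
  thus ?thesis using r(3)[of "k (s x)"] GQD(1) k(1) s xQ by metis
 qed
 thus ?thesis using GQD(1)[OF s xQ] by (simp add: cut_out_field_def)
qed

lemma restrict_Gal_cut_out: assumes s: "s \<in> GQ" shows "restrict s H \<in> Gal H"
proof -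
 obtain r where r: "r \<in> GQ" "!!x. x \<in> Qbar ==> r (s x) = x" "!!x. x \<in> Qbar ==> s (r x) = x"
  using Gal_inverse[OF s] by blast
 have "bij_betw s H H"
  by (rule bij_betw_byWitness[of _ r]) (use r cut_outD(1) Gal_cut_out s in auto)
 thus ?thesis unfolding Gal_def
  using Gal_cut_out[OF s] GQD(2,3)[OF s] cut_outD(1) subring_QbarD(3,4)[OF subring_cut_out] by (auto cong: bij_betw_cong)
qed

text \<open>The commutator of \<open>s\<close> with complex conjugation has character value 1, so it
  fixes \<open>H\<close>; this is the commutativity of the Galois group of \<open>H\<close>.\<close>

lemma Gal_cut_out_cnj: assumes s: "s \<in> GQ" and x: "x \<in> H" shows "s (cnj x) = cnj (s x)"
proof -
 have xQ: "x \<in> Qbar" using cut_outD(1)[OF x] .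
 obtain r where r: "r \<in> GQ" "!!x. x \<in> Qbar ==> r (s x) = x" "!!x. x \<in> Qbar ==> s (r x) = x"
  using Gal_inverse[OF s] by blast
 define c where "c = restrict cnj Qbar"
 have c: "c \<in> GQ" "!!x. x \<in> Qbar ==> c x = cnj x" by (simp_all add: c_def cnj_in_Gal)
 have cc: "gchar c * gchar c = 1" by (rule galois_character_inverse[OF c(1) c(1)]) (simp add: c Qbar_closed)
 define k where "k = compose Qbar c (compose Qbar r (compose Qbar c s))"
 have "k \<in> GQ" unfolding k_def by (intro Gal_compose c r s)
 moreover have "gchar k = (gchar c * gchar c) * (gchar r * gchar s)"
  unfolding k_def by (simp add: galois_character_compose Gal_compose c r s mult_ac)
 ultimately have "k x = x" using cut_outD(2)[OF x] cc galois_character_inverse[OF s r(1,2)] by simp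
 moreover have "k x = cnj (r (cnj (s x)))"
  using xQ GQD(1)[OF s xQ] c(2) GQD(1)[OF r(1)] Qbar_closed(9) by (simp add: k_def compose_def)
 ultimately have "r (cnj (s x)) = cnj x" by (metis complex_cnj_cnj)
 thus ?thesis using r(3)[of "cnj (s x)"] Qbar_closed(9) GQD(1)[OF s xQ] by metis
qed

lemma ker_res_bij: assumes "\<phi> (int a) = 1" shows "bij_betw (%b. a * b mod N) ker_res ker_res"
proof -
 have fin: "finite ker_res" by (simp add: ker_res_def)
 have cop: "coprime a N" using assms character_simps(3)[of "int a"] by auto
 have "inj_on (%b. a * b mod N) ker_res"
 proof (rule inj_onI)
  fix i j assume ij: "i \<in> ker_res" "j \<in> ker_res" "a * i mod N = a * j mod N"
  hence "[i = j] (mod N)" using cop by (simp add: cong_def[symmetric] cong_mult_lcancel_nat)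
  thus "i = j" using ij by (simp add: cong_def ker_res_def)
 qed
 moreover have "(%b. a * b mod N) ` ker_res \<subseteq> ker_res"
 proof
  fix y assume "y \<in> (%b. a * b mod N) ` ker_res"
  then obtain b where b: "b < N" "\<phi> (int b) = 1" "y = a * b mod N" by (auto simp: ker_res_def)
  have "\<phi> (int y) = \<phi> (int a * int b)" unfolding b(3) by (rule character_simps(5)) (simp add: cong_def zmod_int)
  thus "y \<in> ker_res" using b assms character_simps(1,2) by (simp add: ker_res_def)
 qed
 ultimately show ?thesis using endo_inj_surj[OF fin] by (simp add: bij_betw_def)
qed

text \<open>The field \<open>H\<close> determines \<open>gchar\<close>: it contains the values at the natural numbers of the polynomial with the roots
 \<open>\<zeta>\<^sup>b\<close> for \<open>b\<close> in the kernel of \<open>\<phi>\<close>, so these roots are permuted by an automorphism that fixes \<open>H\<close>.\<close>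

lemma fix_cut_out: assumes s: "s \<in> GQ" and stable: "!!x. x \<in> H ==> s x = x" shows "gchar s = 1"
proof -
 note N = character_simps(1)
 have fin: "finite ker_res" by (simp add: ker_res_def)
 define P where "P a = (\<Prod>b\<in>ker_res. [:- (\<zeta>^(a * b)), 1:])" for a
 have lin: "poly [:- (\<zeta>^i), 1:] (of_nat t) = of_nat t - \<zeta>^i" "of_nat t - \<zeta>^i \<in> Qbar" for i t
  using Qbar_closed(1)[OF Qbar_closed(5) Qbar_closed(4)[OF zeta_Qbar], of "of_nat t" i] by simp_all
 have act: "k (poly (P 1) (of_nat t)) = poly (P a) (of_nat t)" if k: "k \<in> GQ" "k \<zeta> = \<zeta>^a" for k a t
 proof -
  have "k (of_nat t - \<zeta>^b) = of_nat t - \<zeta>^(a * b)" for b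
   using GQD(2)[OF k(1), of "of_nat t" "- (\<zeta>^b)"] GQ_hom(2,6)[OF k(1)] GQ_hom(3)[OF k(1), of \<zeta> b] zeta_Qbar[of b] zeta_Qbar[of 1] k(2)
   by (simp add: Qbar_closed(4,5) power_mult)
  thus ?thesis unfolding P_def poly_prod lin(1) mult_1 by (subst GQ_hom(5)[OF k(1) lin(2)]) simp
 qed
 have "poly (P 1) (of_nat t) \<in> H" for t
 proof -
  have "k (poly (P 1) (of_nat t)) = poly (P 1) (of_nat t)" if k: "k \<in> GQ" "gchar k = 1" for k
  proof -
   obtain a where a: "k \<zeta> = \<zeta>^a" using Gal_cis_root[OF k(1) N] by blast
   hence "\<phi> (int a) = 1" using galois_character_eq[of k a] k(2) by simp
   note prod.reindex_bij_betw[OF ker_res_bij[OF this], of "%b. [:- (\<zeta>^b), 1:]"]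
   moreover have "\<zeta>^(a * b mod N) = \<zeta>^(a * b)" for b by (simp add: cis_power_eq_iff[OF N] cong_def)
   ultimately have "P 1 = P a" by (simp add: P_def)
   thus ?thesis unfolding act[OF k(1) a] by simp
  qed
  moreover have "poly (P 1) (of_nat t) \<in> Qbar" unfolding P_def poly_prod lin(1) by (intro Qbar_closed(8) lin(2))
  ultimately show ?thesis by (simp add: cut_out_field_def)
 qed
 hence fixed: "poly (P a) (of_nat t) = poly (P 1) (of_nat t)" if "s \<zeta> = \<zeta>^a" for a t using stable act[OF s that] by metis
 obtain a where a: "s \<zeta> = \<zeta>^a" using Gal_cis_root[OF s N] by blast
 have "P a = P 1"
 proof (rule ccontr)
  assume "P a ~= P 1"
  hence "finite {x. poly (P a - P 1) x = 0}" by (intro poly_roots_finite) simp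
  moreover have "\<nat> \<subseteq> {x. poly (P a - P 1) x = 0}" using fixed[OF a] by (auto elim: Nats_cases)
  ultimately have "finite (\<nat> :: complex set)" by (rule finite_subset[rotated])
  thus False by (simp add: Nats_def range_inj_infinite inj_of_nat)
 qed
 moreover have "poly (P a) (\<zeta>^a) = 0"
 proof -
  \<comment> \<open>\<open>1 mod N\<close> instead of 1 keeps the representative below
    \<open>N\<close> when \<open>N = 1\<close>.\<close>
  have "\<phi> (int (1 mod N)) = \<phi> 1" by (rule character_simps(5)) (simp add: cong_def zmod_int)
  hence "1 mod N \<in> ker_res" using N character_simps(4) by (simp add: ker_res_def)
  moreover have "\<zeta>^(a * (1 mod N)) = \<zeta>^a" unfolding cis_power_eq_iff[OF N] by (simp add: cong_def mod_mult_right_eq)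
  ultimately show ?thesis using fin by (auto simp: P_def poly_prod intro!: bexI[of _ "1 mod N"])
 qed
 ultimately obtain b where b: "b \<in> ker_res" "[a = b] (mod N)"
  using fin cis_power_eq_iff[OF N] by (auto simp: P_def poly_prod)
 have "\<phi> (int a) = \<phi> (int b)" by (rule character_simps(5)) (use b(2) in \<open>simp add: cong_int_iff\<close>)
 thus ?thesis using galois_character_eq[of s a, OF a] b(1) by (simp add: ker_res_def)
qed

text \<open>Two extensions of \<open>t\<close> differ by an automorphism that fixes
  \<open>H\<close>, and by \<open>fix_cut_out\<close> its character value is 1. So the description
  in \<open>quotient_character\<close> has a single value.\<close>

lemma quotient_character_eq:
 assumes s: "s \<in> GQ" "!!x. x \<in> H ==> s x = t x" shows "quotient_character N \<phi> t = gchar s"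
 unfolding quotient_character_def
proof (rule the_equality)
 show "\<exists>s'\<in>GQ. (\<forall>x\<in>H. s' x = t x) & gchar s = gchar s'" using s by blast
 fix y assume "\<exists>s'\<in>GQ. (\<forall>x\<in>H. s' x = t x) & y = gchar s'"
 then obtain s' where s': "s' \<in> GQ" "\<forall>x\<in>H. s' x = t x" "y = gchar s'" by (elim bexE conjE)
 obtain r where r: "r \<in> GQ" "!!x. x \<in> Qbar ==> r (s x) = x" "!!x. x \<in> Qbar ==> s (r x) = x"
  using Gal_inverse[OF s(1)] by blast
 have "compose Qbar r s' x = x" if x: "x \<in> H" for x
 proof -
  have "compose Qbar r s' x = r (s' x)" using cut_outD(1)[OF x] by (simp add: compose_def)
  also have "... = r (s x)" using s(2)[OF x] s'(2) x by simp
  also have "... = x" by (rule r(2)[OF cut_outD(1)[OF x]])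
  finally show ?thesis .
 qed
 from fix_cut_out[OF Gal_compose[OF r(1) s'(1)] this] have "gchar r * gchar s' = 1"
  unfolding galois_character_compose[OF r(1) s'(1)] .
 moreover have "gchar r * gchar s = 1" by (rule galois_character_inverse[OF s(1) r(1,2)])
 ultimately have "gchar r * gchar s' = gchar r * gchar s" "gchar r ~= 0" by auto
 thus "y = gchar s" unfolding s'(3) by simp
qed

lemma p_integersD: "x \<in> p_integers p H ==> x \<in> H" by (simp add: p_integers_def)

lemma p_integers_mult: assumes "x \<in> p_integers p H" "y \<in> p_integers p H" shows "x * y \<in> p_integers p H"
proof -
 obtain m n where "of_nat p^m * x \<in> Zbar" "of_nat p^n * y \<in> Zbar" using assms by (auto simp: p_integers_def)
 from Zbar_closed(2)[OF this] have "of_nat p^(m + n) * (x * y) \<in> Zbar" by (simp add: power_add mult_ac)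
 thus ?thesis using assms subring_QbarD(4)[OF subring_cut_out] by (auto simp: p_integers_def)
qed

lemma p_integers_Zbar: "x \<in> H ==> x \<in> Zbar ==> x \<in> p_integers p H"
 unfolding p_integers_def by (intro CollectI conjI exI[of _ 0]) auto

lemma unit_group_p_units: "unit_group (p_units p H)"
proof -
 have mult: "u * v \<in> p_units p H" if uv: "u \<in> p_units p H" "v \<in> p_units p H" for u v
 proof -
  obtain u' v' where "u' \<in> p_integers p H" "u * u' = 1" "v' \<in> p_integers p H" "v * v' = 1" using uv by (auto simp: p_units_def)
  hence "u' * v' \<in> p_integers p H" "(u * v) * (u' * v') = 1" using p_integers_mult by (simp_all add: mult_ac)
  thus ?thesis using uv p_integers_mult unfolding p_units_def by blast
 qed
 have inv: "inverse u \<in> p_units p H" if u: "u \<in> p_units p H" for u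
 proof -
  obtain u' where u': "u' \<in> p_integers p H" "u * u' = 1" using u by (auto simp: p_units_def)
  hence "inverse u = u'" by (metis inverse_unique)
  thus ?thesis using u u' unfolding p_units_def by (auto simp: mult.commute)
 qed
 have "1 \<in> p_integers p H" using subring_QbarD(1)[OF subring_cut_out, of 1] Zbar_closed(3)[of 1] by (intro p_integers_Zbar) auto
 hence "1 \<in> p_units p H" by (auto simp: p_units_def)
 thus ?thesis using mult inv by (auto simp: unit_group_def p_units_def)
qed

lemma p_units_Gal: assumes "s \<in> GQ" "u \<in> p_units p H" shows "s u \<in> p_units p H"
proof -
 have int: "s x \<in> p_integers p H" if x: "x \<in> p_integers p H" for x
 proof -
  obtain n where "of_nat p^n * x \<in> Zbar" using x by (auto simp: p_integers_def)
  from Gal_Zbar[OF assms(1) this] have "of_nat p^n * s x \<in> Zbar"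
   using GQD(3)[OF assms(1), of "of_nat (p^n)" x] GQ_hom(6)[OF assms(1), of "p^n"] cut_outD(1)[OF p_integersD[OF x]] by (simp add: Qbar_closed(5))
  thus ?thesis using Gal_cut_out[OF assms(1) p_integersD[OF x]] by (auto simp: p_integers_def)
 qed
 obtain v where v: "v \<in> p_integers p H" "u * v = 1" using assms(2) by (auto simp: p_units_def)
 have u: "u \<in> p_integers p H" using assms(2) by (simp add: p_units_def)
 have "s u * s v = 1"
  using GQD(3)[OF assms(1) cut_outD(1)[OF p_integersD[OF u]] cut_outD(1)[OF p_integersD[OF v(1)]]] v(2) GQD(4)[OF assms(1)] by simp
 thus ?thesis using int u v(1) by (auto simp: p_units_def)
qed

end

lemma embedding_simps:
 assumes "qbar_embedding (\<iota> :: complex => 'b::field_char_0)"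
 shows "x \<in> Qbar ==> y \<in> Qbar ==> \<iota> (x * y) = \<iota> x * \<iota> y" "x \<in> Qbar ==> \<iota> x = 0 \<longleftrightarrow> x = 0"
  "x \<in> Qbar ==> y \<in> Qbar ==> \<iota> x = \<iota> y \<longleftrightarrow> x = y" "x \<in> Qbar ==> \<iota> (inverse x) = inverse (\<iota> x)"
proof -
 note h = ring_hom_onD[OF subring_Qbar_Qbar qbar_embedding_hom[OF assms]]
 have add: "\<iota> (x + y) = \<iota> x + \<iota> y" and mult: "\<iota> (x * y) = \<iota> x * \<iota> y" and one: "\<iota> 1 = 1" if "x \<in> Qbar" "y \<in> Qbar" for x y
  using assms that by (auto simp: qbar_embedding_def)
 have 1: "1 \<in> Qbar" by (rule Qbar_closed(5)) simp
 have inv: "\<iota> x * \<iota> (inverse x) = 1" if "x \<in> Qbar" "x ~= 0" for x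
  using mult[OF that(1) Qbar_closed(3)[OF that(1)]] that(2) one[OF 1 1] by simp
 have zero: "\<iota> x = 0 \<longleftrightarrow> x = 0" if "x \<in> Qbar" for x using inv[OF that] h(8) by (cases "x = 0") auto
 show "x \<in> Qbar ==> y \<in> Qbar ==> \<iota> (x * y) = \<iota> x * \<iota> y" using mult .
 show "x \<in> Qbar ==> \<iota> x = 0 \<longleftrightarrow> x = 0" using zero .
 show "\<iota> x = \<iota> y \<longleftrightarrow> x = y" if "x \<in> Qbar" "y \<in> Qbar"
  using zero[OF Qbar_closed(1)[OF that(1) Qbar_closed(4)[OF that(2)]]] add[OF that(1) Qbar_closed(4)[OF that(2)]] h(2)[OF that(2)] by simp
 show "\<iota> (inverse x) = inverse (\<iota> x)" if "x \<in> Qbar"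
  using inv[OF that] h(8) by (cases "x = 0") (auto simp: inverse_unique)
qed

lemma Gal_qbar_embedding: "s \<in> GQ ==> qbar_embedding s"
 using GQD[of s] by (simp add: qbar_embedding_def)

lemma primitive_roots_power:
 fixes g :: "'b::field"
 assumes n: "n > 0" and g: "g^n = 1" "!!i. g^i = 1 ==> n dvd i" and x: "x^n = 1" obtains i where "x = g^i"
proof -
 define P where "P = monom 1 n - (1 :: 'b poly)"
 have deg: "degree P = n" unfolding P_def using n degree_add_eq_left[of "- 1" "monom 1 n :: 'b poly"] by (simp add: degree_monom_eq)
 hence P: "P ~= 0" using n by auto
 have roots: "{y. poly P y = 0} = {y. y^n = 1}" by (simp add: P_def poly_monom)
 have g0: "g ~= 0" using g(1) n by (auto simp: power_0_left)
 have "inj_on (%i. g^i) {..<n}"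
 proof (rule linorder_inj_onI)
  fix i j assume "i < j" "i \<in> {..<n}" "j \<in> {..<n}"
  show "g^i ~= g^j"
  proof
   assume "g^i = g^j"
   also have "g^j = g^i * g^(j - i)" using \<open>i < j\<close> by (simp flip: power_add)
   finally have "g^(j - i) = 1" using g0 by simp
   thus False using g(2)[of "j - i"] \<open>i < j\<close> \<open>j \<in> {..<n}\<close> by (auto dest!: dvd_imp_le)
  qed
 qed auto
 hence "card ((%i. g^i) ` {..<n}) = n" by (simp add: card_image)
 moreover have "card {y. poly P y = 0} \<le> n" using card_poly_roots_bound[OF P] deg by simp
 moreover have "(%i. g^i) ` {..<n} \<subseteq> {y. poly P y = 0}" unfolding roots using g(1)
  by (auto simp flip: power_mult simp: mult.commute[of _ n]) (simp add: power_mult)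
 ultimately have "(%i. g^i) ` {..<n} = {y. poly P y = 0}" using poly_roots_finite[OF P] by (intro card_seteq) auto
 thus thesis using x that unfolding roots by blast
qed

section \<open>Elements of valuation 0 in the eigenspace\<close>

context padic_closure begin

context
 fixes \<iota> :: "complex => 'k" and N :: nat and \<phi> :: "int => complex"
 assumes emb: "qbar_embedding \<iota>" and dchar: "dirichlet_character N \<phi>" and \<phi>_odd: "\<phi> (- 1) = - 1"
begin

abbreviation (input) H\<^sub>\<phi> where "H\<^sub>\<phi> \<equiv> cut_out_field N \<phi>"
abbreviation (input) "\<psi> \<equiv> quotient_character N \<phi>"

lemma galois_character_cnj: "galois_character N \<phi> (restrict cnj Qbar) = - 1"
proof -
 note N = character_simps(1)[OF dchar]
 have "cnj (cis (2 * pi / real N)) = cis (2 * pi / real N)^(N - 1)"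
 proof -
  have "cis (2 * pi / real N) * cis (2 * pi / real N)^(N - 1) = 1"
   using cis_root(1)[OF N] N by (metis power_minus_mult mult.commute)
  hence "cis (2 * pi / real N)^(N - 1) = inverse (cis (2 * pi / real N))" by (metis inverse_unique)
  thus ?thesis by (simp add: cis_cnj)
 qed
 hence "galois_character N \<phi> (restrict cnj Qbar) = \<phi> (int (N - 1))"
  using cis_root_Qbar[OF N, of 1] by (intro galois_character_eq[OF dchar]) simp
 also have "... = \<phi> (- 1)"
  by (rule character_simps(5)[OF dchar]) (use N in \<open>simp add: of_nat_diff cong_iff_dvd_diff\<close>)
 finally show ?thesis using \<phi>_odd by simp
qed

lemma embedded_Gal_units:
 assumes "s \<in> GQ" "u \<in> p_units p H\<^sub>\<phi>" shows "u \<in> Qbar" "u \<in> H\<^sub>\<phi>" "\<iota> (s u) ~= 0" "u ~= 0"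
proof -
 note U = unit_group_p_units[OF dchar, of p]
 show H: "u \<in> H\<^sub>\<phi>" using assms(2) by (simp add: p_units_def p_integers_def)
 thus Q: "u \<in> Qbar" by (rule cut_outD(1)[OF dchar])
 show "u ~= 0" using assms(2) unit_groupD(1)[OF U] by auto
 thus "\<iota> (s u) ~= 0" using embedding_simps(2)[OF emb GQD(1)[OF assms(1) Q]] GQD(5)[OF assms(1) Q] by simp
qed

lemma ord_Gal_mult:
 assumes "s \<in> GQ" "u \<in> p_units p H\<^sub>\<phi>" "v \<in> p_units p H\<^sub>\<phi>"
 shows "padic_ord p (\<iota> (s (u * v))) = padic_ord p (\<iota> (s u)) + padic_ord p (\<iota> (s v))"
proof -
 note u = embedded_Gal_units[OF assms(1,2)] and v = embedded_Gal_units[OF assms(1,3)]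
 have "\<iota> (s (u * v)) = \<iota> (s u) * \<iota> (s v)"
  using GQD(3)[OF assms(1) u(1) v(1)] embedding_simps(1)[OF emb] GQD(1)[OF assms(1)] u(1) v(1) by simp
 thus ?thesis using padic_ord_mult[OF u(3) v(3)] by simp
qed

text \<open>Since \<open>\<psi>\<close> is odd, twice an element of the eigenspace is a combination of the quotients
 \<open>u / cnj u\<close>, all of whose conjugates have absolute value 1.\<close>

lemma eigenspace_vanishing:
 assumes x: "x \<in> inverse_eigenspace p \<iota> H\<^sub>\<phi> \<psi>" and ord: "tensor_lift (%u. of_rat (padic_ord p (\<iota> u))) x = 0"
 shows "tensor_eq (p_units p H\<^sub>\<phi>) x 0"
proof -
 define U where "U = p_units p H\<^sub>\<phi>"
 have U: "unit_group U" unfolding U_def by (rule unit_group_p_units[OF dchar])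
 have keys: "Poly_Mapping.keys x \<subseteq> U" using x by (simp add: inverse_eigenspace_def formal_sums_def U_def)
 have eig: "tensor_eq U (tensor_act t x) (tensor_scale (\<iota> (inverse (\<psi> t))) x)" if "t \<in> Gal H\<^sub>\<phi>" for t
  using x that by (simp add: inverse_eigenspace_def U_def)
 have hom: "padic_ord p (\<iota> (s (u * v))) = padic_ord p (\<iota> (s u)) + padic_ord p (\<iota> (s v))"
  if "s \<in> GQ" "u \<in> U" "v \<in> U" for s u v using ord_Gal_mult that by (simp add: U_def)
 have UQ: "u \<in> Qbar" "u \<in> H\<^sub>\<phi>" if "u \<in> U" for u using that cut_outD(1)[OF dchar] by (auto simp: U_def p_units_def p_integers_def)
 define id where "id = restrict (%x. x) Qbar"
 have id: "id \<in> GQ" by (auto simp: id_def Gal_def Qbar_closed bij_betw_def inj_on_def)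
 have hom1: "(of_rat (padic_ord p (\<iota> (u * v))) :: 'k) = of_rat (padic_ord p (\<iota> u)) + of_rat (padic_ord p (\<iota> v))" if "u \<in> U" "v \<in> U" for u v
  using hom[OF id that] UQ(1) that Qbar_closed(2) by (simp add: id_def of_rat_add)
 \<comment> \<open>An automorphism of \<open>H\<close> multiplies \<open>x\<close> by a scalar in
   the tensor product, so vanishing of the valuation at one embedding spreads to all conjugate
   embeddings.\<close>
 have ords: "tensor_lift (%u. of_rat (padic_ord p (\<iota> (s u)))) x = (0 :: 'k)" if s: "s \<in> GQ" for s
 proof -
  define t where "t = restrict s H\<^sub>\<phi>"
  have "t \<in> Gal H\<^sub>\<phi>" unfolding t_def by (rule restrict_Gal_cut_out[OF dchar s])
  from tensor_lift_cong[OF hom1 eig[OF this]]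
  have "tensor_lift (%u. of_rat (padic_ord p (\<iota> (t u)))) x = (0 :: 'k)"
   using ord by (simp add: tensor_lift_act tensor_lift_scale)
  moreover have "tensor_lift (%u. of_rat (padic_ord p (\<iota> (t u)))) x = (tensor_lift (%u. of_rat (padic_ord p (\<iota> (s u)))) x :: 'k)"
   unfolding tensor_lift_def by (intro sum.cong refl) (use keys UQ(2) in \<open>auto simp: t_def\<close>)
  ultimately show ?thesis by simp
 qed
 define c where "c = restrict (restrict cnj Qbar) H\<^sub>\<phi>"
 have c: "c \<in> Gal H\<^sub>\<phi>" unfolding c_def by (rule restrict_Gal_cut_out[OF dchar cnj_in_Gal])
 have cu: "c u = cnj u" if "u \<in> U" for u using UQ that by (simp add: c_def)
 have "\<psi> c = - 1"
  using quotient_character_eq[OF dchar cnj_in_Gal, of c] galois_character_cnj by (simp add: c_def)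
 moreover have "\<iota> (- 1) = - 1"
  using ring_hom_onD(7)[OF subring_Qbar_Qbar qbar_embedding_hom[OF emb], of "- 1"] by simp
 ultimately have "tensor_eq U (tensor_act c x) (- x)" using eig[OF c] by (simp add: tensor_scale_minus_1)
 \<comment> \<open>Conjugation acts on \<open>x\<close> by -1, so \<open>x\<close> minus its
   conjugate is twice \<open>x\<close>.\<close>
 from tensor_eq_diff[OF tensor_eq_refl[of U x] this] have two: "tensor_eq U (x - tensor_act c x) (x + x)" by (simp only: diff_minus_eq_add)
 define w where "w u = u * inverse (cnj u)" for u
 define y where "y = (\<Sum>u\<in>Poly_Mapping.keys x. sg (w u) (Poly_Mapping.lookup x u))"
 have cnjU: "cnj u \<in> U" if "u \<in> U" for u
  using p_units_Gal[OF dchar cnj_in_Gal, of u p] UQ(1)[OF that] that by (simp add: U_def)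
 have "tensor_eq U y (\<Sum>u\<in>Poly_Mapping.keys x. sg u (Poly_Mapping.lookup x u) - sg (cnj u) (Poly_Mapping.lookup x u))"
  unfolding y_def
 proof (rule tensor_eq_sum)
  fix u assume "u \<in> Poly_Mapping.keys x"
  hence u: "u \<in> U" using keys by blast
  define d where "d = Poly_Mapping.lookup x u"
  have "tensor_eq U (sg (w u) d) (sg u d + sg (inverse (cnj u)) d)"
   unfolding w_def by (intro tensor_mult[OF U] u unit_groupD(4)[OF U] cnjU)
  moreover have "tensor_eq U (sg u d + sg (inverse (cnj u)) d) (sg u d + - sg (cnj u) d)"
   by (intro tensor_eq_add tensor_eq_refl tensor_inverse[OF U] cnjU u)
  ultimately show "tensor_eq U (sg (w u) d) (sg u d - sg (cnj u) d)" using tensor_eq_trans by fastforce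
 qed
 also have "(\<Sum>u\<in>Poly_Mapping.keys x. sg u (Poly_Mapping.lookup x u) - sg (cnj u) (Poly_Mapping.lookup x u)) = x - tensor_act c x"
  unfolding sum_subtractf sum_singles tensor_act_def using cu keys by (intro arg_cong2[of _ _ _ _ minus] refl sum.cong) auto
 finally have y: "tensor_eq U y (x + x)" using tensor_eq_trans[OF _ two] by blast
 define W where "W = {u \<in> U. \<forall>s\<in>GQ. cmod (s u) = 1}"
 have W: "unit_group W"
 proof -
  have "cmod (s 1) = 1 & cmod (s (u * v)) = cmod (s u) * cmod (s v) & cmod (s (inverse u)) = inverse (cmod (s u))"
   if "s \<in> GQ" "u \<in> U" "v \<in> U" for s u v
   using GQD(3,4)[OF that(1)] embedding_simps(4)[OF Gal_qbar_embedding[OF that(1)]] UQ(1) that by (simp add: norm_mult norm_inverse)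
  thus ?thesis using unit_groupD(1-4)[OF U] by (auto simp: unit_group_def W_def)
 qed
 \<comment> \<open>The linear forms are the valuations at all conjugates; a unit in \<open>W\<close>
   on which they all vanish is a root of unity by \<open>kronecker\<close>.\<close>
 have "tensor_eq U y 0" unfolding y_def
 proof (rule tensor_vanishing[OF U, where W = W and S = GQ and L = "%s u. padic_ord p (\<iota> (s u))"])
  show "W \<subseteq> U" by (auto simp: W_def)
  show "u^n * v powi m \<in> W" if "u \<in> W" "v \<in> W" for u v n m
   using that by (intro unit_groupD[OF W])
  show "padic_ord p (\<iota> (s (u * v))) = padic_ord p (\<iota> (s u)) + padic_ord p (\<iota> (s v))" if "s \<in> GQ" "u \<in> U" "v \<in> U" for s u v
   by (rule hom[OF that])
  show "\<exists>n>0. u^n = 1" if u: "u \<in> W" "!!s. s \<in> GQ ==> padic_ord p (\<iota> (s u)) = 0" for u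
  proof -
   have uU: "u \<in> U" using u(1) by (simp add: W_def)
   then obtain M where "of_nat p^M * u \<in> Zbar" by (auto simp: U_def p_units_def p_integers_def)
   thus ?thesis using kronecker[OF emb UQ(1)[OF uU], of M] u embedded_Gal_units(3) uU padic_ord_eq_0_iff
    by (simp add: W_def U_def) (metis order_refl)
  qed
  show "finite (Poly_Mapping.keys x)" by simp
  show "w u \<in> W" if "u \<in> Poly_Mapping.keys x" for u
  proof -
   have u: "u \<in> U" using that keys by blast
   have "cmod (s (w u)) = 1" if s: "s \<in> GQ" for s
    using GQD(3)[OF s] embedding_simps(4)[OF Gal_qbar_embedding[OF s]] Gal_cut_out_cnj[OF dchar s UQ(2)[OF u]] UQ(1)[OF u] GQD(5)[OF s]
     embedded_Gal_units(4)[OF s] u Qbar_closed(3,9) by (simp add: w_def norm_mult norm_inverse U_def)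
   thus ?thesis using unit_groupD(3,4)[OF U] u cnjU by (auto simp: W_def w_def)
  qed
  show "tensor_lift (%u. of_rat (padic_ord p (\<iota> (s u)))) (\<Sum>u\<in>Poly_Mapping.keys x. sg (w u) (Poly_Mapping.lookup x u)) = (0 :: 'k)" if s: "s \<in> GQ" for s
   using tensor_lift_cong[OF _ y, of "%u. of_rat (padic_ord p (\<iota> (s u)))", unfolded tensor_lift_add ords[OF s] add_0_left y_def] hom[OF s]
   by (simp add: of_rat_add)
 qed
 from tensor_eq_scale[OF tensor_eq_trans[OF tensor_eq_sym[OF this] y], of "1 / 2"]
 have "tensor_eq U 0 (tensor_scale (1 / 2) (x + x))" unfolding tensor_scale_0 .
 moreover have "tensor_scale (1 / 2) (x + x) = x"
  by (rule poly_mapping_eqI) (simp only: lookup_add lookup_tensor_scale, simp)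
 ultimately show ?thesis using tensor_eq_sym by (simp only: U_def)
qed

end

end

section \<open>Gauss sums in the complex numbers\<close>

lemma sum_periodic_shift:
 fixes F :: "nat => 'a::ab_group_add"
 assumes "!!j. F (j + m) = F j" shows "(\<Sum>j<m. F (j + t)) = (\<Sum>j<m. F j)"
proof (induction t)
 case (Suc t)
 have "F (0 + t) + (\<Sum>j<m. F (Suc j + t)) = (\<Sum>j<m. F (j + t)) + F (m + t)"
  by (subst sum.lessThan_Suc_shift[symmetric]) simp
 thus ?case using Suc assms[of t] by (simp add: add.commute)
qed simp

context padic_closure begin

definition zc :: "nat => complex" where "zc f = cis (2 * pi / real (p^f - 1))"
definition wc :: complex where "wc = cis (2 * pi / real p)"

context
 fixes \<iota> :: "complex => 'k" and f :: nat
 assumes emb: "qbar_embedding \<iota>" and f: "f > 0"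
begin

abbreviation (input) "m \<equiv> p^f - 1"
abbreviation (input) "z \<equiv> zc f"

lemmas \<iota>_simps = embedding_simps[OF emb]
lemmas \<iota>_hom = ring_hom_onD[OF subring_Qbar_Qbar qbar_embedding_hom[OF emb]]

lemma m_pos: "m > 0"
 using one_less_power[OF p_gt_1 f] by simp

lemma root_Qbar: "z^i \<in> Qbar" "wc^i \<in> Qbar" "z \<in> Qbar" "wc \<in> Qbar"
 using cis_root_Qbar[OF m_pos] cis_root_Qbar[OF m_pos, of 1] cis_root_Qbar[OF p_gt_0] cis_root_Qbar[OF p_gt_0, of 1] by (simp_all add: zc_def wc_def)

lemma \<iota>_root: "\<iota> z^i = \<iota> (z^i)" "\<iota> wc^i = \<iota> (wc^i)"
 using \<iota>_hom(3) root_Qbar by simp_all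

lemma \<iota>_1: "\<iota> 1 = 1" using \<iota>_hom(6)[of 1] by simp

lemma embedded_root: assumes "M > 0"
 shows "\<iota> (cis (2 * pi / real M))^M = 1" "\<iota> (cis (2 * pi / real M))^i = 1 ==> M dvd i"
proof -
 have e: "\<iota> (cis (2 * pi / real M))^i = 1 \<longleftrightarrow> M dvd i" for i
  using \<iota>_hom(3)[of "cis (2 * pi / real M)" i] cis_root_Qbar[OF assms, of 1] cis_root_Qbar[OF assms, of i]
   cis_root_Qbar[OF assms, of 0] \<iota>_simps(3)[of "cis (2 * pi / real M)^i" 1] \<iota>_1 cis_power_eq_iff[OF assms, of i 0] by (simp add: cong_0_iff)
 show "\<iota> (cis (2 * pi / real M))^M = 1" "\<iota> (cis (2 * pi / real M))^i = 1 ==> M dvd i" using e by simp_all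
qed

lemma z_primitive: "\<iota> z^m = 1" "\<forall>n. \<iota> z^n = 1 --> m dvd n"
 using embedded_root[OF m_pos] unfolding zc_def by blast+

lemma z_power_pf: "(\<iota> z^j)^(p^f) = \<iota> z^j"
proof -
 have 1: "(\<iota> z^j)^m = 1" unfolding power_mult[symmetric] mult.commute[of j] unfolding power_mult z_primitive(1) by simp
 have "Suc m = p^f" using m_pos by simp
 thus ?thesis using power_Suc[of "\<iota> z^j" m] unfolding 1 by simp
qed

text \<open>The values of \<open>theta\<close> lie in \<open>'k\<close>; recording them as exponents
  of a \<open>p\<close>-th root of unity transports the additive character to C.\<close>

definition theta_exp :: "nat => nat" where "theta_exp j = (SOME i. theta f (\<iota> z^j) = \<iota> wc^i)"

lemma av_z_power: "av (\<iota> z^j) \<le> 1"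
 using av_z[OF f z_primitive] by simp

lemma theta_exp: "\<iota> (wc^theta_exp j) = theta f (\<iota> z^j)"
proof -
 have "theta f (\<iota> z^j)^p = 1" by (rule theta_root[OF f av_z_power z_power_pf])
 from primitive_roots_power[OF p_gt_0 embedded_root[OF p_gt_0, folded wc_def] this]
 have "\<exists>i. theta f (\<iota> z^j) = \<iota> wc^i" by metis
 from someI_ex[OF this] show ?thesis unfolding theta_exp_def \<iota>_root by metis
qed

text \<open>The Gauss sum in \<open>\<complex>\<close> that \<open>\<iota>\<close> maps to \<open>gauss f (\<iota> z) a\<close>.\<close>

definition gauss_c :: "nat => complex"
 where "gauss_c a = (\<Sum>j<m. inverse z^(a * j) * wc^theta_exp j)"

lemma inverse_zc: "inverse z^(m * i) = 1" "a \<le> m ==> inverse z^a = z^(m - a)"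
proof -
 show "inverse z^(m * i) = 1" unfolding power_inverse power_mult zc_def cis_root(1)[OF m_pos] by simp
 assume "a \<le> m"
 hence "z^(m - a) * z^a = 1" using cis_root(1)[OF m_pos, folded zc_def] by (simp only: power_add[symmetric] le_add_diff_inverse2)
 hence "z^(m - a) = inverse (z^a)" by (metis inverse_unique mult.commute)
 thus "inverse z^a = z^(m - a)" by (simp add: power_inverse)
qed

lemma gauss_c_cong: assumes "[a = b] (mod m)" shows "gauss_c a = gauss_c b"
proof -
 have *: "inverse z^a = inverse z^(a mod m)" for a
 proof -
  have "inverse z^(m * (a div m) + a mod m) = inverse z^(a mod m)" unfolding power_add inverse_zc by simp
  thus ?thesis by (simp only: mult_div_mod_eq)
 qed
 show ?thesis using *[of a] *[of b] assms unfolding gauss_c_def power_mult cong_def by simp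
qed

lemma gauss_c_Zbar: "gauss_c a \<in> Zbar"
 unfolding gauss_c_def inverse_zc(2)[of 1, simplified power_one_right, OF m_pos[unfolded Suc_le_eq[symmetric] One_nat_def[symmetric]]]
 by (intro Zbar_closed(2,4,5) cis_root_Zbar[OF m_pos, folded zc_def] cis_root_Zbar[OF p_gt_0, folded wc_def])

lemma \<iota>_gauss_c: assumes "a \<le> m" shows "\<iota> (gauss_c a) = gauss f (\<iota> z) a"
proof -
 have t: "inverse z^(a * j) * wc^theta_exp j = z^((m - a) * j) * wc^theta_exp j" for j
  unfolding power_mult inverse_zc(2)[OF assms] ..
 have "z^((m - a) * j) * wc^theta_exp j \<in> Qbar" for j by (intro Qbar_closed(2) root_Qbar)
 thus ?thesis unfolding gauss_c_def t gauss_def[OF f z_primitive] qf_def[OF f z_primitive]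
  by (subst \<iota>_hom(4)) (simp_all only: \<iota>_simps(1)[OF root_Qbar(1,2)] theta_exp \<iota>_root)
qed

text \<open>\<open>s\<close> raises the additive character to a power \<open>B\<close> prime to
  \<open>p\<close>. The lift \<open>c\<close> of \<open>B\<close> to a root of unity is a power
  \<open>z^i\<close>, and \<open>theta_mult_unit\<close> turns raising to the power \<open>B\<close>
  into multiplication of the argument by \<open>c\<close>, a shift of \<open>j\<close> by
  \<open>i\<close>. The multiplicative character answers with a root of unity.\<close>

lemma Gal_gauss_c:
 assumes s: "s \<in> GQ" "s z = z^A" obtains i where "inverse z^(A * a * i) * s (gauss_c a) = gauss_c (A * a)"
proof -
 obtain B where B: "s wc = wc^B" using Gal_cis_root[OF s(1) p_gt_0, folded wc_def] by blast
 have "\<not> p dvd B"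
 proof
  assume "p dvd B"
  hence "s wc = 1" using B cis_power_eq_iff[OF p_gt_0, folded wc_def, of B 0] by (simp add: cong_0_iff)
  moreover have "s (wc - 1) = s wc - 1"
   using GQD(2)[OF s(1), of wc "- 1"] GQ_hom(7)[OF s(1), of "- 1"] root_Qbar(4) Qbar_closed(5)[of "- 1"] by simp
  moreover have "wc - 1 \<in> Qbar" using Qbar_closed(1)[OF root_Qbar(4) Qbar_closed(5)[of "- 1"]] by simp
  ultimately have "wc^1 = wc^0" using GQD(5)[OF s(1)] by simp
  thus False using cis_power_eq_iff[OF p_gt_0, folded wc_def, of 1 0] p_gt_1 by (simp add: cong_0_iff)
 qed
 hence cop: "coprime (int B) (int p)" using coprime_p_iff by simp
 \<comment> \<open>For odd \<open>p\<close> the Teichmueller lift has the required order. For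
   \<open>p = 2\<close> that lift is only a square root of 1, whereas the exponent
   \<open>p - 1\<close> is 1, so \<open>c = 1\<close> is taken.\<close>
 have "\<exists>c. c^(p - 1) = 1 & av (c - of_nat B) < 1"
 proof (cases "p = 2")
  case True
  hence "int p dvd 1 - int B" using cop by simp
  hence "av (of_int (1 - int B)) < 1" unfolding av_of_int_less_iff .
  thus ?thesis using True by (intro exI[of _ 1]) simp
 next
  case False
  hence "totient qq = p - 1" using totient_prime[OF prime_p] by (simp add: qq_def)
  thus ?thesis using teichmuller_spec[OF cop] inv_qq_le_1(2) by (intro exI[of _ "teichmuller p (int B)"]) auto
 qed
 then obtain c where c: "c^(p - 1) = 1" "av (c - of_nat B) < 1" by blast
 have cp: "c^p = c" using c(1) power_minus_mult[OF p_gt_0, of c] by simp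
 have "[p = 1] (mod (p - 1))" using p_gt_1 by (simp add: cong_altdef_nat)
 from cong_to_1_nat[OF cong_pow[OF this, of f, unfolded power_one]] have "p - 1 dvd m" .
 hence "c^m = 1" using c(1) by (auto elim!: dvdE simp: power_mult)
 from primitive_roots_power[OF m_pos z_primitive(1) _ this] obtain i where i: "c = \<iota> z^i" using z_primitive(2) by blast
 have wB: "s (wc^theta_exp j) = wc^theta_exp (j + i)" for j
 proof -
  have "\<iota> ((wc^theta_exp j)^B) = theta f (\<iota> z^j)^B"
   using \<iota>_hom(3)[OF root_Qbar(2)] theta_exp by simp
  also have "... = theta f (c * \<iota> z^j)" by (rule theta_mult_unit[OF f av_z_power z_power_pf cp c(2), symmetric])
  also have "... = \<iota> (wc^theta_exp (j + i))" unfolding theta_exp i by (simp add: power_add mult.commute)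
  finally have "(wc^theta_exp j)^B = wc^theta_exp (j + i)"
   using \<iota>_simps(3) root_Qbar(2) Qbar_closed(6) by blast
  thus ?thesis using GQ_hom(3)[OF s(1) root_Qbar(4)] B by (simp add: mult.commute flip: power_mult)
 qed
 have sz: "s (inverse z^k) = inverse z^(A * k)" for k
  using GQ_hom(3)[OF s(1), of "inverse z" k] embedding_simps(4)[OF Gal_qbar_embedding[OF s(1)] root_Qbar(3)] s(2) root_Qbar(3)
  by (simp add: Qbar_closed(3) power_mult power_inverse)
 define F where "F j = inverse z^(A * a * j) * wc^theta_exp j" for j
 have "F (j + m) = F j" for j
 proof -
  have "\<iota> z^(j + m) = \<iota> z^j" unfolding power_add z_primitive(1) by simp
  hence "theta_exp (j + m) = theta_exp j" unfolding theta_exp_def by simp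
  moreover have "inverse z^(A * a * (j + m)) = inverse z^(A * a * j)"
   unfolding distrib_left power_add using inverse_zc(1)[of "A * a"] by (simp add: mult.commute)
  ultimately show ?thesis by (simp add: F_def)
 qed
 from sum_periodic_shift[of F m i, OF this] have "(\<Sum>j<m. F (j + i)) = gauss_c (A * a)" by (simp add: F_def gauss_c_def)
 moreover have "inverse z^(A * a * i) * s (gauss_c a) = (\<Sum>j<m. F (j + i))"
 proof -
  have Q: "inverse z^k \<in> Qbar" for k by (intro Qbar_closed(3,6) root_Qbar)
  have "s (gauss_c a) = (\<Sum>j<m. s (inverse z^(a * j) * wc^theta_exp j))"
   unfolding gauss_c_def by (rule GQ_hom(4)[OF s(1)]) (intro Qbar_closed(2) Q root_Qbar)
  also have "... = (\<Sum>j<m. inverse z^(A * (a * j)) * wc^theta_exp (j + i))"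
   by (intro sum.cong refl) (simp only: GQD(3)[OF s(1) Q root_Qbar(2)] sz wB)
  finally show ?thesis unfolding F_def sum_distrib_left by (simp only:) (simp add: sum_distrib_left algebra_simps power_add)
 qed
 ultimately show thesis using that by metis
qed

end

end

section \<open>The element of the eigenspace built from Gauss sums, and the conclusion\<close>

lemma mean_zero_odd:
 fixes g :: "int => 'a::field_char_0"
 assumes "N > 0" "!!a b. [a = b] (mod int N) ==> g a = g b" "!!a. g (- a) = - g a" shows "mean_zero N g"
proof -
 have "(\<Sum>j<N. g (0 + - 1 * int j)) = (\<Sum>j<N. g (int j))" by (rule sum_residues) (use assms(1,2) in auto)
 thus ?thesis using assms(2)[of "_ + int N"] by (simp add: mean_zero_def assms(3) sum_negf cong_def)
qed

lemma tensor_scale_sum: "tensor_scale a (sum x I) = (\<Sum>i\<in>I. tensor_scale a (x i))"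
 by (induction I rule: infinite_finite_induct) (simp_all add: tensor_scale_add tensor_scale_0)

lemma tensor_act_scale: "tensor_act t (tensor_scale a x) = tensor_scale a (tensor_act t x)"
proof -
 let ?s = "\<Sum>u\<in>Poly_Mapping.keys x. sg u (Poly_Mapping.lookup x u)"
 have "tensor_act t (tensor_scale a ?s) = tensor_scale a (tensor_act t ?s)"
  by (simp only: tensor_scale_sum tensor_act_sum tensor_scale_single tensor_act_single)
 thus ?thesis unfolding sum_singles .
qed

lemma inverse_eigenspace_add_scale:
 assumes "x \<in> inverse_eigenspace p \<iota> F \<xi>" "y \<in> inverse_eigenspace p \<iota> F \<xi>"
 shows "x + tensor_scale a y \<in> inverse_eigenspace p \<iota> F \<xi>"
proof -
 have "Poly_Mapping.keys (tensor_scale a y) \<subseteq> Poly_Mapping.keys y" by (auto simp: in_keys_iff lookup_tensor_scale)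
 hence "Poly_Mapping.keys (x + tensor_scale a y) \<subseteq> p_units p F"
  using assms Poly_Mapping.keys_add[of x "tensor_scale a y"] unfolding inverse_eigenspace_def formal_sums_def by blast
 moreover have "tensor_scale s (tensor_scale a y) = tensor_scale a (tensor_scale s y)" for s by (simp add: tensor_scale_scale mult.commute)
 ultimately show ?thesis using assms
  by (simp add: inverse_eigenspace_def formal_sums_def tensor_act_add tensor_act_scale tensor_scale_add tensor_eq_add tensor_eq_scale)
qed

text \<open>\<open>L_value\<close> arises from the values of \<open>g\<close> by field operations
  with rational constants, all of which \<open>\<iota>\<close> respects.\<close>

lemma embedded_L_value:
 assumes "qbar_embedding (\<iota> :: complex => 'b::field_char_0)" and g: "!!a. g a \<in> Qbar"
 shows "\<iota> (L_value N g k) = L_value N (%a. \<iota> (g a)) k" "L_value N g k \<in> Qbar"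
proof -
 note s = embedding_simps[OF assms(1)] and h = ring_hom_onD[OF subring_Qbar_Qbar qbar_embedding_hom[OF assms(1)]]
 have Q: "of_nat i \<in> Qbar" "of_int j \<in> Qbar" for i j by (simp_all add: Qbar_closed(5))
 have *: "iter_reg N h i a \<in> Qbar & \<iota> (iter_reg N h i a) = iter_reg N (%a. \<iota> (h a)) i a" if "!!a. h a \<in> Qbar" for h i a
 proof (induction i arbitrary: a)
  case (Suc i)
  have "- (\<Sum>j<N. of_nat j * iter_reg N h i (a + 1 + int j)) \<in> Qbar" using Suc by (intro Qbar_closed(2,4,7) Q) auto
  thus ?case using Suc by (simp add: reg_sum_def divide_inverse s h Q Qbar_closed)
 qed (use that in simp)
 show "L_value N g k \<in> Qbar" unfolding L_value_def by (intro Qbar_closed(2,7) Q conjunct1[OF *] g)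
 show "\<iota> (L_value N g k) = L_value N (%a. \<iota> (g a)) k" unfolding L_value_def
  by (subst h(4), intro Qbar_closed(2) Q conjunct1[OF *] g)
   (intro sum.cong refl, simp only: s(1)[OF conjunct1[OF *[of "%n. g (n + 1)", OF g]] Q(2)] conjunct2[OF *[of "%n. g (n + 1)", OF g]] h(7))
qed

context padic_closure begin

context
 fixes \<iota> :: "complex => 'k" and f N e :: nat and \<phi> :: "int => complex"
 assumes emb: "qbar_embedding \<iota>" and f: "f > 0" and dchar: "dirichlet_character N \<phi>" and odd: "\<phi> (- 1) = - 1"
  and cop: "coprime N p" and \<phi>p: "\<phi> (int p) = 1" and e: "N * e = p^f - 1"
begin

abbreviation (input) "gc \<equiv> gauss_c \<iota> f"
abbreviation (input) "GN \<equiv> gauss f (\<iota> (zc f))"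
abbreviation (input) "c \<equiv> %a. \<iota> (\<phi> a)"
abbreviation (input) "K \<equiv> ker_res N \<phi>"
abbreviation (input) "UH \<equiv> p_units p (cut_out_field N \<phi>)"

lemmas chr = character_simps[OF dchar]

text \<open>The roots of unity produced by \<open>Gal_gauss_c\<close> have order dividing
  \<open>N\<close> here, as \<open>N * e = p^f - 1\<close>, and the \<open>N\<close>-th power
  removes them. The product over the kernel of \<phi> is permuted by automorphisms of character
  value 1.\<close>

definition gauss_period :: "nat => complex" where "gauss_period r = (\<Prod>b\<in>K. gc (b * r * e)^N)"

lemma e_pos: "e > 0" using e m_pos[OF emb f] by (cases e) auto

lemma mult_e_mod: "(r mod N) * e = (r * e) mod (p^f - 1)"
 unfolding e[symmetric] by (simp add: mult_mod_left)

lemma gc_mod: "gc ((r mod N) * e) = gc (r * e)"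
 unfolding mult_e_mod by (rule gauss_c_cong[OF emb f]) simp

lemma gauss_period_mod: "gauss_period (r mod N) = gauss_period r"
 unfolding gauss_period_def
proof (intro prod.cong refl arg_cong[of _ _ "%x. x^N"])
 fix b show "gc (b * (r mod N) * e) = gc (b * r * e)"
  using gc_mod[of "b * (r mod N)"] gc_mod[of "b * r"] by (simp add: mod_mult_right_eq)
qed

lemma gauss_period_Zbar: "gauss_period r \<in> Zbar"
 unfolding gauss_period_def by (intro Zbar_closed(4,6) gauss_c_Zbar[OF emb f])

lemma Gal_gauss_period:
 assumes s: "s \<in> GQ" obtains A where "galois_character N \<phi> s = \<phi> (int A)" "!!r. s (gauss_period r) = gauss_period (A * r)"
proof -
 note m = m_pos[OF emb f]
 obtain A where A: "s (zc f) = zc f^A" using Gal_cis_root[OF s m, folded zc_def] by blast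
 have zN: "cis (2 * pi / real N) = zc f^e"
  using chr(1) e_pos unfolding zc_def cis_root(2) e[symmetric] by (simp add: field_simps)
 have "s (cis (2 * pi / real N)) = cis (2 * pi / real N)^A"
  unfolding zN GQ_hom(3)[OF s root_Qbar(3)[OF emb f]] A by (simp add: mult.commute flip: power_mult)
 hence 1: "galois_character N \<phi> s = \<phi> (int A)" by (rule galois_character_eq[OF dchar])
 have gQ: "gc a \<in> Qbar" for a using Zbar_closed(7) gauss_c_Zbar[OF emb f] by blast
 have "s (gc (b * r * e))^N = gc (b * (A * r) * e)^N" for b r
 proof -
  obtain i where i: "inverse (zc f)^(A * (b * r * e) * i) * s (gc (b * r * e)) = gc (A * (b * r * e))"
   using Gal_gauss_c[OF emb f s A] by blast
  have "(inverse (zc f)^(A * (b * r * e) * i))^N = 1"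
   using inverse_zc(1)[OF emb f, of "A * b * r * i"] unfolding e[symmetric] by (simp add: mult_ac flip: power_mult)
  with arg_cong[OF i, of "%x. x^N"] show ?thesis by (simp add: power_mult_distrib mult_ac)
 qed
 hence "s (gauss_period r) = gauss_period (A * r)" for r
  unfolding gauss_period_def by (subst GQ_hom(5)[OF s]) (simp_all add: GQ_hom(3)[OF s] gQ Qbar_closed(6))
 with 1 show thesis using that by blast
qed

lemma gauss_period_cut_out: "gauss_period r \<in> cut_out_field N \<phi>"
proof -
 have "s (gauss_period r) = gauss_period r" if s: "s \<in> GQ" "galois_character N \<phi> s = 1" for s
 proof -
  obtain A where A: "galois_character N \<phi> s = \<phi> (int A)" "!!r. s (gauss_period r) = gauss_period (A * r)"
   using Gal_gauss_period[OF s(1)] by blast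
  have "bij_betw (%b. A * b mod N) K K" using A(1) s(2) by (intro ker_res_bij[OF dchar]) simp
  from prod.reindex_bij_betw[OF this, of "%b. gc (b * r * e)^N"]
  have "gauss_period r = (\<Prod>b\<in>K. gc ((A * b mod N) * r * e)^N)" by (simp add: gauss_period_def)
  also have "... = gauss_period (A * r)" unfolding gauss_period_def
  proof (intro prod.cong refl arg_cong[of _ _ "%x. x^N"])
   fix b show "gc ((A * b mod N) * r * e) = gc (b * (A * r) * e)"
    using gc_mod[of "(A * b mod N) * r"] gc_mod[of "b * (A * r)"] by (simp add: mod_mult_left_eq mod_mult_right_eq mult_ac)
  qed
  finally show ?thesis unfolding A(2) ..
 qed
 thus ?thesis using Zbar_closed(7)[OF gauss_period_Zbar] by (simp add: cut_out_field_def)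
qed

lemma mod_range: assumes "\<phi> (int r) ~= 0" shows "0 < r mod N" "(r mod N) * e < p^f - 1"
proof -
 have "N ~= 1"
 proof
  assume "N = 1"
  hence "\<phi> (- 1) = \<phi> 1" by (intro chr(5)) simp
  thus False using odd chr(4) by simp
 qed
 moreover have "coprime r N" using assms chr(3)[of "int r"] by simp
 ultimately show "0 < r mod N" by (metis coprime_0_left_iff coprime_mod_left_iff gr0I nat_dvd_1_iff_1 chr(1))
 show "(r mod N) * e < p^f - 1" using chr(1) e_pos unfolding e[symmetric] by simp
qed

lemma ker_mult: "b \<in> K ==> \<phi> (int (b * r)) = \<phi> (int r)"
 by (simp add: ker_res_def[OF dchar] chr(2))

lemma \<iota>_gc: assumes "\<phi> (int r) ~= 0" shows "\<iota> (gc (r * e)) = GN ((r mod N) * e)" "GN ((r mod N) * e) ~= 0"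
 using \<iota>_gauss_c[OF emb f, of "(r mod N) * e"] gauss_nonzero[OF f z_primitive[OF emb f], of "(r mod N) * e"] mod_range[OF assms]
 by (simp_all add: gc_mod qf_def[OF f z_primitive[OF emb f]])

text \<open>\<open>P\<close> describes the algebraic integers dividing a power of \<open>p\<close>.
  It is closed under products, and the Gauss sums that occur satisfy it by
  \<open>gs_product\<close>.\<close>

lemma gauss_period_unit: assumes "\<phi> (int r) ~= 0" shows "gauss_period r \<in> UH"
proof -
 define P where "P x \<longleftrightarrow> x \<in> Zbar & (\<exists>y\<in>Zbar. \<exists>k. x * y = of_nat p^k)" for x :: complex
 have P1: "P 1" unfolding P_def using Zbar_closed(3)[of 1] by (auto intro!: bexI[of _ 1] exI[of _ 0])
 have Pm: "P (x * y)" if xy: "P x" "P y" for x y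
 proof -
  obtain x' y' k l where "x' \<in> Zbar" "x * x' = of_nat p^k" "y' \<in> Zbar" "y * y' = of_nat p^l" using xy unfolding P_def by blast
  hence "x' * y' \<in> Zbar" "(x * y) * (x' * y') = of_nat p^(k + l)" by (simp_all add: power_add Zbar_closed mult_ac)
  thus ?thesis using xy Zbar_closed(2) unfolding P_def by blast
 qed
 have Pp: "P (x^n)" if "P x" for x n using that by (induction n) (simp_all add: P1 Pm)
 have "P (gc (b * r * e))" if "b \<in> K" for b
 proof -
  define a where "a = (b * r mod N) * e"
  have nz: "\<phi> (int (b * r)) ~= 0" using ker_mult[OF that, of r] assms by simp
  have a: "0 < a" "a < p^f - 1" using mod_range[OF nz] e_pos by (simp_all add: a_def)
  obtain n where n: "n > 0" "(GN a * GN (p^f - 1 - a))^n = of_nat (p^f)^n" using gs_product[OF f z_primitive[OF emb f] a] by blast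
  have Z: "gc k \<in> Zbar" "gc k \<in> Qbar" for k using gauss_c_Zbar[OF emb f] Zbar_closed(7) by blast+
  have "\<iota> ((gc a * gc (p^f - 1 - a))^n) = (GN a * GN (p^f - 1 - a))^n"
   using a Z(2) by (simp add: \<iota>_hom(3)[OF emb f] \<iota>_simps(1)[OF emb f] Qbar_closed(2) \<iota>_gauss_c[OF emb f])
  also have "... = \<iota> (of_nat (p^(f * n)))" unfolding n(2) \<iota>_hom(6)[OF emb f] by (simp add: power_mult)
  finally have "(gc a * gc (p^f - 1 - a))^n = of_nat (p^(f * n))"
   using \<iota>_simps(3)[OF emb f] Z(2) by (simp add: Qbar_closed del: of_nat_power)
  moreover have "(gc a * gc (p^f - 1 - a))^n = gc a * (gc a^(n - 1) * gc (p^f - 1 - a)^n)"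
   using n(1) by (cases n) (simp_all add: power_mult_distrib)
  ultimately have "P (gc a)" unfolding P_def using Z(1) by (auto intro!: bexI[of _ "gc a^(n - 1) * gc (p^f - 1 - a)^n"] exI[of _ "f * n"] Zbar_closed(2,4))
  thus ?thesis by (simp add: a_def gc_mod)
 qed
 hence "P (\<Prod>b\<in>B. gc (b * r * e)^N)" if "B \<subseteq> K" for B
  using that by (induction B rule: infinite_finite_induct) (auto simp: P1 Pm Pp)
 hence "P (gauss_period r)" by (simp add: gauss_period_def)
 then obtain y k where y: "y \<in> Zbar" "gauss_period r * y = of_nat p^k" unfolding P_def by blast
 hence nz: "gauss_period r ~= 0" using p_nonzero by (metis mult_zero_left of_nat_eq_0_iff power_not_zero)
 hence "of_nat p^k * inverse (gauss_period r) = y" unfolding y(2)[symmetric] by simp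
 hence "inverse (gauss_period r) \<in> p_integers p (cut_out_field N \<phi>)"
  using y(1) cut_out_inverse[OF dchar gauss_period_cut_out] by (auto simp: p_integers_def)
 moreover have "gauss_period r * inverse (gauss_period r) = 1" using nz by simp
 ultimately show ?thesis using p_integers_Zbar[OF dchar gauss_period_cut_out gauss_period_Zbar] unfolding p_units_def by blast
qed

definition gross_element :: "complex \<Rightarrow>\<^sub>0 'k"
 where "gross_element = (\<Sum>r<N. sg (gauss_period r) (c (int r)))"

lemma \<phi>_Qbar: "\<phi> a \<in> Qbar"
proof (cases "coprime a (int N)")
 case True
 define b where "b = nat (a mod int N)"
 have b: "\<phi> a = \<phi> (int b)" using chr(1) by (intro chr(5)) (simp add: b_def cong_def)
 have "coprime b N" using True b chr(3)[of a] chr(3)[of "int b"] by simp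
 hence "[int (b^totient N) = int 1] (mod int N)" unfolding cong_int_iff by (rule euler_theorem)
 from chr(5)[OF this] have "\<phi> (int (b^totient N)) = 1" using chr(4) by simp
 moreover have "\<phi> (int (b^n)) = \<phi> (int b)^n" for n by (induction n) (simp_all add: chr(2,4))
 ultimately have "\<phi> (int b)^totient N = 1" by simp
 thus ?thesis unfolding b using chr(1) by (intro Zbar_closed(7) root_of_unity_in_Zbar[of _ "totient N"]) auto
qed (use chr(3)[of a] Qbar_closed(5)[of 0] in simp)

lemma \<iota>\<phi>: "c (a * b) = c a * c b" "c a = 0 \<longleftrightarrow> \<phi> a = 0" "c (- a) = - c a"
 using chr(2)[of "- 1" a] by (simp_all add: chr(2) \<iota>_simps[OF emb f] \<phi>_Qbar odd \<iota>_hom(2)[OF emb f])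

lemma mean_zero_\<phi>: "mean_zero N \<phi>" "mean_zero N c"
 using chr(2)[of "- 1"] \<iota>\<phi>(3) chr(5) by (auto intro!: mean_zero_odd chr(1) simp: odd)

text \<open>A general homomorphism \<open>L\<close> covers both the logarithm and the valuation.
  Replacing \<open>r\<close> by \<open>b * r\<close> shows that every \<open>b\<close> in the kernel
  contributes the same sum; the factor \<open>N\<close> is the exponent in
  \<open>gauss_period\<close>.\<close>

lemma sum_gauss_period:
 fixes L :: "'k => 'k"
 assumes L: "!!x y. x ~= 0 ==> y ~= 0 ==> L (x * y) = L x + L y"
 shows "tensor_lift (%u. L (\<iota> u)) gross_element = of_nat (N * card K) * (\<Sum>r<N. c (int r) * L (GN (r * e)))"
proof -
 have LP: "L (prod g B) = (\<Sum>b\<in>B. L (g b))" if "!!b. b \<in> B ==> g b ~= 0" for g and B :: "nat set"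
  using that L[of 1 1] by (induction B rule: infinite_finite_induct) (simp_all add: L)
 have gQ: "gc a \<in> Qbar" for a using Zbar_closed(7) gauss_c_Zbar[OF emb f] by blast
 have "c (int r) * L (\<iota> (gauss_period r)) = (\<Sum>b\<in>K. of_nat N * (c (int (b * r mod N)) * L (GN ((b * r mod N) * e))))" for r
 proof (cases "\<phi> (int r) = 0")
  case False
  have nz: "\<phi> (int (b * r)) ~= 0" if "b \<in> K" for b using ker_mult[OF that] False by simp
  have "\<iota> (gauss_period r) = (\<Prod>b\<in>K. \<iota> (gc (b * r * e)^N))"
   unfolding gauss_period_def by (rule \<iota>_hom(5)[OF emb f]) (intro Qbar_closed(6) gQ)
  also have "... = (\<Prod>b\<in>K. GN ((b * r mod N) * e)^N)"
   by (rule prod.cong[OF refl]) (simp only: \<iota>_hom(3)[OF emb f gQ] \<iota>_gc(1)[OF nz])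
  also have "L ... = (\<Sum>b\<in>K. L (GN ((b * r mod N) * e)^N))" by (intro LP power_not_zero \<iota>_gc(2) nz)
  also have "... = (\<Sum>b\<in>K. of_nat N * L (GN ((b * r mod N) * e)))"
   by (rule sum.cong[OF refl]) (rule hom_power(1)[of L, OF L \<iota>_gc(2)[OF nz]])
  finally have "c (int r) * L (\<iota> (gauss_period r)) = (\<Sum>b\<in>K. c (int r) * (of_nat N * L (GN ((b * r mod N) * e))))"
   by (simp only: sum_distrib_left)
  moreover have "c (int (b * r mod N)) = c (int r)" if "b \<in> K" for b
   using chr(5)[of "int (b * r mod N)" "int (b * r)"] ker_mult[OF that, of r] by (simp add: cong_def zmod_int del: of_nat_mult)
  ultimately show ?thesis by (simp only: mult.left_commute cong: sum.cong)
 next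
  case True
  have "\<phi> (int (b * r mod N)) = 0" if "b \<in> K" for b
   using chr(5)[of "int (b * r mod N)" "int (b * r)"] ker_mult[OF that, of r] True by (simp add: cong_def zmod_int del: of_nat_mult)
  thus ?thesis using True \<iota>_hom(8)[OF emb f] by simp
 qed
 hence "(\<Sum>r<N. c (int r) * L (\<iota> (gauss_period r))) = (\<Sum>b\<in>K. of_nat N * (\<Sum>r<N. c (int (b * r mod N)) * L (GN ((b * r mod N) * e))))"
  by (simp only:) (subst sum.swap, simp only: sum_distrib_left)
 also have "... = (\<Sum>b\<in>K. of_nat N * (\<Sum>r<N. c (int r) * L (GN (r * e))))"
 proof (rule sum.cong[OF refl])
  fix b assume "b \<in> K"
  hence "coprime b N" using chr(3)[of "int b"] by (simp add: ker_res_def[OF dchar])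
  thus "of_nat N * (\<Sum>r<N. c (int (b * r mod N)) * L (GN ((b * r mod N) * e))) = of_nat N * (\<Sum>r<N. c (int r) * L (GN (r * e)))"
   by (intro arg_cong[of _ _ "%x. of_nat N * x"] sum_mult_mod[of b N "%r. c (int r) * L (GN (r * e))"] chr(1))
 qed
 finally show ?thesis by (simp add: gross_element_def tensor_lift_sum tensor_lift_single mult.commute mult.left_commute)
qed

text \<open>An automorphism of character value \<open>\<phi> A\<close> moves the period of
  \<open>r\<close> to that of \<open>A * r\<close>. Reindexing multiplies the coefficients by the
  inverse of \<open>\<phi> A\<close>, hence the inverse eigenspace.\<close>

lemma gross_element_eigen: "gross_element \<in> inverse_eigenspace p \<iota> (cut_out_field N \<phi>) (quotient_character N \<phi>)"
proof -
 let ?H = "cut_out_field N \<phi>"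
 have "tensor_act t gross_element = tensor_scale (\<iota> (inverse (quotient_character N \<phi> t))) gross_element" if t: "t \<in> Gal ?H" for t
 proof -
  obtain s where s: "s \<in> GQ" "!!x. x \<in> ?H ==> s x = t x" using Gal_extend[OF subring_cut_out[OF dchar] t] by blast
  obtain A where A: "galois_character N \<phi> s = \<phi> (int A)" "!!r. s (gauss_period r) = gauss_period (A * r)"
   using Gal_gauss_period[OF s(1)] by blast
  obtain g where g: "g \<in> GQ" "!!x. x \<in> Qbar ==> g (s x) = x" "!!x. x \<in> Qbar ==> s (g x) = x"
   by (rule Gal_inverse[OF s(1)]) (rule that)
  have "galois_character N \<phi> g * \<phi> (int A) = 1" using galois_character_inverse[OF dchar s(1) g(1,2)] A(1) by simp
  hence A0: "\<phi> (int A) ~= 0" by auto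
  hence cop: "coprime A N" using chr(3)[of "int A"] by simp
  have q: "quotient_character N \<phi> t = \<phi> (int A)" using quotient_character_eq[OF dchar s] A(1) by simp
  have "c (int (A * r mod N)) = c (int A) * c (int r)" for r
   using chr(5)[of "int (A * r mod N)" "int A * int r"] unfolding \<iota>\<phi>(1)[symmetric] by (simp add: cong_def zmod_int)
  hence c: "inverse (c (int A)) * c (int (A * r mod N)) = c (int r)" for r using A0 by (simp only: \<iota>\<phi>(2) mult.assoc[symmetric] left_inverse mult_1 not_False_eq_True)
  have "tensor_act t gross_element = (\<Sum>r<N. sg (gauss_period (A * r mod N)) (inverse (c (int A)) * c (int (A * r mod N))))"
   unfolding gross_element_def tensor_act_sum tensor_act_single s(2)[OF gauss_period_cut_out, symmetric] A(2) gauss_period_mod c by (rule refl)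
  also have "... = (\<Sum>r<N. sg (gauss_period r) (inverse (c (int A)) * c (int r)))" by (rule sum_mult_mod[OF cop chr(1)])
  also have "... = tensor_scale (\<iota> (inverse (quotient_character N \<phi> t))) gross_element"
   by (simp add: gross_element_def tensor_scale_sum tensor_scale_single q \<iota>_simps(4)[OF emb f] \<phi>_Qbar)
  finally show ?thesis .
 qed
 moreover have "Poly_Mapping.keys gross_element \<subseteq> UH"
 proof -
  have "Poly_Mapping.keys (sg (gauss_period r) (c (int r))) \<subseteq> UH" for r using gauss_period_unit[of r] by (simp add: \<iota>\<phi>(2))
  thus ?thesis unfolding gross_element_def using keys_sum by fast
 qed
 ultimately show ?thesis by (simp add: inverse_eigenspace_def formal_sums_def tensor_eq_refl)
qed

text \<open>Logarithm and valuation of \<open>gross_element\<close> are the same multiple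
  \<open>- C\<close> of the logarithmic moment and of \<open>L_value N c 0\<close>. If the latter is
  0, the element vanishes in the tensor product by \<open>eigenspace_vanishing\<close>, and so does
  the moment. Otherwise the element spans the eigenspace, and the ratio is the same for the chosen
  basis vector \<open>u\<close>.\<close>

lemma L_invariant_eq:
 "L_invariant p \<iota> (cut_out_field N \<phi>) (quotient_character N \<phi>) * L_value N c 0 = - log_moment N c 1"
proof -
 let ?E = "inverse_eigenspace p \<iota> (cut_out_field N \<phi>) (quotient_character N \<phi>)"
 define lo where "lo = (tensor_lift (%u. lg (\<iota> u)) :: _ => 'k)"
 define or where "or = (tensor_lift (%u. of_rat (padic_ord p (\<iota> u))) :: _ => 'k)"
 define C where "C = (of_nat (N * card K * f) :: 'k)"
 note z = z_primitive[OF emb f]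
 have cp: "c (int p * b) = c b" "c 0 = 0" for b using \<iota>\<phi>(1)[of "int p" b] \<iota>\<phi>(3)[of 0] by (simp_all add: \<phi>p \<iota>_1[OF emb f])
 have C: "C ~= 0"
 proof -
  have "\<phi> (int (1 mod N)) = 1" using chr(5)[of "int (1 mod N)" 1] chr(4) by (simp add: cong_def zmod_int)
  hence "1 mod N \<in> K" using chr(1) by (simp add: ker_res_def[OF dchar])
  hence "card K ~= 0" by (auto simp: ker_res_def[OF dchar])
  thus ?thesis using chr(1) f by (simp add: C_def)
 qed
 have lo: "lo gross_element = - C * log_moment N c 1"
  using sum_gauss_period[of lg, OF lg_mult] gs_lg_sum[OF f z chr(1) cop mean_zero_\<phi>(2) cp(1) \<iota>\<phi>(3) e] by (simp add: lo_def C_def)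
 have or: "or gross_element = - C * L_value N c 0"
  using sum_gauss_period[of "%x. of_rat (padic_ord p x)"] gs_ord_sum[OF f z chr(1) cop mean_zero_\<phi>(2) cp e]
  by (simp add: or_def C_def padic_ord_mult of_rat_add)
 have hom: "\<iota> (u * v) = \<iota> u * \<iota> v & \<iota> u ~= 0 & \<iota> v ~= 0" if "u \<in> UH" "v \<in> UH" for u v
  using that unit_groupD(1)[OF unit_group_p_units[OF dchar]] cut_outD(1)[OF dchar] p_integersD[OF dchar] \<iota>_simps(1,2)[OF emb f]
  by (metis (no_types, lifting) mem_Collect_eq p_units_def)
 have lo_eq: "lo x = lo y" if "tensor_eq UH x y" for x y
  unfolding lo_def by (rule tensor_lift_cong[OF _ that]) (metis hom lg_mult)
 have or_eq: "or x = or y" if "tensor_eq UH x y" for x y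
  unfolding or_def by (rule tensor_lift_cong[OF _ that]) (metis hom padic_ord_mult of_rat_add)
 have vanish: "tensor_eq UH x 0" if "x \<in> ?E" "or x = 0" for x
  using eigenspace_vanishing[OF emb dchar odd that(1)] that(2) by (simp add: or_def)
 show ?thesis
 proof (cases "L_value N c 0 = 0")
  case True
  hence "lo gross_element = lo 0" using or by (intro lo_eq vanish gross_element_eigen) simp
  thus ?thesis using True lo C by (simp add: lo_def tensor_lift_0)
 next
  case False
  hence or0: "or gross_element ~= 0" using or C by simp
  have "inverse_eigenspace_basis p \<iota> (cut_out_field N \<phi>) (quotient_character N \<phi>) gross_element"
   unfolding inverse_eigenspace_basis_def
  proof (intro conjI ballI gross_element_eigen)
   show "\<not> tensor_eq UH gross_element 0" using or0 or_eq[of gross_element 0] by (auto simp: or_def tensor_lift_0)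
   fix x assume x: "x \<in> ?E"
   \<comment> \<open>Subtracting the multiple of \<open>gross_element\<close> that has the valuation
     of \<open>x\<close> leaves an element of the eigenspace with valuation 0, which
     vanishes.\<close>
   define y where "y = x - tensor_scale (or x / or gross_element) gross_element"
   have "y = x + tensor_scale (- (or x / or gross_element)) gross_element"
    unfolding y_def by (rule poly_mapping_eqI) (simp add: lookup_minus lookup_add lookup_tensor_scale)
   hence "y \<in> ?E" using inverse_eigenspace_add_scale[OF x gross_element_eigen] by simp
   moreover have "or y = 0" using or0 by (simp add: y_def or_def tensor_lift_diff tensor_lift_scale)
   ultimately show "\<exists>d. tensor_eq UH x (tensor_scale d gross_element)" using vanish[of y] by (auto simp: y_def tensor_eq_def)
  qed
  from someI[of "inverse_eigenspace_basis p \<iota> (cut_out_field N \<phi>) (quotient_character N \<phi>)", OF this]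
  obtain u where u: "u = (SOME u. inverse_eigenspace_basis p \<iota> (cut_out_field N \<phi>) (quotient_character N \<phi>) u)"
   and b: "inverse_eigenspace_basis p \<iota> (cut_out_field N \<phi>) (quotient_character N \<phi>) u" by blast
  then obtain d where d: "tensor_eq UH gross_element (tensor_scale d u)"
   using gross_element_eigen unfolding inverse_eigenspace_basis_def by blast
  have 1: "- C * log_moment N c 1 = d * lo u" "- C * L_value N c 0 = d * or u"
   using lo_eq[OF d] or_eq[OF d] lo or by (simp_all add: lo_def or_def tensor_lift_scale)
  have nz: "d ~= 0" "or u ~= 0" using 1(2) C False by auto
  have "L_invariant p \<iota> (cut_out_field N \<phi>) (quotient_character N \<phi>) = - lo u / or u"
   unfolding L_invariant_def u lo_def or_def by (simp add: Let_def)
  moreover have "d * (lo u * L_value N c 0) = d * (or u * log_moment N c 1)"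
   unfolding mult.assoc[symmetric] 1[symmetric] by simp
  hence "lo u * L_value N c 0 = or u * log_moment N c 1" using nz(1) by simp
  ultimately show ?thesis using nz(2) by simp
 qed
qed

lemma kubota_leopoldt_derivative:
 "(kubota_leopoldt p \<iota> \<phi> has_padic_derivative
   (L_invariant p \<iota> (cut_out_field N \<phi>) (quotient_character N \<phi>) * \<iota> (dirichlet_L \<phi> 0))) 0"
proof -
 have cp: "c (int p * b) = c b" for b using \<iota>\<phi>(1)[of "int p" b] by (simp add: \<phi>p \<iota>_1[OF emb f])
 note ctx = chr(1) cop mean_zero_\<phi>(2) cp
 have LQ: "\<iota> (dirichlet_L \<phi> (- of_nat k)) = L_value N c k" for k
  unfolding dirichlet_L_value[OF chr(1) mean_zero_\<phi>(1)] by (rule embedded_L_value(1)[OF emb \<phi>_Qbar])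
 have "\<iota> ((1 - \<phi> (int p) * of_nat p^k) * dirichlet_L \<phi> (- of_nat k)) = (1 - of_nat p^k) * L_value N c k" for k
 proof -
  have "(1 - \<phi> (int p) * of_nat p^k) * dirichlet_L \<phi> (- of_nat k) = of_int (1 - int p^k) * dirichlet_L \<phi> (- of_nat k)" by (simp add: \<phi>p)
  moreover have "dirichlet_L \<phi> (- of_nat k) \<in> Qbar"
   unfolding dirichlet_L_value[OF chr(1) mean_zero_\<phi>(1)] by (rule embedded_L_value(2)[OF emb \<phi>_Qbar])
  ultimately show ?thesis by (simp only: \<iota>_simps(1)[OF emb f Qbar_closed(5)[OF Rats_of_int]] \<iota>_hom(7)[OF emb f] LQ) simp
 qed
 from kubota_leopoldt_eq[OF ctx this] show ?thesis
  using padic_L_derivative[OF ctx] L_invariant_eq LQ[of 0] by simp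
qed

end

end

theorem corollary5p8:
  fixes p N :: nat
    and \<iota> :: "complex \<Rightarrow> 'k::{alg_closed_field, field_char_0, metric_space}"
    and \<phi> :: "int \<Rightarrow> complex"
  assumes "padic_closure TYPE('k) p"
    and "qbar_embedding \<iota>"
    and "primitive_dirichlet_character N \<phi>"
    and "\<phi> (-1) = -1"
    and "coprime N p"
    and "\<phi> (int p) = 1"
  shows "(kubota_leopoldt p \<iota> \<phi> has_padic_derivative
           (L_invariant p \<iota> (cut_out_field N \<phi>) (quotient_character N \<phi>) * \<iota> (dirichlet_L \<phi> 0))) 0"
proof -
 have dchar: "dirichlet_character N \<phi>" using assms(3) by (simp add: primitive_dirichlet_character_def)
 have "[p^totient N = 1] (mod N)" by (rule euler_theorem) (use assms(5) in \<open>simp add: coprime_commute\<close>)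
 hence "N dvd p^totient N - 1" by (rule cong_to_1_nat)
 then obtain e where "N * e = p^totient N - 1" by (metis dvdE)
 thus ?thesis using character_simps(1)[OF dchar]
  by (intro padic_closure.kubota_leopoldt_derivative[OF assms(1,2) _ dchar assms(4-6)]) auto
qed

end
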